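(* Let $l\in\mathbb{N}$ and $x_1,\dots,x_l\in\mathbb{N}$. Let $b=b(n)$ and $M=M(n)$ be sequences of real numbers such that $b,M\to\infty$, $\frac{b^2M^2}{n}\to0$ and $\frac{b}{M^4}\to0$ as $n\to\infty$. Assume $\mathbb{E}[A(0)^2]<\infty$, $\sum_{n=1}^\infty\sqrt{1-G(n)}<\infty$ and $\mathbb{E}[A(0)^4]<\infty$. Then $$\sup_{x\in\mathbb{R}^l}\left|\mathbb{P}\left(\sqrt n(\mathbf{H}_n-\mathbf{H})\le x\right)-\mathbb{P}^*\left(\sqrt n(\mathbf{H}_n^*-\mathbf{H}^* )\le x\right)\right|\to0$$ in probability as $n\to\infty$, where $\mathbf{H}_n=(\widehat H_n(x_1),\dots,\widehat H_n(x_l))^T$, $\mathbf{H}=(H(x_1),\dots,H(x_l))^T$, $\mathbf{H}_n^*=(\widehat H_n^*(x_1),\dots,\widehat H_n^*(x_l))^T$, $\mathbf{H}^*=(H^*(x_1),\dots,H^*(x_l))^T$, and inequalities between vectors are componentwise.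
   Context: Model (discrete-time $GI/G/\infty$ queue): $\mathbb{N}=\{1,2,\dots\}$, $\mathbb{N}_0=\mathbb{N}\cup\{0\}$. $(A(t))_{t\in\mathbb{Z}}$ (numbers of arrivals) is an i.i.d. sequence of $\mathbb{N}_0$-valued random variables with $\mathbb{E}[A(0)]<\infty$. $(S_{t,l})_{t\in\mathbb{Z},l\in\mathbb{N}}$ (service times) are i.i.d. $\mathbb{N}$-valued random variables, independent of $(A(t))_{t\in\mathbb{Z}}$, with cdf $G$, $G(0)=0$, and finite mean, i.e. $\sum_{i\ge1}(1-G(i))<\infty$. The number of departures in slot $t$ is $D(t)=\sum_{j=1}^\infty\sum_{l=1}^{A(t-j)}\mathbf{1}_{\{S_{t-j,l}=j\}}$. Put $Z(t)=t-\max\{n<t: A(n)>0\}$ and $c=\mathbb{P}(A(0)=0)$, with $c\in(0,1)$. For $x\in\mathbb{N}$ define $H(x)=\mathbb{E}[D(0)\mathbf{1}_{\{Z(0)\le x\}}]/\mathbb{E}[D(0)]$ and $\widehat H_n(x)=\sum_{i=1}^nD(i)\mathbf{1}_{\{Z(i)\le x\}}\big/\sum_{i=1}^nD(i)$. Moving blocks bootstrap: for sample size $n$ and block size $b=b(n)$, put $k=n/b$ (block size and number of blocks are treated as positive integers). Let $I_1,\dots,I_k$ be i.i.d. uniformly distributed on $\{1,\dots,n-b+1\}$, independent of the queueing process. For a process $(X_i)_{i\in\mathbb{Z}}$, the bootstrap sample $\{X_i^*\}_{i\in\{1,\dots,n\}}$ consists of the blocks $(X_{I_d+1},\dots,X_{I_d+b})$,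 $d=1,\dots,k$. $\mathbb{P}^*$ and $\mathbb{E}^*$ denote probability and expectation with respect to the randomness of $I_1,\dots,I_k$, conditionally on the data. Applying this (with the same $I_d$) to $X_i=D(i)\mathbf{1}_{\{Z(i)\le x\}}$ and to $X_i=D(i)$, define $$\widehat H_n^*(x)=\frac{\sum_{i=1}^n(D(i)\mathbf{1}_{\{Z(i)\le x\}})^*}{\sum_{i=1}^n(D(i))^*},\qquad H^*(x)=\frac{\mathbb{E}^*\left[\frac1n\sum_{i=1}^n(D(i)\mathbf{1}_{\{Z(i)\le x\}})^*\right]}{\mathbb{E}^*\left[\frac1n\sum_{i=1}^n(D(i))^*\right]}.$$ When a denominator vanishes, the corresponding ratio is set equal to $1$. *)

theory Defs
  imports "HOL-Probability.Probability"
begin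

text \<open>
  The stationary discrete-time GI/G/infinity queue. The service times are indexed by arrival slot
  (an integer) and customer number \<open>l \<ge> 1\<close>; the values \<open>S t 0\<close> are irrelevant junk.
  \<open>G\<close> is only evaluated at natural numbers, which determines the distribution of an
  integer-valued service time.
\<close>

locale discrete_GI_G_infinity = prob_space M
  for M :: "'a measure" and A :: "int \<Rightarrow> 'a \<Rightarrow> nat" and S :: "int \<Rightarrow> nat \<Rightarrow> 'a \<Rightarrow> nat"
    and G :: "nat \<Rightarrow> real" +
  assumes arrivals_indep: "indep_vars (\<lambda>_. count_space UNIV) A UNIV"
    and arrivals_ident: "distr M (count_space UNIV) (A t) = distr M (count_space UNIV) (A 0)"
    and arrivals_mean: "integrable M (\<lambda>\<omega>. real (A 0 \<omega>))"
    and idle_slot: "0 < prob {\<omega> \<in> space M. A 0 \<omega> = 0}" "prob {\<omega> \<in> space M. A 0 \<omega> = 0} < 1"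
    and service_indep: "indep_vars (\<lambda>_. count_space UNIV) (\<lambda>(t, l). S t l) (UNIV \<times> {1..})"
    and service_pos: "l \<ge> 1 \<Longrightarrow> \<omega> \<in> space M \<Longrightarrow> S t l \<omega> \<ge> 1"
    and service_cdf: "l \<ge> 1 \<Longrightarrow> prob {\<omega> \<in> space M. S t l \<omega> \<le> i} = G i"
    and service_mean: "summable (\<lambda>i. 1 - G (Suc i))"
    and arrivals_service_indep:
      "indep_set
        (sets (vimage_algebra (space M) (\<lambda>\<omega> t. A t \<omega>) (\<Pi>\<^sub>M t\<in>UNIV. count_space UNIV)))
        (sets (vimage_algebra (space M) (\<lambda>\<omega>. \<lambda>(t, l)\<in>UNIV \<times> {1..}. S t l \<omega>)
          (\<Pi>\<^sub>M p\<in>UNIV \<times> {1..}. count_space UNIV)))"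

text \<open>
  Departures in slot \<open>t\<close>. The summation index is shifted: \<open>Suc j\<close> ranges over the positive
  integers. The series converges almost surely since the arrivals and services have finite mean;
  its value on the exceptional null set is irrelevant.
\<close>

definition departures :: "(int \<Rightarrow> 'a \<Rightarrow> nat) \<Rightarrow> (int \<Rightarrow> nat \<Rightarrow> 'a \<Rightarrow> nat) \<Rightarrow> int \<Rightarrow> 'a \<Rightarrow> real" where
  "departures A S t \<omega> =
    (\<Sum>j. \<Sum>l=1..A (t - int (Suc j)) \<omega>. of_bool (S (t - int (Suc j)) l \<omega> = Suc j))"

text \<open>
  Time since the last slot with an arrival strictly before \<open>t\<close>. Such a slot exists almost surely;
  \<open>GREATEST\<close> is the maximum of the (infinite, bounded above) set of these slots.
\<close>

definition last_arrival_age :: "(int \<Rightarrow> 'a \<Rightarrow> nat) \<Rightarrow> int \<Rightarrow> 'a \<Rightarrow> int" where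
  "last_arrival_age A t \<omega> = t - (GREATEST n. n < t \<and> A n \<omega> > 0)"

definition marked_departures ::
  "(int \<Rightarrow> 'a \<Rightarrow> nat) \<Rightarrow> (int \<Rightarrow> nat \<Rightarrow> 'a \<Rightarrow> nat) \<Rightarrow> nat \<Rightarrow> int \<Rightarrow> 'a \<Rightarrow> real" where
  "marked_departures A S x t \<omega> =
    departures A S t \<omega> * of_bool (last_arrival_age A t \<omega> \<le> int x)"

definition ratio :: "real \<Rightarrow> real \<Rightarrow> real" where
  "ratio p q = (if q = 0 then 1 else p / q)"

definition H ::
  "'a measure \<Rightarrow> (int \<Rightarrow> 'a \<Rightarrow> nat) \<Rightarrow> (int \<Rightarrow> nat \<Rightarrow> 'a \<Rightarrow> nat) \<Rightarrow> nat \<Rightarrow> real" where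
  "H M A S x =
    ratio (\<integral>\<omega>. marked_departures A S x 0 \<omega> \<partial>M) (\<integral>\<omega>. departures A S 0 \<omega> \<partial>M)"

definition H_hat ::
  "(int \<Rightarrow> 'a \<Rightarrow> nat) \<Rightarrow> (int \<Rightarrow> nat \<Rightarrow> 'a \<Rightarrow> nat) \<Rightarrow> nat \<Rightarrow> nat \<Rightarrow> 'a \<Rightarrow> real" where
  "H_hat A S n x \<omega> =
    ratio (\<Sum>i=1..n. marked_departures A S x (int i) \<omega>) (\<Sum>i=1..n. departures A S (int i) \<omega>)"

text \<open>
  Moving blocks bootstrap for sample size \<open>n\<close> and integer block size \<open>B\<close>. The number of blocks is
  \<open>n div B\<close>, so the bootstrap sample consists of \<open>(n div B) * B\<close> values (which is \<open>n\<close> if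
  \<open>B\<close> divides \<open>n\<close>). The block starts are drawn independently of the queue, so conditioning
  on the data means integrating over the block starts with the sample point of the queue held fixed.
  The value \<open>0\<close> passed to \<open>Pi_pmf\<close> is only the dummy value outside the index set.
\<close>

definition block_starts :: "nat \<Rightarrow> nat \<Rightarrow> (nat \<Rightarrow> nat) pmf" where
  "block_starts n B = Pi_pmf {1..n div B} 0 (\<lambda>_. pmf_of_set {1..n - B + 1})"

text \<open>
  The \<open>i\<close>-th bootstrap value: writing \<open>i = (d - 1) * B + r\<close> with \<open>1 \<le> r \<le> B\<close>, it is
  \<open>X (I d + r)\<close>.
\<close>

definition bootstrap :: "nat \<Rightarrow> (nat \<Rightarrow> nat) \<Rightarrow> (int \<Rightarrow> real) \<Rightarrow> nat \<Rightarrow> real" where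
  "bootstrap B I X i = X (int (I ((i - 1) div B + 1) + ((i - 1) mod B + 1)))"

definition bootstrap_sum :: "nat \<Rightarrow> nat \<Rightarrow> (nat \<Rightarrow> nat) \<Rightarrow> (int \<Rightarrow> real) \<Rightarrow> real" where
  "bootstrap_sum n B I X = (\<Sum>i=1..(n div B) * B. bootstrap B I X i)"

definition H_hat_star ::
  "(int \<Rightarrow> 'a \<Rightarrow> nat) \<Rightarrow> (int \<Rightarrow> nat \<Rightarrow> 'a \<Rightarrow> nat) \<Rightarrow> nat \<Rightarrow> nat \<Rightarrow> nat \<Rightarrow> 'a \<Rightarrow> (nat \<Rightarrow> nat) \<Rightarrow> real" where
  "H_hat_star A S n B x \<omega> I =
    ratio (bootstrap_sum n B I (\<lambda>t. marked_departures A S x t \<omega>))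
          (bootstrap_sum n B I (\<lambda>t. departures A S t \<omega>))"

definition H_star ::
  "(int \<Rightarrow> 'a \<Rightarrow> nat) \<Rightarrow> (int \<Rightarrow> nat \<Rightarrow> 'a \<Rightarrow> nat) \<Rightarrow> nat \<Rightarrow> nat \<Rightarrow> nat \<Rightarrow> 'a \<Rightarrow> real" where
  "H_star A S n B x \<omega> =
    ratio
      (measure_pmf.expectation (block_starts n B)
        (\<lambda>I. 1 / real n * bootstrap_sum n B I (\<lambda>t. marked_departures A S x t \<omega>)))
      (measure_pmf.expectation (block_starts n B)
        (\<lambda>I. 1 / real n * bootstrap_sum n B I (\<lambda>t. departures A S t \<omega>)))"

definition converges_in_probability ::
  "'a measure \<Rightarrow> (nat \<Rightarrow> 'a \<Rightarrow> real) \<Rightarrow> real \<Rightarrow> bool" where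
  "converges_in_probability M X c \<longleftrightarrow>
    (\<forall>n. X n \<in> borel_measurable M) \<and>
    (\<forall>\<epsilon>>0. (\<lambda>n. measure M {\<omega> \<in> space M. \<bar>X n \<omega> - c\<bar> > \<epsilon>}) \<longlonglongrightarrow> 0)"

end

theory Submission
  imports Defs "HOL-Real_Asymp.Real_Asymp"
begin

text \<open>
  Writing \<open>\<^bold>1{Z(t) \<le> x}\<close> as the indicator of an arrival in the \<open>x\<close> slots before \<open>t\<close>, all roots become ratios
  of sums of \<open>w(t) D(t)\<close> with a bounded weight \<open>w\<close> depending on finitely many slots. Truncation of
  services and arrivals makes such a sequence, in mean square, a perturbation of a bounded finitely
  dependent stationary one. This gives the central limit theorem for the sums and, since \<open>b\<^sup>2/n \<rightarrow> 0\<close>, the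
  convergence in mean of the empirical block covariances and of a Lindeberg functional. Given the data the bootstrap blocks
  are i.i.d., so the conditional characteristic functions have the same Gaussian limit as those of the
  sample roots. The two distribution functions are then compared directly: the coordinates with
  \<open>G(x) < 1\<close> have nondegenerate Gaussian limits, which gives uniformity in the argument, and the
  roots of the others vanish almost surely.
\<close>

section \<open>Comparison of distribution functions\<close>

text \<open>The bootstrap law is random, whereas a comparison of distribution functions concerns
  fixed laws. The two are separated: all randomness of the data is collected in one nonnegative
  variable \<open>total_error\<close> with mean tending to 0, and a deterministic statement gives
  the bootstrap characteristic functions along any sample sizes and sample points for which
  \<open>total_error\<close> vanishes. A contradiction argument turns this into a uniform threshold,
  and Markov's inequality finishes. The limiting covariance matrix may be singular; only its
  diagonal is shown positive. This is enough because indicators of orthants are bracketed by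
  products of one-dimensional functions. For one fixed service length the weighted departures read a
  bounded number of slots, however far apart. The service lengths are recombined by Cauchy-Schwarz
  with weights of size \<open>sqrt (1 - G i)\<close>, which is where the summability condition on
  the service tail enters. Positivity of the variances comes from an explicit orthogonal family of
  products of centred idle indicators.\<close>

inductive trig_poly :: "'i set \<Rightarrow> (('i \<Rightarrow> real) \<Rightarrow> complex) \<Rightarrow> bool" for J where
  monomial: "trig_poly J (\<lambda>v. c * iexp (\<Sum>j\<in>J. \<theta> j * v j))"
| add: "trig_poly J f \<Longrightarrow> trig_poly J g \<Longrightarrow> trig_poly J (\<lambda>v. f v + g v)"

lemma trig_poly_const: "trig_poly J (\<lambda>v. c)"
  using trig_poly.monomial[of J c "\<lambda>_. 0"] by simp

lemma trig_poly_mult: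
  assumes f: "trig_poly J f" and g: "trig_poly J g"
  shows "trig_poly J (\<lambda>v. f v * g v)"
  using f
proof induction
  case (monomial c \<theta>)
  from g show ?case
  proof induction
    case (monomial c' \<theta>')
    have "(\<lambda>v. (c * iexp (\<Sum>j\<in>J. \<theta> j * v j)) * (c' * iexp (\<Sum>j\<in>J. \<theta>' j * v j)))
        = (\<lambda>v. (c * c') * iexp (\<Sum>j\<in>J. (\<theta> j + \<theta>' j) * v j))"
      by (intro ext) (simp add: algebra_simps sum.distrib exp_add[symmetric])
    then show ?case by (simp only: trig_poly.monomial)
  next
    case (add f' g')
    then show ?case by (simp only: distrib_left trig_poly.add)
  qed
next
  case (add f' g')
  then show ?case by (simp only: distrib_right trig_poly.add)
qed

lemma trig_poly_prod:
  assumes "finite I" "\<And>i. i \<in> I \<Longrightarrow> trig_poly J (f i)"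
  shows "trig_poly J (\<lambda>v. \<Prod>i\<in>I. f i v)"
  using assms by (induction) (auto intro: trig_poly_const trig_poly_mult)

lemma trig_poly_sin:
  assumes "finite J" "j \<in> J"
  shows "trig_poly J (\<lambda>v. complex_of_real (sin (\<alpha> * v j)))"
proof -
  have *: "(\<Sum>i\<in>J. (if i = j then c else 0) * v i) = c * v j" for c :: real and v
    using assms by (simp add: if_distrib[of "\<lambda>x. x * _"] sum.delta cong: if_cong)
  have "trig_poly J (\<lambda>v. 1 / (2 * \<i>) * iexp (\<Sum>i\<in>J. (if i = j then \<alpha> else 0) * v i)
      + (- 1 / (2 * \<i>)) * iexp (\<Sum>i\<in>J. (if i = j then - \<alpha> else 0) * v i))"
    by (intro trig_poly.intros)
  also have "(\<lambda>v. 1 / (2 * \<i>) * iexp (\<Sum>i\<in>J. (if i = j then \<alpha> else 0) * v i)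
      + (- 1 / (2 * \<i>)) * iexp (\<Sum>i\<in>J. (if i = j then - \<alpha> else 0) * v i))
      = (\<lambda>v. complex_of_real (sin (\<alpha> * v j)))"
    unfolding * sin_of_real[symmetric] sin_exp_eq by (simp add: field_simps)
  finally show ?thesis .
qed

lemma trig_poly_polynomial_sin:
  assumes "finite J" "j \<in> J" "real_polynomial_function q"
  shows "trig_poly J (\<lambda>v. complex_of_real (q (sin (\<alpha> * v j))))"
  using assms(3)
proof induction
  case (linear f)
  have "f u = u * f 1" for u
    using linear_scale[OF bounded_linear.linear[OF linear], of u 1] by simp
  then have "(\<lambda>v. complex_of_real (f (sin (\<alpha> * v j))))
      = (\<lambda>v. complex_of_real (sin (\<alpha> * v j)) * of_real (f 1))"
    by (metis of_real_mult)
  then show ?case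
    using trig_poly_mult[OF trig_poly_sin[OF assms(1,2), of \<alpha>] trig_poly_const[of J "of_real (f 1)"]]
    by simp
qed (auto intro: trig_poly_const trig_poly_mult trig_poly.add)

text \<open>
  Composing a polynomial with the sine keeps the approximant bounded on the whole line, so only
  the mass outside \<open>[-L, L]\<close> has to be controlled.
\<close>

lemma sin_polynomial_approx:
  fixes g :: "real \<Rightarrow> real"
  assumes g: "continuous_on UNIV g" "\<And>v. \<bar>g v\<bar> \<le> 1" and L: "L > 0" and \<epsilon>: "\<epsilon> > 0"
  obtains q where "real_polynomial_function q" "\<And>u. u \<in> {-1..1} \<Longrightarrow> \<bar>q u\<bar> \<le> 1"
    "\<And>v. \<bar>v\<bar> \<le> L \<Longrightarrow> \<bar>g v - q (sin (pi / (2 * L) * v))\<bar> \<le> \<epsilon>"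
proof -
  \<comment> \<open>\<open>G\<close> is \<open>g\<close> on \<open>[-L, L]\<close> transported to
    \<open>[-1, 1]\<close>: for \<open>\<bar>v\<bar> \<le> L\<close> the angle
    \<open>pi / (2 * L) * v\<close> stays between \<open>- pi / 2\<close> and \<open>pi / 2\<close>,
    where \<open>arcsin\<close> inverts the sine.\<close>
  define G where "G u = g (2 * L / pi * arcsin u)" for u
  define e where "e = \<epsilon> / 2"
  have e: "e > 0" using \<epsilon> by (simp add: e_def)
  have "continuous_on {-1..1} G"
    unfolding G_def
    by (rule continuous_on_compose2[OF g(1)]) (auto intro!: continuous_intros)
  from Stone_Weierstrass_real_polynomial_function[OF compact_Icc this e]
  obtain p where p: "real_polynomial_function p" and pG: "\<And>u. u \<in> {-1..1} \<Longrightarrow> \<bar>G u - p u\<bar> < e"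
    by auto
  \<comment> \<open>On \<open>[-1, 1]\<close> the polynomial \<open>p\<close> may exceed 1 by up to
    \<open>e\<close>. Dividing by \<open>1 + e\<close> restores the bound 1 and costs at most
    another \<open>e\<close>, whence \<open>e = \<epsilon> / 2\<close>.\<close>
  define q where "q u = p u * (1 / (1 + e))" for u
  have q: "real_polynomial_function q"
    unfolding q_def by (intro real_polynomial_function.intros p)
  have pb: "\<bar>p u\<bar> \<le> 1 + e" if "u \<in> {-1..1}" for u
    using pG[OF that] g(2)[of "2 * L / pi * arcsin u"] unfolding G_def by linarith
  have qb: "\<bar>q u\<bar> \<le> 1" if "u \<in> {-1..1}" for u
    using pb[OF that] e by (simp add: q_def abs_mult field_simps)
  have "\<bar>g v - q (sin (pi / (2 * L) * v))\<bar> \<le> \<epsilon>" if v: "\<bar>v\<bar> \<le> L" for v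
  proof -
    let ?u = "sin (pi / (2 * L) * v)"
    have u: "?u \<in> {-1..1}" by simp
    have "pi * \<bar>v\<bar> \<le> pi * L" using v by (intro mult_left_mono) auto
    then have "\<bar>pi * v\<bar> \<le> pi * L" by (simp add: abs_mult)
    then have "arcsin ?u = pi / (2 * L) * v"
      using L by (intro arcsin_sin) (auto simp: field_simps abs_le_iff)
    then have "G ?u = g v" using L by (simp add: G_def)
    then have 1: "\<bar>g v - p ?u\<bar> < e" using pG[OF u] by simp
    have "p ?u - q ?u = e * q ?u" using e by (simp add: q_def field_simps)
    then have "\<bar>p ?u - q ?u\<bar> \<le> e * 1"
      using qb[OF u] e by (simp only: abs_mult) (intro mult_mono, auto)
    with 1 e_def show ?thesis by linarith
  qed
  with q qb show ?thesis by (rule that)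
qed

text \<open>By linearity only single exponentials matter, and for these the claim is the hypothesis.
  Integrability is carried through the induction because the sum case has to split the
  integrals.\<close>

lemma integral_trig_poly_tendsto:
  assumes P: "\<And>n. prob_space (P n)" and Q: "\<And>n. prob_space (Q n)"
    and V[measurable]: "\<And>n j. j \<in> J \<Longrightarrow> V n j \<in> borel_measurable (P n)"
    and W[measurable]: "\<And>n j. j \<in> J \<Longrightarrow> W n j \<in> borel_measurable (Q n)"
    and char: "\<And>\<theta>. (\<lambda>n. (\<integral>\<omega>. iexp (\<Sum>j\<in>J. \<theta> j * V n j \<omega>) \<partial>P n)
        - (\<integral>\<omega>. iexp (\<Sum>j\<in>J. \<theta> j * W n j \<omega>) \<partial>Q n)) \<longlonglongrightarrow> 0"
    and f: "trig_poly J f"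
  shows "(\<lambda>n. (\<integral>\<omega>. f (\<lambda>j. V n j \<omega>) \<partial>P n) - (\<integral>\<omega>. f (\<lambda>j. W n j \<omega>) \<partial>Q n)) \<longlonglongrightarrow> 0
    \<and> (\<forall>n. integrable (P n) (\<lambda>\<omega>. f (\<lambda>j. V n j \<omega>)))
    \<and> (\<forall>n. integrable (Q n) (\<lambda>\<omega>. f (\<lambda>j. W n j \<omega>)))"
  using f
proof induction
  case (monomial c \<theta>)
  have "integrable (P n) (\<lambda>\<omega>. c * iexp (\<Sum>j\<in>J. \<theta> j * V n j \<omega>))" for n
  proof -
    interpret prob_space "P n" by (rule P)
    show ?thesis by (intro integrable_mult_right integrable_const_bound[where B = 1]) auto
  qed
  moreover have "integrable (Q n) (\<lambda>\<omega>. c * iexp (\<Sum>j\<in>J. \<theta> j * W n j \<omega>))" for n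
  proof -
    interpret prob_space "Q n" by (rule Q)
    show ?thesis by (intro integrable_mult_right integrable_const_bound[where B = 1]) auto
  qed
  ultimately show ?case
    using tendsto_mult_left[OF char[of \<theta>], of c] by (simp add: right_diff_distrib)
next
  case (add f g)
  then have "(\<lambda>n. ((\<integral>\<omega>. f (\<lambda>j. V n j \<omega>) \<partial>P n) - (\<integral>\<omega>. f (\<lambda>j. W n j \<omega>) \<partial>Q n))
      + ((\<integral>\<omega>. g (\<lambda>j. V n j \<omega>) \<partial>P n) - (\<integral>\<omega>. g (\<lambda>j. W n j \<omega>) \<partial>Q n))) \<longlonglongrightarrow> 0 + 0"
    by (intro tendsto_add) auto
  then show ?case using add by (auto simp: algebra_simps)
qed

text \<open>The factors are exchanged one at a time; since all others are bounded by 1, each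
  exchange costs at most the difference of the two factors involved.\<close>

lemma (in prob_space) integral_prod_diff_le:
  fixes a b :: "'i \<Rightarrow> 'a \<Rightarrow> real"
  assumes J: "finite J"
    and [measurable]: "\<And>j. j \<in> J \<Longrightarrow> a j \<in> borel_measurable M" "\<And>j. j \<in> J \<Longrightarrow> b j \<in> borel_measurable M"
    and bounded: "\<And>j \<omega>. j \<in> J \<Longrightarrow> \<bar>a j \<omega>\<bar> \<le> 1" "\<And>j \<omega>. j \<in> J \<Longrightarrow> \<bar>b j \<omega>\<bar> \<le> 1"
  shows "\<bar>(\<integral>\<omega>. (\<Prod>j\<in>J. a j \<omega>) \<partial>M) - (\<integral>\<omega>. (\<Prod>j\<in>J. b j \<omega>) \<partial>M)\<bar>
    \<le> (\<Sum>j\<in>J. \<integral>\<omega>. \<bar>a j \<omega> - b j \<omega>\<bar> \<partial>M)"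
proof -
  have ia: "integrable M (\<lambda>\<omega>. \<Prod>j\<in>J. a j \<omega>)" and ib: "integrable M (\<lambda>\<omega>. \<Prod>j\<in>J. b j \<omega>)"
    using bounded by (auto intro!: integrable_const_bound[where B = 1] AE_I2 prod_le_1 simp: abs_prod)
  have id: "integrable M (\<lambda>\<omega>. \<bar>a j \<omega> - b j \<omega>\<bar>)" if "j \<in> J" for j
  proof (rule integrable_const_bound[where B = 2])
    show "AE \<omega> in M. norm \<bar>a j \<omega> - b j \<omega>\<bar> \<le> 2"
      using bounded that by (intro AE_I2) (smt (verit, best) real_norm_def)
  qed (use that in measurable)
  have "\<bar>(\<integral>\<omega>. (\<Prod>j\<in>J. a j \<omega>) \<partial>M) - (\<integral>\<omega>. (\<Prod>j\<in>J. b j \<omega>) \<partial>M)\<bar>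
      = \<bar>\<integral>\<omega>. (\<Prod>j\<in>J. a j \<omega>) - (\<Prod>j\<in>J. b j \<omega>) \<partial>M\<bar>"
    using ia ib by simp
  also have "\<dots> \<le> (\<integral>\<omega>. \<bar>(\<Prod>j\<in>J. a j \<omega>) - (\<Prod>j\<in>J. b j \<omega>)\<bar> \<partial>M)"
    by (rule integral_abs_bound)
  also have "\<dots> \<le> (\<integral>\<omega>. (\<Sum>j\<in>J. \<bar>a j \<omega> - b j \<omega>\<bar>) \<partial>M)"
    using ia ib id norm_prod_diff[of J "\<lambda>j. a j _" "\<lambda>j. b j _"] bounded
    by (intro integral_mono) auto
  also have "\<dots> = (\<Sum>j\<in>J. \<integral>\<omega>. \<bar>a j \<omega> - b j \<omega>\<bar> \<partial>M)"
    using id by (rule Bochner_Integration.integral_sum)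
  finally show ?thesis .
qed

text \<open>Inside \<open>[-L, L]\<close> the error is at most \<open>\<epsilon>\<close>. Outside,
  both functions are still bounded by 1, so the error is at most 2 and is paid for by the tail
  probability.\<close>

lemma (in prob_space) integral_sin_approx_le:
  fixes X :: "'a \<Rightarrow> real"
  assumes [measurable]: "X \<in> borel_measurable M" "g \<in> borel_measurable borel" "q \<in> borel_measurable borel"
    and g: "\<And>v. \<bar>g v\<bar> \<le> 1" and q: "\<And>u. u \<in> {-1..1} \<Longrightarrow> \<bar>q u\<bar> \<le> 1"
    and gq: "\<And>v. \<bar>v\<bar> \<le> L \<Longrightarrow> \<bar>g v - q (sin (\<alpha> * v))\<bar> \<le> \<epsilon>" and \<epsilon>: "0 \<le> \<epsilon>"
  shows "(\<integral>\<omega>. \<bar>g (X \<omega>) - q (sin (\<alpha> * X \<omega>))\<bar> \<partial>M) \<le> \<epsilon> + 2 * prob {\<omega> \<in> space M. \<bar>X \<omega>\<bar> > L}"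
proof -
  let ?E = "{\<omega> \<in> space M. \<bar>X \<omega>\<bar> > L}"
  have b2: "\<bar>g v - q (sin (\<alpha> * v))\<bar> \<le> 2" for v
    using g[of v] q[of "sin (\<alpha> * v)"] by simp
  have i: "integrable M (\<lambda>\<omega>. \<bar>g (X \<omega>) - q (sin (\<alpha> * X \<omega>))\<bar>)"
    using b2 by (intro integrable_const_bound[where B = 2]) auto
  have "(\<integral>\<omega>. \<bar>g (X \<omega>) - q (sin (\<alpha> * X \<omega>))\<bar> \<partial>M) \<le> (\<integral>\<omega>. \<epsilon> + 2 * indicator ?E \<omega> \<partial>M)"
  proof (rule integral_mono[OF i])
    show "integrable M (\<lambda>\<omega>. \<epsilon> + 2 * indicator ?E \<omega> :: real)"
      by (intro Bochner_Integration.integrable_add integrable_mult_right) (auto simp: emeasure_eq_measure)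
    fix \<omega> assume "\<omega> \<in> space M"
    then show "\<bar>g (X \<omega>) - q (sin (\<alpha> * X \<omega>))\<bar> \<le> \<epsilon> + 2 * indicator ?E \<omega>"
      using gq[of "X \<omega>"] b2[of "X \<omega>"] \<epsilon> by (cases "\<bar>X \<omega>\<bar> \<le> L") (auto simp: indicator_def)
  qed
  also have "\<dots> = \<epsilon> + 2 * prob ?E" by (simp add: prob_space emeasure_eq_measure)
  finally show ?thesis .
qed


text \<open>Products of one-variable functions are the only test functions that orthants will
  require, and each factor can be replaced separately by a polynomial in a sine. What remains is a
  trigonometric polynomial, whose integrals are governed by the characteristic functions. The two
  laws are compared with each other, so no limit law in several dimensions appears.\<close>

lemma integral_prod_tendsto:
  fixes g :: "'i \<Rightarrow> real \<Rightarrow> real"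
  assumes P: "\<And>n. prob_space (P n)" and Q: "\<And>n. prob_space (Q n)" and J: "finite J"
    and V[measurable]: "\<And>n j. j \<in> J \<Longrightarrow> V n j \<in> borel_measurable (P n)"
    and W[measurable]: "\<And>n j. j \<in> J \<Longrightarrow> W n j \<in> borel_measurable (Q n)"
    and char: "\<And>\<theta>. (\<lambda>n. (\<integral>\<omega>. iexp (\<Sum>j\<in>J. \<theta> j * V n j \<omega>) \<partial>P n)
        - (\<integral>\<omega>. iexp (\<Sum>j\<in>J. \<theta> j * W n j \<omega>) \<partial>Q n)) \<longlonglongrightarrow> 0"
    and tightV: "\<And>\<epsilon>. \<epsilon> > 0 \<Longrightarrow> \<exists>L>0. \<forall>j\<in>J. \<forall>\<^sub>F n in sequentially. \<forall>K\<ge>L.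
        measure (P n) {\<omega> \<in> space (P n). \<bar>V n j \<omega>\<bar> > K} < \<epsilon>"
    and tightW: "\<And>\<epsilon>. \<epsilon> > 0 \<Longrightarrow> \<exists>L>0. \<forall>j\<in>J. \<forall>\<^sub>F n in sequentially. \<forall>K\<ge>L.
        measure (Q n) {\<omega> \<in> space (Q n). \<bar>W n j \<omega>\<bar> > K} < \<epsilon>"
    and g: "\<And>j. j \<in> J \<Longrightarrow> continuous_on UNIV (g j)" "\<And>j v. j \<in> J \<Longrightarrow> \<bar>g j v\<bar> \<le> 1"
  shows "(\<lambda>n. (\<integral>\<omega>. (\<Prod>j\<in>J. g j (V n j \<omega>)) \<partial>P n) - (\<integral>\<omega>. (\<Prod>j\<in>J. g j (W n j \<omega>)) \<partial>Q n)) \<longlonglongrightarrow> 0"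
proof (rule LIMSEQ_I)
  fix \<delta> :: real assume \<delta>: "0 < \<delta>"
  \<comment> \<open>Each coordinate will cost at most \<open>3 * \<epsilon>\<close> under either
    law, which adds up to \<open>3 * \<delta> / 8\<close> per law. Together with
    \<open>\<delta> / 8\<close> for the trigonometric polynomial the total stays below
    \<open>\<delta>\<close>.\<close>
  define \<epsilon> where "\<epsilon> = \<delta> / (8 * (1 + card J))"
  have \<epsilon>: "\<epsilon> > 0" using \<delta> by (simp add: \<epsilon>_def add_pos_nonneg)
  obtain L1 where L1: "L1 > 0" "\<And>j. j \<in> J \<Longrightarrow> \<forall>\<^sub>F n in sequentially. \<forall>K\<ge>L1.
      measure (P n) {\<omega> \<in> space (P n). \<bar>V n j \<omega>\<bar> > K} < \<epsilon>" using tightV[OF \<epsilon>] by blast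
  obtain L2 where L2: "L2 > 0" "\<And>j. j \<in> J \<Longrightarrow> \<forall>\<^sub>F n in sequentially. \<forall>K\<ge>L2.
      measure (Q n) {\<omega> \<in> space (Q n). \<bar>W n j \<omega>\<bar> > K} < \<epsilon>" using tightW[OF \<epsilon>] by blast
  define L where "L = max L1 L2"
  have L: "L > 0" using L1 by (simp add: L_def)
  have "\<exists>q. \<forall>j\<in>J. real_polynomial_function (q j) \<and> (\<forall>u\<in>{-1..1}. \<bar>q j u\<bar> \<le> 1)
      \<and> (\<forall>v. \<bar>v\<bar> \<le> L \<longrightarrow> \<bar>g j v - q j (sin (pi / (2 * L) * v))\<bar> \<le> \<epsilon>)"
  proof (rule bchoice, rule ballI)
    fix j assume j: "j \<in> J"
    from sin_polynomial_approx[OF g(1)[OF j] g(2)[OF j] L \<epsilon>] obtain q where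
      "real_polynomial_function q" "\<And>u. u \<in> {-1..1} \<Longrightarrow> \<bar>q u\<bar> \<le> 1"
      "\<And>v. \<bar>v\<bar> \<le> L \<Longrightarrow> \<bar>g j v - q (sin (pi / (2 * L) * v))\<bar> \<le> \<epsilon>" by metis
    then show "\<exists>q. real_polynomial_function q \<and> (\<forall>u\<in>{-1..1}. \<bar>q u\<bar> \<le> 1)
      \<and> (\<forall>v. \<bar>v\<bar> \<le> L \<longrightarrow> \<bar>g j v - q (sin (pi / (2 * L) * v))\<bar> \<le> \<epsilon>)" by blast
  qed
  then obtain q where q: "\<And>j. j \<in> J \<Longrightarrow> real_polynomial_function (q j)"
    "\<And>j u. j \<in> J \<Longrightarrow> u \<in> {-1..1} \<Longrightarrow> \<bar>q j u\<bar> \<le> 1"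
    "\<And>j v. j \<in> J \<Longrightarrow> \<bar>v\<bar> \<le> L \<Longrightarrow> \<bar>g j v - q j (sin (pi / (2 * L) * v))\<bar> \<le> \<epsilon>"
    by blast
  have [measurable]: "q j \<in> borel_measurable borel" "g j \<in> borel_measurable borel" if "j \<in> J" for j
    using q(1)[OF that] g(1)[OF that]
    by (auto intro!: borel_measurable_continuous_onI
        continuous_on_polymonial_function simp: real_polynomial_function_eq)
  define s where "s j v = q j (sin (pi / (2 * L) * v))" for j v
  have s1: "\<bar>s j v\<bar> \<le> 1" if "j \<in> J" for j v using q(2)[OF that] by (simp add: s_def)
  have [measurable]: "s j \<in> borel_measurable borel" if "j \<in> J" for j
    unfolding s_def using that by measurable
  let ?f = "\<lambda>v :: 'i \<Rightarrow> real. complex_of_real (\<Prod>j\<in>J. s j (v j))"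
  have "trig_poly J ?f"
    unfolding s_def of_real_prod using J q(1) by (intro trig_poly_prod trig_poly_polynomial_sin)
  from integral_trig_poly_tendsto[OF P Q V W char this]
  have "(\<lambda>n. (\<integral>\<omega>. ?f (\<lambda>j. V n j \<omega>) \<partial>P n) - (\<integral>\<omega>. ?f (\<lambda>j. W n j \<omega>) \<partial>Q n)) \<longlonglongrightarrow> 0"
    by blast
  then have "(\<lambda>n. complex_of_real ((\<integral>\<omega>. (\<Prod>j\<in>J. s j (V n j \<omega>)) \<partial>P n) - (\<integral>\<omega>. (\<Prod>j\<in>J. s j (W n j \<omega>)) \<partial>Q n)))
      \<longlonglongrightarrow> complex_of_real 0"
    by (simp only: integral_complex_of_real of_real_diff of_real_0)
  then have "(\<lambda>n. (\<integral>\<omega>. (\<Prod>j\<in>J. s j (V n j \<omega>)) \<partial>P n) - (\<integral>\<omega>. (\<Prod>j\<in>J. s j (W n j \<omega>)) \<partial>Q n)) \<longlonglongrightarrow> 0"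
    by (simp only: tendsto_of_real_iff)
  from LIMSEQ_D[OF this, of "\<delta> / 8"] \<delta>
  have ev: "\<forall>\<^sub>F n in sequentially. \<bar>(\<integral>\<omega>. (\<Prod>j\<in>J. s j (V n j \<omega>)) \<partial>P n) - (\<integral>\<omega>. (\<Prod>j\<in>J. s j (W n j \<omega>)) \<partial>Q n)\<bar> < \<delta> / 8"
    by (auto simp: eventually_sequentially)
  have approx: "\<bar>(\<integral>\<omega>. (\<Prod>j\<in>J. g j (Z j \<omega>)) \<partial>R) - (\<integral>\<omega>. (\<Prod>j\<in>J. s j (Z j \<omega>)) \<partial>R)\<bar> \<le> 3 * \<delta> / 8"
    if R: "prob_space R" and Z[measurable]: "\<And>j. j \<in> J \<Longrightarrow> Z j \<in> borel_measurable R"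
      and tail: "\<forall>j\<in>J. measure R {\<omega> \<in> space R. \<bar>Z j \<omega>\<bar> > L} < \<epsilon>" for R and Z :: "'i \<Rightarrow> 'z \<Rightarrow> real"
  proof -
    interpret R: prob_space R by (rule R)
    have "\<bar>(\<integral>\<omega>. (\<Prod>j\<in>J. g j (Z j \<omega>)) \<partial>R) - (\<integral>\<omega>. (\<Prod>j\<in>J. s j (Z j \<omega>)) \<partial>R)\<bar>
      \<le> (\<Sum>j\<in>J. \<integral>\<omega>. \<bar>g j (Z j \<omega>) - s j (Z j \<omega>)\<bar> \<partial>R)"
      by (rule R.integral_prod_diff_le[OF J]) (use g(2) s1 in auto)
    also have "\<dots> \<le> (\<Sum>j\<in>J. 3 * \<epsilon>)"
    proof (rule sum_mono)
      fix j assume j: "j \<in> J"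
      have "(\<integral>\<omega>. \<bar>g j (Z j \<omega>) - s j (Z j \<omega>)\<bar> \<partial>R) \<le> \<epsilon> + 2 * measure R {\<omega> \<in> space R. \<bar>Z j \<omega>\<bar> > L}"
        unfolding s_def using j \<epsilon> g(2) q by (intro R.integral_sin_approx_le) auto
      then show "(\<integral>\<omega>. \<bar>g j (Z j \<omega>) - s j (Z j \<omega>)\<bar> \<partial>R) \<le> 3 * \<epsilon>" using tail j by fastforce
    qed
    also have "\<dots> = 3 * (card J * \<epsilon>)" by simp
    also have "card J * \<epsilon> \<le> \<delta> / 8" using \<delta> by (simp add: \<epsilon>_def field_simps)
    finally show ?thesis by simp
  qed
  have "\<forall>\<^sub>F n in sequentially. \<forall>j\<in>J. measure (P n) {\<omega> \<in> space (P n). \<bar>V n j \<omega>\<bar> > L} < \<epsilon>"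
    using J by (intro eventually_ball_finite ballI eventually_mono[OF L1(2)]) (auto simp: L_def simp del: max_less_iff_conj)
  moreover have "\<forall>\<^sub>F n in sequentially. \<forall>j\<in>J. measure (Q n) {\<omega> \<in> space (Q n). \<bar>W n j \<omega>\<bar> > L} < \<epsilon>"
    using J by (intro eventually_ball_finite ballI eventually_mono[OF L2(2)]) (auto simp: L_def simp del: max_less_iff_conj)
  ultimately have "\<forall>\<^sub>F n in sequentially.
      norm ((\<integral>\<omega>. (\<Prod>j\<in>J. g j (V n j \<omega>)) \<partial>P n) - (\<integral>\<omega>. (\<Prod>j\<in>J. g j (W n j \<omega>)) \<partial>Q n) - 0) < \<delta>"
    using ev
  proof eventually_elim
    case (elim n)
    from approx[OF P V elim(1)] approx[OF Q W elim(2)] elim(3) \<delta> show ?case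
      unfolding real_norm_def by linarith
  qed
  then show "\<exists>no. \<forall>n\<ge>no. norm ((\<integral>\<omega>. (\<Prod>j\<in>J. g j (V n j \<omega>)) \<partial>P n)
      - (\<integral>\<omega>. (\<Prod>j\<in>J. g j (W n j \<omega>)) \<partial>Q n) - 0) < \<delta>"
    by (simp add: eventually_sequentially)
qed

section \<open>Bracketing half-lines by finitely many continuous functions\<close>

definition ramp :: "real \<Rightarrow> real \<Rightarrow> real \<Rightarrow> real" where
  "ramp a b v = max 0 (min 1 ((b - v) / (b - a)))"

lemma ramp_continuous: "a < b \<Longrightarrow> continuous_on UNIV (ramp a b)"
  unfolding ramp_def by (intro continuous_intros) auto

lemma ramp_bounds: "0 \<le> ramp a b v" "ramp a b v \<le> 1"
  by (auto simp: ramp_def)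

lemma ramp_eq_1: "a < b \<Longrightarrow> v \<le> a \<Longrightarrow> ramp a b v = 1"
  by (auto simp: ramp_def field_simps max_def min_def)

lemma ramp_eq_0: "a < b \<Longrightarrow> b \<le> v \<Longrightarrow> ramp a b v = 0"
  by (auto simp: ramp_def field_simps max_def min_def)

text \<open>Uniformity in \<open>y\<close> comes from a finite family of functions that brackets the
  indicators of all half-lines at once. The points \<open>a i\<close> are quantiles of the limit
  \<open>F\<close> at the levels \<open>i / r\<close>, and \<open>s i\<close> descends from 1 to 0
  between two consecutive quantiles; the constants 0 and 1 close the family at its ends. Continuity
  of \<open>F\<close> is what makes all levels attained.\<close>

lemma coordinate_brackets:
  fixes F :: "real \<Rightarrow> real" and V :: "nat \<Rightarrow> 'a \<Rightarrow> real" and r :: nat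
  assumes P: "\<And>n. prob_space (P n)" and V[measurable]: "\<And>n. V n \<in> borel_measurable (P n)"
    and weak: "\<And>a. (\<lambda>n. measure (P n) {\<omega> \<in> space (P n). V n \<omega> \<le> a}) \<longlonglongrightarrow> F a"
    and F: "mono F" "continuous_on UNIV F" "(F \<longlongrightarrow> 0) at_bot" "(F \<longlongrightarrow> 1) at_top"
    and r: "r \<ge> 3"
  obtains s :: "nat \<Rightarrow> real \<Rightarrow> real" where
    "\<And>i. continuous_on UNIV (s i)" "\<And>i v. s i v \<in> {0..1}"
    "\<forall>\<^sub>F n in sequentially. \<forall>y. \<exists>i<r. \<exists>k<r. (\<forall>v. s i v \<le> of_bool (v \<le> y) \<and> of_bool (v \<le> y) \<le> s k v)
        \<and> (\<integral>\<omega>. \<bar>s k (V n \<omega>) - s i (V n \<omega>)\<bar> \<partial>P n) \<le> 6 / r"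
proof -
  have F_range: "\<exists>x. F x = u" if u: "0 < u" "u < 1" for u
  proof -
    obtain x1 where x1: "F x1 < u" using order_tendstoD(2)[OF F(3) u(1)]
      by (auto simp: eventually_at_bot_linorder)
    obtain x2 where x2: "F x2 > u" using order_tendstoD(1)[OF F(4) u(2)]
      by (auto simp: eventually_at_top_linorder)
    have "x1 \<le> x2" using x1 x2 monoD[OF F(1), of x2 x1] by linarith
    then show ?thesis using IVT'[of F x1 u x2] x1 x2 continuous_on_subset[OF F(2)] by fastforce
  qed
  define a where "a i = (SOME x. F x = real i / r)" for i
  have a: "F (a i) = real i / r" if "1 \<le> i" "i < r" for i
    unfolding a_def by (rule someI_ex, rule F_range) (use that in auto)
  have a_less: "a i < x" if "1 \<le> i" "i < r" "real i / r < F x" for i x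
    using that(3) a[OF that(1,2)] monoD[OF F(1), of x "a i"] by (cases "a i < x") auto
  have a_gr: "x < a i" if "1 \<le> i" "i < r" "F x < real i / r" for i x
    using that(3) a[OF that(1,2)] monoD[OF F(1), of "a i" x] by (cases "x < a i") auto
  have a_mono: "a i < a (Suc i)" if "1 \<le> i" "Suc i < r" for i
    using that a[of "Suc i"] r by (intro a_less) (auto simp: divide_strict_right_mono)
  define s where "s i = (if i = 0 then (\<lambda>_. 0) else if Suc i \<ge> r then (\<lambda>_. 1) else ramp (a i) (a (Suc i)))" for i
  have s_cont: "continuous_on UNIV (s i)" for i
    unfolding s_def by (auto intro!: ramp_continuous a_mono)
  have s_range: "s i v \<in> {0..1}" for i v
    unfolding s_def by (auto simp: ramp_bounds)
  have [measurable]: "s i \<in> borel_measurable borel" for i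
    by (rule borel_measurable_continuous_onI[OF s_cont])
  have s1: "s i v = 1" if "1 \<le> i" "i < r" "v \<le> a i" for i v
    using that a_mono by (auto simp: s_def ramp_eq_1)
  have s0: "s i v = 0" if "Suc i < r" "i = 0 \<or> a (Suc i) \<le> v" for i v
    using that a_mono by (auto simp: s_def ramp_eq_0)
  have bracket: "\<exists>i<r. \<exists>k<r. (\<forall>v. s i v \<le> of_bool (v \<le> y) \<and> of_bool (v \<le> y) \<le> s k v) \<and> k \<le> i + 3" for y
  proof -
    have F01: "0 \<le> F y" "F y \<le> 1"
    proof -
      show "0 \<le> F y"
        by (rule tendsto_upperbound[OF F(3), of "F y"])
          (auto simp: eventually_at_bot_linorder intro!: exI[of _ y] monoD[OF F(1)])
      show "F y \<le> 1"
        by (rule tendsto_lowerbound[OF F(4), of "F y"])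
          (auto simp: eventually_at_top_linorder intro!: exI[of _ y] monoD[OF F(1)])
    qed
    \<comment> \<open>Thus \<open>c / r \<le> F y < (c + 1) / r\<close>. The index
      \<open>c - 2\<close> is used because \<open>s (c - 2)\<close> vanishes from
      \<open>a (c - 1)\<close> on, and \<open>a (c - 1) < y\<close> by strict comparison of levels;
      likewise \<open>y < a (c + 1)\<close>. The upper index is capped at \<open>r - 1\<close>,
      where the function is constantly 1, and the two indices never differ by more than 3.\<close>
    define c where "c = nat \<lfloor>r * F y\<rfloor>"
    have "0 \<le> r * F y" using F01(1) by (intro mult_nonneg_nonneg) auto
    then have c: "real c \<le> r * F y" "r * F y < real c + 1"
      unfolding c_def by linarith+
    have cr: "c \<le> r" using c(1) F01(2) r
      by (smt (verit, best) mult_left_le of_nat_0_le_iff of_nat_le_iff)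
    let ?i = "c - 2" and ?k = "min (c + 1) (r - 1)"
    have "s ?i v \<le> of_bool (v \<le> y)" for v
    proof (cases "v \<le> y")
      case True then show ?thesis using s_range[of ?i v] by simp
    next
      case v: False
      have "?i = 0 \<or> a (Suc ?i) \<le> v"
      proof (cases "c \<le> 2")
        case False
        then have "a (Suc ?i) < y"
          using cr c(1) r by (intro a_less) (auto simp: divide_less_eq mult.commute)
        then show ?thesis using v by linarith
      qed simp
      then have "s ?i v = 0" using cr r by (intro s0) auto
      then show ?thesis using v by simp
    qed
    moreover have "of_bool (v \<le> y) \<le> s ?k v" for v
    proof (cases "v \<le> y")
      case False then show ?thesis using s_range[of ?k v] by simp
    next
      case v: True
      have "s ?k v = 1"
      proof (cases "c + 1 < r")
        case True
        then have "y < a (c + 1)" using c(2) r by (intro a_gr) (auto simp: less_divide_eq mult.commute)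
        then show ?thesis using True v by (simp add: s1 min_def)
      next
        case False then show ?thesis using r by (simp add: s_def min_def)
      qed
      then show ?thesis by simp
    qed
    ultimately have "(\<forall>v. s ?i v \<le> of_bool (v \<le> y) \<and> of_bool (v \<le> y) \<le> s ?k v)" by blast
    moreover have "?i < r" "?k < r" "?k \<le> ?i + 3" using cr r by auto
    ultimately show ?thesis by blast
  qed
  have "\<forall>\<^sub>F n in sequentially. \<forall>i\<in>{1..<r}.
      \<bar>measure (P n) {\<omega> \<in> space (P n). V n \<omega> \<le> a i} - real i / r\<bar> < 1 / r"
  proof (intro eventually_ball_finite ballI)
    fix i assume "i \<in> {1..<r}"
    then have "(\<lambda>n. measure (P n) {\<omega> \<in> space (P n). V n \<omega> \<le> a i}) \<longlonglongrightarrow> real i / r"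
      using weak[of "a i"] a[of i] by simp
    from tendstoD[OF this, of "1 / r"] r show "\<forall>\<^sub>F n in sequentially.
      \<bar>measure (P n) {\<omega> \<in> space (P n). V n \<omega> \<le> a i} - real i / r\<bar> < 1 / r" by (simp add: dist_real_def)
  qed simp
  then have "\<forall>\<^sub>F n in sequentially. \<forall>y. \<exists>i<r. \<exists>k<r. (\<forall>v. s i v \<le> of_bool (v \<le> y) \<and> of_bool (v \<le> y) \<le> s k v)
        \<and> (\<integral>\<omega>. \<bar>s k (V n \<omega>) - s i (V n \<omega>)\<bar> \<partial>P n) \<le> 6 / r"
  proof eventually_elim
    case (elim n)
    interpret prob_space "P n" by (rule P)
    have int: "integrable (P n) (\<lambda>\<omega>. s i (V n \<omega>))" for i
      using s_range by (intro integrable_const_bound[where B = 1]) auto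
    have intI: "integrable (P n) (indicator {\<omega> \<in> space (P n). V n \<omega> \<le> a i} :: 'a \<Rightarrow> real)" for i
      by (simp add: emeasure_eq_measure)
    \<comment> \<open>\<open>s i\<close> lies between the indicators of the half-lines ending at
      \<open>a i\<close> and \<open>a (Suc i)\<close>, whose probabilities are within
      \<open>1 / r\<close> of the levels. Hence its mean lies between \<open>(i - 1) / r\<close> and
      \<open>(i + 2) / r\<close>, and an index gap of 3 yields the constant 6.\<close>
    have lo: "(\<integral>\<omega>. s i (V n \<omega>) \<partial>P n) \<ge> (real i - 1) / r" if i: "i < r" for i
    proof (cases "i = 0")
      case True then show ?thesis by (simp add: s_def)
    next
      case False
      then have "(real i - 1) / r \<le> prob {\<omega> \<in> space (P n). V n \<omega> \<le> a i}"
        using elim[rule_format, of i] i r by (simp add: diff_divide_distrib)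
      also have "\<dots> = (\<integral>\<omega>. indicator {\<omega> \<in> space (P n). V n \<omega> \<le> a i} \<omega> \<partial>P n)"
        by (simp add: emeasure_eq_measure)
      also have "\<dots> \<le> (\<integral>\<omega>. s i (V n \<omega>) \<partial>P n)"
        using s_range False i
        by (intro integral_mono int intI) (auto simp: indicator_def s1)
      finally show ?thesis .
    qed
    have up: "(\<integral>\<omega>. s i (V n \<omega>) \<partial>P n) \<le> (real i + 2) / r" if i: "i < r" for i
    proof (cases "Suc i < r")
      case False
      have "(\<integral>\<omega>. s i (V n \<omega>) \<partial>P n) \<le> (\<integral>\<omega>. 1 \<partial>P n)"
        using s_range by (intro integral_mono int) auto
      also have "\<dots> \<le> (real i + 2) / r" using False i r by (simp add: prob_space le_divide_eq)
      finally show ?thesis .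
    next
      case True
      have "(\<integral>\<omega>. s i (V n \<omega>) \<partial>P n) \<le> (\<integral>\<omega>. indicator {\<omega> \<in> space (P n). V n \<omega> \<le> a (Suc i)} \<omega> \<partial>P n)"
      proof (intro integral_mono int intI)
        fix \<omega> assume "\<omega> \<in> space (P n)"
        then show "s i (V n \<omega>) \<le> indicator {\<omega> \<in> space (P n). V n \<omega> \<le> a (Suc i)} \<omega>"
          using s_range[of i "V n \<omega>"] s0[OF True, of "V n \<omega>"] by (auto simp: indicator_def)
      qed
      also have "\<dots> = prob {\<omega> \<in> space (P n). V n \<omega> \<le> a (Suc i)}"
        by (simp add: emeasure_eq_measure)
      also have "\<dots> \<le> (real i + 2) / r"
        using elim[rule_format, of "Suc i"] True r by (simp add: add_divide_distrib)
      finally show ?thesis .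
    qed
    show ?case
    proof
      fix y
      obtain i k where ik: "i < r" "k < r" "\<And>v. s i v \<le> of_bool (v \<le> y)" "\<And>v. of_bool (v \<le> y) \<le> s k v" "k \<le> i + 3"
        using bracket[of y] by blast
      have le: "s i v \<le> s k v" for v using ik(3,4) order_trans by blast
      have "(\<integral>\<omega>. \<bar>s k (V n \<omega>) - s i (V n \<omega>)\<bar> \<partial>P n) = (\<integral>\<omega>. s k (V n \<omega>) \<partial>P n) - (\<integral>\<omega>. s i (V n \<omega>) \<partial>P n)"
        using le int by simp
      also have "\<dots> \<le> (real k + 2) / r - (real i - 1) / r" using lo[OF ik(1)] up[OF ik(2)] by linarith
      also have "\<dots> = (real k - real i + 3) / r" by (simp add: diff_divide_distrib add_divide_distrib)
      also have "\<dots> \<le> 6 / r" using ik(5) by (intro divide_right_mono) auto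
      finally show "\<exists>i<r. \<exists>k<r. (\<forall>v. s i v \<le> of_bool (v \<le> y) \<and> of_bool (v \<le> y) \<le> s k v)
        \<and> (\<integral>\<omega>. \<bar>s k (V n \<omega>) - s i (V n \<omega>)\<bar> \<partial>P n) \<le> 6 / r" using ik by blast
    qed
  qed
  with s_cont s_range show ?thesis by (rule that)
qed


lemma std_normal_cdf_continuous: "continuous_on UNIV (cdf std_normal_distribution)"
proof -
  interpret real_distribution std_normal_distribution by (rule real_dist_normal_dist)
  have "emeasure std_normal_distribution {x} = 0" for x
    by (subst emeasure_density) (auto intro!: nn_integral_null_set)
  then have "measure std_normal_distribution {x} = 0" for x
    by (simp add: measure_def)
  then show ?thesis by (simp add: continuous_on_eq_continuous_at isCont_cdf)
qed

text \<open>Division by \<open>s\<close> reduces the limit to the standard normal law, to which the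
  continuity theorem of Levy applies; its distribution function has no jump, so convergence holds at
  every point.\<close>

lemma cdf_tendsto_std_normal:
  fixes V :: "nat \<Rightarrow> 'a \<Rightarrow> real"
  assumes P: "\<And>n. prob_space (P n)" and V[measurable]: "\<And>n. V n \<in> borel_measurable (P n)"
    and char: "\<And>t. (\<lambda>n. \<integral>\<omega>. iexp (t * V n \<omega>) \<partial>P n) \<longlonglongrightarrow> complex_of_real (exp (- (t * s)\<^sup>2 / 2))"
    and s: "s > 0"
  shows "(\<lambda>n. measure (P n) {\<omega> \<in> space (P n). V n \<omega> \<le> a}) \<longlonglongrightarrow> cdf std_normal_distribution (a / s)"
proof -
  let ?D = "\<lambda>n. distr (P n) borel (\<lambda>\<omega>. V n \<omega> / s)"
  interpret N: real_distribution std_normal_distribution by (rule real_dist_normal_dist)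
  have "weak_conv_m ?D std_normal_distribution"
  proof (rule levy_continuity)
    fix t
    have "(\<lambda>n. \<integral>\<omega>. iexp ((t / s) * V n \<omega>) \<partial>P n) \<longlonglongrightarrow> complex_of_real (exp (- (t / s * s)\<^sup>2 / 2))"
      by (rule char)
    then show "(\<lambda>n. char (?D n) t) \<longlonglongrightarrow> char std_normal_distribution t"
      unfolding char_std_normal_distribution using s by (simp add: char_def integral_distr)
  qed (auto intro!: prob_space.real_distribution_distr P real_dist_normal_dist)
  moreover have "isCont (cdf std_normal_distribution) x" for x
    using std_normal_cdf_continuous by (simp add: continuous_on_eq_continuous_at)
  ultimately have "(\<lambda>n. cdf (?D n) (a / s)) \<longlonglongrightarrow> cdf std_normal_distribution (a / s)"
    unfolding weak_conv_m_def weak_conv_def by blast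
  moreover have "cdf (?D n) (a / s) = measure (P n) {\<omega> \<in> space (P n). V n \<omega> \<le> a}" for n
    unfolding cdf_def using s by (subst measure_distr) (auto intro!: arg_cong[where f = "measure _"] simp: divide_le_cancel)
  ultimately show ?thesis by simp
qed

text \<open>The limit function at two points already controls the tails. The bound is stated for all
  \<open>K \<ge> L\<close> so that \<open>L\<close> may later be enlarged to a value common to all
  coordinates and to both families of laws.\<close>

lemma tight_std_normal:
  fixes V :: "nat \<Rightarrow> 'a \<Rightarrow> real"
  assumes P: "\<And>n. prob_space (P n)" and V[measurable]: "\<And>n. V n \<in> borel_measurable (P n)"
    and weak: "\<And>a. (\<lambda>n. measure (P n) {\<omega> \<in> space (P n). V n \<omega> \<le> a}) \<longlonglongrightarrow> F a"
    and F: "(F \<longlongrightarrow> 0) at_bot" "(F \<longlongrightarrow> 1) at_top" and \<epsilon>: "\<epsilon> > 0"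
  shows "\<exists>L>0. \<forall>\<^sub>F n in sequentially. \<forall>K\<ge>L. measure (P n) {\<omega> \<in> space (P n). \<bar>V n \<omega>\<bar> > K} < \<epsilon>"
proof -
  obtain a where a: "F a < \<epsilon> / 2" "a \<le> 0"
    using eventually_happens[OF eventually_conj[OF order_tendstoD(2)[OF F(1), of "\<epsilon> / 2"] eventually_le_at_bot[of "0 :: real"]]] \<epsilon>
    by auto
  obtain b where b: "F b > 1 - \<epsilon> / 2" "b > 0"
    using eventually_happens[OF eventually_conj[OF order_tendstoD(1)[OF F(2), of "1 - \<epsilon> / 2"] eventually_gt_at_top[of "0 :: real"]]] \<epsilon>
    by auto
  define L where "L = max b (- a)"
  have "\<forall>\<^sub>F n in sequentially. \<forall>K\<ge>L. measure (P n) {\<omega> \<in> space (P n). \<bar>V n \<omega>\<bar> > K} < \<epsilon>"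
    using order_tendstoD(2)[OF weak a(1)] order_tendstoD(1)[OF weak b(1)]
  proof eventually_elim
    case (elim n)
    interpret prob_space "P n" by (rule P)
    show ?case
    proof (intro allI impI)
      fix K assume K: "L \<le> K"
      have "prob {\<omega> \<in> space (P n). \<bar>V n \<omega>\<bar> > K}
        \<le> prob ({\<omega> \<in> space (P n). V n \<omega> \<le> a} \<union> (space (P n) - {\<omega> \<in> space (P n). V n \<omega> \<le> b}))"
        using K by (intro finite_measure_mono) (auto simp: L_def)
      also have "\<dots> \<le> prob {\<omega> \<in> space (P n). V n \<omega> \<le> a} + prob (space (P n) - {\<omega> \<in> space (P n). V n \<omega> \<le> b})"
        by (rule measure_Un_le) auto
      also have "\<dots> < \<epsilon>" using elim by (subst prob_compl) auto
      finally show "prob {\<omega> \<in> space (P n). \<bar>V n \<omega>\<bar> > K} < \<epsilon>" .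
    qed
  qed
  moreover have "L > 0" using b by (simp add: L_def)
  ultimately show ?thesis by blast
qed

lemma uniform_tail_bound:
  fixes p :: "nat \<Rightarrow> 'i \<Rightarrow> real \<Rightarrow> real"
  assumes "finite J" "\<And>j. j \<in> J \<Longrightarrow> \<exists>L>0. \<forall>\<^sub>F n in sequentially. \<forall>K\<ge>L. p n j K < \<epsilon>"
  shows "\<exists>L>0. \<forall>j\<in>J. \<forall>\<^sub>F n in sequentially. \<forall>K\<ge>L. p n j K < \<epsilon>"
  using assms
proof induction
  case empty
  show ?case by (intro exI[of _ 1]) simp
next
  case (insert i J)
  obtain L where L: "L > 0" "\<forall>j\<in>J. \<forall>\<^sub>F n in sequentially. \<forall>K\<ge>L. p n j K < \<epsilon>"
    using insert.IH insert.prems by auto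
  obtain L' where L': "L' > 0" "\<forall>\<^sub>F n in sequentially. \<forall>K\<ge>L'. p n i K < \<epsilon>"
    using insert.prems by blast
  show ?case
  proof (intro exI[of _ "max L L'"] conjI ballI)
    fix j assume "j \<in> insert i J"
    then show "\<forall>\<^sub>F n in sequentially. \<forall>K\<ge>max L L'. p n j K < \<epsilon>"
      using L(2) eventually_mono[OF L'(2)] by (auto elim!: eventually_mono)
  qed (use L in auto)
qed

text \<open>An orthant indicator is a product of half-line indicators, hence sandwiched between
  products of one-dimensional brackets. The brackets need only continuous marginal limits, which is
  why \<open>normal\<close> speaks of one coordinate at a time. Their width is measured under
  \<open>P n\<close> alone and transferred to \<open>Q n\<close> by the convergence of integrals of
  products.\<close>

theorem char_tendsto_imp_cdf_diff:
  fixes V :: "nat \<Rightarrow> 'i \<Rightarrow> 'a \<Rightarrow> real" and W :: "nat \<Rightarrow> 'i \<Rightarrow> 'b \<Rightarrow> real"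
  assumes P: "\<And>n. prob_space (P n)" and Q: "\<And>n. prob_space (Q n)" and J: "finite J"
    and V[measurable]: "\<And>n j. j \<in> J \<Longrightarrow> V n j \<in> borel_measurable (P n)"
    and W[measurable]: "\<And>n j. j \<in> J \<Longrightarrow> W n j \<in> borel_measurable (Q n)"
    and charV: "\<And>\<theta>. (\<lambda>n. \<integral>\<omega>. iexp (\<Sum>j\<in>J. \<theta> j * V n j \<omega>) \<partial>P n) \<longlonglongrightarrow> \<phi> \<theta>"
    and charW: "\<And>\<theta>. (\<lambda>n. \<integral>\<omega>. iexp (\<Sum>j\<in>J. \<theta> j * W n j \<omega>) \<partial>Q n) \<longlonglongrightarrow> \<phi> \<theta>"
    and normal: "\<And>j t. j \<in> J \<Longrightarrow> \<phi> (\<lambda>i. if i = j then t else 0) = complex_of_real (exp (- (t * s j)\<^sup>2 / 2))"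
    and s: "\<And>j. j \<in> J \<Longrightarrow> s j > 0" and \<epsilon>: "\<epsilon> > 0"
  shows "\<forall>\<^sub>F n in sequentially. \<forall>y. \<bar>measure (P n) {\<omega> \<in> space (P n). \<forall>j\<in>J. V n j \<omega> \<le> y j}
      - measure (Q n) {\<omega> \<in> space (Q n). \<forall>j\<in>J. W n j \<omega> \<le> y j}\<bar> \<le> \<epsilon>"
proof -
  interpret N: real_distribution std_normal_distribution by (rule real_dist_normal_dist)
  define F where "F j a = cdf std_normal_distribution (a / s j)" for j a
  have single: "(\<Sum>i\<in>J. (if i = j then t else 0) * v i) = t * v j" if "j \<in> J" for j t and v :: "'i \<Rightarrow> real"
    using that J by (simp add: if_distrib[of "\<lambda>x. x * _"] sum.delta cong: if_cong)
  have weakV: "(\<lambda>n. measure (P n) {\<omega> \<in> space (P n). V n j \<omega> \<le> a}) \<longlonglongrightarrow> F j a" if j: "j \<in> J" for j a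
    unfolding F_def
  proof (rule cdf_tendsto_std_normal[OF P V[OF j] _ s[OF j]])
    show "(\<lambda>n. \<integral>\<omega>. iexp (t * V n j \<omega>) \<partial>P n) \<longlonglongrightarrow> complex_of_real (exp (- (t * s j)\<^sup>2 / 2))" for t
      using charV[of "\<lambda>i. if i = j then t else 0"] by (simp only: single[OF j] normal[OF j])
  qed
  have weakW: "(\<lambda>n. measure (Q n) {\<omega> \<in> space (Q n). W n j \<omega> \<le> a}) \<longlonglongrightarrow> F j a" if j: "j \<in> J" for j a
    unfolding F_def
  proof (rule cdf_tendsto_std_normal[OF Q W[OF j] _ s[OF j]])
    show "(\<lambda>n. \<integral>\<omega>. iexp (t * W n j \<omega>) \<partial>Q n) \<longlonglongrightarrow> complex_of_real (exp (- (t * s j)\<^sup>2 / 2))" for t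
      using charW[of "\<lambda>i. if i = j then t else 0"] by (simp only: single[OF j] normal[OF j])
  qed
  have F: "mono (F j)" "continuous_on UNIV (F j)" "(F j \<longlongrightarrow> 0) at_bot" "(F j \<longlongrightarrow> 1) at_top"
    if j: "j \<in> J" for j
  proof -
    show "mono (F j)"
      unfolding F_def using s[OF j] by (intro monoI N.cdf_nondecreasing divide_right_mono) auto
    show "continuous_on UNIV (F j)" unfolding F_def
      using s[OF j] by (intro continuous_on_compose2[OF std_normal_cdf_continuous] continuous_intros) auto
    have "filterlim (\<lambda>a. a / s j) at_bot at_bot" "filterlim (\<lambda>a. a / s j) at_top at_top"
      using s[OF j] by real_asymp+
    then show "(F j \<longlongrightarrow> 0) at_bot" "(F j \<longlongrightarrow> 1) at_top" unfolding F_def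
      using filterlim_compose[OF N.cdf_lim_at_bot] filterlim_compose[OF N.cdf_lim_at_top_prob] by blast+
  qed
  have tightV: "\<exists>L>0. \<forall>j\<in>J. \<forall>\<^sub>F n in sequentially. \<forall>K\<ge>L. measure (P n) {\<omega> \<in> space (P n). \<bar>V n j \<omega>\<bar> > K} < \<epsilon>"
    if "\<epsilon> > 0" for \<epsilon>
    using J tight_std_normal[OF P V weakV F(3,4) that] by (rule uniform_tail_bound) blast
  have tightW: "\<exists>L>0. \<forall>j\<in>J. \<forall>\<^sub>F n in sequentially. \<forall>K\<ge>L. measure (Q n) {\<omega> \<in> space (Q n). \<bar>W n j \<omega>\<bar> > K} < \<epsilon>"
    if "\<epsilon> > 0" for \<epsilon>
    using J tight_std_normal[OF Q W weakW F(3,4) that] by (rule uniform_tail_bound) blast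
  \<comment> \<open>Large enough that the bracket widths \<open>6 / r\<close>, summed over the
    coordinates, stay below \<open>\<epsilon> / 2\<close>; the summand 3 secures the minimal number
    of levels.\<close>
  define r where "r = nat \<lceil>12 * (1 + card J) / \<epsilon>\<rceil> + 3"
  have r: "r \<ge> 3" "6 * card J / r \<le> \<epsilon> / 2"
  proof -
    show "r \<ge> 3" by (simp add: r_def)
    have "12 * (1 + card J) / \<epsilon> \<le> r" unfolding r_def by linarith
    then have "12 * (1 + card J) \<le> r * \<epsilon>" using \<epsilon> by (simp add: field_simps)
    then show "6 * card J / r \<le> \<epsilon> / 2" using \<open>r \<ge> 3\<close> by (simp add: field_simps)
  qed
  have "\<exists>b. \<forall>j\<in>J. (\<forall>i. continuous_on UNIV (b j i)) \<and> (\<forall>i v. b j i v \<in> {0..1 :: real}) \<and>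
    (\<forall>\<^sub>F n in sequentially. \<forall>y. \<exists>i<r. \<exists>k<r. (\<forall>v. b j i v \<le> of_bool (v \<le> y) \<and> of_bool (v \<le> y) \<le> b j k v)
        \<and> (\<integral>\<omega>. \<bar>b j k (V n j \<omega>) - b j i (V n j \<omega>)\<bar> \<partial>P n) \<le> 6 / r)"
  proof (rule bchoice, rule ballI)
    fix j assume j: "j \<in> J"
    show "\<exists>s. (\<forall>i. continuous_on UNIV (s i)) \<and> (\<forall>i v. s i v \<in> {0..1 :: real}) \<and>
    (\<forall>\<^sub>F n in sequentially. \<forall>y. \<exists>i<r. \<exists>k<r. (\<forall>v. s i v \<le> of_bool (v \<le> y) \<and> of_bool (v \<le> y) \<le> s k v)
        \<and> (\<integral>\<omega>. \<bar>s k (V n j \<omega>) - s i (V n j \<omega>)\<bar> \<partial>P n) \<le> 6 / r)"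
      by (rule coordinate_brackets[OF P V[OF j] weakV[OF j] F[OF j] r(1)]) blast
  qed
  then obtain b where b: "\<And>j i. j \<in> J \<Longrightarrow> continuous_on UNIV (b j i)"
      "\<And>j i v. j \<in> J \<Longrightarrow> b j i v \<in> {0..1 :: real}"
      "\<And>j. j \<in> J \<Longrightarrow> \<forall>\<^sub>F n in sequentially. \<forall>y. \<exists>i<r. \<exists>k<r. (\<forall>v. b j i v \<le> of_bool (v \<le> y) \<and> of_bool (v \<le> y) \<le> b j k v)
        \<and> (\<integral>\<omega>. \<bar>b j k (V n j \<omega>) - b j i (V n j \<omega>)\<bar> \<partial>P n) \<le> 6 / r"
    by blast
  have [measurable]: "b j i \<in> borel_measurable borel" if "j \<in> J" for j i
    by (rule borel_measurable_continuous_onI[OF b(1)[OF that]])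
  have b1: "\<bar>b j i v\<bar> \<le> 1" "0 \<le> b j i v" if "j \<in> J" for j i v using b(2)[OF that, of i v] by auto
  let ?EP = "\<lambda>n \<kappa>. \<integral>\<omega>. (\<Prod>j\<in>J. b j (\<kappa> j) (V n j \<omega>)) \<partial>P n"
  let ?EQ = "\<lambda>n \<kappa>. \<integral>\<omega>. (\<Prod>j\<in>J. b j (\<kappa> j) (W n j \<omega>)) \<partial>Q n"
  \<comment> \<open>The argument \<open>y\<close> has disappeared: only the finitely many choices of
    one bracket per coordinate have to be compared, so one threshold for \<open>n\<close> serves all
    \<open>y\<close>.\<close>
  have ev2: "\<forall>\<^sub>F n in sequentially. \<forall>\<kappa>\<in>J \<rightarrow>\<^sub>E {..<r}. \<bar>?EP n \<kappa> - ?EQ n \<kappa>\<bar> < \<epsilon> / 2"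
  proof (intro eventually_ball_finite ballI)
    show "finite (J \<rightarrow>\<^sub>E {..<r})" using J by (intro finite_PiE) auto
    fix \<kappa>
    have "(\<lambda>n. ?EP n \<kappa> - ?EQ n \<kappa>) \<longlonglongrightarrow> 0"
    proof (rule integral_prod_tendsto[OF P Q J V W])
      show "(\<lambda>n. (\<integral>\<omega>. iexp (\<Sum>j\<in>J. \<theta> j * V n j \<omega>) \<partial>P n) - (\<integral>\<omega>. iexp (\<Sum>j\<in>J. \<theta> j * W n j \<omega>) \<partial>Q n)) \<longlonglongrightarrow> 0" for \<theta>
        using tendsto_diff[OF charV charW, of \<theta> \<theta>] by simp
    qed (use tightV tightW b b1 in auto)
    from tendstoD[OF this, of "\<epsilon> / 2"] \<epsilon> show "\<forall>\<^sub>F n in sequentially. \<bar>?EP n \<kappa> - ?EQ n \<kappa>\<bar> < \<epsilon> / 2"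
      by (simp add: dist_real_def)
  qed
  have ev1: "\<forall>\<^sub>F n in sequentially. \<forall>j\<in>J. \<forall>y. \<exists>i<r. \<exists>k<r. (\<forall>v. b j i v \<le> of_bool (v \<le> y) \<and> of_bool (v \<le> y) \<le> b j k v)
        \<and> (\<integral>\<omega>. \<bar>b j k (V n j \<omega>) - b j i (V n j \<omega>)\<bar> \<partial>P n) \<le> 6 / r"
    using b(3) J by (intro eventually_ball_finite) auto
  have sandwich: "(\<integral>\<omega>. (\<Prod>j\<in>J. b j (i j) (Z j \<omega>)) \<partial>R) \<le> measure R {\<omega> \<in> space R. \<forall>j\<in>J. Z j \<omega> \<le> y j}
      \<and> measure R {\<omega> \<in> space R. \<forall>j\<in>J. Z j \<omega> \<le> y j} \<le> (\<integral>\<omega>. (\<Prod>j\<in>J. b j (k j) (Z j \<omega>)) \<partial>R)"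
    if R: "prob_space R" and Z[measurable]: "\<And>j. j \<in> J \<Longrightarrow> Z j \<in> borel_measurable R"
      and ik: "\<And>j v. j \<in> J \<Longrightarrow> b j (i j) v \<le> of_bool (v \<le> y j)" "\<And>j v. j \<in> J \<Longrightarrow> of_bool (v \<le> y j) \<le> b j (k j) v"
    for R and Z :: "'i \<Rightarrow> 'z \<Rightarrow> real" and i k y
  proof -
    interpret R: prob_space R by (rule R)
    have set: "{\<omega> \<in> space R. \<forall>j\<in>J. Z j \<omega> \<le> y j} \<in> sets R"
      using J by measurable
    have of_bool: "(\<Prod>j\<in>J. of_bool (Z j \<omega> \<le> y j)) = (of_bool (\<forall>j\<in>J. Z j \<omega> \<le> y j) :: real)" for \<omega>
      using J by induction auto
    have ind: "measure R {\<omega> \<in> space R. \<forall>j\<in>J. Z j \<omega> \<le> y j} = (\<integral>\<omega>. (\<Prod>j\<in>J. of_bool (Z j \<omega> \<le> y j)) \<partial>R)"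
    proof -
      have "(\<integral>\<omega>. (\<Prod>j\<in>J. of_bool (Z j \<omega> \<le> y j)) \<partial>R) = (\<integral>\<omega>. (indicator {\<omega> \<in> space R. \<forall>j\<in>J. Z j \<omega> \<le> y j} \<omega> :: real) \<partial>R)"
        by (intro Bochner_Integration.integral_cong refl) (auto simp: indicator_def of_bool)
      also have "\<dots> = measure R {\<omega> \<in> space R. \<forall>j\<in>J. Z j \<omega> \<le> y j}"
        using set by (simp add: R.emeasure_eq_measure)
      finally show ?thesis by simp
    qed
    have int: "integrable R (\<lambda>\<omega>. \<Prod>j\<in>J. b j (\<kappa> j) (Z j \<omega>))" for \<kappa>
      using b1 by (intro R.integrable_const_bound[where B = 1]) (auto simp: abs_prod intro!: prod_le_1)
    have int': "integrable R (\<lambda>\<omega>. \<Prod>j\<in>J. of_bool (Z j \<omega> \<le> y j) :: real)"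
      by (intro R.integrable_const_bound[where B = 1]) (auto simp: abs_prod intro!: prod_le_1)
    show ?thesis unfolding ind
      by (intro conjI integral_mono int int' prod_mono) (use ik b1 in auto)
  qed
  from ev1 ev2 show ?thesis
  proof eventually_elim
    case (elim n)
    interpret P: prob_space "P n" by (rule P)
    show ?case
    proof
      fix y
      have "\<exists>i. \<forall>j\<in>J. \<exists>k. i j < r \<and> k < r \<and> (\<forall>v. b j (i j) v \<le> of_bool (v \<le> y j) \<and> of_bool (v \<le> y j) \<le> b j k v)
        \<and> (\<integral>\<omega>. \<bar>b j k (V n j \<omega>) - b j (i j) (V n j \<omega>)\<bar> \<partial>P n) \<le> 6 / r"
        using elim(1) by (intro bchoice) blast
      then obtain i where "\<forall>j\<in>J. \<exists>k. i j < r \<and> k < r \<and> (\<forall>v. b j (i j) v \<le> of_bool (v \<le> y j) \<and> of_bool (v \<le> y j) \<le> b j k v)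
        \<and> (\<integral>\<omega>. \<bar>b j k (V n j \<omega>) - b j (i j) (V n j \<omega>)\<bar> \<partial>P n) \<le> 6 / r" ..
      from bchoice[OF this] obtain k where ik: "\<And>j. j \<in> J \<Longrightarrow> i j < r" "\<And>j. j \<in> J \<Longrightarrow> k j < r"
        "\<And>j v. j \<in> J \<Longrightarrow> b j (i j) v \<le> of_bool (v \<le> y j)"
        "\<And>j v. j \<in> J \<Longrightarrow> of_bool (v \<le> y j) \<le> b j (k j) v"
        "\<And>j. j \<in> J \<Longrightarrow> (\<integral>\<omega>. \<bar>b j (k j) (V n j \<omega>) - b j (i j) (V n j \<omega>)\<bar> \<partial>P n) \<le> 6 / r" by blast
      have cl: "\<bar>?EP n \<kappa> - ?EQ n \<kappa>\<bar> < \<epsilon> / 2" if "\<And>j. j \<in> J \<Longrightarrow> \<kappa> j < r" for \<kappa>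
      proof -
        have "restrict \<kappa> J \<in> J \<rightarrow>\<^sub>E {..<r}" using that by auto
        from elim(2)[rule_format, OF this] show ?thesis by simp
      qed
      \<comment> \<open>The distance between the product brackets is at most the sum of the
        distances between their factors.\<close>
      have "\<bar>?EP n k - ?EP n i\<bar> \<le> (\<Sum>j\<in>J. \<integral>\<omega>. \<bar>b j (k j) (V n j \<omega>) - b j (i j) (V n j \<omega>)\<bar> \<partial>P n)"
        by (rule P.integral_prod_diff_le[OF J]) (use b1 in auto)
      also have "\<dots> \<le> (\<Sum>j\<in>J. 6 / r)" using ik(5) by (rule sum_mono)
      also have "\<dots> = 6 * card J / r" by simp
      also note r(2)
      finally have gap: "\<bar>?EP n k - ?EP n i\<bar> \<le> \<epsilon> / 2" .
      show "\<bar>measure (P n) {\<omega> \<in> space (P n). \<forall>j\<in>J. V n j \<omega> \<le> y j}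
          - measure (Q n) {\<omega> \<in> space (Q n). \<forall>j\<in>J. W n j \<omega> \<le> y j}\<bar> \<le> \<epsilon>"
      proof -
        have "?EP n i \<le> measure (P n) {\<omega> \<in> space (P n). \<forall>j\<in>J. V n j \<omega> \<le> y j}
            \<and> measure (P n) {\<omega> \<in> space (P n). \<forall>j\<in>J. V n j \<omega> \<le> y j} \<le> ?EP n k"
          by (rule sandwich[OF P V]) (use ik in auto)
        moreover have "?EQ n i \<le> measure (Q n) {\<omega> \<in> space (Q n). \<forall>j\<in>J. W n j \<omega> \<le> y j}
            \<and> measure (Q n) {\<omega> \<in> space (Q n). \<forall>j\<in>J. W n j \<omega> \<le> y j} \<le> ?EQ n k"
          by (rule sandwich[OF Q W]) (use ik in auto)
        moreover have "\<bar>?EP n i - ?EQ n i\<bar> < \<epsilon> / 2" "\<bar>?EP n k - ?EQ n k\<bar> < \<epsilon> / 2"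
          using cl[of i] cl[of k] ik(1,2) by blast+
        ultimately show ?thesis using gap by linarith
      qed
    qed
  qed
qed

section \<open>Characteristic functions of ratios and of high powers\<close>

lemma cmod_iexp_diff_le: "cmod (iexp a - iexp b) \<le> \<bar>a - b\<bar>"
proof -
  have "iexp a - iexp b = iexp b * (iexp (a - b) - 1)"
    by (simp add: algebra_simps exp_add[symmetric])
  then have "cmod (iexp a - iexp b) = cmod (iexp (a - b) - 1)" by (simp add: norm_mult)
  also have "\<dots> \<le> \<bar>a - b\<bar>" using iexp_approx1[of "a - b" 0] by simp
  finally show ?thesis .
qed

lemma cmod_iexp_diff_le_2: "cmod (iexp a - iexp b) \<le> 2"
  using norm_triangle_ineq4[of "iexp a" "iexp b"] by simp

text \<open>The cubic bound is the good one near 0 and the quadratic one far away. Keeping the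
  minimum of the two makes the remainder usable for block sums that are controlled in mean square
  only.\<close>

lemma cmod_iexp_second_order: "cmod (iexp x - (1 + \<i> * x - x\<^sup>2 / 2)) \<le> min (\<bar>x\<bar> ^ 3) (x\<^sup>2)"
proof -
  have sum: "(\<Sum>k\<le>2. (\<i> * complex_of_real x) ^ k / fact k) = 1 + \<i> * x - x\<^sup>2 / 2"
    by (simp add: numeral_2_eq_2 power2_eq_square algebra_simps)
  have "cmod (iexp x - (1 + \<i> * x - x\<^sup>2 / 2)) \<le> \<bar>x\<bar> ^ 3 / 6"
    using iexp_approx1[of x 2] unfolding sum by (simp add: numeral_3_eq_3 fact_numeral)
  moreover have "cmod (iexp x - (1 + \<i> * x - x\<^sup>2 / 2)) \<le> x\<^sup>2"
    using iexp_approx2[of x 2] unfolding sum by simp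
  moreover have "\<bar>x\<bar> ^ 3 / 6 \<le> \<bar>x\<bar> ^ 3" by simp
  ultimately show ?thesis by linarith
qed

lemma (in prob_space) char_diff_le:
  assumes [measurable]: "Y \<in> borel_measurable M" "Z \<in> borel_measurable M"
    and f: "integrable M f" "\<And>\<omega>. \<omega> \<in> space M \<Longrightarrow> min 2 \<bar>Y \<omega> - Z \<omega>\<bar> \<le> f \<omega>"
  shows "cmod ((\<integral>\<omega>. iexp (Y \<omega>) \<partial>M) - (\<integral>\<omega>. iexp (Z \<omega>) \<partial>M)) \<le> (\<integral>\<omega>. f \<omega> \<partial>M)"
proof -
  have i: "integrable M (\<lambda>\<omega>. iexp (X \<omega>))" if [measurable]: "X \<in> borel_measurable M" for X
    by (intro integrable_const_bound[where B = 1]) auto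
  have "cmod ((\<integral>\<omega>. iexp (Y \<omega>) \<partial>M) - (\<integral>\<omega>. iexp (Z \<omega>) \<partial>M))
      = cmod (\<integral>\<omega>. iexp (Y \<omega>) - iexp (Z \<omega>) \<partial>M)"
    using i[of Y] i[of Z] by simp
  also have "\<dots> \<le> (\<integral>\<omega>. cmod (iexp (Y \<omega>) - iexp (Z \<omega>)) \<partial>M)"
    by (rule integral_norm_bound)
  also have "\<dots> \<le> (\<integral>\<omega>. f \<omega> \<partial>M)"
  proof (rule integral_mono)
    show "integrable M (\<lambda>\<omega>. cmod (iexp (Y \<omega>) - iexp (Z \<omega>)))"
      using i[of Y] i[of Z] by simp
    fix \<omega> assume "\<omega> \<in> space M"
    then show "cmod (iexp (Y \<omega>) - iexp (Z \<omega>)) \<le> f \<omega>"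
      using f(2)[of \<omega>] cmod_iexp_diff_le[of "Y \<omega>" "Z \<omega>"] cmod_iexp_diff_le_2[of "Y \<omega>" "Z \<omega>"] by linarith
  qed (rule f)
  finally show ?thesis .
qed

text \<open>Slutsky's theorem in terms of characteristic functions: the denominator is replaced by
  its limit \<open>d\<close>. \<open>R\<close> is tied to the quotient only where \<open>den\<close>
  is positive, so the default value of \<open>ratio\<close> is confined to an event of vanishing
  probability.\<close>

lemma char_ratio_tendsto:
  fixes P :: "nat \<Rightarrow> 'a measure" and num R :: "nat \<Rightarrow> 'i \<Rightarrow> 'a \<Rightarrow> real" and den :: "nat \<Rightarrow> 'a \<Rightarrow> real"
  assumes P: "\<And>n. prob_space (P n)" and J: "finite J"
    and [measurable]: "\<And>n j. j \<in> J \<Longrightarrow> num n j \<in> borel_measurable (P n)"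
      "\<And>n j. j \<in> J \<Longrightarrow> R n j \<in> borel_measurable (P n)" "\<And>n. den n \<in> borel_measurable (P n)"
    and num: "\<And>j. j \<in> J \<Longrightarrow> \<forall>\<^sub>F n in sequentially. integrable (P n) (\<lambda>\<omega>. (num n j \<omega>)\<^sup>2) \<and> (\<integral>\<omega>. (num n j \<omega>)\<^sup>2 \<partial>P n) \<le> C"
    and den: "\<And>\<eta>. \<eta> > 0 \<Longrightarrow> (\<lambda>n. measure (P n) {\<omega> \<in> space (P n). \<bar>den n \<omega> - d\<bar> \<ge> \<eta>}) \<longlonglongrightarrow> 0" and d: "d > 0"
    and R: "\<forall>\<^sub>F n in sequentially. \<forall>j\<in>J. \<forall>\<omega>\<in>space (P n). den n \<omega> > 0 \<longrightarrow> R n j \<omega> = num n j \<omega> / den n \<omega>"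
    and char: "(\<lambda>n. \<integral>\<omega>. iexp (\<Sum>j\<in>J. \<theta> j * (num n j \<omega> / d)) \<partial>P n) \<longlonglongrightarrow> \<phi>"
  shows "(\<lambda>n. \<integral>\<omega>. iexp (\<Sum>j\<in>J. \<theta> j * R n j \<omega>) \<partial>P n) \<longlonglongrightarrow> \<phi>"
proof -
  have "(\<lambda>n. (\<integral>\<omega>. iexp (\<Sum>j\<in>J. \<theta> j * R n j \<omega>) \<partial>P n) - (\<integral>\<omega>. iexp (\<Sum>j\<in>J. \<theta> j * (num n j \<omega> / d)) \<partial>P n)) \<longlonglongrightarrow> 0"
  proof (rule LIMSEQ_I)
    fix \<epsilon> :: real assume \<epsilon>: "0 < \<epsilon>"
    define \<Theta> where "\<Theta> = (\<Sum>j\<in>J. \<bar>\<theta> j\<bar>) * (1 + \<bar>C\<bar>)"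
    have \<Theta>: "\<Theta> \<ge> 0" by (auto simp: \<Theta>_def intro!: mult_nonneg_nonneg sum_nonneg)
    \<comment> \<open>The bound \<open>d / 2\<close> keeps the denominator above
      \<open>d / 2\<close> on the good event. The other bound makes the error
      \<open>2 * \<eta> / d\<^sup>2 * \<Theta>\<close> at most \<open>\<epsilon> / 4\<close>, where
      \<open>\<Theta>\<close> bounds the contribution of the numerators.\<close>
    define \<eta> where "\<eta> = min (d / 2) (\<epsilon> * d\<^sup>2 / (8 * (1 + \<Theta>)))"
    have \<eta>: "\<eta> > 0" "\<eta> \<le> d / 2" using d \<epsilon> \<Theta> unfolding \<eta>_def by (simp, intro min.cobounded1)
    have "\<eta> \<le> \<epsilon> * d\<^sup>2 / (8 * (1 + \<Theta>))" by (simp add: \<eta>_def)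
    then have "\<eta> * (8 * (1 + \<Theta>)) \<le> \<epsilon> * d\<^sup>2" using \<Theta> by (subst (asm) le_divide_eq) auto
    then have "8 * (\<eta> * \<Theta>) \<le> \<epsilon> * d\<^sup>2" using \<eta>(1) by (simp add: algebra_simps)
    then have \<eta>\<Theta>: "2 * \<eta> / d\<^sup>2 * \<Theta> \<le> \<epsilon> / 4" using d by (simp add: field_simps)
    have "\<forall>\<^sub>F n in sequentially. \<forall>j\<in>J. integrable (P n) (\<lambda>\<omega>. (num n j \<omega>)\<^sup>2) \<and> (\<integral>\<omega>. (num n j \<omega>)\<^sup>2 \<partial>P n) \<le> C"
      using J num by (intro eventually_ball_finite) auto
    moreover have "\<forall>\<^sub>F n in sequentially. measure (P n) {\<omega> \<in> space (P n). \<bar>den n \<omega> - d\<bar> \<ge> \<eta>} < \<epsilon> / 4"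
      using order_tendstoD(2)[OF den[OF \<eta>(1)], of "\<epsilon> / 4"] \<epsilon> by simp
    moreover note R
    ultimately have "\<forall>\<^sub>F n in sequentially. norm ((\<integral>\<omega>. iexp (\<Sum>j\<in>J. \<theta> j * R n j \<omega>) \<partial>P n)
        - (\<integral>\<omega>. iexp (\<Sum>j\<in>J. \<theta> j * (num n j \<omega> / d)) \<partial>P n) - 0) < \<epsilon>"
    proof eventually_elim
      case (elim n)
      interpret prob_space "P n" by (rule P)
      let ?E = "{\<omega> \<in> space (P n). \<bar>den n \<omega> - d\<bar> \<ge> \<eta>}"
      \<comment> \<open>On the bad event the two exponentials differ by at most 2. Elsewhere the
        inverse denominators differ by at most \<open>2 * \<eta> / d\<^sup>2\<close>, and a
        numerator is at most 1 plus its square in absolute value.\<close>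
      let ?f = "\<lambda>\<omega>. 2 * indicator ?E \<omega> + 2 * \<eta> / d\<^sup>2 * (\<Sum>j\<in>J. \<bar>\<theta> j\<bar> * (1 + (num n j \<omega>)\<^sup>2))"
      have i1: "integrable (P n) (\<lambda>\<omega>. 2 * indicator ?E \<omega> :: real)" by (simp add: emeasure_eq_measure)
      have i2: "integrable (P n) (\<lambda>\<omega>. \<bar>\<theta> j\<bar> * (1 + (num n j \<omega>)\<^sup>2))" if "j \<in> J" for j
        using elim(1) that by simp
      have i3: "integrable (P n) (\<lambda>\<omega>. \<Sum>j\<in>J. \<bar>\<theta> j\<bar> * (1 + (num n j \<omega>)\<^sup>2))"
        by (rule Bochner_Integration.integrable_sum[OF i2])
      have i: "integrable (P n) ?f"
        by (intro Bochner_Integration.integrable_add[OF i1] integrable_mult_right i3)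
      have "cmod ((\<integral>\<omega>. iexp (\<Sum>j\<in>J. \<theta> j * R n j \<omega>) \<partial>P n)
          - (\<integral>\<omega>. iexp (\<Sum>j\<in>J. \<theta> j * (num n j \<omega> / d)) \<partial>P n)) \<le> (\<integral>\<omega>. ?f \<omega> \<partial>P n)"
      proof (rule char_diff_le[OF _ _ i])
        fix \<omega> assume \<omega>: "\<omega> \<in> space (P n)"
        have nn: "0 \<le> 2 * \<eta> / d\<^sup>2 * (\<Sum>j\<in>J. \<bar>\<theta> j\<bar> * (1 + (num n j \<omega>)\<^sup>2))"
          using \<eta> by (intro mult_nonneg_nonneg sum_nonneg) auto
        show "min 2 \<bar>(\<Sum>j\<in>J. \<theta> j * R n j \<omega>) - (\<Sum>j\<in>J. \<theta> j * (num n j \<omega> / d))\<bar> \<le> ?f \<omega>"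
        proof (cases "\<omega> \<in> ?E")
          case True
          then show ?thesis using nn by (simp add: indicator_def)
        next
          case False
          then have close: "\<bar>den n \<omega> - d\<bar> < \<eta>" using \<omega> by auto
          then have den: "den n \<omega> > d / 2" using \<eta> by (auto simp: abs_less_iff)
          then have pos: "den n \<omega> > 0" using d by linarith
          have inv: "\<bar>1 / den n \<omega> - 1 / d\<bar> \<le> 2 * \<eta> / d\<^sup>2"
          proof -
            have "\<bar>1 / den n \<omega> - 1 / d\<bar> = \<bar>den n \<omega> - d\<bar> / (den n \<omega> * d)"
              using pos d by (simp add: diff_frac_eq abs_minus_commute abs_mult)
            also have "\<dots> \<le> \<eta> / (d / 2 * d)"
              using close den pos d by (intro frac_le mult_right_mono) auto
            also have "\<dots> = 2 * \<eta> / d\<^sup>2" by (simp add: power2_eq_square)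
            finally show ?thesis .
          qed
          have "\<bar>(\<Sum>j\<in>J. \<theta> j * R n j \<omega>) - (\<Sum>j\<in>J. \<theta> j * (num n j \<omega> / d))\<bar>
              = \<bar>\<Sum>j\<in>J. \<theta> j * num n j \<omega> * (1 / den n \<omega> - 1 / d)\<bar>"
            using elim(3) \<omega> pos by (simp add: sum_subtractf[symmetric] algebra_simps)
          also have "\<dots> \<le> (\<Sum>j\<in>J. \<bar>\<theta> j * num n j \<omega> * (1 / den n \<omega> - 1 / d)\<bar>)" by (rule sum_abs)
          also have "\<dots> \<le> (\<Sum>j\<in>J. 2 * \<eta> / d\<^sup>2 * (\<bar>\<theta> j\<bar> * (1 + (num n j \<omega>)\<^sup>2)))"
          proof (rule sum_mono)
            fix j
            have "\<bar>num n j \<omega>\<bar> \<le> 1 + (num n j \<omega>)\<^sup>2"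
              using zero_le_power2[of "\<bar>num n j \<omega>\<bar> - 1"] by (simp add: power2_diff)
            then have "\<bar>\<theta> j\<bar> * \<bar>num n j \<omega>\<bar> * \<bar>1 / den n \<omega> - 1 / d\<bar> \<le> \<bar>\<theta> j\<bar> * (1 + (num n j \<omega>)\<^sup>2) * (2 * \<eta> / d\<^sup>2)"
              using inv by (intro mult_mono) auto
            then show "\<bar>\<theta> j * num n j \<omega> * (1 / den n \<omega> - 1 / d)\<bar> \<le> 2 * \<eta> / d\<^sup>2 * (\<bar>\<theta> j\<bar> * (1 + (num n j \<omega>)\<^sup>2))"
              by (simp add: abs_mult mult_ac)
          qed
          also have "\<dots> = 2 * \<eta> / d\<^sup>2 * (\<Sum>j\<in>J. \<bar>\<theta> j\<bar> * (1 + (num n j \<omega>)\<^sup>2))" by (simp only: sum_distrib_left)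
          finally have "\<bar>(\<Sum>j\<in>J. \<theta> j * R n j \<omega>) - (\<Sum>j\<in>J. \<theta> j * (num n j \<omega> / d))\<bar>
              \<le> 2 * \<eta> / d\<^sup>2 * (\<Sum>j\<in>J. \<bar>\<theta> j\<bar> * (1 + (num n j \<omega>)\<^sup>2))" .
          moreover have "indicator ?E \<omega> = (0 :: real)" using False by simp
          ultimately show ?thesis by (simp only: mult_zero_right add_0_left min.coboundedI2)
        qed
      qed (use J in measurable)
      also have "(\<integral>\<omega>. ?f \<omega> \<partial>P n) = 2 * prob ?E + 2 * \<eta> / d\<^sup>2 * (\<Sum>j\<in>J. \<bar>\<theta> j\<bar> * (1 + (\<integral>\<omega>. (num n j \<omega>)\<^sup>2 \<partial>P n)))"
      proof -
        have "(\<integral>\<omega>. ?f \<omega> \<partial>P n) = (\<integral>\<omega>. 2 * indicator ?E \<omega> \<partial>P n) + (\<integral>\<omega>. 2 * \<eta> / d\<^sup>2 * (\<Sum>j\<in>J. \<bar>\<theta> j\<bar> * (1 + (num n j \<omega>)\<^sup>2)) \<partial>P n)"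
          by (intro Bochner_Integration.integral_add i1 integrable_mult_right i3)
        also have "(\<integral>\<omega>. 2 * indicator ?E \<omega> \<partial>P n) = 2 * prob ?E" by (simp add: emeasure_eq_measure)
        also have "(\<integral>\<omega>. 2 * \<eta> / d\<^sup>2 * (\<Sum>j\<in>J. \<bar>\<theta> j\<bar> * (1 + (num n j \<omega>)\<^sup>2)) \<partial>P n)
            = 2 * \<eta> / d\<^sup>2 * (\<Sum>j\<in>J. \<integral>\<omega>. \<bar>\<theta> j\<bar> * (1 + (num n j \<omega>)\<^sup>2) \<partial>P n)"
          using i2 by (subst integral_mult_right_zero, subst Bochner_Integration.integral_sum) auto
        also have "(\<Sum>j\<in>J. \<integral>\<omega>. \<bar>\<theta> j\<bar> * (1 + (num n j \<omega>)\<^sup>2) \<partial>P n) = (\<Sum>j\<in>J. \<bar>\<theta> j\<bar> * (1 + (\<integral>\<omega>. (num n j \<omega>)\<^sup>2 \<partial>P n)))"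
          using elim(1) by (intro sum.cong refl) (simp add: prob_space)
        finally show ?thesis .
      qed
      also have "\<dots> \<le> 2 * prob ?E + 2 * \<eta> / d\<^sup>2 * \<Theta>"
      proof -
        have "(\<Sum>j\<in>J. \<bar>\<theta> j\<bar> * (1 + (\<integral>\<omega>. (num n j \<omega>)\<^sup>2 \<partial>P n))) \<le> (\<Sum>j\<in>J. \<bar>\<theta> j\<bar> * (1 + \<bar>C\<bar>))"
          using elim(1) by (intro sum_mono mult_left_mono add_left_mono) (auto intro: order_trans[OF _ abs_ge_self])
        then show ?thesis using \<eta> unfolding \<Theta>_def sum_distrib_right by (intro add_left_mono mult_left_mono) auto
      qed
      also have "\<dots> < \<epsilon>" using elim(2) \<eta>\<Theta> \<epsilon> by linarith
      finally show ?case by simp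
    qed
    then show "\<exists>no. \<forall>n\<ge>no. norm ((\<integral>\<omega>. iexp (\<Sum>j\<in>J. \<theta> j * R n j \<omega>) \<partial>P n)
        - (\<integral>\<omega>. iexp (\<Sum>j\<in>J. \<theta> j * (num n j \<omega> / d)) \<partial>P n) - 0) < \<epsilon>"
      by (simp add: eventually_sequentially)
  qed
  from tendsto_add[OF this char] show ?thesis by simp
qed

text \<open>The Lindeberg argument for \<open>k n\<close> independent draws from a finite population
  \<open>I n\<close>. The mean over the population is compared first with its second-order Taylor
  polynomial, then with \<open>1 - s / (2 * k n)\<close>; both comparisons survive the power
  \<open>k n\<close> because all three numbers lie in the unit disc.\<close>

lemma power_char_tendsto:
  fixes \<tau> :: "nat \<Rightarrow> 'j \<Rightarrow> real" and I :: "nat \<Rightarrow> 'j set" and k :: "nat \<Rightarrow> nat"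
  assumes I: "\<And>n. finite (I n)" "\<And>n. I n \<noteq> {}"
    and k: "filterlim k at_top sequentially"
    and mean: "\<forall>\<^sub>F n in sequentially. (\<Sum>i\<in>I n. \<tau> n i) = 0"
    and var: "(\<lambda>n. k n / card (I n) * (\<Sum>i\<in>I n. (\<tau> n i)\<^sup>2)) \<longlonglongrightarrow> s"
    and lind: "(\<lambda>n. k n / card (I n) * (\<Sum>i\<in>I n. min (\<bar>\<tau> n i\<bar> ^ 3) ((\<tau> n i)\<^sup>2))) \<longlonglongrightarrow> 0"
  shows "(\<lambda>n. ((\<Sum>i\<in>I n. iexp (\<tau> n i)) / card (I n)) ^ k n) \<longlonglongrightarrow> complex_of_real (exp (- s / 2))"
proof -
  define \<psi> where "\<psi> n = (\<Sum>i\<in>I n. iexp (\<tau> n i)) / card (I n)" for n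
  define a where "a n = (\<Sum>i\<in>I n. (\<tau> n i)\<^sup>2) / card (I n)" for n
  \<comment> \<open>The Taylor polynomial of the population mean; the linear term is absent because
    the population is centred.\<close>
  define w where "w n = complex_of_real (1 - a n / 2)" for n
  define v where "v n = complex_of_real (1 + (- s / 2) / k n)" for n
  have N: "real (card (I n)) > 0" for n using I by (simp add: card_gt_0_iff)
  have kr: "filterlim (\<lambda>n. real (k n)) at_top sequentially"
    using filterlim_compose[OF filterlim_real_sequentially k] .
  have ka: "(\<lambda>n. k n * a n) \<longlonglongrightarrow> s" using var by (simp add: a_def)
  have "(\<lambda>n. (k n * a n) * inverse (real (k n))) \<longlonglongrightarrow> s * 0"
    by (intro tendsto_mult ka tendsto_inverse_0_at_top kr)
  moreover have kpos: "\<forall>\<^sub>F n in sequentially. k n > 0"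
    using eventually_compose_filterlim[OF eventually_gt_at_top k] .
  ultimately have a0: "a \<longlonglongrightarrow> 0"
    by (rule_tac Lim_transform_eventually) (auto elim!: eventually_mono)
  have psi1: "norm (\<psi> n) \<le> 1" for n
  proof -
    have "norm (\<Sum>i\<in>I n. iexp (\<tau> n i)) \<le> (\<Sum>i\<in>I n. 1)"
      by (rule order_trans[OF norm_sum]) simp
    then show ?thesis using N[of n] by (simp add: \<psi>_def norm_divide)
  qed
  have "(\<lambda>n. \<psi> n ^ k n - w n ^ k n) \<longlonglongrightarrow> 0"
  proof (rule Lim_null_comparison[OF _ lind])
    \<comment> \<open>With \<open>0 \<le> a n < 4\<close> the number \<open>1 - a n / 2\<close> has
      modulus at most 1, as the estimate for differences of powers requires.\<close>
    have "\<forall>\<^sub>F n in sequentially. a n < 4" using order_tendstoD(2)[OF a0, of 4] by simp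
    with mean show "\<forall>\<^sub>F n in sequentially. norm (\<psi> n ^ k n - w n ^ k n)
        \<le> k n / card (I n) * (\<Sum>i\<in>I n. min (\<bar>\<tau> n i\<bar> ^ 3) ((\<tau> n i)\<^sup>2))"
    proof eventually_elim
      case (elim n)
      have "0 \<le> a n" by (auto simp: a_def intro!: divide_nonneg_nonneg sum_nonneg)
      then have w1: "norm (w n) \<le> 1" using elim(2) unfolding w_def norm_of_real by linarith
      have "(\<Sum>i\<in>I n. iexp (\<tau> n i) - (1 + \<i> * \<tau> n i - (\<tau> n i)\<^sup>2 / 2))
          = (\<Sum>i\<in>I n. iexp (\<tau> n i)) - (card (I n) + \<i> * complex_of_real (\<Sum>i\<in>I n. \<tau> n i) - complex_of_real (\<Sum>i\<in>I n. (\<tau> n i)\<^sup>2) / 2)"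
        by (simp add: sum_subtractf sum.distrib sum_distrib_left sum_divide_distrib)
      also have "\<dots> = card (I n) * (\<psi> n - w n)"
        using N[of n] elim(1) by (simp add: \<psi>_def w_def a_def field_simps)
      finally have eq: "\<psi> n - w n = (\<Sum>i\<in>I n. iexp (\<tau> n i) - (1 + \<i> * \<tau> n i - (\<tau> n i)\<^sup>2 / 2)) / card (I n)"
        using N[of n] by (simp add: field_simps)
      have "norm (\<psi> n - w n) \<le> (\<Sum>i\<in>I n. min (\<bar>\<tau> n i\<bar> ^ 3) ((\<tau> n i)\<^sup>2)) / card (I n)"
        unfolding eq norm_divide using cmod_iexp_second_order
        by (auto intro!: divide_right_mono order_trans[OF norm_sum] sum_mono simp del: min_def)
      then have "k n * norm (\<psi> n - w n) \<le> k n * ((\<Sum>i\<in>I n. min (\<bar>\<tau> n i\<bar> ^ 3) ((\<tau> n i)\<^sup>2)) / card (I n))"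
        by (intro mult_left_mono) auto
      with norm_power_diff[OF psi1[of n] w1, of "k n"] show ?case by simp
    qed
  qed
  moreover have "(\<lambda>n. w n ^ k n - v n ^ k n) \<longlonglongrightarrow> 0"
  proof (rule Lim_null_comparison)
    have "(\<lambda>n. \<bar>k n * a n - s\<bar> / 2) \<longlonglongrightarrow> \<bar>s - s\<bar> / 2" by (intro tendsto_intros ka) simp
    then show "(\<lambda>n. \<bar>k n * a n - s\<bar> / 2) \<longlonglongrightarrow> 0" by simp
    have s: "s \<ge> 0"
      by (rule tendsto_lowerbound[OF ka]) (auto simp: a_def intro!: always_eventually sum_nonneg divide_nonneg_nonneg mult_nonneg_nonneg)
    have "\<forall>\<^sub>F n in sequentially. a n < 4" using order_tendstoD(2)[OF a0, of 4] by simp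
    moreover have "\<forall>\<^sub>F n in sequentially. real (k n) \<ge> s + 1"
      using kr by (auto simp: filterlim_at_top)
    ultimately show "\<forall>\<^sub>F n in sequentially. norm (w n ^ k n - v n ^ k n) \<le> \<bar>k n * a n - s\<bar> / 2"
    proof eventually_elim
      case (elim n)
      have "0 \<le> a n" by (auto simp: a_def intro!: divide_nonneg_nonneg sum_nonneg)
      then have w1: "norm (w n) \<le> 1" using elim(1) unfolding w_def norm_of_real by linarith
      have k0: "real (k n) > 0" using elim(2) s by linarith
      have "(s / 2) / k n \<le> 1" "0 \<le> (s / 2) / k n" using elim(2) s k0 by (auto simp: field_simps)
      then have v1: "norm (v n) \<le> 1" unfolding v_def norm_of_real by (simp add: abs_le_iff)
      have "norm (w n ^ k n - v n ^ k n) \<le> k n * norm (w n - v n)"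
        by (rule norm_power_diff[OF w1 v1])
      also have "w n - v n = complex_of_real (- (k n * a n - s) / (2 * k n))"
        unfolding w_def v_def of_real_diff[symmetric] using k0 by (intro arg_cong[where f = of_real]) (simp add: field_simps)
      also have "k n * norm \<dots> = \<bar>k n * a n - s\<bar> / 2"
        unfolding norm_of_real using k0 by (simp add: abs_divide)
      finally show ?case .
    qed
  qed
  moreover have "(\<lambda>n. v n ^ k n) \<longlonglongrightarrow> complex_of_real (exp (- s / 2))"
    unfolding v_def of_real_power[symmetric]
    by (intro tendsto_of_real filterlim_compose[OF tendsto_exp_limit_sequentially[of "- s / 2"] k])
  ultimately have "(\<lambda>n. (\<psi> n ^ k n - w n ^ k n) + (w n ^ k n - v n ^ k n) + v n ^ k n) \<longlonglongrightarrow> 0 + 0 + complex_of_real (exp (- s / 2))"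
    by (intro tendsto_add)
  then show ?thesis by (simp add: \<psi>_def)
qed

section \<open>Finitely dependent approximation\<close>

lemma (in prob_space) indep_vars_inj_reindex:
  assumes X: "indep_vars M' X I" and f: "inj_on f J" "f ` J \<subseteq> I"
  shows "indep_vars (\<lambda>j. M' (f j)) (\<lambda>j. X (f j)) J"
proof -
  have "indep_vars (\<lambda>j. PiM {f j} M') (\<lambda>j \<omega>. restrict (\<lambda>i. X i \<omega>) {f j}) J"
    using f by (intro indep_vars_restrict[OF X]) (auto simp: disjoint_family_on_def inj_on_def)
  then have "indep_vars (\<lambda>j. M' (f j)) (\<lambda>j \<omega>. (\<lambda>g. g (f j)) (restrict (\<lambda>i. X i \<omega>) {f j})) J"
    by (rule indep_vars_compose2) (auto intro: measurable_component_singleton)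
  then show ?thesis by simp
qed

lemma (in prob_space) integrable_mult_of_squares:
  fixes Y Z :: "'a \<Rightarrow> real"
  assumes [measurable]: "Y \<in> borel_measurable M" "Z \<in> borel_measurable M"
    and sq: "integrable M (\<lambda>\<omega>. (Y \<omega>)\<^sup>2)" "integrable M (\<lambda>\<omega>. (Z \<omega>)\<^sup>2)"
  shows "integrable M (\<lambda>\<omega>. Y \<omega> * Z \<omega>)"
    and "expectation (\<lambda>\<omega>. Y \<omega> * Z \<omega>) \<le> (expectation (\<lambda>\<omega>. (Y \<omega>)\<^sup>2) + expectation (\<lambda>\<omega>. (Z \<omega>)\<^sup>2)) / 2"
proof -
  have ab: "\<bar>a * b\<bar> \<le> (a\<^sup>2 + b\<^sup>2) / 2" for a b :: real
    using zero_le_power2[of "a - b"] zero_le_power2[of "a + b"]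
    by (auto simp: power2_eq_square algebra_simps abs_le_iff)
  show i: "integrable M (\<lambda>\<omega>. Y \<omega> * Z \<omega>)"
    by (rule Bochner_Integration.integrable_bound[of _ "\<lambda>\<omega>. ((Y \<omega>)\<^sup>2 + (Z \<omega>)\<^sup>2) / 2"])
      (use sq ab in \<open>auto intro!: AE_I2\<close>)
  have "expectation (\<lambda>\<omega>. Y \<omega> * Z \<omega>) \<le> expectation (\<lambda>\<omega>. ((Y \<omega>)\<^sup>2 + (Z \<omega>)\<^sup>2) / 2)"
    using sq order_trans[OF abs_ge_self ab] by (intro integral_mono i) auto
  then show "expectation (\<lambda>\<omega>. Y \<omega> * Z \<omega>) \<le> (expectation (\<lambda>\<omega>. (Y \<omega>)\<^sup>2) + expectation (\<lambda>\<omega>. (Z \<omega>)\<^sup>2)) / 2"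
    using sq by simp
qed

text \<open>Every mixed moment is at most \<open>v\<close> by the arithmetic-geometric mean
  inequality, so only the number of correlated pairs counts. This one estimate serves finitely
  dependent sequences, squared block sums, independent big blocks, departures of one service length,
  and the bootstrap draws.\<close>

lemma (in prob_space) second_moment_sum_le:
  fixes Y :: "'i \<Rightarrow> 'a \<Rightarrow> real" and v :: real and c :: nat
  assumes T: "finite T"
    and [measurable]: "\<And>t. t \<in> T \<Longrightarrow> Y t \<in> borel_measurable M"
    and sq: "\<And>t. t \<in> T \<Longrightarrow> integrable M (\<lambda>\<omega>. (Y t \<omega>)\<^sup>2)"
    and v: "\<And>t. t \<in> T \<Longrightarrow> expectation (\<lambda>\<omega>. (Y t \<omega>)\<^sup>2) \<le> v"
    and c: "\<And>t. t \<in> T \<Longrightarrow> card {s \<in> T. expectation (\<lambda>\<omega>. Y t \<omega> * Y s \<omega>) \<noteq> 0} \<le> c"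
  shows "integrable M (\<lambda>\<omega>. (\<Sum>t\<in>T. Y t \<omega>)\<^sup>2)"
    and "expectation (\<lambda>\<omega>. (\<Sum>t\<in>T. Y t \<omega>)\<^sup>2) \<le> card T * c * v"
proof -
  have eq: "(\<Sum>t\<in>T. Y t \<omega>)\<^sup>2 = (\<Sum>t\<in>T. \<Sum>s\<in>T. Y t \<omega> * Y s \<omega>)" for \<omega>
    by (simp add: power2_eq_square sum_product)
  have i: "integrable M (\<lambda>\<omega>. Y t \<omega> * Y s \<omega>)" if "t \<in> T" "s \<in> T" for t s
    using that sq by (intro integrable_mult_of_squares) auto
  show "integrable M (\<lambda>\<omega>. (\<Sum>t\<in>T. Y t \<omega>)\<^sup>2)" unfolding eq using i by (intro Bochner_Integration.integrable_sum)
  have "expectation (\<lambda>\<omega>. (\<Sum>t\<in>T. Y t \<omega>)\<^sup>2) = (\<Sum>t\<in>T. \<Sum>s\<in>T. expectation (\<lambda>\<omega>. Y t \<omega> * Y s \<omega>))"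
    unfolding eq using i by (simp add: Bochner_Integration.integral_sum Bochner_Integration.integrable_sum)
  also have "\<dots> \<le> (\<Sum>t\<in>T. real c * v)"
  proof (rule sum_mono)
    fix t assume t: "t \<in> T"
    have v0: "0 \<le> v" using v[OF t] by (rule order_trans[rotated]) auto
    let ?S = "{s \<in> T. expectation (\<lambda>\<omega>. Y t \<omega> * Y s \<omega>) \<noteq> 0}"
    have "(\<Sum>s\<in>T. expectation (\<lambda>\<omega>. Y t \<omega> * Y s \<omega>)) = (\<Sum>s\<in>?S. expectation (\<lambda>\<omega>. Y t \<omega> * Y s \<omega>))"
      using T by (intro sum.mono_neutral_right) auto
    also have "\<dots> \<le> (\<Sum>s\<in>?S. v)"
    proof (rule sum_mono)
      fix s assume s: "s \<in> ?S"
      then have "expectation (\<lambda>\<omega>. Y t \<omega> * Y s \<omega>) \<le> (expectation (\<lambda>\<omega>. (Y t \<omega>)\<^sup>2) + expectation (\<lambda>\<omega>. (Y s \<omega>)\<^sup>2)) / 2"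
        using t sq by (intro integrable_mult_of_squares) auto
      also have "\<dots> \<le> v" using v[OF t] v[of s] s by auto
      finally show "expectation (\<lambda>\<omega>. Y t \<omega> * Y s \<omega>) \<le> v" .
    qed
    also have "\<dots> \<le> c * v" using c[OF t] v0 by (auto intro!: mult_right_mono)
    finally show "(\<Sum>s\<in>T. expectation (\<lambda>\<omega>. Y t \<omega> * Y s \<omega>)) \<le> c * v" .
  qed
  also have "\<dots> = card T * c * v" by simp
  finally show "expectation (\<lambda>\<omega>. (\<Sum>t\<in>T. Y t \<omega>)\<^sup>2) \<le> card T * c * v" .
qed

text \<open>The sum runs from \<open>a + 1\<close> to \<open>a + n\<close>, in accordance with the
  bootstrap convention that the block with start \<open>q\<close> consists of the values at
  \<open>q + 1, ..., q + B\<close>.\<close>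

definition psum :: "(int \<Rightarrow> 'a \<Rightarrow> real) \<Rightarrow> int \<Rightarrow> nat \<Rightarrow> 'a \<Rightarrow> real" where
  "psum Y a n \<omega> = (\<Sum>r=1..n. Y (a + int r) \<omega>)"

lemma psum_measurable[measurable]:
  "(\<And>t. Y t \<in> borel_measurable M) \<Longrightarrow> psum Y a n \<in> borel_measurable M"
  unfolding psum_def[abs_def] by measurable

lemma psum_eq_sum: "psum Y a n \<omega> = (\<Sum>t\<in>{a<..a + int n}. Y t \<omega>)"
  unfolding psum_def
  by (rule sum.reindex_bij_witness[where i = "\<lambda>t. nat (t - a)" and j = "\<lambda>r. a + int r"]) auto

text \<open>Many short overlapping sums are exchanged for few long ones. This is what makes an
  average over all block starts small.\<close>

lemma sum_psum_swap: "(\<Sum>i=1..N. psum Y (int i) B \<omega>) = (\<Sum>r=1..B. psum Y (int r) N \<omega>)"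
  unfolding psum_def by (subst sum.swap) (simp add: add.commute)

text \<open>The queue is abstracted to a field of independent inputs, \<open>l\<close> numbering the
  inputs attached to one slot. Their laws may vary with \<open>l\<close> but not with the slot,
  which is exactly what stationarity requires.\<close>

locale iid_slots = prob_space M
  for M :: "'a measure" and X :: "int \<Rightarrow> 'k \<Rightarrow> 'a \<Rightarrow> 'b" and N :: "'b measure" +
  assumes slots_indep: "indep_vars (\<lambda>_. N) (\<lambda>p. X (fst p) (snd p)) UNIV"
    and slots_ident: "distr M N (X s l) = distr M N (X 0 l)"
begin

definition config :: "int \<Rightarrow> 'a \<Rightarrow> int \<times> 'k \<Rightarrow> 'b" where
  "config a \<omega> = (\<lambda>p. X (fst p + a) (snd p) \<omega>)"

text \<open>The sigma-algebra generated by the inputs of the slots in \<open>K\<close>;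
  measurability with respect to it expresses dependence on those slots only, and disjoint sets of
  slots give independence.\<close>

definition slots :: "int set \<Rightarrow> 'a measure" where
  "slots K = vimage_algebra (space M) (\<lambda>\<omega>. restrict (\<lambda>p. X (fst p) (snd p) \<omega>) (K \<times> UNIV)) (PiM (K \<times> UNIV) (\<lambda>_. N))"

lemma X_measurable[measurable]: "X s l \<in> measurable M N"
  using slots_indep unfolding indep_vars_def by (auto dest: bspec[of _ _ "(s, l)"])

lemma space_slots[simp]: "space (slots K) = space M"
  by (simp add: slots_def)

lemma restrict_X_measurable[measurable]:
  "(\<lambda>\<omega>. restrict (\<lambda>p. X (fst p) (snd p) \<omega>) L) \<in> measurable M (PiM L (\<lambda>_. N))"
  by measurable

lemma sets_slots: "sets (slots K) = {(\<lambda>\<omega>. restrict (\<lambda>p. X (fst p) (snd p) \<omega>) (K \<times> UNIV)) -` A \<inter> space M | A.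
    A \<in> sets (PiM (K \<times> UNIV) (\<lambda>_. N))}"
  unfolding slots_def
  using measurable_space[OF restrict_X_measurable[of "K \<times> UNIV"]]
  by (intro sets_vimage_algebra2) auto

lemma sets_slots_subset: "sets (slots K) \<subseteq> sets M"
  unfolding sets_slots using measurable_sets[OF restrict_X_measurable] by auto

lemma measurable_slots: "f \<in> measurable (slots K) L \<Longrightarrow> f \<in> measurable M L"
  using sets_slots_subset[of K] unfolding measurable_def by auto

lemma slots_mono: "K \<subseteq> K' \<Longrightarrow> f \<in> measurable (slots K) L \<Longrightarrow> f \<in> measurable (slots K') L"
proof -
  assume K: "K \<subseteq> K'" and f: "f \<in> measurable (slots K) L"
  have "(\<lambda>\<omega>. restrict (\<lambda>p. X (fst p) (snd p) \<omega>) (K' \<times> UNIV)) \<in> measurable (slots K') (PiM (K' \<times> UNIV) (\<lambda>_. N))"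
    unfolding slots_def using measurable_space[OF restrict_X_measurable]
    by (intro measurable_vimage_algebra1) auto
  from measurable_compose[OF this measurable_restrict_subset[of "K \<times> UNIV" "K' \<times> UNIV"]]
  have "(\<lambda>\<omega>. restrict (restrict (\<lambda>p. X (fst p) (snd p) \<omega>) (K' \<times> UNIV)) (K \<times> UNIV)) \<in> measurable (slots K') (PiM (K \<times> UNIV) (\<lambda>_. N))"
    using K by auto
  moreover have "restrict (restrict (\<lambda>p. X (fst p) (snd p) \<omega>) (K' \<times> UNIV)) (K \<times> UNIV)
      = restrict (\<lambda>p. X (fst p) (snd p) \<omega>) (K \<times> UNIV)" for \<omega>
    using K by (auto simp: restrict_def fun_eq_iff)
  ultimately have "(\<lambda>\<omega>. restrict (\<lambda>p. X (fst p) (snd p) \<omega>) (K \<times> UNIV)) \<in> measurable (slots K') (PiM (K \<times> UNIV) (\<lambda>_. N))"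
    by simp
  then have "(\<lambda>\<omega>. \<omega>) \<in> measurable (slots K') (slots K)"
    unfolding slots_def[of K] by (intro measurable_vimage_algebra2) auto
  from measurable_compose[OF this f] show ?thesis by simp
qed

lemma X_measurable_slots: "s \<in> K \<Longrightarrow> X s l \<in> measurable (slots K) N"
proof -
  assume s: "s \<in> K"
  have "(\<lambda>\<omega>. restrict (\<lambda>p. X (fst p) (snd p) \<omega>) (K \<times> UNIV)) \<in> measurable (slots K) (PiM (K \<times> UNIV) (\<lambda>_. N))"
    unfolding slots_def using measurable_space[OF restrict_X_measurable]
    by (intro measurable_vimage_algebra1) auto
  from measurable_compose[OF this measurable_component_singleton[of "(s, l)"]] s show ?thesis by simp
qed

lemma slots_indep_vars:
  assumes disj: "disjoint_family_on K I" and Y: "\<And>i. i \<in> I \<Longrightarrow> Y i \<in> measurable (slots (K i)) (L i)"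
  shows "indep_vars L Y I"
proof -
  have "indep_vars (\<lambda>i. PiM (K i \<times> UNIV) (\<lambda>_. N)) (\<lambda>i \<omega>. restrict (\<lambda>p. X (fst p) (snd p) \<omega>) (K i \<times> UNIV)) I"
    using disj by (intro indep_vars_restrict[OF slots_indep]) (auto simp: disjoint_family_on_def)
  then have "indep_sets (\<lambda>i. sets (slots (K i))) I"
    unfolding indep_vars_def2 sets_slots by blast
  then have "indep_sets (\<lambda>i. {Y i -` A \<inter> space M |A. A \<in> sets (L i)}) I"
    by (rule indep_sets_mono_sets) (auto dest!: measurable_sets[OF Y])
  then show ?thesis unfolding indep_vars_def2 using measurable_slots[OF Y] by blast
qed

lemma slots_indep_var:
  assumes disj: "K \<inter> K' = {}" and Y: "Y \<in> measurable (slots K) L" and Z: "Z \<in> measurable (slots K') L'"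
  shows "indep_var L Y L' Z"
  unfolding indep_var_def
  by (rule slots_indep_vars[where K = "case_bool K K'"])
    (use disj Y Z in \<open>auto simp: disjoint_family_on_def split: bool.splits\<close>)

lemma slots_uncorrelated:
  fixes Y Z :: "'a \<Rightarrow> real"
  assumes disj: "K \<inter> K' = {}" and Y: "Y \<in> borel_measurable (slots K)" and Z: "Z \<in> borel_measurable (slots K')"
    and int: "integrable M Y" "integrable M Z" and 0: "expectation Y = 0 \<or> expectation Z = 0"
  shows "expectation (\<lambda>\<omega>. Y \<omega> * Z \<omega>) = 0"
  using indep_var_lebesgue_integral[OF slots_indep_var[OF disj Y Z] int] 0 by auto

lemma config_measurable[measurable]: "config a \<in> measurable M (PiM UNIV (\<lambda>_. N))"
  unfolding config_def using measurable_space[OF X_measurable]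
  by (intro measurable_PiM_single') (auto simp: space_PiM)

text \<open>A time shift is an injective renaming of the inputs, so the joint law stays a product
  measure, and its factors do not depend on the slot.\<close>

lemma distr_config: "distr M (PiM UNIV (\<lambda>_. N)) (config a) = distr M (PiM UNIV (\<lambda>_. N)) (config 0)"
proof -
  have *: "distr M (PiM UNIV (\<lambda>_. N)) (config a) = PiM UNIV (\<lambda>p. distr M N (X 0 (snd p)))" for a
  proof -
    have "indep_vars (\<lambda>_. N) (\<lambda>p. X (fst (fst p + a, snd p)) (snd (fst p + a, snd p))) UNIV"
      by (rule indep_vars_inj_reindex[OF slots_indep, where f = "\<lambda>p. (fst p + a, snd p)"]) (auto simp: inj_on_def)
    then have "indep_vars (\<lambda>_. N) (\<lambda>p. X (fst p + a) (snd p)) UNIV" by simp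
    then have "distr M (PiM UNIV (\<lambda>_. N)) (\<lambda>\<omega>. \<lambda>p\<in>UNIV. X (fst p + a) (snd p) \<omega>)
        = PiM UNIV (\<lambda>p. distr M N (X (fst p + a) (snd p)))"
      by (subst (asm) indep_vars_iff_distr_eq_PiM) auto
    then show ?thesis
      unfolding config_def by (simp add: slots_ident[of "_ + a"] restrict_UNIV)
  qed
  show ?thesis unfolding *[of a] *[of 0] ..
qed

lemma distr_config_compose:
  assumes "g \<in> measurable (PiM UNIV (\<lambda>_. N)) L"
  shows "distr M L (\<lambda>\<omega>. g (config a \<omega>)) = distr M L (\<lambda>\<omega>. g (config 0 \<omega>))"
  using distr_distr[OF assms config_measurable, of a] distr_distr[OF assms config_measurable, of 0]
  by (simp add: distr_config[of a] comp_def)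

lemma expectation_config:
  fixes g :: "_ \<Rightarrow> real"
  assumes g: "g \<in> borel_measurable (PiM UNIV (\<lambda>_. N))"
  shows "expectation (\<lambda>\<omega>. g (config a \<omega>)) = expectation (\<lambda>\<omega>. g (config 0 \<omega>))"
  using integral_distr[OF config_measurable g, of a] integral_distr[OF config_measurable g, of 0]
  by (simp add: distr_config[of a])

lemma config_shift: "config (a + b) \<omega> = (\<lambda>p. config a \<omega> (fst p + b, snd p))"
  by (auto simp: config_def fun_eq_iff ac_simps)

text \<open>A bounded, centred, finitely dependent process. The last conjunct, a single functional
  of the shifted environment, provides strict stationarity.\<close>

definition moving_block :: "nat \<Rightarrow> real \<Rightarrow> (int \<Rightarrow> 'a \<Rightarrow> real) \<Rightarrow> bool" where
  "moving_block m K Y \<longleftrightarrow> (\<forall>t. Y t \<in> borel_measurable (slots {t - int m..t}))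
    \<and> (\<forall>t. \<forall>\<omega>\<in>space M. \<bar>Y t \<omega>\<bar> \<le> K) \<and> (\<forall>t. expectation (Y t) = 0)
    \<and> (\<exists>f\<in>borel_measurable (PiM UNIV (\<lambda>_. N)). \<forall>t. \<forall>\<omega>\<in>space M. Y t \<omega> = f (config t \<omega>))"

context
  fixes m K Y assumes Y: "moving_block m K Y"
begin

lemma mb_slots: "Y t \<in> borel_measurable (slots {t - int m..t})"
  using Y by (simp add: moving_block_def)

lemma mb_measurable[measurable]: "Y t \<in> borel_measurable M"
  by (rule measurable_slots[OF mb_slots])

lemma mb_bound: "\<omega> \<in> space M \<Longrightarrow> \<bar>Y t \<omega>\<bar> \<le> K"
  using Y by (simp add: moving_block_def)

lemma mb_mean: "expectation (Y t) = 0"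
  using Y by (simp add: moving_block_def)

lemma mb_K: "0 \<le> K"
proof -
  obtain \<omega> where "\<omega> \<in> space M" using not_empty by blast
  from mb_bound[OF this, of 0] show ?thesis by linarith
qed

lemma mb_integrable: "integrable M (Y t)"
  using mb_bound by (intro integrable_const_bound[where B = K]) auto

lemma mb_square_bound: "\<omega> \<in> space M \<Longrightarrow> (Y t \<omega>)\<^sup>2 \<le> K\<^sup>2"
  using mb_bound[of \<omega> t] by (metis abs_ge_zero power2_abs power_mono)

lemma mb_integrable_square: "integrable M (\<lambda>\<omega>. (Y t \<omega>)\<^sup>2)"
  using mb_square_bound by (intro integrable_const_bound[where B = "K\<^sup>2"]) auto

lemma mb_second_moment: "expectation (\<lambda>\<omega>. (Y t \<omega>)\<^sup>2) \<le> K\<^sup>2"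
proof -
  have "expectation (\<lambda>\<omega>. (Y t \<omega>)\<^sup>2) \<le> expectation (\<lambda>\<omega>. K\<^sup>2)"
    using mb_square_bound by (intro integral_mono mb_integrable_square) auto
  then show ?thesis by (simp add: prob_space)
qed

lemma mb_uncorrelated: "\<bar>t - s\<bar> > int m \<Longrightarrow> expectation (\<lambda>\<omega>. Y t \<omega> * Y s \<omega>) = 0"
  by (rule slots_uncorrelated[OF _ mb_slots mb_slots mb_integrable mb_integrable]) (auto simp: mb_mean)

lemma mb_sum:
  assumes "finite T"
  shows "integrable M (\<lambda>\<omega>. (\<Sum>t\<in>T. Y t \<omega>)\<^sup>2)"
    and "expectation (\<lambda>\<omega>. (\<Sum>t\<in>T. Y t \<omega>)\<^sup>2) \<le> card T * (2 * real m + 1) * K\<^sup>2"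
proof -
  have c: "card {s \<in> T. expectation (\<lambda>\<omega>. Y t \<omega> * Y s \<omega>) \<noteq> 0} \<le> 2 * m + 1" for t
  proof -
    have "{s \<in> T. expectation (\<lambda>\<omega>. Y t \<omega> * Y s \<omega>) \<noteq> 0} \<subseteq> {t - int m..t + int m}"
      using mb_uncorrelated[of t] by (force simp: not_less)
    from card_mono[OF _ this] show ?thesis by simp
  qed
  note * = second_moment_sum_le[OF assms mb_measurable mb_integrable_square mb_second_moment c]
  show "integrable M (\<lambda>\<omega>. (\<Sum>t\<in>T. Y t \<omega>)\<^sup>2)" by (rule *(1))
  show "expectation (\<lambda>\<omega>. (\<Sum>t\<in>T. Y t \<omega>)\<^sup>2) \<le> card T * (2 * real m + 1) * K\<^sup>2"
    using *(2) by (simp add: algebra_simps)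
qed

lemma mb_psum:
  shows "integrable M (\<lambda>\<omega>. (psum Y a n \<omega>)\<^sup>2)"
    and "expectation (\<lambda>\<omega>. (psum Y a n \<omega>)\<^sup>2) \<le> n * (2 * real m + 1) * K\<^sup>2"
  using mb_sum[of "{a<..a + int n}"] by (simp_all add: psum_eq_sum)

lemma mb_psum_bound: "\<omega> \<in> space M \<Longrightarrow> \<bar>psum Y a n \<omega>\<bar> \<le> n * K"
  unfolding psum_def using mb_bound
  by (intro order_trans[OF sum_abs] order_trans[OF sum_bounded_above[where K = K]]) auto

lemma mb_psum_slots: "psum Y a n \<in> borel_measurable (slots {a + 1 - int m..a + int n})"
  unfolding psum_def[abs_def]
  by (intro borel_measurable_sum slots_mono[OF _ mb_slots]) auto

lemma mb_psum_config:
  obtains F where "F \<in> borel_measurable (PiM UNIV (\<lambda>_. N))"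
    "\<And>a \<omega>. \<omega> \<in> space M \<Longrightarrow> psum Y a n \<omega> = F (config a \<omega>)"
proof -
  obtain f where f[measurable]: "f \<in> borel_measurable (PiM UNIV (\<lambda>_. N))"
    and Yf: "\<And>t \<omega>. \<omega> \<in> space M \<Longrightarrow> Y t \<omega> = f (config t \<omega>)"
    using Y by (auto simp: moving_block_def)
  define F where "F c = (\<Sum>r=1..n. f (\<lambda>p. c (fst p + int r, snd p)))" for c
  show ?thesis
  proof (rule that[of F])
    have "(\<lambda>c p. c (fst p + int r, snd p)) \<in> measurable (PiM UNIV (\<lambda>_. N)) (PiM UNIV (\<lambda>_. N))" for r :: nat and p :: "int \<times> 'k"
      by (rule measurable_PiM_single') (auto simp: space_PiM)
    from measurable_compose[OF this f] show "F \<in> borel_measurable (PiM UNIV (\<lambda>_. N))"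
      unfolding F_def by (intro borel_measurable_sum) auto
    show "psum Y a n \<omega> = F (config a \<omega>)" if "\<omega> \<in> space M" for a \<omega>
      unfolding psum_def F_def using that by (simp add: Yf config_shift)
  qed
qed

lemma mb_psum_distr: "distr M borel (psum Y a n) = distr M borel (psum Y 0 n)"
proof -
  obtain F where F: "F \<in> borel_measurable (PiM UNIV (\<lambda>_. N))"
    "\<And>a \<omega>. \<omega> \<in> space M \<Longrightarrow> psum Y a n \<omega> = F (config a \<omega>)" using mb_psum_config[of n] by blast
  have "distr M borel (psum Y a n) = distr M borel (\<lambda>\<omega>. F (config a \<omega>))" for a
    using F(2) by (intro distr_cong) auto
  then show ?thesis using distr_config_compose[OF F(1), of a] by simp
qed

lemma mb_psum_second_moment_eq: "expectation (\<lambda>\<omega>. (psum Y a n \<omega>)\<^sup>2) = expectation (\<lambda>\<omega>. (psum Y 0 n \<omega>)\<^sup>2)"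
proof -
  have "expectation (\<lambda>\<omega>. (psum Y a n \<omega>)\<^sup>2) = (\<integral>x. x\<^sup>2 \<partial>distr M borel (psum Y a n))" for a
    by (subst integral_distr) auto
  then show ?thesis by (simp add: mb_psum_distr[of a])
qed

text \<open>From length \<open>m\<close> on every further term adds the same amount to the variance
  of the sum: its covariance with the past involves the last \<open>m\<close> terms only, and
  stationarity makes this covariance constant. The variance is therefore eventually affine in
  \<open>n\<close>.\<close>

lemma mb_variance_limit:
  obtains s where "(\<lambda>n. expectation (\<lambda>\<omega>. (psum Y 0 n \<omega>)\<^sup>2) / n) \<longlonglongrightarrow> s"
proof -
  define v where "v n = expectation (\<lambda>\<omega>. (psum Y 0 n \<omega>)\<^sup>2)" for n
  define s where "s = v (Suc m) - v m"
  have covar: "expectation (\<lambda>\<omega>. psum Y a k \<omega> * Y (a + int (Suc k)) \<omega>) = expectation (\<lambda>\<omega>. psum Y 0 k \<omega> * Y (int (Suc k)) \<omega>)" for a k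
  proof -
    \<comment> \<open>Polarisation writes the covariance in terms of second moments of partial sums,
      for which shift invariance is already known.\<close>
    have *: "expectation (\<lambda>\<omega>. psum Y a k \<omega> * Y (a + int (Suc k)) \<omega>)
       = (expectation (\<lambda>\<omega>. (psum Y a (Suc k) \<omega>)\<^sup>2) - expectation (\<lambda>\<omega>. (psum Y a k \<omega>)\<^sup>2) - expectation (\<lambda>\<omega>. (psum Y (a + int k) 1 \<omega>)\<^sup>2)) / 2" for a
    proof -
      have eq: "psum Y a k \<omega> * Y (a + int (Suc k)) \<omega> = ((psum Y a (Suc k) \<omega>)\<^sup>2 - (psum Y a k \<omega>)\<^sup>2 - (psum Y (a + int k) 1 \<omega>)\<^sup>2) / 2" for \<omega>
        by (simp add: psum_def power2_eq_square algebra_simps)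
      show ?thesis unfolding eq using mb_psum(1) by simp
    qed
    show ?thesis using *[of a] *[of 0]
      by (simp add: mb_psum_second_moment_eq[of a] mb_psum_second_moment_eq[of "a + int k"] mb_psum_second_moment_eq[of "int k"])
  qed
  have step: "v (Suc n) = v n + s" if n: "n \<ge> m" for n
  proof -
    have rec: "v (Suc k) = v k + 2 * expectation (\<lambda>\<omega>. psum Y 0 k \<omega> * Y (int (Suc k)) \<omega>) + v 1" for k
    proof -
      have eq: "(psum Y 0 (Suc k) \<omega>)\<^sup>2 = (psum Y 0 k \<omega>)\<^sup>2 + 2 * (psum Y 0 k \<omega> * Y (int (Suc k)) \<omega>) + (psum Y (int k) 1 \<omega>)\<^sup>2" for \<omega>
        by (simp add: psum_def power2_eq_square algebra_simps)
      have i: "integrable M (\<lambda>\<omega>. psum Y 0 k \<omega> * Y (int (Suc k)) \<omega>)"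
        by (rule integrable_mult_of_squares) (auto intro: mb_psum(1) mb_integrable_square)
      show ?thesis unfolding v_def eq using i mb_psum(1) mb_psum_second_moment_eq[of "int k" 1] by simp
    qed
    have split: "psum Y 0 n \<omega> = psum Y 0 (n - m) \<omega> + psum Y (int (n - m)) m \<omega>" for \<omega>
    proof -
      have "{0<..int n} = {0<..int (n - m)} \<union> {int (n - m)<..int (n - m) + int m}" using n by auto
      then show ?thesis unfolding psum_eq_sum by (simp add: sum.union_disjoint)
    qed
    have i: "integrable M (\<lambda>\<omega>. psum Y b k \<omega> * Y t \<omega>)" for b k t
      by (rule integrable_mult_of_squares) (auto intro: mb_psum(1) mb_integrable_square)
    have i': "integrable M (\<lambda>\<omega>. Y u \<omega> * Y t \<omega>)" for u t
      by (rule integrable_mult_of_squares) (auto intro: mb_integrable_square)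
    have "expectation (\<lambda>\<omega>. psum Y 0 (n - m) \<omega> * Y (int (Suc n)) \<omega>) = 0"
      unfolding psum_def sum_distrib_right using i' mb_uncorrelated n
      by (subst Bochner_Integration.integral_sum) (auto intro!: sum.neutral)
    then have "expectation (\<lambda>\<omega>. psum Y 0 n \<omega> * Y (int (Suc n)) \<omega>) = expectation (\<lambda>\<omega>. psum Y (int (n - m)) m \<omega> * Y (int (n - m) + int (Suc m)) \<omega>)"
      unfolding split distrib_right using i n by (simp add: add.commute)
    also have "\<dots> = expectation (\<lambda>\<omega>. psum Y 0 m \<omega> * Y (int (Suc m)) \<omega>)" by (rule covar)
    finally show ?thesis using rec[of n] rec[of m] by (simp add: s_def)
  qed
  have lin: "v (m + j) = v m + j * s" for j
    by (induction j) (auto simp: step algebra_simps)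
  have "\<forall>\<^sub>F n in sequentially. s + (v m - m * s) / n = v n / n"
  proof (rule eventually_sequentiallyI[of "m + 1"])
    fix n assume "m + 1 \<le> n"
    then obtain j where "n = m + j" "n > 0" by (metis add_leD1 le_Suc_ex add_gr_0 le_add2 less_le_trans zero_less_one)
    then have "v n = v m + (real n - real m) * s" using lin[of j] by simp
    then show "s + (v m - m * s) / n = v n / n" using \<open>n > 0\<close> by (simp add: field_simps)
  qed
  moreover have "(\<lambda>n. s + (v m - m * s) / real n) \<longlonglongrightarrow> s" by real_asymp
  ultimately have "(\<lambda>n. v n / n) \<longlonglongrightarrow> s" by (rule Lim_transform_eventually[rotated])
  then show ?thesis using that unfolding v_def by blast
qed

end

end

text \<open>With \<open>r = x - y\<close> the difference of squares is
  \<open>2 * x * r - r\<^sup>2\<close>, and Young's inequality splits the product. It turns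
  smallness of \<open>x - y\<close> in mean square into smallness of the difference of squares in
  mean.\<close>

lemma abs_square_diff_le:
  fixes x y \<eta> :: real
  assumes \<eta>: "\<eta> > 0"
  shows "\<bar>x\<^sup>2 - y\<^sup>2\<bar> \<le> \<eta> * x\<^sup>2 + (1 + 1 / \<eta>) * (x - y)\<^sup>2"
proof -
  define r where "r = x - y"
  have "0 \<le> (\<eta> * \<bar>x\<bar> - \<bar>r\<bar>)\<^sup>2 / \<eta>" using \<eta> by simp
  also have "\<dots> = \<eta> * x\<^sup>2 + r\<^sup>2 / \<eta> - 2 * \<bar>x * r\<bar>"
    using \<eta> by (simp add: power2_diff power_mult_distrib abs_mult field_simps power2_eq_square)
  finally have 1: "2 * \<bar>x * r\<bar> \<le> \<eta> * x\<^sup>2 + r\<^sup>2 / \<eta>" by simp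
  have "x\<^sup>2 - y\<^sup>2 = 2 * (x * r) - r\<^sup>2" by (simp add: r_def power2_eq_square algebra_simps)
  then have "\<bar>x\<^sup>2 - y\<^sup>2\<bar> \<le> 2 * \<bar>x * r\<bar> + r\<^sup>2"
    using abs_triangle_ineq4[of "2 * (x * r)" "r\<^sup>2"] by (simp add: abs_mult)
  also have "\<dots> \<le> \<eta> * x\<^sup>2 + (1 + 1 / \<eta>) * r\<^sup>2" using 1 by (simp add: algebra_simps)
  finally show ?thesis by (simp add: r_def)
qed

lemma abs_le_square: "\<alpha> > 0 \<Longrightarrow> \<bar>x\<bar> \<le> x\<^sup>2 / (2 * \<alpha>) + \<alpha> / 2" for x \<alpha> :: real
proof -
  assume \<alpha>: "\<alpha> > 0"
  have "0 \<le> (\<bar>x\<bar> - \<alpha>)\<^sup>2 / (2 * \<alpha>)" using \<alpha> by simp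
  also have "\<dots> = x\<^sup>2 / (2 * \<alpha>) + \<alpha> / 2 - \<bar>x\<bar>" using \<alpha> by (simp add: power2_diff field_simps power2_eq_square)
  finally show ?thesis by simp
qed

text \<open>Either \<open>x\<close> is comparable to \<open>x - y\<close>, and the square in the
  minimum is used, or \<open>x\<close> is at most twice \<open>y\<close> in absolute value, and the
  cube gains the factor \<open>c\<close>. In the application \<open>y\<close> is a uniformly small
  approximation of \<open>x\<close>.\<close>

lemma min_cube_square_le:
  fixes x y c :: real
  assumes "2 * \<bar>y\<bar> \<le> c"
  shows "min (\<bar>x\<bar> ^ 3) (x\<^sup>2) \<le> 4 * (x - y)\<^sup>2 + c * x\<^sup>2"
proof (cases "\<bar>x\<bar> \<le> 2 * \<bar>x - y\<bar>")
  case True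
  then have "\<bar>x\<bar>\<^sup>2 \<le> (2 * \<bar>x - y\<bar>)\<^sup>2" by (intro power_mono) auto
  then have "x\<^sup>2 \<le> 4 * (x - y)\<^sup>2" by (simp add: power_mult_distrib)
  moreover have "0 \<le> c * x\<^sup>2" using assms by simp
  ultimately show ?thesis by linarith
next
  case False
  moreover have "\<not> u \<le> 2 * w \<Longrightarrow> u - v \<le> w \<Longrightarrow> u \<le> 2 * v" for u v w :: real by linarith
  ultimately have "\<bar>x\<bar> \<le> 2 * \<bar>y\<bar>" using abs_triangle_ineq2[of x y] by blast
  then have "\<bar>x\<bar> * x\<^sup>2 \<le> c * x\<^sup>2" using assms by (intro mult_right_mono) auto
  then have "\<bar>x\<bar> ^ 3 \<le> c * x\<^sup>2" by (simp add: power3_eq_cube power2_eq_square)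
  moreover have "0 \<le> 4 * (x - y)\<^sup>2" by simp
  ultimately show ?thesis by linarith
qed

section \<open>Processes whose partial sums are approximable in mean square\<close>

context iid_slots
begin

text \<open>The closeness is demanded of partial sums, with an error linear in the length and
  uniform in the position. Closeness of the individual terms would say nothing about sums of
  correlated terms.\<close>

definition approximable :: "(int \<Rightarrow> 'a \<Rightarrow> real) \<Rightarrow> bool" where
  "approximable Y \<longleftrightarrow> (\<forall>t. Y t \<in> borel_measurable M)
    \<and> (\<forall>\<delta>::real. \<delta> > 0 \<longrightarrow> (\<exists>m K Z. moving_block m K Z \<and> (\<forall>a n. integrable M (\<lambda>\<omega>. (psum Y a n \<omega> - psum Z a n \<omega>)\<^sup>2)
        \<and> expectation (\<lambda>\<omega>. (psum Y a n \<omega> - psum Z a n \<omega>)\<^sup>2) \<le> \<delta> * n)))"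

lemma approximable_measurable: "approximable Y \<Longrightarrow> Y t \<in> borel_measurable M"
  by (simp add: approximable_def)

lemma approximableE:
  fixes \<delta> :: real
  assumes Y: "approximable Y" and \<delta>: "\<delta> > 0"
  obtains m K Z where "moving_block m K Z"
    "\<And>a n. integrable M (\<lambda>\<omega>. (psum Y a n \<omega> - psum Z a n \<omega>)\<^sup>2)"
    "\<And>a n. expectation (\<lambda>\<omega>. (psum Y a n \<omega> - psum Z a n \<omega>)\<^sup>2) \<le> \<delta> * n"
proof -
  from Y[unfolded approximable_def, THEN conjunct2, THEN spec, THEN mp, OF \<delta>]
  show ?thesis by (elim exE conjE) (rule that, auto)
qed

lemma approximable_second_moment:
  assumes Y: "approximable Y"
  obtains C :: real where "C \<ge> 0" "\<And>a n. integrable M (\<lambda>\<omega>. (psum Y a n \<omega>)\<^sup>2)"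
    "\<And>a n. expectation (\<lambda>\<omega>. (psum Y a n \<omega>)\<^sup>2) \<le> C * real n"
proof -
  note [measurable] = approximable_measurable[OF Y]
  obtain m K Z where Z: "moving_block m K Z"
    and i: "\<And>a n. integrable M (\<lambda>\<omega>. (psum Y a n \<omega> - psum Z a n \<omega>)\<^sup>2)"
    and d: "\<And>a n. expectation (\<lambda>\<omega>. (psum Y a n \<omega> - psum Z a n \<omega>)\<^sup>2) \<le> 1 * real n"
    by (rule approximableE[OF Y zero_less_one]) (rule that)
  note [measurable] = mb_measurable[OF Z]
  have sq: "(x :: real)\<^sup>2 \<le> 2 * (x - y)\<^sup>2 + 2 * y\<^sup>2" for x y
    using zero_le_power2[of "x - 2 * y"] by (simp add: power2_eq_square algebra_simps)
  have i2: "integrable M (\<lambda>\<omega>. 2 * (psum Y a n \<omega> - psum Z a n \<omega>)\<^sup>2 + 2 * (psum Z a n \<omega>)\<^sup>2)" for a n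
    using i mb_psum(1)[OF Z] by simp
  have iY: "integrable M (\<lambda>\<omega>. (psum Y a n \<omega>)\<^sup>2)" for a n
    by (rule Bochner_Integration.integrable_bound[OF i2[of a n]]) (auto intro!: AE_I2 sq)
  have "expectation (\<lambda>\<omega>. (psum Y a n \<omega>)\<^sup>2) \<le> (2 + 2 * ((2 * real m + 1) * K\<^sup>2)) * n" for a n
  proof -
    have "expectation (\<lambda>\<omega>. (psum Y a n \<omega>)\<^sup>2) \<le> expectation (\<lambda>\<omega>. 2 * (psum Y a n \<omega> - psum Z a n \<omega>)\<^sup>2 + 2 * (psum Z a n \<omega>)\<^sup>2)"
      by (intro integral_mono iY i2 sq)
    also have "\<dots> = 2 * expectation (\<lambda>\<omega>. (psum Y a n \<omega> - psum Z a n \<omega>)\<^sup>2) + 2 * expectation (\<lambda>\<omega>. (psum Z a n \<omega>)\<^sup>2)"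
      using i mb_psum(1)[OF Z] by simp
    also have "\<dots> \<le> 2 * (1 * real n) + 2 * (n * (2 * real m + 1) * K\<^sup>2)"
      by (intro add_mono mult_left_mono d mb_psum(2)[OF Z]) auto
    finally show ?thesis by (simp add: algebra_simps)
  qed
  from that[OF _ iY this] show ?thesis by simp
qed

lemma approximable_square:
  fixes \<epsilon> :: real
  assumes Y: "approximable Y" and \<epsilon>: "\<epsilon> > 0"
  obtains m K Z where "moving_block m K Z"
    "\<And>a n. integrable M (\<lambda>\<omega>. (psum Y a n \<omega> - psum Z a n \<omega>)\<^sup>2)"
    "\<And>a n. expectation (\<lambda>\<omega>. (psum Y a n \<omega> - psum Z a n \<omega>)\<^sup>2) \<le> \<epsilon> * n"
    "\<And>a n. expectation (\<lambda>\<omega>. \<bar>(psum Y a n \<omega>)\<^sup>2 - (psum Z a n \<omega>)\<^sup>2\<bar>) \<le> \<epsilon> * n"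
proof -
  note [measurable] = approximable_measurable[OF Y]
  obtain C :: real where C: "C \<ge> 0" "\<And>a n. integrable M (\<lambda>\<omega>. (psum Y a n \<omega>)\<^sup>2)"
    "\<And>a n. expectation (\<lambda>\<omega>. (psum Y a n \<omega>)\<^sup>2) \<le> C * real n"
    by (rule approximable_second_moment[OF Y]) (rule that)
  \<comment> \<open>\<open>\<eta>\<close> is chosen to make
    \<open>\<eta> * C \<le> \<epsilon> / 2\<close>, and \<open>\<delta>\<close> afterwards to make
    \<open>(1 + 1 / \<eta>) * \<delta> \<le> \<epsilon> / 2\<close>; these are the two terms of
    \<open>abs_square_diff_le\<close>.\<close>
  define \<eta> where "\<eta> = \<epsilon> / (2 * (C + 1))"
  have \<eta>: "\<eta> > 0" using \<epsilon> C by (simp add: \<eta>_def)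
  define \<delta> where "\<delta> = min \<epsilon> (\<epsilon> / 2 / (1 + 1 / \<eta>))"
  have p: "1 + 1 / \<eta> > 0" using \<eta> by (simp add: add_pos_pos)
  have \<delta>: "\<delta> > 0" "\<delta> \<le> \<epsilon>" "\<delta> \<le> \<epsilon> / 2 / (1 + 1 / \<eta>)" using \<epsilon> p by (auto simp: \<delta>_def)
  have \<delta>': "(1 + 1 / \<eta>) * \<delta> \<le> \<epsilon> / 2"
    using \<delta>(3) p by (simp only: le_divide_eq) (simp add: mult.commute)
  have \<eta>': "\<eta> * C \<le> \<epsilon> / 2" using C \<epsilon> by (simp add: \<eta>_def field_simps)
  obtain m K Z where Z: "moving_block m K Z"
    and i: "\<And>a n. integrable M (\<lambda>\<omega>. (psum Y a n \<omega> - psum Z a n \<omega>)\<^sup>2)"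
    and d: "\<And>a n. expectation (\<lambda>\<omega>. (psum Y a n \<omega> - psum Z a n \<omega>)\<^sup>2) \<le> \<delta> * n"
    by (rule approximableE[OF Y \<delta>(1)]) (rule that)
  note [measurable] = mb_measurable[OF Z]
  have "expectation (\<lambda>\<omega>. \<bar>(psum Y a n \<omega>)\<^sup>2 - (psum Z a n \<omega>)\<^sup>2\<bar>) \<le> \<epsilon> * n" for a n
  proof -
    have "expectation (\<lambda>\<omega>. \<bar>(psum Y a n \<omega>)\<^sup>2 - (psum Z a n \<omega>)\<^sup>2\<bar>)
        \<le> expectation (\<lambda>\<omega>. \<eta> * (psum Y a n \<omega>)\<^sup>2 + (1 + 1 / \<eta>) * (psum Y a n \<omega> - psum Z a n \<omega>)\<^sup>2)"
      using C(2) i mb_psum(1)[OF Z] by (intro integral_mono abs_square_diff_le \<eta>) auto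
    also have "\<dots> = \<eta> * expectation (\<lambda>\<omega>. (psum Y a n \<omega>)\<^sup>2) + (1 + 1 / \<eta>) * expectation (\<lambda>\<omega>. (psum Y a n \<omega> - psum Z a n \<omega>)\<^sup>2)"
      using C(2) i by simp
    also have "\<dots> \<le> \<eta> * (C * n) + (1 + 1 / \<eta>) * (\<delta> * n)"
      using \<eta> p by (intro add_mono mult_left_mono C d) auto
    also have "\<dots> = (\<eta> * C) * n + ((1 + 1 / \<eta>) * \<delta>) * n" by simp
    also have "\<dots> \<le> \<epsilon> / 2 * n + \<epsilon> / 2 * n"
      by (intro add_mono mult_right_mono \<eta>' \<delta>') auto
    finally show ?thesis by simp
  qed
  moreover have "expectation (\<lambda>\<omega>. (psum Y a n \<omega> - psum Z a n \<omega>)\<^sup>2) \<le> \<epsilon> * n" for a n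
    by (rule order_trans[OF d]) (use \<delta> in \<open>auto intro: mult_right_mono\<close>)
  ultimately show ?thesis using that[OF Z i] by blast
qed

text \<open>No formula for the limit is at hand. The normalised variances are uniformly close to
  those of an approximating process, which converge, and are therefore a Cauchy sequence.\<close>

lemma approximable_variance_limit:
  assumes Y: "approximable Y"
  obtains s where "(\<lambda>n. expectation (\<lambda>\<omega>. (psum Y 0 n \<omega>)\<^sup>2) / n) \<longlonglongrightarrow> s"
proof -
  obtain C :: real where C: "C \<ge> 0" "\<And>a n. integrable M (\<lambda>\<omega>. (psum Y a n \<omega>)\<^sup>2)"
    "\<And>a n. expectation (\<lambda>\<omega>. (psum Y a n \<omega>)\<^sup>2) \<le> C * real n"
    by (rule approximable_second_moment[OF Y]) (rule that)
  let ?v = "\<lambda>Y n. expectation (\<lambda>\<omega>. (psum Y 0 n \<omega>)\<^sup>2) / n"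
  have "Cauchy (?v Y)"
  proof (rule metric_CauchyI)
    fix e :: real assume e: "0 < e"
    then have e4: "e / 4 > 0" by simp
    obtain m K Z where Z: "moving_block m K Z"
      and d: "\<And>a n. expectation (\<lambda>\<omega>. \<bar>(psum Y a n \<omega>)\<^sup>2 - (psum Z a n \<omega>)\<^sup>2\<bar>) \<le> e / 4 * n"
      by (rule approximable_square[OF Y e4]) (rule that)
    have close: "\<bar>?v Y n - ?v Z n\<bar> \<le> e / 4" for n
    proof (cases "n = 0")
      case False
      have "\<bar>expectation (\<lambda>\<omega>. (psum Y 0 n \<omega>)\<^sup>2) - expectation (\<lambda>\<omega>. (psum Z 0 n \<omega>)\<^sup>2)\<bar>
          = \<bar>expectation (\<lambda>\<omega>. (psum Y 0 n \<omega>)\<^sup>2 - (psum Z 0 n \<omega>)\<^sup>2)\<bar>"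
        using C(2) mb_psum(1)[OF Z] by simp
      also have "\<dots> \<le> e / 4 * n" by (rule order_trans[OF integral_abs_bound d])
      finally show ?thesis using False unfolding diff_divide_distrib[symmetric] abs_divide by (simp add: divide_le_eq)
    qed (use e in simp)
    obtain s where "?v Z \<longlonglongrightarrow> s" using mb_variance_limit[OF Z] by blast
    from metric_LIMSEQ_D[OF this e4] obtain n0 where n0: "\<And>n. n \<ge> n0 \<Longrightarrow> dist (?v Z n) s < e / 4" by blast
    have "dist (?v Y i) (?v Y j) < e" if "i \<ge> n0" "j \<ge> n0" for i j
      using close[of i] close[of j] n0[OF that(1)] n0[OF that(2)] unfolding dist_real_def by linarith
    then show "\<exists>n0. \<forall>i\<ge>n0. \<forall>j\<ge>n0. dist (?v Y i) (?v Y j) < e" by blast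
  qed
  then obtain s where "?v Y \<longlonglongrightarrow> s" unfolding Cauchy_convergent_iff convergent_def ..
  then show ?thesis by (rule that)
qed

lemma approximable_block:
  fixes \<epsilon> :: real
  assumes Y: "approximable Y" and s: "(\<lambda>n. expectation (\<lambda>\<omega>. (psum Y 0 n \<omega>)\<^sup>2) / n) \<longlonglongrightarrow> s" and \<epsilon>: "\<epsilon> > 0"
  obtains m K Z s' where "moving_block m K Z"
    "\<And>a n. integrable M (\<lambda>\<omega>. (psum Y a n \<omega> - psum Z a n \<omega>)\<^sup>2)"
    "\<And>a n. expectation (\<lambda>\<omega>. (psum Y a n \<omega> - psum Z a n \<omega>)\<^sup>2) \<le> \<epsilon> * n"
    "\<And>a n. expectation (\<lambda>\<omega>. \<bar>(psum Y a n \<omega>)\<^sup>2 - (psum Z a n \<omega>)\<^sup>2\<bar>) \<le> \<epsilon> * n"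
    "(\<lambda>n. expectation (\<lambda>\<omega>. (psum Z 0 n \<omega>)\<^sup>2) / n) \<longlonglongrightarrow> s'" "\<bar>s' - s\<bar> \<le> \<epsilon>"
proof -
  obtain C :: real where C: "C \<ge> 0" "\<And>a n. integrable M (\<lambda>\<omega>. (psum Y a n \<omega>)\<^sup>2)"
    "\<And>a n. expectation (\<lambda>\<omega>. (psum Y a n \<omega>)\<^sup>2) \<le> C * real n"
    by (rule approximable_second_moment[OF Y]) (rule that)
  let ?v = "\<lambda>Y n. expectation (\<lambda>\<omega>. (psum Y 0 n \<omega>)\<^sup>2) / n"
  obtain m K Z where Z: "moving_block m K Z"
      and i: "\<And>a n. integrable M (\<lambda>\<omega>. (psum Y a n \<omega> - psum Z a n \<omega>)\<^sup>2)"
      and e: "\<And>a n. expectation (\<lambda>\<omega>. (psum Y a n \<omega> - psum Z a n \<omega>)\<^sup>2) \<le> \<epsilon> * n"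
      and d: "\<And>a n. expectation (\<lambda>\<omega>. \<bar>(psum Y a n \<omega>)\<^sup>2 - (psum Z a n \<omega>)\<^sup>2\<bar>) \<le> \<epsilon> * n" by (rule approximable_square[OF Y \<epsilon>]) (rule that)
  have close: "\<bar>?v Z n - ?v Y n\<bar> \<le> \<epsilon>" for n
  proof (cases "n = 0")
    case False
    have "\<bar>expectation (\<lambda>\<omega>. (psum Y 0 n \<omega>)\<^sup>2) - expectation (\<lambda>\<omega>. (psum Z 0 n \<omega>)\<^sup>2)\<bar>
        = \<bar>expectation (\<lambda>\<omega>. (psum Y 0 n \<omega>)\<^sup>2 - (psum Z 0 n \<omega>)\<^sup>2)\<bar>"
      using C(2) mb_psum(1)[OF Z] by simp
    also have "\<dots> \<le> \<epsilon> * n" by (rule order_trans[OF integral_abs_bound d])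
    finally show ?thesis using False
      by (subst abs_minus_commute) (simp only: diff_divide_distrib[symmetric] abs_divide, simp add: divide_le_eq)
  qed (use \<epsilon> in simp)
  obtain s' where s': "?v Z \<longlonglongrightarrow> s'" using mb_variance_limit[OF Z] by blast
  have "(\<lambda>n. \<bar>?v Z n - ?v Y n\<bar>) \<longlonglongrightarrow> \<bar>s' - s\<bar>" by (intro tendsto_intros s s')
  then have "\<bar>s' - s\<bar> \<le> \<epsilon>" by (rule tendsto_upperbound) (auto intro: always_eventually close)
  from that[OF Z i e d s' this] show ?thesis .
qed

text \<open>Bounding the square of an average by the average of squares would give the order
  \<open>B\<close>. Exchanging block and offset first, and applying Cauchy-Schwarz to the
  \<open>B\<close> offsets only, gives \<open>B\<^sup>2 / L\<close>, which tends to 0.\<close>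

lemma approximable_average_second_moment:
  fixes B L :: nat
  assumes C: "\<And>a n. integrable M (\<lambda>\<omega>. (psum Y a n \<omega>)\<^sup>2)"
    "\<And>a n. expectation (\<lambda>\<omega>. (psum Y a n \<omega>)\<^sup>2) \<le> C * real n" and L: "L > 0"
    and [measurable]: "\<And>t. Y t \<in> borel_measurable M"
  shows "integrable M (\<lambda>\<omega>. ((\<Sum>i=1..L. psum Y (int i) B \<omega>) / L)\<^sup>2)"
    and "expectation (\<lambda>\<omega>. ((\<Sum>i=1..L. psum Y (int i) B \<omega>) / L)\<^sup>2) \<le> C * (real B)\<^sup>2 / L"
proof -
  have cs: "(\<Sum>r=1..B. f r)\<^sup>2 \<le> B * (\<Sum>r=1..B. (f r)\<^sup>2)" for f :: "nat \<Rightarrow> real"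
    using Cauchy_Schwarz_ineq_sum[of "\<lambda>_. 1" f "{1..B}"] by simp
  have le: "((\<Sum>i=1..L. psum Y (int i) B \<omega>) / L)\<^sup>2 \<le> B / (real L)\<^sup>2 * (\<Sum>r=1..B. (psum Y (int r) L \<omega>)\<^sup>2)" for \<omega>
    using divide_right_mono[OF cs[of "\<lambda>r. psum Y (int r) L \<omega>"], of "(real L)\<^sup>2"]
    by (subst sum_psum_swap) (simp add: power_divide)
  have i: "integrable M (\<lambda>\<omega>. B / (real L)\<^sup>2 * (\<Sum>r=1..B. (psum Y (int r) L \<omega>)\<^sup>2))"
    using C(1) by (intro integrable_mult_right Bochner_Integration.integrable_sum)
  show i': "integrable M (\<lambda>\<omega>. ((\<Sum>i=1..L. psum Y (int i) B \<omega>) / L)\<^sup>2)"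
  proof (rule Bochner_Integration.integrable_bound[OF i])
    show "AE \<omega> in M. norm (((\<Sum>i=1..L. psum Y (int i) B \<omega>) / L)\<^sup>2) \<le> norm (B / (real L)\<^sup>2 * (\<Sum>r=1..B. (psum Y (int r) L \<omega>)\<^sup>2))"
      using order_trans[OF le abs_ge_self] by (intro AE_I2) simp
  qed measurable
  have "expectation (\<lambda>\<omega>. ((\<Sum>i=1..L. psum Y (int i) B \<omega>) / L)\<^sup>2) \<le> expectation (\<lambda>\<omega>. B / (real L)\<^sup>2 * (\<Sum>r=1..B. (psum Y (int r) L \<omega>)\<^sup>2))"
    by (intro integral_mono i i' le)
  also have "\<dots> = B / (real L)\<^sup>2 * (\<Sum>r=1..B. expectation (\<lambda>\<omega>. (psum Y (int r) L \<omega>)\<^sup>2))"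
    using C(1) by simp
  also have "\<dots> \<le> B / (real L)\<^sup>2 * (\<Sum>r=1..B. C * L)"
    using C(2) by (intro mult_left_mono sum_mono) auto
  also have "\<dots> = C * (real B)\<^sup>2 / L" using L by (simp add: power2_eq_square)
  finally show "expectation (\<lambda>\<omega>. ((\<Sum>i=1..L. psum Y (int i) B \<omega>) / L)\<^sup>2) \<le> C * (real B)\<^sup>2 / L" .
qed

text \<open>A law of large numbers for squared block sums. Squares of blocks starting more than
  \<open>B + m\<close> apart read disjoint slots, so each correlates with order \<open>B\<close>
  others, and each has variance of order \<open>B ^ 3\<close>. After division by
  \<open>L * B\<close> the order \<open>B\<^sup>2 / L\<close> remains.\<close>

lemma mb_average_square:
  fixes B L :: nat
  assumes Z: "moving_block m K Z" and B: "B > 0" and L: "L > 0"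
  defines "v \<equiv> expectation (\<lambda>\<omega>. (psum Z 0 B \<omega>)\<^sup>2)"
  shows "integrable M (\<lambda>\<omega>. ((\<Sum>i=1..L. (psum Z (int i) B \<omega>)\<^sup>2 - v) / (L * B))\<^sup>2)"
    and "expectation (\<lambda>\<omega>. ((\<Sum>i=1..L. (psum Z (int i) B \<omega>)\<^sup>2 - v) / (L * B))\<^sup>2)
      \<le> (2 * real m + 3) * (2 * real m + 1) * K ^ 4 * ((real B)\<^sup>2 / L)"
proof -
  note [measurable] = mb_measurable[OF Z]
  let ?U = "\<lambda>i \<omega>. (psum Z (int i) B \<omega>)\<^sup>2 - v"
  have b2: "(psum Z a B \<omega>)\<^sup>2 \<le> (B * K)\<^sup>2" if "\<omega> \<in> space M" for a \<omega>
    using power_mono[OF mb_psum_bound[OF Z that, of a B] abs_ge_zero, of 2] by (simp only: power2_abs)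
  \<comment> \<open>The fourth power is estimated by the uniform bound \<open>B * K\<close> on two
    factors and the second moment on the other two; this yields \<open>B ^ 3\<close> instead of
    \<open>B ^ 4\<close>.\<close>
  have b4: "((psum Z a B \<omega>)\<^sup>2)\<^sup>2 \<le> (B * K)\<^sup>2 * (psum Z a B \<omega>)\<^sup>2" if "\<omega> \<in> space M" for a \<omega>
    using mult_right_mono[OF b2[OF that, of a] zero_le_power2[of "psum Z a B \<omega>"]]
    by (simp only: power2_eq_square[of "(psum Z a B \<omega>)\<^sup>2"])
  have v0: "v = expectation (\<lambda>\<omega>. (psum Z a B \<omega>)\<^sup>2)" for a
    unfolding v_def using mb_psum_second_moment_eq[OF Z] by metis
  have i2: "integrable M (\<lambda>\<omega>. (psum Z a B \<omega>)\<^sup>2)" for a using mb_psum(1)[OF Z] .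
  have i4: "integrable M (\<lambda>\<omega>. ((psum Z a B \<omega>)\<^sup>2)\<^sup>2)" for a
    using power_mono[OF b2 zero_le_power2, of _ a 2]
    by (intro integrable_const_bound[where B = "((B * K)\<^sup>2)\<^sup>2"]) (auto intro!: AE_I2)
  have mean: "expectation (?U i) = 0" for i using i2[of "int i"] v0[of "int i"] by (simp add: prob_space)
  have sq: "(?U i \<omega>)\<^sup>2 = ((psum Z (int i) B \<omega>)\<^sup>2)\<^sup>2 - 2 * v * (psum Z (int i) B \<omega>)\<^sup>2 + v\<^sup>2" for i \<omega>
    by (simp add: power2_diff)
  have iU2: "integrable M (\<lambda>\<omega>. (?U i \<omega>)\<^sup>2)" for i unfolding sq using i2 i4 by simp
  have iU: "integrable M (?U i)" for i using i2 by simp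
  have var: "expectation (\<lambda>\<omega>. (?U i \<omega>)\<^sup>2) \<le> (B * K)\<^sup>2 * (B * (2 * real m + 1) * K\<^sup>2)" for i
  proof -
    have "expectation (\<lambda>\<omega>. (?U i \<omega>)\<^sup>2) = expectation (\<lambda>\<omega>. ((psum Z (int i) B \<omega>)\<^sup>2)\<^sup>2) - 2 * v * v + v\<^sup>2"
      unfolding sq using i2[of "int i"] i4[of "int i"] v0[of "int i"] by (simp add: prob_space)
    also have "\<dots> \<le> expectation (\<lambda>\<omega>. ((psum Z (int i) B \<omega>)\<^sup>2)\<^sup>2)" by (simp add: power2_eq_square)
    also have "\<dots> \<le> expectation (\<lambda>\<omega>. (B * K)\<^sup>2 * (psum Z (int i) B \<omega>)\<^sup>2)"
      using i2 b4 by (intro integral_mono[OF i4]) simp_all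
    also have "\<dots> = (B * K)\<^sup>2 * expectation (\<lambda>\<omega>. (psum Z (int i) B \<omega>)\<^sup>2)" by simp
    also have "\<dots> \<le> (B * K)\<^sup>2 * (B * (2 * real m + 1) * K\<^sup>2)"
      by (intro mult_left_mono mb_psum(2)[OF Z]) auto
    finally show ?thesis .
  qed
  have card: "card {j \<in> {1..L}. expectation (\<lambda>\<omega>. ?U i \<omega> * ?U j \<omega>) \<noteq> 0} \<le> 2 * (B + m) + 1" if "i \<in> {1..L}" for i
  proof -
    have Us: "?U j \<in> borel_measurable (slots {int j + 1 - int m..int j + int B})" for j
      using mb_psum_slots[OF Z, of "int j" B] by measurable
    have "expectation (\<lambda>\<omega>. ?U i \<omega> * ?U j \<omega>) = 0" if "\<bar>int i - int j\<bar> > int (B + m)" for j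
      by (rule slots_uncorrelated[OF _ Us Us iU iU]) (use that mean in auto)
    then have "{j \<in> {1..L}. expectation (\<lambda>\<omega>. ?U i \<omega> * ?U j \<omega>) \<noteq> 0} \<subseteq> {i - (B + m)..i + (B + m)}"
      by (force simp: not_less)
    from card_mono[OF _ this] show ?thesis by simp
  qed
  have meas: "?U i \<in> borel_measurable M" for i by measurable
  note * = second_moment_sum_le[where T = "{1..L}" and Y = ?U, OF finite_atLeastAtMost meas iU2 var card]
  have eq: "((\<Sum>i=1..L. ?U i \<omega>) / (L * B))\<^sup>2 = 1 / (real L * real B)\<^sup>2 * (\<Sum>i=1..L. ?U i \<omega>)\<^sup>2" for \<omega>
    by (simp add: power_divide)
  have i: "integrable M (\<lambda>\<omega>. (\<Sum>i=1..L. ?U i \<omega>)\<^sup>2)" by (rule *(1))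
  show "integrable M (\<lambda>\<omega>. ((\<Sum>i=1..L. ?U i \<omega>) / (L * B))\<^sup>2)"
    unfolding eq by (intro integrable_mult_right i)
  have "expectation (\<lambda>\<omega>. (\<Sum>i=1..L. ?U i \<omega>)\<^sup>2) \<le> real (card {1..L}) * real (2 * (B + m) + 1) * ((B * K)\<^sup>2 * (B * (2 * real m + 1) * K\<^sup>2))"
    using *(2) by (simp only: of_nat_mult)
  then have "expectation (\<lambda>\<omega>. ((\<Sum>i=1..L. ?U i \<omega>) / (L * B))\<^sup>2)
      \<le> 1 / (real L * real B)\<^sup>2 * (L * real (2 * (B + m) + 1) * ((B * K)\<^sup>2 * (B * (2 * real m + 1) * K\<^sup>2)))"
    unfolding eq integral_mult_right_zero by (intro mult_left_mono) auto
  also have "\<dots> = real (2 * (B + m) + 1) * ((2 * real m + 1) * K ^ 4 * (B / L))"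
    using L B by (simp add: field_simps power2_eq_square power4_eq_xxxx)
  also have "\<dots> \<le> (2 * real m + 3) * B * ((2 * real m + 1) * K ^ 4 * (B / L))"
  proof (rule mult_right_mono)
    have "1 * (2 * real m + 1) \<le> B * (2 * real m + 1)" using B by (intro mult_right_mono) auto
    then show "real (2 * (B + m) + 1) \<le> (2 * real m + 3) * B" by (simp add: algebra_simps)
  qed auto
  also have "\<dots> = (2 * real m + 3) * (2 * real m + 1) * K ^ 4 * ((real B)\<^sup>2 / L)"
    by (simp add: power2_eq_square)
  finally show "expectation (\<lambda>\<omega>. ((\<Sum>i=1..L. ?U i \<omega>) / (L * B))\<^sup>2)
      \<le> (2 * real m + 3) * (2 * real m + 1) * K ^ 4 * ((real B)\<^sup>2 / L)" .
qed


text \<open>The squares are replaced in mean by those of a bounded finitely dependent process, for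
  which the variance estimate \<open>mb_average_square\<close> is available. Convergence in mean is
  kept because the errors of several such averages are added later.\<close>

lemma approximable_average_square:
  fixes B L :: "nat \<Rightarrow> nat"
  assumes Y: "approximable Y" and s: "(\<lambda>n. expectation (\<lambda>\<omega>. (psum Y 0 n \<omega>)\<^sup>2) / n) \<longlonglongrightarrow> s"
    and B: "filterlim B at_top sequentially" and L: "\<And>n. L n > 0"
    and small: "(\<lambda>n. (real (B n))\<^sup>2 / L n) \<longlonglongrightarrow> 0"
  shows "(\<lambda>n. expectation (\<lambda>\<omega>. \<bar>(\<Sum>i=1..L n. (psum Y (int i) (B n) \<omega>)\<^sup>2) / (L n * B n) - s\<bar>)) \<longlonglongrightarrow> 0"
proof (rule LIMSEQ_I)
  fix e :: real assume e: "0 < e"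
  \<comment> \<open>The replacement of squares costs \<open>\<epsilon>\<close>, the fluctuation
    another \<open>\<epsilon>\<close>, and the two comparisons of variances
    \<open>2 * \<epsilon>\<close>.\<close>
  define \<epsilon> where "\<epsilon> = e / 6"
  have \<epsilon>: "\<epsilon> > 0" using e by (simp add: \<epsilon>_def)
  note [measurable] = approximable_measurable[OF Y]
  obtain C :: real where C: "C \<ge> 0" "\<And>a n. integrable M (\<lambda>\<omega>. (psum Y a n \<omega>)\<^sup>2)"
    "\<And>a n. expectation (\<lambda>\<omega>. (psum Y a n \<omega>)\<^sup>2) \<le> C * real n"
    by (rule approximable_second_moment[OF Y]) (rule that)
  obtain m K Z s' where Z: "moving_block m K Z"
      and d: "\<And>a n. expectation (\<lambda>\<omega>. \<bar>(psum Y a n \<omega>)\<^sup>2 - (psum Z a n \<omega>)\<^sup>2\<bar>) \<le> \<epsilon> * n"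
      and s': "(\<lambda>n. expectation (\<lambda>\<omega>. (psum Z 0 n \<omega>)\<^sup>2) / n) \<longlonglongrightarrow> s'" "\<bar>s' - s\<bar> \<le> \<epsilon>"
    by (rule approximable_block[OF Y s \<epsilon>]) (rule that)
  note [measurable] = mb_measurable[OF Z]
  define c where "c = (2 * real m + 3) * (2 * real m + 1) * K ^ 4"
  have "(\<lambda>n. c * ((real (B n))\<^sup>2 / L n)) \<longlonglongrightarrow> c * 0" by (intro tendsto_intros small)
  then have ev1: "\<forall>\<^sub>F n in sequentially. c * ((real (B n))\<^sup>2 / L n) < \<epsilon>\<^sup>2"
    using \<epsilon> by (intro order_tendstoD(2)[where y = 0]) auto
  have ev2: "\<forall>\<^sub>F n in sequentially. B n > 0"
    using eventually_compose_filterlim[OF eventually_gt_at_top B] .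
  have "\<forall>\<^sub>F n in sequentially. dist (expectation (\<lambda>\<omega>. (psum Z 0 (B n) \<omega>)\<^sup>2) / B n) s' < \<epsilon>"
    using eventually_compose_filterlim[OF tendstoD[OF s'(1) \<epsilon>] B] .
  with ev1 ev2 have "\<forall>\<^sub>F n in sequentially. norm (expectation (\<lambda>\<omega>. \<bar>(\<Sum>i=1..L n. (psum Y (int i) (B n) \<omega>)\<^sup>2) / (L n * B n) - s\<bar>) - 0) < e"
  proof eventually_elim
    case (elim n)
    define v where "v = expectation (\<lambda>\<omega>. (psum Z 0 (B n) \<omega>)\<^sup>2)"
    let ?X = "\<lambda>\<omega>. (\<Sum>i=1..L n. (psum Y (int i) (B n) \<omega>)\<^sup>2) / (L n * B n)"
    let ?U = "\<lambda>\<omega>. (\<Sum>i=1..L n. (psum Z (int i) (B n) \<omega>)\<^sup>2 - v) / (L n * B n)"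
    let ?D = "\<lambda>\<omega>. (\<Sum>i=1..L n. \<bar>(psum Y (int i) (B n) \<omega>)\<^sup>2 - (psum Z (int i) (B n) \<omega>)\<^sup>2\<bar>) / (L n * B n)"
    have LB: "real (L n) * real (B n) > 0" using elim(2) L[of n] by simp
    note U = mb_average_square[OF Z elim(2) L[of n], folded v_def]
    have iD1: "integrable M (\<lambda>\<omega>. \<bar>(psum Y a (B n) \<omega>)\<^sup>2 - (psum Z a (B n) \<omega>)\<^sup>2\<bar>)" for a
      using C(2) mb_psum(1)[OF Z] by simp
    have iD: "integrable M ?D" using iD1 by simp
    have iX: "integrable M (\<lambda>\<omega>. \<bar>?X \<omega> - s\<bar>)" using C(2) by simp
    have pw: "\<bar>?X \<omega> - s\<bar> \<le> ?D \<omega> + ((?U \<omega>)\<^sup>2 / (2 * \<epsilon>) + \<epsilon> / 2) + 2 * \<epsilon>" for \<omega>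
    proof -
      have 1: "?X \<omega> = (\<Sum>i=1..L n. (psum Y (int i) (B n) \<omega>)\<^sup>2 - (psum Z (int i) (B n) \<omega>)\<^sup>2) / (L n * B n) + ?U \<omega> + v / B n"
        using elim(2) L[of n] by (simp add: sum_subtractf field_simps)
      have 2: "\<bar>(\<Sum>i=1..L n. (psum Y (int i) (B n) \<omega>)\<^sup>2 - (psum Z (int i) (B n) \<omega>)\<^sup>2) / (L n * B n)\<bar> \<le> ?D \<omega>"
        unfolding abs_divide by (simp add: divide_right_mono)
      have 3: "\<bar>?U \<omega>\<bar> \<le> (?U \<omega>)\<^sup>2 / (2 * \<epsilon>) + \<epsilon> / 2" by (rule abs_le_square[OF \<epsilon>])
      have 4: "\<bar>v / B n - s'\<bar> < \<epsilon>" using elim(3) by (simp add: v_def dist_real_def)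
      show ?thesis using 1 2 3 4 s'(2) by linarith
    qed
    have iR: "integrable M (\<lambda>\<omega>. ?D \<omega> + ((?U \<omega>)\<^sup>2 / (2 * \<epsilon>) + \<epsilon> / 2) + 2 * \<epsilon>)"
      by (intro Bochner_Integration.integrable_add iD integrable_divide U(1)) auto
    have "expectation (\<lambda>\<omega>. \<bar>?X \<omega> - s\<bar>) \<le> expectation (\<lambda>\<omega>. ?D \<omega> + ((?U \<omega>)\<^sup>2 / (2 * \<epsilon>) + \<epsilon> / 2) + 2 * \<epsilon>)"
      by (rule integral_mono[OF iX iR pw])
    also have "\<dots> = expectation ?D + (expectation (\<lambda>\<omega>. (?U \<omega>)\<^sup>2) / (2 * \<epsilon>) + \<epsilon> / 2) + 2 * \<epsilon>"
    proof -
      have i2: "integrable M (\<lambda>\<omega>. (?U \<omega>)\<^sup>2 / (2 * \<epsilon>))" by (intro integrable_divide U(1))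
      have "expectation (\<lambda>\<omega>. ?D \<omega> + ((?U \<omega>)\<^sup>2 / (2 * \<epsilon>) + \<epsilon> / 2) + 2 * \<epsilon>)
          = expectation ?D + (expectation (\<lambda>\<omega>. (?U \<omega>)\<^sup>2 / (2 * \<epsilon>)) + expectation (\<lambda>\<omega>. \<epsilon> / 2)) + expectation (\<lambda>\<omega>. 2 * \<epsilon>)"
        using iD i2 by (subst Bochner_Integration.integral_add, simp, simp)+ simp
      then show ?thesis by (simp add: prob_space)
    qed
    also have "expectation ?D \<le> \<epsilon>"
    proof -
      have "expectation ?D = (\<Sum>i=1..L n. expectation (\<lambda>\<omega>. \<bar>(psum Y (int i) (B n) \<omega>)\<^sup>2 - (psum Z (int i) (B n) \<omega>)\<^sup>2\<bar>)) / (L n * B n)"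
        using iD1 by simp
      also have "\<dots> \<le> (\<Sum>i=1..L n. \<epsilon> * B n) / (L n * B n)"
        using LB by (intro divide_right_mono sum_mono d) auto
      also have "\<dots> = \<epsilon>" using elim(2) L[of n] by simp
      finally show ?thesis .
    qed
    also have "expectation (\<lambda>\<omega>. (?U \<omega>)\<^sup>2) / (2 * \<epsilon>) \<le> \<epsilon>\<^sup>2 / (2 * \<epsilon>)"
      using U(2) elim(1) \<epsilon> by (intro divide_right_mono) (auto simp: c_def)
    finally have "expectation (\<lambda>\<omega>. \<bar>?X \<omega> - s\<bar>) \<le> 4 * \<epsilon>"
      using \<epsilon> by (simp add: power2_eq_square)
    moreover have "expectation (\<lambda>\<omega>. \<bar>?X \<omega> - s\<bar>) \<ge> 0" by simp
    ultimately show ?case using \<epsilon> unfolding \<epsilon>_def by simp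
  qed
  then show "\<exists>no. \<forall>n\<ge>no. norm (expectation (\<lambda>\<omega>. \<bar>(\<Sum>i=1..L n. (psum Y (int i) (B n) \<omega>)\<^sup>2) / (L n * B n) - s\<bar>) - 0) < e"
    by (simp add: eventually_sequentially)
qed

text \<open>Block sums of the bounded approximation are at most \<open>B * K\<close>, which is
  negligible against \<open>sqrt n\<close>; the cubic bound then gains a vanishing factor. The
  approximation error is charged to the quadratic bound.\<close>

lemma approximable_lindeberg:
  fixes B L k :: "nat \<Rightarrow> nat"
  assumes Y: "approximable Y" and kB: "\<And>n. k n * B n \<le> n" and L: "\<And>n. L n > 0"
    and small: "(\<lambda>n. real (B n) / sqrt n) \<longlonglongrightarrow> 0"
  shows "(\<lambda>n. expectation (\<lambda>\<omega>. k n / L n * (\<Sum>i=1..L n.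
      min (\<bar>psum Y (int i) (B n) \<omega> / sqrt n\<bar> ^ 3) ((psum Y (int i) (B n) \<omega> / sqrt n)\<^sup>2)))) \<longlonglongrightarrow> 0"
proof (rule LIMSEQ_I)
  fix e :: real assume e: "0 < e"
  define \<epsilon> where "\<epsilon> = e / 16"
  have \<epsilon>: "\<epsilon> > 0" using e by (simp add: \<epsilon>_def)
  note [measurable] = approximable_measurable[OF Y]
  obtain C :: real where C: "C \<ge> 0" "\<And>a n. integrable M (\<lambda>\<omega>. (psum Y a n \<omega>)\<^sup>2)"
    "\<And>a n. expectation (\<lambda>\<omega>. (psum Y a n \<omega>)\<^sup>2) \<le> C * real n"
    by (rule approximable_second_moment[OF Y]) (rule that)
  obtain m K Z where Z: "moving_block m K Z"
      and i: "\<And>a n. integrable M (\<lambda>\<omega>. (psum Y a n \<omega> - psum Z a n \<omega>)\<^sup>2)"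
      and d: "\<And>a n. expectation (\<lambda>\<omega>. (psum Y a n \<omega> - psum Z a n \<omega>)\<^sup>2) \<le> \<epsilon> * n"
    by (rule approximableE[OF Y \<epsilon>]) (rule that)
  note [measurable] = mb_measurable[OF Z]
  have K: "K \<ge> 0" by (rule mb_K[OF Z])
  \<comment> \<open>Twice the uniform bound of a normalised block sum of the approximation, as
    \<open>min_cube_square_le\<close> requires.\<close>
  define c where "c n = 2 * K * (real (B n) / sqrt n)" for n
  have c0: "c n \<ge> 0" for n using K by (simp add: c_def)
  have "(\<lambda>n. c n * C) \<longlonglongrightarrow> 2 * K * 0 * C" unfolding c_def by (intro tendsto_intros small)
  then have "\<forall>\<^sub>F n in sequentially. c n * C < e / 4"
    using e by (intro order_tendstoD(2)[where y = 0]) auto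
  with eventually_gt_at_top[of 0] have "\<forall>\<^sub>F n in sequentially. norm (expectation (\<lambda>\<omega>. k n / L n * (\<Sum>i=1..L n.
      min (\<bar>psum Y (int i) (B n) \<omega> / sqrt n\<bar> ^ 3) ((psum Y (int i) (B n) \<omega> / sqrt n)\<^sup>2))) - 0) < e"
  proof eventually_elim
    case (elim n)
    let ?x = "\<lambda>i \<omega>. psum Y (int i) (B n) \<omega> / sqrt n"
    let ?y = "\<lambda>i \<omega>. psum Z (int i) (B n) \<omega> / sqrt n"
    have n: "real n > 0" using elim by simp
    have ix: "integrable M (\<lambda>\<omega>. (?x i \<omega>)\<^sup>2)" for i using C(2) by (simp add: power_divide)
    have xy: "(?x i \<omega> - ?y i \<omega>)\<^sup>2 = (psum Y (int i) (B n) \<omega> - psum Z (int i) (B n) \<omega>)\<^sup>2 / n" for i \<omega>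
      using n by (simp add: diff_divide_distrib[symmetric] power_divide)
    have ixy: "integrable M (\<lambda>\<omega>. (?x i \<omega> - ?y i \<omega>)\<^sup>2)" for i unfolding xy using i by simp
    have imin: "integrable M (\<lambda>\<omega>. min (\<bar>?x i \<omega>\<bar> ^ 3) ((?x i \<omega>)\<^sup>2))" for i
      by (rule Bochner_Integration.integrable_bound[OF ix[of i]]) auto
    have E1: "expectation (\<lambda>\<omega>. min (\<bar>?x i \<omega>\<bar> ^ 3) ((?x i \<omega>)\<^sup>2)) \<le> (4 * \<epsilon> + c n * C) * (B n / n)" for i
    proof -
      have "expectation (\<lambda>\<omega>. min (\<bar>?x i \<omega>\<bar> ^ 3) ((?x i \<omega>)\<^sup>2)) \<le> expectation (\<lambda>\<omega>. 4 * (?x i \<omega> - ?y i \<omega>)\<^sup>2 + c n * (?x i \<omega>)\<^sup>2)"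
      proof (rule integral_mono[OF imin])
        show "integrable M (\<lambda>\<omega>. 4 * (?x i \<omega> - ?y i \<omega>)\<^sup>2 + c n * (?x i \<omega>)\<^sup>2)"
          by (intro Bochner_Integration.integrable_add integrable_mult_right ix ixy)
        fix \<omega> assume "\<omega> \<in> space M"
        then have "\<bar>psum Z (int i) (B n) \<omega>\<bar> / sqrt n \<le> B n * K / sqrt n"
          by (intro divide_right_mono mb_psum_bound[OF Z]) auto
        from mult_left_mono[OF this, of 2] have "2 * \<bar>?y i \<omega>\<bar> \<le> c n"
          by (simp add: c_def abs_divide mult_ac)
        then show "min (\<bar>?x i \<omega>\<bar> ^ 3) ((?x i \<omega>)\<^sup>2) \<le> 4 * (?x i \<omega> - ?y i \<omega>)\<^sup>2 + c n * (?x i \<omega>)\<^sup>2"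
          by (rule min_cube_square_le)
      qed
      also have "\<dots> = 4 * expectation (\<lambda>\<omega>. (?x i \<omega> - ?y i \<omega>)\<^sup>2) + c n * expectation (\<lambda>\<omega>. (?x i \<omega>)\<^sup>2)"
        using ix ixy by simp
      also have "\<dots> \<le> 4 * (\<epsilon> * B n / n) + c n * (C * B n / n)"
      proof (intro add_mono mult_left_mono c0)
        show "expectation (\<lambda>\<omega>. (?x i \<omega> - ?y i \<omega>)\<^sup>2) \<le> \<epsilon> * B n / n"
          unfolding xy using d[of "int i" "B n"] n by (simp add: divide_right_mono)
        show "expectation (\<lambda>\<omega>. (?x i \<omega>)\<^sup>2) \<le> C * B n / n"
          using C(3)[of "int i" "B n"] n by (simp add: power_divide divide_right_mono)
      qed simp
      finally show ?thesis by (simp add: algebra_simps add_divide_distrib)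
    qed
    have "expectation (\<lambda>\<omega>. k n / L n * (\<Sum>i=1..L n. min (\<bar>?x i \<omega>\<bar> ^ 3) ((?x i \<omega>)\<^sup>2)))
        = k n / L n * (\<Sum>i=1..L n. expectation (\<lambda>\<omega>. min (\<bar>?x i \<omega>\<bar> ^ 3) ((?x i \<omega>)\<^sup>2)))"
      using imin by (subst integral_mult_right_zero, subst Bochner_Integration.integral_sum) auto
    also have "\<dots> \<le> k n / L n * (\<Sum>i=1..L n. (4 * \<epsilon> + c n * C) * (B n / n))"
      by (intro mult_left_mono sum_mono E1) auto
    also have "\<dots> = (4 * \<epsilon> + c n * C) * (k n * B n / n)" using L[of n] by simp
    also have "\<dots> \<le> (4 * \<epsilon> + c n * C) * 1"
    proof (rule mult_left_mono)
      have "real (k n * B n) \<le> real n" using kB[of n] by (simp only: of_nat_le_iff)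
      then show "real (k n * B n) / real n \<le> 1" using n by simp
    qed (use \<epsilon> c0 C in auto)
    also have "\<dots> < e" using elim(2) e by (simp add: \<epsilon>_def)
    finally have "expectation (\<lambda>\<omega>. k n / L n * (\<Sum>i=1..L n. min (\<bar>?x i \<omega>\<bar> ^ 3) ((?x i \<omega>)\<^sup>2))) < e" .
    moreover have "expectation (\<lambda>\<omega>. k n / L n * (\<Sum>i=1..L n. min (\<bar>?x i \<omega>\<bar> ^ 3) ((?x i \<omega>)\<^sup>2))) \<ge> 0"
      by (intro integral_nonneg_AE AE_I2 mult_nonneg_nonneg sum_nonneg) auto
    ultimately show ?case by simp
  qed
  then show "\<exists>no. \<forall>n\<ge>no. norm (expectation (\<lambda>\<omega>. k n / L n * (\<Sum>i=1..L n.
      min (\<bar>psum Y (int i) (B n) \<omega> / sqrt n\<bar> ^ 3) ((psum Y (int i) (B n) \<omega> / sqrt n)\<^sup>2))) - 0) < e"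
    by (simp add: eventually_sequentially)
qed


section \<open>The central limit theorem by independent big blocks\<close>

lemma iid_sum_second_moment:
  fixes W :: "nat \<Rightarrow> 'a \<Rightarrow> real"
  assumes indep: "indep_vars (\<lambda>_. borel) W UNIV" and mean: "\<And>k. expectation (W k) = 0"
    and sq: "\<And>k. integrable M (\<lambda>\<omega>. (W k \<omega>)\<^sup>2)" and v: "\<And>k. expectation (\<lambda>\<omega>. (W k \<omega>)\<^sup>2) \<le> v"
  shows "integrable M (\<lambda>\<omega>. (\<Sum>k<n. W k \<omega>)\<^sup>2)" "expectation (\<lambda>\<omega>. (\<Sum>k<n. W k \<omega>)\<^sup>2) \<le> real n * v"
proof -
  have [measurable]: "W k \<in> borel_measurable M" for k
    using indep unfolding indep_vars_def by auto
  have int: "integrable M (W k)" for k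
    by (rule square_integrable_imp_integrable[OF _ sq]) auto
  have zero: "expectation (\<lambda>\<omega>. W i \<omega> * W j \<omega>) = 0" if "i \<noteq> j" for i j
  proof -
    have "indep_var borel (W i) borel (W j)"
    proof -
      have "indep_vars (\<lambda>_. borel) (\<lambda>b. W (case_bool i j b)) UNIV"
        using that by (intro indep_vars_inj_reindex[OF indep]) (auto simp: inj_on_def split: bool.splits)
      moreover have "(\<lambda>b. W (case_bool i j b)) = case_bool (W i) (W j)"
        "(\<lambda>_. borel) = case_bool borel (borel :: real measure)"
        by (auto simp: fun_eq_iff split: bool.splits)
      ultimately show ?thesis unfolding indep_var_def by simp
    qed
    from indep_var_lebesgue_integral[OF this int int] mean show ?thesis by simp
  qed
  have "{j \<in> {..<n}. expectation (\<lambda>\<omega>. W i \<omega> * W j \<omega>) \<noteq> 0} \<subseteq> {i}" for i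
  proof
    fix j assume "j \<in> {j \<in> {..<n}. expectation (\<lambda>\<omega>. W i \<omega> * W j \<omega>) \<noteq> 0}"
    then show "j \<in> {i}" using zero[of i j] by (cases "i = j") auto
  qed
  from card_mono[OF _ this] have c: "card {j \<in> {..<n}. expectation (\<lambda>\<omega>. W i \<omega> * W j \<omega>) \<noteq> 0} \<le> 1" for i
    by simp
  have meas: "W k \<in> borel_measurable M" for k by measurable
  note * = second_moment_sum_le[of "{..<n}" W, OF finite_lessThan meas sq v c]
  show "integrable M (\<lambda>\<omega>. (\<Sum>k<n. W k \<omega>)\<^sup>2)" by (rule *(1))
  show "expectation (\<lambda>\<omega>. (\<Sum>k<n. W k \<omega>)\<^sup>2) \<le> real n * v" using *(2) by simp
qed

lemma div_over_tendsto:
  fixes p :: nat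
  assumes "p > 0"
  shows "(\<lambda>n. real (n div p) / real n) \<longlonglongrightarrow> 1 / p"
proof (rule tendsto_sandwich)
  have 1: "real n < real (n div p) * p + p" for n
  proof -
    have "n < (n div p) * p + p"
      using div_mult_mod_eq[of n p] mod_less_divisor[OF assms, of n] by linarith
    then have "real n < real ((n div p) * p + p)" by (simp only: of_nat_less_iff)
    then show ?thesis by simp
  qed
  show "\<forall>\<^sub>F n in sequentially. 1 / real p - 1 / real n \<le> real (n div p) / real n"
    using eventually_gt_at_top[of 0]
  proof eventually_elim
    case (elim n)
    have "(real n - p) / (n * p) \<le> (real (n div p) * p) / (n * p)"
      using 1[of n] by (intro divide_right_mono) auto
    then show ?case using elim assms by (simp add: diff_divide_distrib)
  qed
  have "real (n div p) * p \<le> n" for n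
    using div_times_less_eq_dividend[of n p] by (simp only: of_nat_mult[symmetric] of_nat_le_iff)
  then have "real (n div p) / real n \<le> 1 / real p" for n
    using assms by (cases "n = 0") (simp_all add: field_simps)
  then show "\<forall>\<^sub>F n in sequentially. real (n div p) / real n \<le> 1 / real p" by simp
  show "(\<lambda>n. 1 / real p - 1 / real n) \<longlonglongrightarrow> 1 / real p" by real_asymp
qed simp

text \<open>With \<open>n div p\<close> blocks the classical theorem normalises by the standard
  deviation of their sum, whereas \<open>sqrt n\<close> is wanted. Since \<open>n div p\<close> over
  \<open>n\<close> tends to \<open>1 / p\<close>, the change of normalisation is asymptotically a
  constant factor, and the first absolute moment of the sum bounds what is lost.\<close>

lemma iid_char_tendsto:
  fixes W :: "nat \<Rightarrow> 'a \<Rightarrow> real" and p :: nat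
  assumes indep: "indep_vars (\<lambda>_. borel) W UNIV" and mean: "\<And>k. expectation (W k) = 0"
    and sq: "\<And>k. integrable M (\<lambda>\<omega>. (W k \<omega>)\<^sup>2)" and v: "\<And>k. expectation (\<lambda>\<omega>. (W k \<omega>)\<^sup>2) = v"
    and distr: "\<And>k. distr M borel (W k) = distr M borel (W 0)" and v0: "v > 0" and p: "p > 0"
  shows "(\<lambda>n. \<integral>\<omega>. iexp ((\<Sum>k<n div p. W k \<omega>) / sqrt n) \<partial>M) \<longlonglongrightarrow> complex_of_real (exp (- (v / p) / 2))"
proof -
  define S where "S n \<omega> = (\<Sum>k<n. W k \<omega>)" for n \<omega>
  have [measurable]: "W k \<in> borel_measurable M" for k
    using indep unfolding indep_vars_def by auto
  have [measurable]: "S n \<in> borel_measurable M" for n unfolding S_def by measurable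
  have S2: "integrable M (\<lambda>\<omega>. (S n \<omega>)\<^sup>2)" "expectation (\<lambda>\<omega>. (S n \<omega>)\<^sup>2) \<le> real n * v" for n
    unfolding S_def using iid_sum_second_moment[OF indep mean sq eq_refl[OF v]] by auto
  have iS: "integrable M (S n)" for n by (rule square_integrable_imp_integrable[OF _ S2(1)]) auto
  have ES: "expectation (\<lambda>\<omega>. \<bar>S n \<omega>\<bar>) \<le> sqrt (real n * v)" for n
  proof (cases "n = 0")
    case False
    define \<alpha> where "\<alpha> = sqrt (real n * v)"
    have \<alpha>: "\<alpha> > 0" "\<alpha>\<^sup>2 = real n * v" using False v0 by (auto simp: \<alpha>_def)
    have "expectation (\<lambda>\<omega>. \<bar>S n \<omega>\<bar>) \<le> expectation (\<lambda>\<omega>. (S n \<omega>)\<^sup>2 / (2 * \<alpha>) + \<alpha> / 2)"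
      using iS S2(1) by (intro integral_mono abs_le_square \<alpha>) auto
    also have "\<dots> = expectation (\<lambda>\<omega>. (S n \<omega>)\<^sup>2) / (2 * \<alpha>) + \<alpha> / 2" using S2(1) by (simp add: prob_space)
    also have "\<dots> \<le> \<alpha>\<^sup>2 / (2 * \<alpha>) + \<alpha> / 2" using S2(2) \<alpha> by (intro add_mono divide_right_mono) auto
    also have "\<dots> = \<alpha>" using \<alpha>(1) by (simp add: power2_eq_square)
    finally show ?thesis by (simp add: \<alpha>_def)
  qed (simp add: S_def)
  have var: "variance (W k) = (sqrt v)\<^sup>2" for k using v v0 by (simp add: mean)
  have wc: "weak_conv_m (\<lambda>n. distr M borel (\<lambda>x. (\<Sum>i<n. W i x) / sqrt (n * (sqrt v)\<^sup>2))) std_normal_distribution"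
    by (rule central_limit_theorem_zero_mean[OF indep mean _ sq var]) (use v0 distr in auto)
  \<comment> \<open>At this argument the standard normal characteristic function equals the required
    limit \<open>exp (- (v / p) / 2)\<close>.\<close>
  define t where "t = sqrt (v / p)"
  have "(\<lambda>n. char (distr M borel (\<lambda>x. (\<Sum>i<n. W i x) / sqrt (n * (sqrt v)\<^sup>2))) t) \<longlonglongrightarrow> char std_normal_distribution t"
    by (rule levy_continuity1[OF _ real_dist_normal_dist wc]) (auto intro!: real_distribution_distr)
  then have lim: "(\<lambda>n. \<integral>\<omega>. iexp (t * (S n \<omega> / sqrt (n * v))) \<partial>M) \<longlonglongrightarrow> complex_of_real (exp (- t\<^sup>2 / 2))"
    unfolding char_std_normal_distribution using v0
    by (simp add: char_def integral_distr S_def)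
  have kdiv: "filterlim (\<lambda>n. n div p) at_top sequentially"
    unfolding filterlim_at_top
  proof
    fix c
    show "\<forall>\<^sub>F n in sequentially. c \<le> n div p"
      using div_le_mono[of "c * p" _ p] p by (intro eventually_sequentiallyI[of "c * p"]) simp
  qed
  have lim': "(\<lambda>n. \<integral>\<omega>. iexp (t * (S (n div p) \<omega> / sqrt (real (n div p) * v))) \<partial>M) \<longlonglongrightarrow> complex_of_real (exp (- t\<^sup>2 / 2))"
    by (rule filterlim_compose[OF lim kdiv])
  have "(\<lambda>n. (\<integral>\<omega>. iexp (S (n div p) \<omega> / sqrt n) \<partial>M) - (\<integral>\<omega>. iexp (t * (S (n div p) \<omega> / sqrt (real (n div p) * v))) \<partial>M)) \<longlonglongrightarrow> 0"
  proof (rule Lim_null_comparison)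
    let ?K = "\<lambda>n. n div p"
    have "(\<lambda>n. \<bar>sqrt (real (?K n) / n) * sqrt v - t\<bar>) \<longlonglongrightarrow> \<bar>sqrt (1 / p) * sqrt v - t\<bar>"
      by (intro tendsto_intros div_over_tendsto p)
    also have "sqrt (1 / p) * sqrt v - t = 0" by (simp add: t_def real_sqrt_divide)
    finally show "(\<lambda>n. \<bar>sqrt (real (?K n) / n) * sqrt v - t\<bar>) \<longlonglongrightarrow> 0" by simp
    show "\<forall>\<^sub>F n in sequentially. cmod ((\<integral>\<omega>. iexp (S (?K n) \<omega> / sqrt n) \<partial>M) - (\<integral>\<omega>. iexp (t * (S (?K n) \<omega> / sqrt (real (?K n) * v))) \<partial>M))
        \<le> \<bar>sqrt (real (?K n) / n) * sqrt v - t\<bar>"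
    proof (rule eventually_sequentiallyI[of p])
      fix n assume n: "p \<le> n"
      have K: "real (?K n) > 0" using n p by (simp add: div_greater_zero_iff)
      have n0: "real n > 0" using n p by simp
      define c where "c = \<bar>1 / sqrt n - t / sqrt (real (?K n) * v)\<bar>"
      have "cmod ((\<integral>\<omega>. iexp (S (?K n) \<omega> / sqrt n) \<partial>M) - (\<integral>\<omega>. iexp (t * (S (?K n) \<omega> / sqrt (real (?K n) * v))) \<partial>M))
          \<le> expectation (\<lambda>\<omega>. c * \<bar>S (?K n) \<omega>\<bar>)"
      proof (rule char_diff_le)
        show "integrable M (\<lambda>\<omega>. c * \<bar>S (?K n) \<omega>\<bar>)" using iS by simp
        fix \<omega>
        have "S (?K n) \<omega> / sqrt n - t * (S (?K n) \<omega> / sqrt (real (?K n) * v)) = (1 / sqrt n - t / sqrt (real (?K n) * v)) * S (?K n) \<omega>"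
          by (simp add: algebra_simps)
        then show "min 2 \<bar>S (?K n) \<omega> / sqrt n - t * (S (?K n) \<omega> / sqrt (real (?K n) * v))\<bar> \<le> c * \<bar>S (?K n) \<omega>\<bar>"
          by (simp add: c_def abs_mult)
      qed measurable
      also have "\<dots> = c * expectation (\<lambda>\<omega>. \<bar>S (?K n) \<omega>\<bar>)" by simp
      also have "\<dots> \<le> c * sqrt (real (?K n) * v)" by (intro mult_left_mono ES) (simp add: c_def)
      also have "\<dots> = \<bar>(1 / sqrt n - t / sqrt (real (?K n) * v)) * sqrt (real (?K n) * v)\<bar>"
        using K v0 by (simp add: c_def abs_mult)
      also have "(1 / sqrt n - t / sqrt (real (?K n) * v)) * sqrt (real (?K n) * v) = sqrt (real (?K n) / n) * sqrt v - t"
        using K v0 n0 by (simp add: left_diff_distrib real_sqrt_mult real_sqrt_divide)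
      finally show "cmod ((\<integral>\<omega>. iexp (S (?K n) \<omega> / sqrt n) \<partial>M) - (\<integral>\<omega>. iexp (t * (S (?K n) \<omega> / sqrt (real (?K n) * v))) \<partial>M))
        \<le> \<bar>sqrt (real (?K n) / n) * sqrt v - t\<bar>" .
    qed
  qed
  from tendsto_add[OF this lim'] show ?thesis using v0 p by (simp add: S_def t_def)
qed

text \<open>Bernstein's method: blocks of \<open>q\<close> terms separated by gaps of
  \<open>m\<close> terms are independent. The discarded terms make up a fraction of about
  \<open>m / p\<close> of all terms, and being finitely dependent they contribute a second moment
  proportional to their number.\<close>

lemma mb_big_blocks:
  fixes \<epsilon> :: real
  assumes Z: "moving_block m K Z" and s: "(\<lambda>n. expectation (\<lambda>\<omega>. (psum Z 0 n \<omega>)\<^sup>2) / n) \<longlonglongrightarrow> s" and \<epsilon>: "\<epsilon> > 0"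
  obtains p :: nat and W :: "nat \<Rightarrow> 'a \<Rightarrow> real" and v where "p > 0" "indep_vars (\<lambda>_. borel) W UNIV" "\<And>k. expectation (W k) = 0"
    "\<And>k. integrable M (\<lambda>\<omega>. (W k \<omega>)\<^sup>2)" "\<And>k. expectation (\<lambda>\<omega>. (W k \<omega>)\<^sup>2) = v"
    "\<And>k. distr M borel (W k) = distr M borel (W 0)" "\<bar>v / p - s\<bar> \<le> \<epsilon>"
    "\<And>n. integrable M (\<lambda>\<omega>. (psum Z 0 n \<omega> - (\<Sum>k<n div p. W k \<omega>))\<^sup>2)"
    "\<forall>\<^sub>F n in sequentially. expectation (\<lambda>\<omega>. (psum Z 0 n \<omega> - (\<Sum>k<n div p. W k \<omega>))\<^sup>2) \<le> \<epsilon> * n"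
proof -
  note [measurable] = mb_measurable[OF Z]
  define c where "c = (2 * real m + 1) * K\<^sup>2"
  have c0: "c \<ge> 0" by (simp add: c_def)
  define V where "V q = expectation (\<lambda>\<omega>. (psum Z 0 q \<omega>)\<^sup>2)" for q
  have "(\<lambda>q. (V q / q) * (real q / real (q + m))) \<longlonglongrightarrow> s * 1"
  proof (intro tendsto_mult)
    show "(\<lambda>q. real q / real (q + m)) \<longlonglongrightarrow> 1" by real_asymp
  qed (use s in \<open>simp add: V_def\<close>)
  then have "\<forall>\<^sub>F q in sequentially. dist ((V q / q) * (real q / real (q + m))) s < \<epsilon>"
    unfolding mult_1_right by (rule tendstoD[OF _ \<epsilon>])
  moreover have "\<forall>\<^sub>F q in sequentially. c * m / real q < \<epsilon> / 2"
  proof -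
    have "(\<lambda>q. c * m / real q) \<longlonglongrightarrow> 0" by real_asymp
    then show ?thesis using \<epsilon> by (intro order_tendstoD(2)[where y = 0]) auto
  qed
  moreover have "\<forall>\<^sub>F q in sequentially. q > (0 :: nat)" by (rule eventually_gt_at_top)
  ultimately have "\<forall>\<^sub>F q in sequentially. dist ((V q / q) * (real q / real (q + m))) s < \<epsilon> \<and> c * m / real q < \<epsilon> / 2 \<and> q > 0"
    by eventually_elim auto
  then obtain q where q: "dist ((V q / q) * (real q / real (q + m))) s < \<epsilon>" "c * m / real q < \<epsilon> / 2" "q > 0"
    by (auto dest: eventually_happens)
  define p where "p = q + m"
  have p: "p > 0" "q \<le> p" using q by (auto simp: p_def)
  define W where "W k = psum Z (int (k * p)) q" for k
  have W_slots: "W k \<in> borel_measurable (slots {int (k * p) + 1 - int m..int (k * p) + int q})" for k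
    unfolding W_def by (rule mb_psum_slots[OF Z])
  \<comment> \<open>Block \<open>k\<close> reads the slots from \<open>k * p + 1 - m\<close> to
    \<open>k * p + q\<close>. As \<open>p = q + m\<close>, the next block begins reading at the very
    next slot.\<close>
  have disj: "disjoint_family (\<lambda>k. {int (k * p) + 1 - int m..int (k * p) + int q})"
  proof -
    have "{int (k * p) + 1 - int m..int (k * p) + int q} \<inter> {int (j * p) + 1 - int m..int (j * p) + int q} = {}" if "k < j" for k j
    proof -
      have "(k + 1) * p \<le> j * p" using that by (intro mult_right_mono) auto
      then have "int (k * p) + int q + int m \<le> int (j * p)" unfolding p_def by (simp add: algebra_simps flip: of_nat_add of_nat_mult)
      then show ?thesis by auto
    qed
    then show ?thesis unfolding disjoint_family_on_def by (metis Int_commute linorder_neqE_nat)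
  qed
  have indep: "indep_vars (\<lambda>_. borel) W UNIV"
    by (rule slots_indep_vars[OF disj W_slots])
  have mean: "expectation (W k) = 0" for k
    unfolding W_def psum_def[abs_def] using mb_integrable[OF Z] mb_mean[OF Z] by (simp add: Bochner_Integration.integral_sum)
  have v: "expectation (\<lambda>\<omega>. (W k \<omega>)\<^sup>2) = V q" for k
    unfolding W_def V_def by (rule mb_psum_second_moment_eq[OF Z])
  have dW: "distr M borel (W k) = distr M borel (W 0)" for k
    unfolding W_def mb_psum_distr[OF Z, of "int (k * p)"] by simp
  have close: "\<bar>V q / p - s\<bar> \<le> \<epsilon>"
    using q(1,3) by (simp add: p_def dist_real_def)
  \<comment> \<open>\<open>G n\<close> collects the times covered by the complete big blocks;
    \<open>R n\<close> consists of the gaps and the incomplete last period.\<close>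
  define G where "G n = (\<lambda>(k, r). int (k * p) + int r) ` ({..<n div p} \<times> {1..q})" for n
  define R where "R n = {0<..int n} - G n" for n
  have inj: "inj_on (\<lambda>(k, r). int (k * p) + int r) ({..<n div p} \<times> {1..q})" for n
  proof (rule inj_onI, clarify)
    fix k r k' r' :: nat
    assume r: "r \<in> {1..q}" "r' \<in> {1..q}" and eq: "int (k * p) + int r = int (k' * p) + int r'"
    have "k * p + (r - 1) = k' * p + (r' - 1)" using eq r by (simp flip: of_nat_add of_nat_mult)
    moreover have "r - 1 < p" "r' - 1 < p" using r p by auto
    ultimately have "k = k'" "r - 1 = r' - 1"
      by (metis add.commute div_mult_self1_is_m div_mult_self3 div_less add_0 p(1) less_not_refl, metis mod_mult_self3 mod_less)
    then show "k = k' \<and> r = r'" using r by auto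
  qed
  have G_sub: "G n \<subseteq> {0<..int n}" for n
  proof
    fix t assume "t \<in> G n"
    then obtain k r where kr: "k < n div p" "1 \<le> r" "r \<le> q" "t = int (k * p) + int r" by (auto simp: G_def)
    have "(k + 1) * p \<le> (n div p) * p" using kr by (intro mult_right_mono) auto
    also have "\<dots> \<le> n" by (rule div_times_less_eq_dividend)
    finally have "k * p + r \<le> n" using kr p by (simp add: algebra_simps)
    then show "t \<in> {0<..int n}" using kr by (simp flip: of_nat_add of_nat_mult)
  qed
  have sumG: "(\<Sum>t\<in>G n. Z t \<omega>) = (\<Sum>k<n div p. W k \<omega>)" for n \<omega>
    unfolding G_def by (subst sum.reindex[OF inj]) (simp add: W_def psum_def sum.cartesian_product case_prod_unfold comp_def)
  have diff: "psum Z 0 n \<omega> - (\<Sum>k<n div p. W k \<omega>) = (\<Sum>t\<in>R n. Z t \<omega>)" for n \<omega>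
    unfolding R_def sumG[symmetric] psum_eq_sum using G_sub by (subst sum_diff) auto
  have cardR: "real (card (R n)) \<le> p + n * (m / p)" for n
  proof -
    have "card (G n) = (n div p) * q" unfolding G_def by (subst card_image[OF inj]) simp
    then have "card (R n) = n - (n div p) * q" unfolding R_def
      using G_sub finite_subset[OF G_sub] by (subst card_Diff_subset) auto
    moreover have "n = (n div p) * q + (n div p) * m + n mod p"
      using div_mult_mod_eq[of n p] by (simp add: p_def algebra_simps)
    ultimately have "card (R n) = (n div p) * m + n mod p" by linarith
    moreover have "real ((n div p) * m + n mod p) \<le> real n / p * m + p"
    proof -
      have "real (n div p) \<le> real n / p"
        using div_times_less_eq_dividend[of n p] p by (simp add: le_divide_eq flip: of_nat_mult)
      then have "real (n div p) * m \<le> real n / p * m" by (rule mult_right_mono) simp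
      then show ?thesis using mod_less_divisor[OF p(1), of n] by simp
    qed
    ultimately show ?thesis by simp
  qed
  have finR: "finite (R n)" for n by (simp add: R_def)
  note R = mb_sum[OF Z finR]
  \<comment> \<open>The incomplete last period has bounded length and is absorbed for large
    \<open>n\<close>; the gaps use up the other half of \<open>\<epsilon>\<close>.\<close>
  have "\<forall>\<^sub>F n in sequentially. c * p < \<epsilon> / 2 * real n"
    using \<epsilon> by real_asymp
  then have ev: "\<forall>\<^sub>F n in sequentially. expectation (\<lambda>\<omega>. (psum Z 0 n \<omega> - (\<Sum>k<n div p. W k \<omega>))\<^sup>2) \<le> \<epsilon> * n"
  proof eventually_elim
    case (elim n)
    have "expectation (\<lambda>\<omega>. (psum Z 0 n \<omega> - (\<Sum>k<n div p. W k \<omega>))\<^sup>2) \<le> card (R n) * c"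
      unfolding diff using R(2)[of n] by (simp add: c_def mult.assoc)
    also have "\<dots> \<le> (p + n * (m / p)) * c" by (intro mult_right_mono cardR c0)
    also have "\<dots> = c * p + n * (c * m / p)" by (simp add: algebra_simps)
    also have "\<dots> \<le> c * p + n * (\<epsilon> / 2)"
    proof (intro add_left_mono mult_left_mono)
      have "c * m / p \<le> c * m / q"
        using q(3) c0 by (intro divide_left_mono) (auto simp: p_def)
      then show "c * m / p \<le> \<epsilon> / 2" using q(2) by linarith
    qed simp
    finally show ?case using elim by (simp add: mult.commute)
  qed
  show ?thesis
  proof (rule that[OF p(1) indep mean _ v dW close _ ev])
    show "integrable M (\<lambda>\<omega>. (W k \<omega>)\<^sup>2)" for k unfolding W_def by (rule mb_psum(1)[OF Z])
    show "integrable M (\<lambda>\<omega>. (psum Z 0 n \<omega> - (\<Sum>k<n div p. W k \<omega>))\<^sup>2)" for n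
      unfolding diff by (rule R(1))
  qed
qed

lemma char_diff_le_square:
  assumes [measurable]: "U \<in> borel_measurable M" "V \<in> borel_measurable M"
    and i: "integrable M (\<lambda>\<omega>. (U \<omega> - V \<omega>)\<^sup>2)" and \<alpha>: "\<alpha> > 0"
  shows "cmod ((\<integral>\<omega>. iexp (U \<omega>) \<partial>M) - (\<integral>\<omega>. iexp (V \<omega>) \<partial>M)) \<le> expectation (\<lambda>\<omega>. (U \<omega> - V \<omega>)\<^sup>2) / (2 * \<alpha>) + \<alpha> / 2"
proof -
  have "cmod ((\<integral>\<omega>. iexp (U \<omega>) \<partial>M) - (\<integral>\<omega>. iexp (V \<omega>) \<partial>M)) \<le> expectation (\<lambda>\<omega>. (U \<omega> - V \<omega>)\<^sup>2 / (2 * \<alpha>) + \<alpha> / 2)"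
    using i abs_le_square[OF \<alpha>] by (intro char_diff_le) (auto intro: min.coboundedI2)
  also have "\<dots> = expectation (\<lambda>\<omega>. (U \<omega> - V \<omega>)\<^sup>2) / (2 * \<alpha>) + \<alpha> / 2" using i by (simp add: prob_space)
  finally show ?thesis .
qed

text \<open>The process is replaced by a finitely dependent one and this by independent big blocks,
  each time with a mean square error linear in \<open>n\<close> and hence uniformly small after
  division by \<open>sqrt n\<close>. The limit variances of the three stages are close as
  well.\<close>

theorem approximable_clt:
  assumes Y: "approximable Y" and s: "(\<lambda>n. expectation (\<lambda>\<omega>. (psum Y 0 n \<omega>)\<^sup>2) / n) \<longlonglongrightarrow> s"
  shows "(\<lambda>n. \<integral>\<omega>. iexp (psum Y 0 n \<omega> / sqrt n) \<partial>M) \<longlonglongrightarrow> complex_of_real (exp (- s / 2))"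
proof (rule LIMSEQ_I)
  fix e :: real assume e: "0 < e"
  note [measurable] = approximable_measurable[OF Y]
  obtain C :: real where C: "C \<ge> 0" "\<And>a n. integrable M (\<lambda>\<omega>. (psum Y a n \<omega>)\<^sup>2)"
    "\<And>a n. expectation (\<lambda>\<omega>. (psum Y a n \<omega>)\<^sup>2) \<le> C * real n"
    by (rule approximable_second_moment[OF Y]) (rule that)
  have s0: "s \<ge> 0" by (rule tendsto_lowerbound[OF s]) auto
  have "\<forall>\<^sub>F n in sequentially. cmod ((\<integral>\<omega>. iexp (psum Y 0 n \<omega> / sqrt n) \<partial>M) - complex_of_real (exp (- s / 2))) < e"
  \<comment> \<open>A vanishing limit variance is treated directly, since normalised partial sums
    then tend to 0 in mean square, while the theorem for independent blocks requires positive
    variance.\<close>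
  proof (cases "s = 0")
    case True
    have "\<forall>\<^sub>F n in sequentially. expectation (\<lambda>\<omega>. (psum Y 0 n \<omega>)\<^sup>2) / n < e\<^sup>2"
      using s True e by (intro order_tendstoD(2)[where y = 0]) auto
    then show ?thesis
    proof eventually_elim
      case (elim n)
      have "cmod ((\<integral>\<omega>. iexp (psum Y 0 n \<omega> / sqrt n) \<partial>M) - (\<integral>\<omega>. iexp ((\<lambda>_. 0) \<omega>) \<partial>M))
          \<le> expectation (\<lambda>\<omega>. (psum Y 0 n \<omega> / sqrt n - (\<lambda>_. 0) \<omega>)\<^sup>2) / (2 * e) + e / 2"
        using C(2) e by (intro char_diff_le_square) (auto simp: power_divide)
      also have "expectation (\<lambda>\<omega>. (psum Y 0 n \<omega> / sqrt n - (\<lambda>_. 0) \<omega>)\<^sup>2) = expectation (\<lambda>\<omega>. (psum Y 0 n \<omega>)\<^sup>2) / n"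
        by (simp add: power_divide)
      also have "\<dots> / (2 * e) < e\<^sup>2 / (2 * e)" using elim e by (intro divide_strict_right_mono) auto
      also have "e\<^sup>2 / (2 * e) + e / 2 = e" using e by (simp add: power2_eq_square)
      finally show ?case using True by (simp add: prob_space)
    qed
  next
    case False
    then have s1: "s > 0" using s0 by simp
    \<comment> \<open>The two replacements cost \<open>3 * a\<close>, the change of variance
      \<open>a\<close>, and the independent blocks \<open>e / 8\<close>. The bound
      \<open>s / 4\<close> in the next choice keeps \<open>v / p\<close>, which differs from
      \<open>s\<close> by at most \<open>2 * \<epsilon>\<close>, positive.\<close>
    define a where "a = min 1 (e / 8)"
    have a: "a > 0" "a \<le> 1" "a \<le> e / 8" using e by (auto simp: a_def)
    define \<epsilon> where "\<epsilon> = min (a\<^sup>2) (s / 4)"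
    have \<epsilon>: "\<epsilon> > 0" "\<epsilon> \<le> a\<^sup>2" "\<epsilon> \<le> s / 4" using a s1 by (auto simp: \<epsilon>_def)
    obtain m K Z s' where Z: "moving_block m K Z"
        and i: "\<And>a n. integrable M (\<lambda>\<omega>. (psum Y a n \<omega> - psum Z a n \<omega>)\<^sup>2)"
        and d: "\<And>a n. expectation (\<lambda>\<omega>. (psum Y a n \<omega> - psum Z a n \<omega>)\<^sup>2) \<le> \<epsilon> * n"
        and s': "(\<lambda>n. expectation (\<lambda>\<omega>. (psum Z 0 n \<omega>)\<^sup>2) / n) \<longlonglongrightarrow> s'" "\<bar>s' - s\<bar> \<le> \<epsilon>"
      by (rule approximable_block[OF Y s \<epsilon>(1)]) (rule that)
    note [measurable] = mb_measurable[OF Z]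
    obtain p :: nat and W v where W: "p > 0" "indep_vars (\<lambda>_. borel) W UNIV" "\<And>k. expectation (W k) = 0"
        "\<And>k. integrable M (\<lambda>\<omega>. (W k \<omega>)\<^sup>2)" "\<And>k. expectation (\<lambda>\<omega>. (W k \<omega>)\<^sup>2) = v"
        "\<And>k. distr M borel (W k) = distr M borel (W 0)"
      and vs: "\<bar>v / p - s'\<bar> \<le> \<epsilon>"
      and iW: "\<And>n. integrable M (\<lambda>\<omega>. (psum Z 0 n \<omega> - (\<Sum>k<n div p. W k \<omega>))\<^sup>2)"
      and dW: "\<forall>\<^sub>F n in sequentially. expectation (\<lambda>\<omega>. (psum Z 0 n \<omega> - (\<Sum>k<n div p. W k \<omega>))\<^sup>2) \<le> \<epsilon> * n"
      by (rule mb_big_blocks[OF Z s'(1) \<epsilon>(1)]) (rule that)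
    have [measurable]: "W k \<in> borel_measurable M" for k using W(2) unfolding indep_vars_def by auto
    have vp: "\<bar>v / p - s\<bar> \<le> 2 * \<epsilon>" using vs s'(2) by linarith
    then have "v / p > 0" using \<epsilon>(3) s1 by linarith
    then have v: "v > 0" using W(1) by (simp add: zero_less_divide_iff)
    have "\<forall>\<^sub>F n in sequentially. cmod ((\<integral>\<omega>. iexp ((\<Sum>k<n div p. W k \<omega>) / sqrt n) \<partial>M) - complex_of_real (exp (- (v / p) / 2))) < e / 8"
      using tendstoD[OF iid_char_tendsto[OF W(2-6) v W(1)], of "e / 8"] e by (simp add: dist_norm)
    with dW eventually_gt_at_top[of 0] show ?thesis
    proof eventually_elim
      case (elim n)
      have n: "real n > 0" using elim by simp
      let ?S = "\<lambda>\<omega>. \<Sum>k<n div p. W k \<omega>"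
      have eq: "(psum Y 0 n \<omega> / sqrt n - ?S \<omega> / sqrt n)\<^sup>2 = (psum Y 0 n \<omega> - ?S \<omega>)\<^sup>2 / n" for \<omega>
        using n by (simp add: diff_divide_distrib[symmetric] power_divide)
      have sq: "(psum Y 0 n \<omega> - ?S \<omega>)\<^sup>2 \<le> 2 * (psum Y 0 n \<omega> - psum Z 0 n \<omega>)\<^sup>2 + 2 * (psum Z 0 n \<omega> - ?S \<omega>)\<^sup>2" for \<omega>
        using zero_le_power2[of "(psum Y 0 n \<omega> - psum Z 0 n \<omega>) - (psum Z 0 n \<omega> - ?S \<omega>)"]
        by (simp add: power2_eq_square algebra_simps)
      have ir: "integrable M (\<lambda>\<omega>. 2 * (psum Y 0 n \<omega> - psum Z 0 n \<omega>)\<^sup>2 + 2 * (psum Z 0 n \<omega> - ?S \<omega>)\<^sup>2)"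
        using i iW by simp
      have il: "integrable M (\<lambda>\<omega>. (psum Y 0 n \<omega> - ?S \<omega>)\<^sup>2)"
        using order_trans[OF sq abs_ge_self] by (intro Bochner_Integration.integrable_bound[OF ir] AE_I2) auto
      have "expectation (\<lambda>\<omega>. (psum Y 0 n \<omega> - ?S \<omega>)\<^sup>2) \<le> expectation (\<lambda>\<omega>. 2 * (psum Y 0 n \<omega> - psum Z 0 n \<omega>)\<^sup>2 + 2 * (psum Z 0 n \<omega> - ?S \<omega>)\<^sup>2)"
        by (intro integral_mono il ir sq)
      also have "\<dots> = 2 * expectation (\<lambda>\<omega>. (psum Y 0 n \<omega> - psum Z 0 n \<omega>)\<^sup>2) + 2 * expectation (\<lambda>\<omega>. (psum Z 0 n \<omega> - ?S \<omega>)\<^sup>2)"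
        using i iW by simp
      also have "\<dots> \<le> 4 * a\<^sup>2 * n" using d[of 0 n] elim(1) mult_right_mono[OF \<epsilon>(2), of "real n"] by simp
      finally have E: "expectation (\<lambda>\<omega>. (psum Y 0 n \<omega> - ?S \<omega>)\<^sup>2) / n \<le> 4 * a\<^sup>2"
        using n by (simp add: divide_le_eq)
      have "cmod ((\<integral>\<omega>. iexp (psum Y 0 n \<omega> / sqrt n) \<partial>M) - (\<integral>\<omega>. iexp (?S \<omega> / sqrt n) \<partial>M))
          \<le> expectation (\<lambda>\<omega>. (psum Y 0 n \<omega> / sqrt n - ?S \<omega> / sqrt n)\<^sup>2) / (2 * a) + a / 2"
        by (rule char_diff_le_square[OF _ _ _ a(1)]) (simp_all add: eq il)
      also have "\<dots> = expectation (\<lambda>\<omega>. (psum Y 0 n \<omega> - ?S \<omega>)\<^sup>2) / n / (2 * a) + a / 2"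
        unfolding eq by simp
      also have "\<dots> \<le> 4 * a\<^sup>2 / (2 * a) + a / 2" using a by (intro add_right_mono divide_right_mono E) auto
      also have "\<dots> \<le> 3 * a" using a by (simp add: power2_eq_square)
      finally have 1: "cmod ((\<integral>\<omega>. iexp (psum Y 0 n \<omega> / sqrt n) \<partial>M) - (\<integral>\<omega>. iexp (?S \<omega> / sqrt n) \<partial>M)) \<le> 3 * a" .
      have "cmod (complex_of_real (exp (- (v / p) / 2)) - complex_of_real (exp (- s / 2))) \<le> \<bar>v / p - s\<bar> / 2"
      proof -
        \<comment> \<open>The function \<open>exp (- x)\<close> has Lipschitz constant 1 on the
          nonnegative reals.\<close>
        have lip: "exp (- y) - exp (- x) \<le> x - y" if "0 \<le> y" "y \<le> x" for x y :: real
        proof -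
          have "exp (- y) * (1 - exp (y - x)) \<le> 1 * (1 - exp (y - x))"
            using that by (intro mult_right_mono) auto
          also have "\<dots> \<le> x - y"
          proof -
            have "1 + (y - x) \<le> E \<Longrightarrow> 1 * (1 - E) \<le> x - y" for E :: real by simp
            from this[OF exp_ge_add_one_self] show ?thesis .
          qed
          finally show ?thesis by (simp add: right_diff_distrib exp_add[symmetric])
        qed
        have "\<bar>exp (- (v / p / 2)) - exp (- (s / 2))\<bar> \<le> \<bar>v / p / 2 - s / 2\<bar>"
          using lip[of "v / p / 2" "s / 2"] lip[of "s / 2" "v / p / 2"] \<open>v / p > 0\<close> s0
          by (cases "v / p / 2 \<le> s / 2") (auto simp: abs_if)
        then have "\<bar>exp (- (v / p) / 2) - exp (- s / 2)\<bar> \<le> \<bar>(v / p - s) / 2\<bar>"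
          by (simp only: minus_divide_left diff_divide_distrib)
        then show ?thesis unfolding of_real_diff[symmetric] norm_of_real by (simp only: abs_divide abs_numeral)
      qed
      also have "\<dots> \<le> a\<^sup>2" using vp \<epsilon>(2) by simp
      also have "\<dots> \<le> a" using a by (simp add: power2_eq_square mult_left_le)
      finally have 2: "cmod (complex_of_real (exp (- (v / p) / 2)) - complex_of_real (exp (- s / 2))) \<le> a" .
      have "cmod ((\<integral>\<omega>. iexp (psum Y 0 n \<omega> / sqrt n) \<partial>M) - complex_of_real (exp (- s / 2)))
        \<le> 3 * a + e / 8 + a"
        using norm_triangle_le[OF add_mono[OF norm_triangle_le[OF add_mono[OF 1 less_imp_le[OF elim(3)]]] 2]]
        by (simp add: algebra_simps)
      then show ?case using a e by linarith
    qed
  qed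
  then show "\<exists>no. \<forall>n\<ge>no. norm ((\<integral>\<omega>. iexp (psum Y 0 n \<omega> / sqrt n) \<partial>M) - complex_of_real (exp (- s / 2))) < e"
    by (simp add: eventually_sequentially)
qed

end

section \<open>Characteristic function of the bootstrap root\<close>

definition avg :: "nat \<Rightarrow> (nat \<Rightarrow> real) \<Rightarrow> real" where
  "avg L f = (\<Sum>i=1..L. f i) / L"

lemma avg_nonneg: "(\<And>i. 0 \<le> f i) \<Longrightarrow> 0 \<le> avg L f"
  by (auto simp: avg_def intro!: divide_nonneg_nonneg sum_nonneg)

lemma avg_mono: "(\<And>i. f i \<le> g i) \<Longrightarrow> avg L f \<le> avg L g"
  by (auto simp: avg_def intro!: divide_right_mono sum_mono)

lemma avg_add: "avg L (\<lambda>i. f i + g i) = avg L f + avg L g"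
  by (simp add: avg_def sum.distrib add_divide_distrib)

lemma avg_diff: "avg L (\<lambda>i. f i - g i) = avg L f - avg L g"
  by (simp add: avg_def sum_subtractf diff_divide_distrib)

lemma avg_cmult: "avg L (\<lambda>i. c * f i) = c * avg L f"
  by (simp add: avg_def sum_distrib_left)

lemma avg_sum: "avg L (\<lambda>i. \<Sum>j\<in>J. f j i) = (\<Sum>j\<in>J. avg L (f j))"
  unfolding avg_def by (subst sum.swap) (simp add: sum_divide_distrib)

lemma avg_const: "L > 0 \<Longrightarrow> avg L (\<lambda>_. c) = c"
  by (simp add: avg_def)

lemma avg_abs: "\<bar>avg L f\<bar> \<le> avg L (\<lambda>i. \<bar>f i\<bar>)"
  by (auto simp: avg_def abs_divide intro!: divide_right_mono)

definition block_sum :: "(int \<Rightarrow> real) \<Rightarrow> nat \<Rightarrow> nat \<Rightarrow> real" where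
  "block_sum X B i = (\<Sum>r=1..B. X (int (i + r)))"

lemma bootstrap_sum_eq: "bootstrap_sum n B I X = (\<Sum>d=1..n div B. block_sum X B (I d))"
\<comment> \<open>For \<open>B = 0\<close> the quotient \<open>n div B\<close> is 0 and both sums
  are empty; otherwise \<open>i = (d - 1) * B + r\<close> is a bijection.\<close>
proof (cases "B = 0")
  case False
  have "(\<Sum>d=1..n div B. block_sum X B (I d)) = (\<Sum>(d, r)\<in>{1..n div B} \<times> {1..B}. X (int (I d + r)))"
    unfolding block_sum_def by (simp add: sum.cartesian_product)
  also have "\<dots> = (\<Sum>i=1..(n div B) * B. X (int (I ((i - 1) div B + 1) + ((i - 1) mod B + 1))))"
  proof (rule sum.reindex_bij_witness[where i = "\<lambda>i. ((i - 1) div B + 1, (i - 1) mod B + 1)" and j = "\<lambda>(d, r). (d - 1) * B + r"])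
    fix i assume i: "i \<in> {1..(n div B) * B}"
    show "(\<lambda>(d, r). (d - 1) * B + r) ((i - 1) div B + 1, (i - 1) mod B + 1) = i"
      using i by (simp add: div_mult_mod_eq)
    have "(i - 1) div B < n div B" using i False by (intro less_mult_imp_div_less) auto
    then show "((i - 1) div B + 1, (i - 1) mod B + 1) \<in> {1..n div B} \<times> {1..B}"
      using False by (auto simp: Suc_le_eq)
  next
    fix a assume a: "a \<in> {1..n div B} \<times> {1..B}"
    obtain d r where dr: "a = (d, r)" "1 \<le> d" "d \<le> n div B" "1 \<le> r" "r \<le> B" using a by (cases a) auto
    have m: "(d - 1) * B + r - 1 = (d - 1) * B + (r - 1)" using dr by simp
    have "(e * B + q) div B = e" "(e * B + q) mod B = q" if "q < B" for e q using that by auto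
    from this[of "r - 1" "d - 1"] have dv: "((d - 1) * B + (r - 1)) div B = d - 1" "((d - 1) * B + (r - 1)) mod B = r - 1"
      using dr by auto
    show "(((case a of (d, r) \<Rightarrow> (d - 1) * B + r) - 1) div B + 1, ((case a of (d, r) \<Rightarrow> (d - 1) * B + r) - 1) mod B + 1) = a"
      using dr by (simp only: case_prod_conv m dv) simp
    have "(d - 1) * B + B \<le> (n div B) * B"
    proof -
      have "(d - 1 + 1) * B \<le> (n div B) * B" using dr by (intro mult_right_mono) auto
      then show ?thesis by simp
    qed
    then show "(case a of (d, r) \<Rightarrow> (d - 1) * B + r) \<in> {1..(n div B) * B}" using dr by auto
    show "X (int (I (((case a of (d, r) \<Rightarrow> (d - 1) * B + r) - 1) div B + 1) + (((case a of (d, r) \<Rightarrow> (d - 1) * B + r) - 1) mod B + 1)))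
        = (case a of (d, r) \<Rightarrow> X (int (I d + r)))"
      using dr by (simp only: case_prod_conv m dv) simp
  qed
  finally show ?thesis by (simp add: bootstrap_sum_def bootstrap_def)
qed (simp add: bootstrap_sum_def)

lemma finite_set_pmf_block_starts: "finite (set_pmf (block_starts n B))"
  unfolding block_starts_def by (auto simp: set_Pi_pmf intro!: finite_PiE_dflt)

lemma integrable_block_starts:
  fixes f :: "_ \<Rightarrow> 'b :: {banach, second_countable_topology}"
  shows "integrable (measure_pmf (block_starts n B)) f"
  by (rule integrable_measure_pmf_finite[OF finite_set_pmf_block_starts])

lemma expectation_block_start:
  fixes f :: "nat \<Rightarrow> 'b :: {banach, second_countable_topology}"
  assumes d: "d \<in> {1..n div B}"
  shows "measure_pmf.expectation (block_starts n B) (\<lambda>I. f (I d)) = (1 / real (n - B + 1)) *\<^sub>R (\<Sum>i=1..n - B + 1. f i)"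
proof -
  have "measure_pmf.expectation (block_starts n B) (\<lambda>I. f (I d)) = measure_pmf.expectation (map_pmf (\<lambda>I. I d) (block_starts n B)) f"
    by simp
  also have "map_pmf (\<lambda>I. I d) (block_starts n B) = pmf_of_set {1..n - B + 1}"
    unfolding block_starts_def using d by (subst Pi_pmf_component) auto
  also have "measure_pmf.expectation \<dots> f = (\<Sum>i\<in>{1..n - B + 1}. pmf (pmf_of_set {1..n - B + 1}) i *\<^sub>R f i)"
    by (rule integral_measure_pmf) (auto simp: set_pmf_of_set)
  also have "\<dots> = (1 / real (n - B + 1)) *\<^sub>R (\<Sum>i=1..n - B + 1. f i)"
    by (simp only: scaleR_sum_right) (intro sum.cong refl, simp)
  finally show ?thesis .
qed

lemma expectation_block_start_real:
  fixes f :: "nat \<Rightarrow> real"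
  assumes "d \<in> {1..n div B}"
  shows "measure_pmf.expectation (block_starts n B) (\<lambda>I. f (I d)) = avg (n - B + 1) f"
  using expectation_block_start[OF assms, of f] by (simp add: avg_def)

lemma block_starts_indep:
  "prob_space.indep_vars (measure_pmf (block_starts n B)) (\<lambda>_. count_space UNIV) (\<lambda>d I. I d) {1..n div B}"
  unfolding block_starts_def by (rule indep_vars_Pi_pmf) simp

lemma expectation_block_sum:
  "measure_pmf.expectation (block_starts n B) (\<lambda>I. \<Sum>d=1..n div B. f (I d)) = real (n div B) * avg (n - B + 1) f"
  by (subst Bochner_Integration.integral_sum)
    (simp_all only: integrable_block_starts expectation_block_start_real sum_constant card_atLeastAtMost diff_Suc_1 add_diff_cancel_right' cong: sum.cong)

text \<open>Distinct draws are independent, so centred terms are uncorrelated and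
  \<open>second_moment_sum_le\<close> applies with one partner per term.\<close>

lemma expectation_block_sum_square:
  assumes 0: "avg (n - B + 1) f = 0"
  shows "measure_pmf.expectation (block_starts n B) (\<lambda>I. (\<Sum>d=1..n div B. f (I d))\<^sup>2) \<le> real (n div B) * avg (n - B + 1) (\<lambda>i. (f i)\<^sup>2)"
proof -
  let ?P = "measure_pmf (block_starts n B)"
  have uncor: "measure_pmf.expectation (block_starts n B) (\<lambda>I. f (I d) * f (I e)) = 0" if "d \<in> {1..n div B}" "e \<in> {1..n div B}" "d \<noteq> e" for d e
  proof -
    have "prob_space.indep_vars ?P (\<lambda>_. count_space UNIV) (\<lambda>d I. I d) {d, e}"
      using prob_space.indep_vars_subset[OF measure_pmf.prob_space_axioms block_starts_indep[of n B], of "{d, e}"] that by auto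
    then have "prob_space.indep_vars ?P (\<lambda>_. borel) (\<lambda>d I. f (I d)) {d, e}"
      by (rule prob_space.indep_vars_compose2[OF measure_pmf.prob_space_axioms]) auto
    from prob_space.indep_vars_lebesgue_integral[OF measure_pmf.prob_space_axioms _ this] show ?thesis
      using that 0 by (simp add: integrable_block_starts expectation_block_start_real)
  qed
  have card: "card {e \<in> {1..n div B}. measure_pmf.expectation (block_starts n B) (\<lambda>I. f (I d) * f (I e)) \<noteq> 0} \<le> 1"
    if d: "d \<in> {1..n div B}" for d
  proof -
    have "{e \<in> {1..n div B}. measure_pmf.expectation (block_starts n B) (\<lambda>I. f (I d) * f (I e)) \<noteq> 0} \<subseteq> {d}"
      using uncor[OF d] by auto
    from card_mono[OF _ this] show ?thesis by simp
  qed
  have var: "measure_pmf.expectation (block_starts n B) (\<lambda>I. (f (I d))\<^sup>2) \<le> avg (n - B + 1) (\<lambda>i. (f i)\<^sup>2)"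
    if "d \<in> {1..n div B}" for d
    using expectation_block_start_real[OF that, of "\<lambda>i. (f i)\<^sup>2"] by simp
  show ?thesis
    using prob_space.second_moment_sum_le(2)[OF measure_pmf.prob_space_axioms finite_atLeastAtMost _ integrable_block_starts var card]
    by simp
qed

lemma expectation_block_iexp:
  "measure_pmf.expectation (block_starts n B) (\<lambda>I. iexp (\<Sum>d=1..n div B. g (I d)))
    = ((\<Sum>i=1..n - B + 1. iexp (g i)) / card {1..n - B + 1}) ^ (n div B)"
proof -
  let ?P = "measure_pmf (block_starts n B)"
  have ind: "prob_space.indep_vars ?P (\<lambda>_. borel) (\<lambda>d I. iexp (g (I d))) {1..n div B}"
    by (rule prob_space.indep_vars_compose2[OF measure_pmf.prob_space_axioms block_starts_indep]) auto
  have "measure_pmf.expectation (block_starts n B) (\<lambda>I. iexp (\<Sum>d=1..n div B. g (I d)))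
      = measure_pmf.expectation (block_starts n B) (\<lambda>I. \<Prod>d=1..n div B. iexp (g (I d)))"
    by (simp add: exp_sum sum_distrib_left)
  also have "\<dots> = (\<Prod>d=1..n div B. measure_pmf.expectation (block_starts n B) (\<lambda>I. iexp (g (I d))))"
    by (rule prob_space.indep_vars_lebesgue_integral[OF measure_pmf.prob_space_axioms _ ind]) (auto intro: integrable_block_starts)
  also have "\<dots> = (\<Prod>d=1..n div B. (\<Sum>i=1..n - B + 1. iexp (g i)) / card {1..n - B + 1})"
    by (intro prod.cong refl, subst expectation_block_start[of _ n B "\<lambda>i. iexp (g i)"]) (auto simp: scaleR_conv_of_real)
  finally show ?thesis by simp
qed

text \<open>The Taylor remainder bound from \<open>cmod_iexp_second_order\<close>, taken as the
  Lindeberg functional. It is monotone in the modulus and behaves well under scaling and finite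
  sums, so linear combinations can be treated coordinate by coordinate.\<close>

definition mcs :: "real \<Rightarrow> real" where "mcs x = min (\<bar>x\<bar> ^ 3) (x\<^sup>2)"

lemma mcs_nonneg: "0 \<le> mcs x" and mcs_le_square: "mcs x \<le> x\<^sup>2"
  by (simp_all add: mcs_def)

lemma mcs_mono: "\<bar>x\<bar> \<le> \<bar>y\<bar> \<Longrightarrow> mcs x \<le> mcs y"
  unfolding mcs_def by (rule min.mono) (auto intro: power_mono simp: abs_le_square_iff)

lemma mcs_mult_le: "mcs (c * x) \<le> (max 1 \<bar>c\<bar>) ^ 3 * mcs x"
proof -
  let ?g = "max 1 \<bar>c\<bar>"
  have g: "?g \<ge> 1" "\<bar>c\<bar> \<le> ?g" by auto
  have "\<bar>c\<bar> ^ 3 \<le> ?g ^ 3" using g by (intro power_mono) auto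
  then have 1: "\<bar>c * x\<bar> ^ 3 \<le> ?g ^ 3 * \<bar>x\<bar> ^ 3"
    by (simp add: abs_mult power_mult_distrib mult_right_mono)
  have "\<bar>c\<bar>\<^sup>2 \<le> ?g\<^sup>2" using g by (intro power_mono) auto
  also have "\<dots> \<le> ?g ^ 3" using g by (intro power_increasing) auto
  finally have 2: "(c * x)\<^sup>2 \<le> ?g ^ 3 * x\<^sup>2"
    by (simp add: power_mult_distrib mult_right_mono)
  have "mcs (c * x) \<le> min (?g ^ 3 * \<bar>x\<bar> ^ 3) (?g ^ 3 * x\<^sup>2)"
    unfolding mcs_def using 1 2 by (rule min.mono)
  also have "\<dots> = ?g ^ 3 * mcs x"
    using g unfolding mcs_def by (simp add: min_mult_distrib_left)
  finally show ?thesis .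
qed

text \<open>The largest term dominates: the modulus of the sum is at most \<open>card J\<close>
  times that of some single term, and monotonicity reduces the claim to this term.\<close>

lemma mcs_sum_le:
  fixes c x :: "'i \<Rightarrow> real"
  assumes J: "finite J"
  shows "mcs (\<Sum>j\<in>J. c j * x j) \<le> (\<Sum>j\<in>J. (max 1 \<bar>card J * c j\<bar>) ^ 3 * mcs (x j))"
proof (cases "J = {}")
  case False
  have "\<exists>i\<in>J. \<bar>\<Sum>j\<in>J. c j * x j\<bar> \<le> card J * \<bar>c i * x i\<bar>"
  proof (rule ccontr)
    assume "\<not> ?thesis"
    then have *: "\<And>i. i \<in> J \<Longrightarrow> card J * \<bar>c i * x i\<bar> < \<bar>\<Sum>j\<in>J. c j * x j\<bar>" by force
    have "(\<Sum>i\<in>J. card J * \<bar>c i * x i\<bar>) < (\<Sum>i\<in>J. \<bar>\<Sum>j\<in>J. c j * x j\<bar>)"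
      using J False * by (intro sum_strict_mono) auto
    also have "\<dots> = card J * \<bar>\<Sum>j\<in>J. c j * x j\<bar>" by simp
    also have "\<dots> \<le> card J * (\<Sum>j\<in>J. \<bar>c j * x j\<bar>)" by (intro mult_left_mono sum_abs) auto
    finally show False by (simp add: sum_distrib_left)
  qed
  then obtain i where i: "i \<in> J" "\<bar>\<Sum>j\<in>J. c j * x j\<bar> \<le> card J * \<bar>c i * x i\<bar>" by blast
  have "mcs (\<Sum>j\<in>J. c j * x j) \<le> mcs ((card J * c i) * x i)"
    using i(2) by (intro mcs_mono) (simp add: abs_mult mult.assoc)
  also have "\<dots> \<le> (max 1 \<bar>card J * c i\<bar>) ^ 3 * mcs (x i)" by (rule mcs_mult_le)
  also have "\<dots> \<le> (\<Sum>j\<in>J. (max 1 \<bar>card J * c j\<bar>) ^ 3 * mcs (x j))"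
    using J i(1) by (intro member_le_sum) (auto intro!: mult_nonneg_nonneg mcs_nonneg)
  finally show ?thesis .
qed (simp add: mcs_def)

text \<open>The difference is at most twice the larger of \<open>a\<close> and \<open>e\<close>. If
  that is \<open>e\<close>, only its square is kept, so a second moment bound on \<open>e\<close>
  suffices.\<close>

lemma mcs_diff_le: "mcs (a - e) \<le> 8 * mcs a + 4 * e\<^sup>2"
proof (cases "\<bar>e\<bar> \<le> \<bar>a\<bar>")
  case True
  then have "mcs (a - e) \<le> mcs (2 * a)" by (intro mcs_mono) auto
  also have "\<dots> \<le> 8 * mcs a" using mcs_mult_le[of 2 a] by (simp add: max_def)
  finally show ?thesis using zero_le_power2[of e] by linarith
next
  case False
  then have "mcs (a - e) \<le> mcs (2 * e)" by (intro mcs_mono) auto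
  also have "\<dots> \<le> 4 * e\<^sup>2" using mcs_le_square[of "2 * e"] by (simp add: power_mult_distrib)
  finally show ?thesis using mcs_nonneg[of a] by linarith
qed

text \<open>By Young's inequality the change is at most \<open>\<eta>\<close> times the original
  mean square plus a multiple of the vanishing one, and \<open>\<eta>\<close> is arbitrary.\<close>

lemma avg_square_perturb:
  fixes w :: "nat \<Rightarrow> real" and L :: "nat \<Rightarrow> nat" and a e :: "nat \<Rightarrow> nat \<Rightarrow> real"
  assumes w: "\<And>n. w n \<ge> 0"
    and a: "(\<lambda>n. w n * avg (L n) (\<lambda>i. (a n i)\<^sup>2)) \<longlonglongrightarrow> s"
    and e: "(\<lambda>n. w n * avg (L n) (\<lambda>i. (e n i)\<^sup>2)) \<longlonglongrightarrow> 0"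
  shows "(\<lambda>n. w n * avg (L n) (\<lambda>i. (a n i - e n i)\<^sup>2)) \<longlonglongrightarrow> s"
proof -
  let ?p = "\<lambda>n. w n * avg (L n) (\<lambda>i. (a n i)\<^sup>2)" and ?q = "\<lambda>n. w n * avg (L n) (\<lambda>i. (e n i)\<^sup>2)"
  let ?r = "\<lambda>n. w n * avg (L n) (\<lambda>i. (a n i - e n i)\<^sup>2)"
  have bound: "\<bar>?r n - ?p n\<bar> \<le> \<eta> * ?p n + (1 + 1 / \<eta>) * ?q n" if "\<eta> > 0" for n \<eta>
  proof -
    have "\<bar>?r n - ?p n\<bar> = w n * \<bar>avg (L n) (\<lambda>i. (a n i)\<^sup>2 - (a n i - e n i)\<^sup>2)\<bar>"
      using w[of n] by (simp add: avg_diff abs_mult right_diff_distrib[symmetric] abs_minus_commute)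
    also have "\<dots> \<le> w n * avg (L n) (\<lambda>i. \<eta> * (a n i)\<^sup>2 + (1 + 1 / \<eta>) * (e n i)\<^sup>2)"
    proof (intro mult_left_mono order_trans[OF avg_abs] avg_mono w)
      show "\<bar>(a n i)\<^sup>2 - (a n i - e n i)\<^sup>2\<bar> \<le> \<eta> * (a n i)\<^sup>2 + (1 + 1 / \<eta>) * (e n i)\<^sup>2" for i
        using abs_square_diff_le[OF that, of "a n i" "a n i - e n i"] by simp
    qed
    also have "\<dots> = \<eta> * ?p n + (1 + 1 / \<eta>) * ?q n"
      unfolding avg_add avg_cmult by (simp add: algebra_simps)
    finally show ?thesis .
  qed
  have s: "s \<ge> 0" by (rule tendsto_lowerbound[OF a]) (auto intro!: always_eventually mult_nonneg_nonneg w avg_nonneg)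
  have "(\<lambda>n. ?r n - ?p n) \<longlonglongrightarrow> 0"
  proof (rule LIMSEQ_I)
    fix \<epsilon> :: real assume \<epsilon>: "0 < \<epsilon>"
    define \<eta> where "\<eta> = \<epsilon> / (2 * (s + 1))"
    have "\<epsilon> * s < \<epsilon> * (2 * (s + 1))" using \<epsilon> s by (intro mult_strict_left_mono) auto
    then have \<eta>: "\<eta> > 0" "\<eta> * s < \<epsilon>" using \<epsilon> s by (auto simp: \<eta>_def divide_less_eq)
    have "(\<lambda>n. \<eta> * ?p n + (1 + 1 / \<eta>) * ?q n) \<longlonglongrightarrow> \<eta> * s + (1 + 1 / \<eta>) * 0"
      by (intro tendsto_intros a e)
    then have "\<forall>\<^sub>F n in sequentially. \<eta> * ?p n + (1 + 1 / \<eta>) * ?q n < \<epsilon>"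
      using \<eta>(2) by (intro order_tendstoD(2)) auto
    then have "\<forall>\<^sub>F n in sequentially. norm (?r n - ?p n - 0) < \<epsilon>"
      by eventually_elim (use bound[OF \<eta>(1)] in \<open>auto intro: le_less_trans\<close>)
    then show "\<exists>no. \<forall>n\<ge>no. norm (?r n - ?p n - 0) < \<epsilon>" by (simp add: eventually_sequentially)
  qed
  from tendsto_add[OF this a] show ?thesis by simp
qed

text \<open>Conditioning on the data means holding them fixed, so the data enter as deterministic
  arrays and the assumptions are numerical limits. The index \<open>\<nu>\<close> is separate from
  the sample size \<open>n \<nu>\<close>, which permits sequences along which both sample size and
  sample point change. \<open>T\<close> centres at the true ratio \<open>h\<close>.\<close>

locale bootstrap_data =
  fixes n B :: "nat \<Rightarrow> nat" and D :: "nat \<Rightarrow> int \<Rightarrow> real" and X :: "nat \<Rightarrow> 'i \<Rightarrow> int \<Rightarrow> real"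
    and h :: "'i \<Rightarrow> real" and J :: "'i set" and k L :: "nat \<Rightarrow> nat"
    and T :: "nat \<Rightarrow> 'i \<Rightarrow> nat \<Rightarrow> real" and \<Delta> :: "nat \<Rightarrow> nat \<Rightarrow> real"
    and Sg :: "'i \<Rightarrow> 'i \<Rightarrow> real" and d :: real
  defines "k \<equiv> \<lambda>\<nu>. n \<nu> div B \<nu>" and "L \<equiv> \<lambda>\<nu>. n \<nu> - B \<nu> + 1"
    and "T \<equiv> \<lambda>\<nu> j. block_sum (\<lambda>t. X \<nu> j t - h j * D \<nu> t) (B \<nu>)"
    and "\<Delta> \<equiv> \<lambda>\<nu>. block_sum (D \<nu>) (B \<nu>)"
  assumes J: "finite J" and k: "filterlim k at_top sequentially"
    and kB: "(\<lambda>\<nu>. real (k \<nu>) * real (B \<nu>) / real (n \<nu>)) \<longlonglongrightarrow> 1"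
    and cov: "\<And>i j. i \<in> J \<Longrightarrow> j \<in> J \<Longrightarrow> (\<lambda>\<nu>. avg (L \<nu>) (\<lambda>q. T \<nu> i q * T \<nu> j q) / B \<nu>) \<longlonglongrightarrow> Sg i j"
    and mean: "\<And>j. j \<in> J \<Longrightarrow> (\<lambda>\<nu>. (avg (L \<nu>) (T \<nu> j))\<^sup>2 / B \<nu>) \<longlonglongrightarrow> 0"
    and lind: "\<And>j. j \<in> J \<Longrightarrow> (\<lambda>\<nu>. k \<nu> * avg (L \<nu>) (\<lambda>q. mcs (T \<nu> j q / sqrt (n \<nu>)))) \<longlonglongrightarrow> 0"
    and \<Delta>_mean: "(\<lambda>\<nu>. avg (L \<nu>) (\<Delta> \<nu>) / B \<nu>) \<longlonglongrightarrow> d" and d: "d > 0"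
    and \<Delta>_var: "(\<lambda>\<nu>. avg (L \<nu>) (\<lambda>q. (\<Delta> \<nu> q - d * B \<nu>)\<^sup>2) / (real (B \<nu>))\<^sup>2) \<longlonglongrightarrow> 0"
begin

lemma L_pos: "L \<nu> > 0" by (simp add: L_def)

lemma eventually_pos: "\<forall>\<^sub>F \<nu> in sequentially. k \<nu> > 0 \<and> B \<nu> > 0 \<and> n \<nu> > 0 \<and> avg (L \<nu>) (\<Delta> \<nu>) > 0"
proof -
  have "\<forall>\<^sub>F \<nu> in sequentially. k \<nu> > 0"
    using eventually_compose_filterlim[OF eventually_gt_at_top k] .
  moreover have "\<forall>\<^sub>F \<nu> in sequentially. avg (L \<nu>) (\<Delta> \<nu>) / B \<nu> > 0"
    using order_tendstoD(1)[OF \<Delta>_mean d] .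
  ultimately show ?thesis
  proof eventually_elim
    case (elim \<nu>)
    then have "B \<nu> > 0" "n \<nu> > 0" by (auto simp: k_def div_greater_zero_iff intro: Nat.gr0I)
    with elim show ?case by (simp add: zero_less_divide_iff)
  qed
qed

text \<open>The correction for centring at the bootstrap ratio of means instead of \<open>h\<close>:
  a multiple of the block total \<open>\<Delta>\<close>, chosen to have the same average over the
  starts as \<open>main\<close>.\<close>

definition err :: "('i \<Rightarrow> real) \<Rightarrow> nat \<Rightarrow> nat \<Rightarrow> real" where
  "err c \<nu> q = (\<Sum>j\<in>J. c j * avg (L \<nu>) (T \<nu> j)) / (avg (L \<nu>) (\<Delta> \<nu>) * sqrt (n \<nu>)) * \<Delta> \<nu> q"

definition main :: "('i \<Rightarrow> real) \<Rightarrow> nat \<Rightarrow> nat \<Rightarrow> real" where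
  "main c \<nu> q = (\<Sum>j\<in>J. c j * (T \<nu> j q / sqrt (n \<nu>)))"

text \<open>The contribution of one block to the linearised root. It averages to 0 over the starts
  exactly, as \<open>power_char_tendsto\<close> requires, although \<open>T\<close> itself does
  not.\<close>

definition tau :: "('i \<Rightarrow> real) \<Rightarrow> nat \<Rightarrow> nat \<Rightarrow> real" where
  "tau c \<nu> q = main c \<nu> q - err c \<nu> q"

lemma main_second_moment: "(\<lambda>\<nu>. k \<nu> * avg (L \<nu>) (\<lambda>q. (main c \<nu> q)\<^sup>2)) \<longlonglongrightarrow> (\<Sum>i\<in>J. \<Sum>j\<in>J. c i * c j * Sg i j)"
proof -
  have "(\<lambda>\<nu>. (real (k \<nu>) * real (B \<nu>) / real (n \<nu>)) * (\<Sum>i\<in>J. \<Sum>j\<in>J. c i * c j * (avg (L \<nu>) (\<lambda>q. T \<nu> i q * T \<nu> j q) / B \<nu>)))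
      \<longlonglongrightarrow> 1 * (\<Sum>i\<in>J. \<Sum>j\<in>J. c i * c j * Sg i j)"
    by (intro tendsto_mult kB tendsto_sum tendsto_const cov)
  moreover have "\<forall>\<^sub>F \<nu> in sequentially. (real (k \<nu>) * real (B \<nu>) / real (n \<nu>)) * (\<Sum>i\<in>J. \<Sum>j\<in>J. c i * c j * (avg (L \<nu>) (\<lambda>q. T \<nu> i q * T \<nu> j q) / B \<nu>))
      = k \<nu> * avg (L \<nu>) (\<lambda>q. (main c \<nu> q)\<^sup>2)"
    using eventually_pos
  proof eventually_elim
    case (elim \<nu>)
    have "(main c \<nu> q)\<^sup>2 = (\<Sum>i\<in>J. \<Sum>j\<in>J. c i * c j / n \<nu> * (T \<nu> i q * T \<nu> j q))" for q
    proof -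
      have "(main c \<nu> q)\<^sup>2 = (\<Sum>i\<in>J. \<Sum>j\<in>J. (c i * (T \<nu> i q / sqrt (n \<nu>))) * (c j * (T \<nu> j q / sqrt (n \<nu>))))"
        by (simp only: main_def power2_eq_square sum_product)
      also have "\<dots> = (\<Sum>i\<in>J. \<Sum>j\<in>J. c i * c j / n \<nu> * (T \<nu> i q * T \<nu> j q))"
      proof (intro sum.cong refl)
        fix i j
        have "sqrt (real (n \<nu>)) * sqrt (real (n \<nu>)) = n \<nu>" by simp
        then show "(c i * (T \<nu> i q / sqrt (n \<nu>))) * (c j * (T \<nu> j q / sqrt (n \<nu>))) = c i * c j / n \<nu> * (T \<nu> i q * T \<nu> j q)"
          by (simp add: mult_ac)
      qed
      finally show ?thesis .
    qed
    then have "avg (L \<nu>) (\<lambda>q. (main c \<nu> q)\<^sup>2) = (\<Sum>i\<in>J. \<Sum>j\<in>J. c i * c j / n \<nu> * avg (L \<nu>) (\<lambda>q. T \<nu> i q * T \<nu> j q))"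
      by (simp only: avg_sum avg_cmult)
    then show ?case using elim by (simp add: sum_distrib_left mult_ac)
  qed
  ultimately show ?thesis by (simp add: Lim_transform_eventually)
qed

text \<open>With \<open>k / n\<close> of order \<open>1 / B\<close> and \<open>\<Delta>\<close> of
  order \<open>B\<close> in mean square, the quantity has the order of the squared average of
  \<open>T\<close> divided by \<open>B\<close>, which tends to 0 by \<open>mean\<close>.\<close>

lemma err_second_moment: "(\<lambda>\<nu>. k \<nu> * avg (L \<nu>) (\<lambda>q. (err c \<nu> q)\<^sup>2)) \<longlonglongrightarrow> 0"
proof (rule tendsto_sandwich[where f = "\<lambda>_. 0"])
  let ?R = "\<lambda>\<nu>. (real (k \<nu>) * real (B \<nu>) / real (n \<nu>)) * (\<Sum>j\<in>J. c j * (avg (L \<nu>) (T \<nu> j) / sqrt (B \<nu>)))\<^sup>2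
      * ((2 * (avg (L \<nu>) (\<lambda>q. (\<Delta> \<nu> q - d * B \<nu>)\<^sup>2) / (real (B \<nu>))\<^sup>2) + 2 * d\<^sup>2) / (avg (L \<nu>) (\<Delta> \<nu>) / B \<nu>)\<^sup>2)"
  have m0: "(\<lambda>\<nu>. avg (L \<nu>) (T \<nu> j) / sqrt (B \<nu>)) \<longlonglongrightarrow> 0" if "j \<in> J" for j
  proof -
    have "(\<lambda>\<nu>. sqrt ((avg (L \<nu>) (T \<nu> j))\<^sup>2 / B \<nu>)) \<longlonglongrightarrow> sqrt 0"
      by (intro tendsto_real_sqrt mean that)
    then have "(\<lambda>\<nu>. \<bar>avg (L \<nu>) (T \<nu> j) / sqrt (B \<nu>)\<bar>) \<longlonglongrightarrow> 0"
      by (simp add: real_sqrt_divide abs_divide)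
    then show ?thesis by (simp only: tendsto_rabs_zero_iff)
  qed
  have "?R \<longlonglongrightarrow> 1 * (\<Sum>j\<in>J. c j * 0)\<^sup>2 * ((2 * 0 + 2 * d\<^sup>2) / d\<^sup>2)"
    using d by (intro tendsto_intros kB m0 \<Delta>_mean \<Delta>_var) auto
  then show "?R \<longlonglongrightarrow> 0" by simp
  show "\<forall>\<^sub>F \<nu> in sequentially. 0 \<le> k \<nu> * avg (L \<nu>) (\<lambda>q. (err c \<nu> q)\<^sup>2)"
    by (auto intro!: always_eventually mult_nonneg_nonneg avg_nonneg)
  show "\<forall>\<^sub>F \<nu> in sequentially. k \<nu> * avg (L \<nu>) (\<lambda>q. (err c \<nu> q)\<^sup>2) \<le> ?R \<nu>"
    using eventually_pos
  proof eventually_elim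
    case (elim \<nu>)
    let ?m = "\<Sum>j\<in>J. c j * avg (L \<nu>) (T \<nu> j)" and ?a = "avg (L \<nu>) (\<Delta> \<nu>)"
    let ?y = "avg (L \<nu>) (\<lambda>q. (\<Delta> \<nu> q - d * B \<nu>)\<^sup>2)"
    have "avg (L \<nu>) (\<lambda>q. (err c \<nu> q)\<^sup>2) = (?m / (?a * sqrt (n \<nu>)))\<^sup>2 * avg (L \<nu>) (\<lambda>q. (\<Delta> \<nu> q)\<^sup>2)"
      unfolding err_def power_mult_distrib avg_cmult ..
    also have "(?m / (?a * sqrt (n \<nu>)))\<^sup>2 = ?m\<^sup>2 / (?a\<^sup>2 * n \<nu>)"
      by (simp add: power_divide power_mult_distrib)
    also have "?m\<^sup>2 / (?a\<^sup>2 * n \<nu>) * avg (L \<nu>) (\<lambda>q. (\<Delta> \<nu> q)\<^sup>2) \<le> ?m\<^sup>2 / (?a\<^sup>2 * n \<nu>) * (2 * ?y + 2 * (d * B \<nu>)\<^sup>2)"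
    proof (rule mult_left_mono)
      have "(\<Delta> \<nu> q)\<^sup>2 \<le> 2 * (\<Delta> \<nu> q - d * B \<nu>)\<^sup>2 + 2 * (d * B \<nu>)\<^sup>2" for q
        using zero_le_power2[of "\<Delta> \<nu> q - 2 * (d * B \<nu>)"] by (simp add: power2_eq_square algebra_simps)
      from avg_mono[of "\<lambda>q. (\<Delta> \<nu> q)\<^sup>2", OF this, of "L \<nu>"] show "avg (L \<nu>) (\<lambda>q. (\<Delta> \<nu> q)\<^sup>2) \<le> 2 * ?y + 2 * (d * B \<nu>)\<^sup>2"
        by (simp only: avg_add avg_cmult avg_const[OF L_pos])
    qed simp
    finally have "k \<nu> * avg (L \<nu>) (\<lambda>q. (err c \<nu> q)\<^sup>2) \<le> k \<nu> * (?m\<^sup>2 / (?a\<^sup>2 * n \<nu>) * (2 * ?y + 2 * (d * B \<nu>)\<^sup>2))"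
      by (rule mult_left_mono) simp
    also have "\<dots> = ?R \<nu>"
    proof -
      have s: "(\<Sum>j\<in>J. c j * (avg (L \<nu>) (T \<nu> j) / sqrt (B \<nu>))) = ?m / sqrt (B \<nu>)"
        by (simp add: sum_divide_distrib)
      have y: "2 * (?y / (real (B \<nu>))\<^sup>2) + 2 * d\<^sup>2 = (2 * ?y + 2 * (d * B \<nu>)\<^sup>2) / (real (B \<nu>))\<^sup>2"
        using elim by (simp add: field_simps power_mult_distrib)
      show ?thesis unfolding s y using elim by (simp add: power_divide power_mult_distrib field_simps)
    qed
    finally show ?case .
  qed
qed simp

lemma tau_second_moment: "(\<lambda>\<nu>. k \<nu> * avg (L \<nu>) (\<lambda>q. (tau c \<nu> q)\<^sup>2)) \<longlonglongrightarrow> (\<Sum>i\<in>J. \<Sum>j\<in>J. c i * c j * Sg i j)"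
  unfolding tau_def by (rule avg_square_perturb[OF _ main_second_moment err_second_moment]) simp

text \<open>For \<open>main\<close> the Lindeberg condition is assumed coordinatewise; for
  \<open>err\<close> the second moment already vanishes.\<close>

lemma tau_lindeberg: "(\<lambda>\<nu>. k \<nu> * avg (L \<nu>) (\<lambda>q. mcs (tau c \<nu> q))) \<longlonglongrightarrow> 0"
proof (rule tendsto_sandwich[where f = "\<lambda>_. 0"])
  let ?g = "\<lambda>j. (max 1 \<bar>card J * c j\<bar>) ^ 3"
  let ?R = "\<lambda>\<nu>. 8 * (\<Sum>j\<in>J. ?g j * (k \<nu> * avg (L \<nu>) (\<lambda>q. mcs (T \<nu> j q / sqrt (n \<nu>))))) + 4 * (k \<nu> * avg (L \<nu>) (\<lambda>q. (err c \<nu> q)\<^sup>2))"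
  have "?R \<longlonglongrightarrow> 8 * (\<Sum>j\<in>J. ?g j * 0) + 4 * 0"
    by (intro tendsto_intros lind err_second_moment)
  then show "?R \<longlonglongrightarrow> 0" by simp
  show "\<forall>\<^sub>F \<nu> in sequentially. 0 \<le> k \<nu> * avg (L \<nu>) (\<lambda>q. mcs (tau c \<nu> q))"
    by (auto intro!: always_eventually mult_nonneg_nonneg avg_nonneg mcs_nonneg)
  show "\<forall>\<^sub>F \<nu> in sequentially. k \<nu> * avg (L \<nu>) (\<lambda>q. mcs (tau c \<nu> q)) \<le> ?R \<nu>"
  proof (intro always_eventually allI)
    fix \<nu>
    have pw: "mcs (tau c \<nu> q) \<le> 8 * (\<Sum>j\<in>J. ?g j * mcs (T \<nu> j q / sqrt (n \<nu>))) + 4 * (err c \<nu> q)\<^sup>2" for q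
    proof -
      have "mcs (main c \<nu> q) \<le> (\<Sum>j\<in>J. ?g j * mcs (T \<nu> j q / sqrt (n \<nu>)))"
        unfolding main_def by (rule mcs_sum_le[OF J])
      then show ?thesis using mcs_diff_le[of "main c \<nu> q" "err c \<nu> q"] unfolding tau_def by linarith
    qed
    have "k \<nu> * avg (L \<nu>) (\<lambda>q. mcs (tau c \<nu> q)) \<le> k \<nu> * avg (L \<nu>) (\<lambda>q. 8 * (\<Sum>j\<in>J. ?g j * mcs (T \<nu> j q / sqrt (n \<nu>))) + 4 * (err c \<nu> q)\<^sup>2)"
      by (intro mult_left_mono avg_mono pw) simp
    also have "\<dots> = ?R \<nu>"
      unfolding avg_add avg_cmult avg_sum by (simp add: algebra_simps sum_distrib_left)
    finally show "k \<nu> * avg (L \<nu>) (\<lambda>q. mcs (tau c \<nu> q)) \<le> ?R \<nu>" .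
  qed
qed simp

lemma tau_mean: "avg (L \<nu>) (\<Delta> \<nu>) \<noteq> 0 \<Longrightarrow> avg (L \<nu>) (tau c \<nu>) = 0"
proof -
  assume a: "avg (L \<nu>) (\<Delta> \<nu>) \<noteq> 0"
  have 1: "avg (L \<nu>) (main c \<nu>) = (\<Sum>j\<in>J. c j * avg (L \<nu>) (T \<nu> j)) / sqrt (n \<nu>)"
  proof -
    have "main c \<nu> = (\<lambda>q. \<Sum>j\<in>J. (c j / sqrt (n \<nu>)) * T \<nu> j q)" by (simp add: main_def fun_eq_iff)
    then show ?thesis by (simp only: avg_sum avg_cmult) (simp add: sum_divide_distrib)
  qed
  have 2: "avg (L \<nu>) (err c \<nu>) = (\<Sum>j\<in>J. c j * avg (L \<nu>) (T \<nu> j)) / sqrt (n \<nu>)"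
    unfolding err_def[abs_def] avg_cmult using a by simp
  show ?thesis unfolding tau_def[abs_def] avg_diff 1 2 by simp
qed

abbreviation starts :: "nat \<Rightarrow> (nat \<Rightarrow> nat) measure" where
  "starts \<nu> \<equiv> measure_pmf (block_starts (n \<nu>) (B \<nu>))"

definition root_error :: "nat \<Rightarrow> 'i \<Rightarrow> (nat \<Rightarrow> nat) \<Rightarrow> real" where
  "root_error \<nu> j I = sqrt (n \<nu>) *
    (ratio (bootstrap_sum (n \<nu>) (B \<nu>) I (X \<nu> j)) (bootstrap_sum (n \<nu>) (B \<nu>) I (D \<nu>))
     - ratio (\<integral>I. 1 / real (n \<nu>) * bootstrap_sum (n \<nu>) (B \<nu>) I (X \<nu> j) \<partial>starts \<nu>)
        (\<integral>I. 1 / real (n \<nu>) * bootstrap_sum (n \<nu>) (B \<nu>) I (D \<nu>) \<partial>starts \<nu>))"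

lemma tau_char:
  assumes \<sigma>: "\<sigma> = (\<Sum>i\<in>J. \<Sum>j\<in>J. c i * c j * Sg i j)"
  shows "(\<lambda>\<nu>. \<integral>I. iexp (\<Sum>q=1..k \<nu>. tau c \<nu> (I q)) \<partial>starts \<nu>) \<longlonglongrightarrow> complex_of_real (exp (- \<sigma> / 2))"
proof -
  have eq: "(\<lambda>\<nu>. \<integral>I. iexp (\<Sum>q=1..k \<nu>. tau c \<nu> (I q)) \<partial>starts \<nu>)
      = (\<lambda>\<nu>. ((\<Sum>i\<in>{1..L \<nu>}. iexp (tau c \<nu> i)) / card {1..L \<nu>}) ^ k \<nu>)"
    unfolding k_def L_def by (intro ext expectation_block_iexp)
  show ?thesis unfolding eq
  proof (rule power_char_tendsto)
    show "\<forall>\<^sub>F \<nu> in sequentially. (\<Sum>i\<in>{1..L \<nu>}. tau c \<nu> i) = 0"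
      using eventually_pos
    proof eventually_elim
      case (elim \<nu>)
      then have "avg (L \<nu>) (tau c \<nu>) = 0" by (intro tau_mean) auto
      then show ?case using L_pos[of \<nu>] by (simp add: avg_def)
    qed
    show "(\<lambda>\<nu>. k \<nu> / card {1..L \<nu>} * (\<Sum>i\<in>{1..L \<nu>}. (tau c \<nu> i)\<^sup>2)) \<longlonglongrightarrow> \<sigma>"
      using tau_second_moment[of c] by (simp add: avg_def \<sigma>)
    show "(\<lambda>\<nu>. k \<nu> / card {1..L \<nu>} * (\<Sum>i\<in>{1..L \<nu>}. min (\<bar>tau c \<nu> i\<bar> ^ 3) ((tau c \<nu> i)\<^sup>2))) \<longlonglongrightarrow> 0"
      using tau_lindeberg[of c] by (simp add: avg_def mcs_def)
  qed (auto simp: k L_pos Suc_le_eq)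
qed

lemma tau_linear: "finite J \<Longrightarrow> (\<Sum>j\<in>J. \<theta> j * tau (\<lambda>i. if i = j then a else 0) \<nu> q) = tau (\<lambda>j. \<theta> j * a) \<nu> q"
proof -
  assume J: "finite J"
  have d: "(\<Sum>i\<in>J. (if i = j then a else 0) * f i) = a * f j" if "j \<in> J" for j and f :: "'i \<Rightarrow> real"
    using J that by (simp add: if_distrib[of "\<lambda>x. x * _"] sum.delta cong: if_cong)
  have m: "main (\<lambda>i. if i = j then a else 0) \<nu> q = a * (T \<nu> j q / sqrt (n \<nu>))" if "j \<in> J" for j
    unfolding main_def by (rule d[OF that])
  have e: "err (\<lambda>i. if i = j then a else 0) \<nu> q = a * avg (L \<nu>) (T \<nu> j) / (avg (L \<nu>) (\<Delta> \<nu>) * sqrt (n \<nu>)) * \<Delta> \<nu> q" if "j \<in> J" for j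
    unfolding err_def by (simp only: d[OF that])
  have "(\<Sum>j\<in>J. \<theta> j * tau (\<lambda>i. if i = j then a else 0) \<nu> q)
      = (\<Sum>j\<in>J. \<theta> j * (a * (T \<nu> j q / sqrt (n \<nu>)) - a * avg (L \<nu>) (T \<nu> j) / (avg (L \<nu>) (\<Delta> \<nu>) * sqrt (n \<nu>)) * \<Delta> \<nu> q))"
    unfolding tau_def by (intro sum.cong refl) (simp only: m e)
  also have "\<dots> = tau (\<lambda>j. \<theta> j * a) \<nu> q"
    unfolding tau_def main_def err_def sum_divide_distrib sum_distrib_right sum_subtractf[symmetric]
    by (intro sum.cong refl) (simp add: algebra_simps)
  finally show ?thesis .
qed

text \<open>The difference of the two ratios has numerator
  \<open>t - (avg T / avg \<Delta>) * s\<close> over the random total \<open>s\<close>, which is a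
  sum of \<open>tau\<close> over the drawn blocks. \<open>char_ratio_tendsto\<close> replaces the
  random denominator by \<open>d\<close>.\<close>

theorem bootstrap_char_tendsto:
  "(\<lambda>\<nu>. \<integral>I. iexp (\<Sum>j\<in>J. \<theta> j * root_error \<nu> j I) \<partial>starts \<nu>)
    \<longlonglongrightarrow> complex_of_real (exp (- ((\<Sum>i\<in>J. \<Sum>j\<in>J. \<theta> i * \<theta> j * Sg i j) / d\<^sup>2) / 2))"
proof -
  define unit :: "'i \<Rightarrow> 'i \<Rightarrow> real" where "unit j = (\<lambda>i. if i = j then 1 else 0)" for j
  define num where "num \<nu> j I = (\<Sum>q=1..k \<nu>. tau (unit j) \<nu> (I q))" for \<nu> j I
  define den where "den \<nu> I = (\<Sum>q=1..k \<nu>. \<Delta> \<nu> (I q)) / n \<nu>" for \<nu> and I :: "nat \<Rightarrow> nat"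
  define C where "C = (\<Sum>j\<in>J. \<bar>Sg j j\<bar>) + 1"
  have unit_sum: "(\<Sum>i\<in>J. unit j i * f i) = f j" if "j \<in> J" for j f
    using J that by (simp add: unit_def if_distrib[of "\<lambda>x. x * _"] sum.delta cong: if_cong)
  have unit_Sg: "(\<Sum>i\<in>J. \<Sum>l\<in>J. unit j i * unit j l * Sg i l) = Sg j j" if "j \<in> J" for j
    using unit_sum[OF that] by (simp add: sum_distrib_left[symmetric] mult.assoc)
  have tau_unit: "tau (unit j) \<nu> q = (T \<nu> j q - avg (L \<nu>) (T \<nu> j) / avg (L \<nu>) (\<Delta> \<nu>) * \<Delta> \<nu> q) / sqrt (n \<nu>)" if "j \<in> J" for j \<nu> q
    unfolding tau_def main_def err_def unit_sum[OF that] by (simp add: diff_divide_distrib)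
  show ?thesis
  proof (rule char_ratio_tendsto[where num = num and den = den and d = d and C = C, OF measure_pmf.prob_space_axioms J])
    fix j assume j: "j \<in> J"
    have "(\<lambda>\<nu>. k \<nu> * avg (L \<nu>) (\<lambda>q. (tau (unit j) \<nu> q)\<^sup>2)) \<longlonglongrightarrow> Sg j j"
      using tau_second_moment[of "unit j"] unfolding unit_Sg[OF j] .
    moreover have "Sg j j < C"
      unfolding C_def using member_le_sum[of j J "\<lambda>j. \<bar>Sg j j\<bar>"] J j by fastforce
    ultimately have "\<forall>\<^sub>F \<nu> in sequentially. k \<nu> * avg (L \<nu>) (\<lambda>q. (tau (unit j) \<nu> q)\<^sup>2) < C"
      by (rule order_tendstoD)
    with eventually_pos show "\<forall>\<^sub>F \<nu> in sequentially. integrable (starts \<nu>) (\<lambda>I. (num \<nu> j I)\<^sup>2) \<and> (\<integral>I. (num \<nu> j I)\<^sup>2 \<partial>starts \<nu>) \<le> C"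
    proof eventually_elim
      case (elim \<nu>)
      have "avg (L \<nu>) (tau (unit j) \<nu>) = 0" using elim by (intro tau_mean) auto
      from expectation_block_sum_square[of "n \<nu>" "B \<nu>", folded k_def L_def, OF this[unfolded L_def]] elim(2)
      show ?case unfolding num_def by (auto simp: integrable_block_starts k_def L_def)
    qed
  next
    fix \<eta> :: real assume \<eta>: "0 < \<eta>"
    let ?bad = "\<lambda>\<nu>. {I \<in> space (starts \<nu>). \<bar>den \<nu> I - d\<bar> \<ge> \<eta>}"
    \<comment> \<open>A Chebyshev bound for the resampled denominator, arranged as a product of
      factors with known limits; 4 comes from the deviation \<open>\<eta> / 2\<close> that is left
      after the mean has been moved to \<open>d\<close>.\<close>
    let ?R = "\<lambda>\<nu>. (real (k \<nu>) * real (B \<nu>) / real (n \<nu>))\<^sup>2 * (avg (L \<nu>) (\<lambda>q. (\<Delta> \<nu> q - d * B \<nu>)\<^sup>2) / (real (B \<nu>))\<^sup>2) * (4 / \<eta>\<^sup>2)"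
    show "(\<lambda>\<nu>. measure (starts \<nu>) (?bad \<nu>)) \<longlonglongrightarrow> 0"
    proof (rule tendsto_sandwich[where f = "\<lambda>_. 0"])
      have "?R \<longlonglongrightarrow> 1\<^sup>2 * 0 * (4 / \<eta>\<^sup>2)" by (intro tendsto_intros kB \<Delta>_var)
      then show "?R \<longlonglongrightarrow> 0" by simp
      have "(\<lambda>\<nu>. (real (k \<nu>) * real (B \<nu>) / real (n \<nu>)) * (avg (L \<nu>) (\<Delta> \<nu>) / B \<nu>)) \<longlonglongrightarrow> 1 * d"
        by (intro tendsto_intros kB \<Delta>_mean)
      then have "\<forall>\<^sub>F \<nu> in sequentially. dist ((real (k \<nu>) * real (B \<nu>) / real (n \<nu>)) * (avg (L \<nu>) (\<Delta> \<nu>) / B \<nu>)) (1 * d) < \<eta> / 2"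
        using \<eta> by (intro tendstoD) auto
      with eventually_pos show "\<forall>\<^sub>F \<nu> in sequentially. measure (starts \<nu>) (?bad \<nu>) \<le> ?R \<nu>"
      proof eventually_elim
        case (elim \<nu>)
        let ?a = "avg (L \<nu>) (\<Delta> \<nu>)"
        define f where "f q = (\<Delta> \<nu> q - ?a) / n \<nu>" for q
        have m: "\<bar>k \<nu> * ?a / n \<nu> - d\<bar> < \<eta> / 2" using elim by (simp add: dist_real_def)
        have f0: "avg (L \<nu>) f = 0"
        proof -
          have "f = (\<lambda>q. 1 / n \<nu> * (\<Delta> \<nu> q - ?a))" by (simp add: f_def fun_eq_iff)
          then show ?thesis by (simp only: avg_cmult avg_diff avg_const[OF L_pos]) simp
        qed
        have den: "den \<nu> I = (\<Sum>q=1..k \<nu>. f (I q)) + k \<nu> * ?a / n \<nu>" for I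
          by (simp add: den_def f_def sum_subtractf sum_divide_distrib[symmetric] diff_divide_distrib)
        have "?bad \<nu> \<subseteq> {I. (\<eta> / 2)\<^sup>2 \<le> (\<Sum>q=1..k \<nu>. f (I q))\<^sup>2}"
        proof
          fix I assume "I \<in> ?bad \<nu>"
          then have "\<eta> \<le> \<bar>(\<Sum>q=1..k \<nu>. f (I q)) + k \<nu> * ?a / n \<nu> - d\<bar>" by (simp add: den)
          then have "\<bar>\<eta> / 2\<bar> \<le> \<bar>\<Sum>q=1..k \<nu>. f (I q)\<bar>" using m \<eta> by linarith
          then show "I \<in> {I. (\<eta> / 2)\<^sup>2 \<le> (\<Sum>q=1..k \<nu>. f (I q))\<^sup>2}"
            by (simp only: mem_Collect_eq abs_le_square_iff)
        qed
        then have "measure (starts \<nu>) (?bad \<nu>) \<le> measure (starts \<nu>) {I. (\<eta> / 2)\<^sup>2 \<le> (\<Sum>q=1..k \<nu>. f (I q))\<^sup>2}"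
          by (intro measure_pmf.finite_measure_mono) auto
        also have "\<dots> \<le> (\<integral>I. (\<Sum>q=1..k \<nu>. f (I q))\<^sup>2 \<partial>starts \<nu>) / (\<eta> / 2)\<^sup>2"
          using integral_Markov_inequality_measure[where A = UNIV and c = "(\<eta> / 2)\<^sup>2" and u = "\<lambda>I. (\<Sum>q=1..k \<nu>. f (I q))\<^sup>2",
              OF integrable_block_starts[of "n \<nu>" "B \<nu>"]] \<eta> by simp
        also have "\<dots> \<le> k \<nu> * (1 / (real (n \<nu>))\<^sup>2 * avg (L \<nu>) (\<lambda>q. (\<Delta> \<nu> q - d * B \<nu>)\<^sup>2)) / (\<eta> / 2)\<^sup>2"
        proof (rule divide_right_mono)
          have f2: "(\<lambda>q. (f q)\<^sup>2) = (\<lambda>q. 1 / (real (n \<nu>))\<^sup>2 * ((\<Delta> \<nu> q - d * B \<nu>)\<^sup>2 - 2 * (?a - d * B \<nu>) * (\<Delta> \<nu> q - d * B \<nu>) + (?a - d * B \<nu>)\<^sup>2))"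
          proof
            fix q
            have "(\<Delta> \<nu> q - ?a)\<^sup>2 = (\<Delta> \<nu> q - d * B \<nu>)\<^sup>2 - 2 * (?a - d * B \<nu>) * (\<Delta> \<nu> q - d * B \<nu>) + (?a - d * B \<nu>)\<^sup>2"
              by (simp add: power2_eq_square algebra_simps)
            then show "(f q)\<^sup>2 = 1 / (real (n \<nu>))\<^sup>2 * ((\<Delta> \<nu> q - d * B \<nu>)\<^sup>2 - 2 * (?a - d * B \<nu>) * (\<Delta> \<nu> q - d * B \<nu>) + (?a - d * B \<nu>)\<^sup>2)"
              by (simp add: f_def power_divide)
          qed
          \<comment> \<open>The mean square about the own average is at most the mean square about
            \<open>d * B\<close>, for which a limit is known.\<close>
          have "avg (L \<nu>) (\<lambda>q. (f q)\<^sup>2) = 1 / (real (n \<nu>))\<^sup>2 * (avg (L \<nu>) (\<lambda>q. (\<Delta> \<nu> q - d * B \<nu>)\<^sup>2) - (?a - d * B \<nu>)\<^sup>2)"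
            unfolding f2 avg_cmult avg_add avg_diff avg_const[OF L_pos] by (simp add: power2_eq_square algebra_simps)
          also have "\<dots> \<le> 1 / (real (n \<nu>))\<^sup>2 * avg (L \<nu>) (\<lambda>q. (\<Delta> \<nu> q - d * B \<nu>)\<^sup>2)"
            by (intro mult_left_mono) auto
          finally have "k \<nu> * avg (L \<nu>) (\<lambda>q. (f q)\<^sup>2) \<le> k \<nu> * (1 / (real (n \<nu>))\<^sup>2 * avg (L \<nu>) (\<lambda>q. (\<Delta> \<nu> q - d * B \<nu>)\<^sup>2))"
            by (rule mult_left_mono) simp
          then show "(\<integral>I. (\<Sum>q=1..k \<nu>. f (I q))\<^sup>2 \<partial>starts \<nu>) \<le> k \<nu> * (1 / (real (n \<nu>))\<^sup>2 * avg (L \<nu>) (\<lambda>q. (\<Delta> \<nu> q - d * B \<nu>)\<^sup>2))"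
            using expectation_block_sum_square[of "n \<nu>" "B \<nu>" f] f0 by (simp add: k_def L_def)
        qed simp
        \<comment> \<open>A further factor \<open>k \<nu> \<ge> 1\<close> is inserted so that the
          bound is expressed through the square of \<open>k * B / n\<close>, whose limit is
          1.\<close>
        also have "\<dots> \<le> real (k \<nu>) * (real (k \<nu>) * (1 / (real (n \<nu>))\<^sup>2 * avg (L \<nu>) (\<lambda>q. (\<Delta> \<nu> q - d * B \<nu>)\<^sup>2)) / (\<eta> / 2)\<^sup>2)"
        proof -
          let ?z = "real (k \<nu>) * (1 / (real (n \<nu>))\<^sup>2 * avg (L \<nu>) (\<lambda>q. (\<Delta> \<nu> q - d * B \<nu>)\<^sup>2)) / (\<eta> / 2)\<^sup>2"
          have "0 \<le> ?z" by (intro divide_nonneg_nonneg mult_nonneg_nonneg avg_nonneg) auto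
          then have "1 * ?z \<le> real (k \<nu>) * ?z" using elim(1) by (intro mult_right_mono) auto
          then show ?thesis by simp
        qed
        also have "\<dots> = ?R \<nu>" using elim \<eta> by (simp add: field_simps power2_eq_square)
        finally show ?case .
      qed
    qed auto
  next
    show "\<forall>\<^sub>F \<nu> in sequentially. \<forall>j\<in>J. \<forall>I\<in>space (starts \<nu>). den \<nu> I > 0 \<longrightarrow> root_error \<nu> j I = num \<nu> j I / den \<nu> I"
      using eventually_pos
    proof eventually_elim
      case (elim \<nu>)
      let ?a = "avg (L \<nu>) (\<Delta> \<nu>)"
      show ?case
      proof (intro ballI impI)
        fix j I assume j: "j \<in> J" and den: "den \<nu> I > 0"
        \<comment> \<open>Blockwise \<open>X\<close> is \<open>T\<close> plus \<open>h\<close> times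
          \<open>D\<close>, so \<open>h\<close> is added to both ratios and cancels in the
          root.\<close>
        have bX: "block_sum (X \<nu> j) (B \<nu>) q = T \<nu> j q + h j * \<Delta> \<nu> q" for q
          by (simp add: T_def \<Delta>_def block_sum_def sum_subtractf sum_distrib_left)
        have eD: "(\<integral>I. 1 / real (n \<nu>) * bootstrap_sum (n \<nu>) (B \<nu>) I (D \<nu>) \<partial>starts \<nu>) = k \<nu> * ?a / n \<nu>"
          unfolding bootstrap_sum_eq integral_mult_right_zero expectation_block_sum by (simp add: k_def L_def \<Delta>_def)
        have eX: "(\<integral>I. 1 / real (n \<nu>) * bootstrap_sum (n \<nu>) (B \<nu>) I (X \<nu> j) \<partial>starts \<nu>) = k \<nu> * (avg (L \<nu>) (T \<nu> j) + h j * ?a) / n \<nu>"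
        proof -
          have "avg (L \<nu>) (block_sum (X \<nu> j) (B \<nu>)) = avg (L \<nu>) (T \<nu> j) + h j * ?a"
            unfolding avg_cmult[symmetric] avg_add[symmetric] bX[symmetric] ..
          then show ?thesis
            unfolding bootstrap_sum_eq integral_mult_right_zero expectation_block_sum by (simp add: k_def L_def)
        qed
        define t s where "t = (\<Sum>q=1..k \<nu>. T \<nu> j (I q))" and "s = (\<Sum>q=1..k \<nu>. \<Delta> \<nu> (I q))"
        have bsD: "bootstrap_sum (n \<nu>) (B \<nu>) I (D \<nu>) = s"
          by (simp add: bootstrap_sum_eq s_def \<Delta>_def k_def)
        have bsX: "bootstrap_sum (n \<nu>) (B \<nu>) I (X \<nu> j) = t + h j * s"
          by (simp add: bootstrap_sum_eq bX t_def s_def k_def sum.distrib sum_distrib_left)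
        have s: "s \<noteq> 0" using den by (auto simp: den_def s_def)
        have num: "num \<nu> j I = (t - avg (L \<nu>) (T \<nu> j) / ?a * s) / sqrt (n \<nu>)"
          unfolding num_def tau_unit[OF j] t_def s_def
          by (simp add: sum_subtractf sum_distrib_left sum_divide_distrib[symmetric])
        have dn: "den \<nu> I = s / n \<nu>" by (simp add: den_def s_def)
        have e: "k \<nu> * ?a / n \<nu> \<noteq> 0" using elim by auto
        have "root_error \<nu> j I = sqrt (n \<nu>) * ((t + h j * s) / s - (avg (L \<nu>) (T \<nu> j) + h j * ?a) / ?a)"
          unfolding root_error_def bsD bsX eD eX ratio_def using s e elim by simp
        also have "\<dots> = sqrt (n \<nu>) * (t / s - avg (L \<nu>) (T \<nu> j) / ?a)"
          using s elim by (simp add: add_divide_distrib)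
        also have "\<dots> = num \<nu> j I / den \<nu> I"
        proof -
          have "r * (t / s - m / a) = (t - m / a * s) / r / (s / (r * r))" if "r \<noteq> 0" "a \<noteq> 0" for r m a :: real
            using that s by (simp add: field_simps)
          from this[of "sqrt (n \<nu>)" ?a "avg (L \<nu>) (T \<nu> j)"] show ?thesis
            unfolding num dn using elim by simp
        qed
        finally show "root_error \<nu> j I = num \<nu> j I / den \<nu> I" .
      qed
    qed
    have "(\<Sum>j\<in>J. \<theta> j * (num \<nu> j I / d)) = (\<Sum>q=1..k \<nu>. tau (\<lambda>j. \<theta> j / d) \<nu> (I q))" for \<nu> I
    proof -
      have "(\<Sum>j\<in>J. \<theta> j * (num \<nu> j I / d)) = (\<Sum>q=1..k \<nu>. (\<Sum>j\<in>J. \<theta> j / d * tau (unit j) \<nu> (I q)))"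
        unfolding num_def by (subst sum.swap) (simp add: sum_distrib_left sum_divide_distrib)
      also have "\<dots> = (\<Sum>q=1..k \<nu>. tau (\<lambda>j. \<theta> j / d) \<nu> (I q))"
        unfolding unit_def by (subst tau_linear[OF J]) simp
      finally show ?thesis .
    qed
    then show "(\<lambda>\<nu>. \<integral>I. iexp (\<Sum>j\<in>J. \<theta> j * (num \<nu> j I / d)) \<partial>starts \<nu>)
      \<longlonglongrightarrow> complex_of_real (exp (- ((\<Sum>i\<in>J. \<Sum>j\<in>J. \<theta> i * \<theta> j * Sg i j) / d\<^sup>2) / 2))"
      by (simp only:) (rule tau_char, simp add: sum_divide_distrib power2_eq_square)
  qed (use d in auto)
qed

end

section \<open>The queue\<close>

text \<open>Fatou's lemma for the squares. It allows infinite sums over customers or service lengths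
  to be estimated through their finite partial sums.\<close>

lemma (in prob_space) second_moment_limit:
  fixes r :: "nat \<Rightarrow> 'a \<Rightarrow> real"
  assumes [measurable]: "\<And>k. r k \<in> borel_measurable M" "R \<in> borel_measurable M"
    and i: "\<And>k. integrable M (\<lambda>\<omega>. (r k \<omega>)\<^sup>2)" and C: "\<And>k. expectation (\<lambda>\<omega>. (r k \<omega>)\<^sup>2) \<le> C"
    and lim: "AE \<omega> in M. (\<lambda>k. r k \<omega>) \<longlonglongrightarrow> R \<omega>"
  shows "integrable M (\<lambda>\<omega>. (R \<omega>)\<^sup>2)" "expectation (\<lambda>\<omega>. (R \<omega>)\<^sup>2) \<le> C"
proof -
  have C0: "0 \<le> C" using C[of 0] by (rule order_trans[rotated]) simp
  have "(\<integral>\<^sup>+\<omega>. ennreal ((R \<omega>)\<^sup>2) \<partial>M) = (\<integral>\<^sup>+\<omega>. liminf (\<lambda>k. ennreal ((r k \<omega>)\<^sup>2)) \<partial>M)"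
  proof (rule nn_integral_cong_AE)
    show "AE \<omega> in M. ennreal ((R \<omega>)\<^sup>2) = liminf (\<lambda>k. ennreal ((r k \<omega>)\<^sup>2))"
      using lim
    proof eventually_elim
      case (elim \<omega>)
      have "(\<lambda>k. ennreal ((r k \<omega>)\<^sup>2)) \<longlonglongrightarrow> ennreal ((R \<omega>)\<^sup>2)"
        by (intro tendsto_ennrealI tendsto_intros elim)
      then show ?case by (rule lim_imp_Liminf[OF trivial_limit_sequentially, symmetric])
    qed
  qed
  also have "\<dots> \<le> liminf (\<lambda>k. \<integral>\<^sup>+\<omega>. ennreal ((r k \<omega>)\<^sup>2) \<partial>M)"
    by (rule nn_integral_liminf) auto
  also have "\<dots> \<le> ennreal C"
  proof -
    have "(\<integral>\<^sup>+\<omega>. ennreal ((r k \<omega>)\<^sup>2) \<partial>M) \<le> ennreal C" for k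
      using C[of k] i[of k] by (subst nn_integral_eq_integral) (auto intro: ennreal_leI)
    then show ?thesis by (intro Liminf_le) (auto intro: always_eventually)
  qed
  finally have le: "(\<integral>\<^sup>+\<omega>. ennreal ((R \<omega>)\<^sup>2) \<partial>M) \<le> ennreal C" .
  then show i': "integrable M (\<lambda>\<omega>. (R \<omega>)\<^sup>2)"
    by (intro integrableI_bounded) (auto intro: le_less_trans)
  from le show "expectation (\<lambda>\<omega>. (R \<omega>)\<^sup>2) \<le> C"
    using C0 by (subst (asm) nn_integral_eq_integral[OF i']) auto
qed

text \<open>Cauchy-Schwarz with free weights \<open>q\<close>; summable weights make it possible to
  add infinitely many contributions in mean square.\<close>

lemma weighted_square_sum_le:
  fixes a q :: "'i \<Rightarrow> real"
  assumes q: "\<And>i. i \<in> I \<Longrightarrow> q i > 0"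
  shows "(\<Sum>i\<in>I. a i)\<^sup>2 \<le> (\<Sum>i\<in>I. q i) * (\<Sum>i\<in>I. (a i)\<^sup>2 / q i)"
proof -
  have "(\<Sum>i\<in>I. sqrt (q i) * (a i / sqrt (q i)))\<^sup>2 \<le> (\<Sum>i\<in>I. (sqrt (q i))\<^sup>2) * (\<Sum>i\<in>I. (a i / sqrt (q i))\<^sup>2)"
    by (rule Cauchy_Schwarz_ineq_sum)
  also have "(\<Sum>i\<in>I. sqrt (q i) * (a i / sqrt (q i))) = (\<Sum>i\<in>I. a i)"
    by (intro sum.cong refl) (use q in force)
  also have "(\<Sum>i\<in>I. (sqrt (q i))\<^sup>2) = (\<Sum>i\<in>I. q i)"
    by (intro sum.cong refl) (use q in \<open>auto intro: less_imp_le\<close>)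
  also have "(\<Sum>i\<in>I. (a i / sqrt (q i))\<^sup>2) = (\<Sum>i\<in>I. (a i)\<^sup>2 / q i)"
    by (intro sum.cong refl) (use q in \<open>auto simp: power_divide intro: less_imp_le\<close>)
  finally show ?thesis .
qed

context discrete_GI_G_infinity
begin

text \<open>The index \<open>l = 0\<close> carries no service time, so it can hold the number of
  arrivals of the slot; all inputs thus form one field.\<close>

definition input :: "int \<Rightarrow> nat \<Rightarrow> 'a \<Rightarrow> nat" where
  "input s l = (if l = 0 then A s else S s l)"

lemma A_measurable[measurable]: "A s \<in> measurable M (count_space UNIV)"
  using arrivals_indep unfolding indep_vars_def by auto

lemma S_measurable: "l \<ge> 1 \<Longrightarrow> S s l \<in> measurable M (count_space UNIV)"
  using service_indep[unfolded indep_vars_def, THEN conjunct1, rule_format, of "(s, l)"] by simp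

lemma input_measurable[measurable]: "input s l \<in> measurable M (count_space UNIV)"
  unfolding input_def by (cases "l = 0") (simp_all add: S_measurable)

text \<open>A finite set of indices splits into arrivals and services. Independence between the two
  families separates the two groups, and independence within each family factors the rest.\<close>

lemma input_indep: "indep_vars (\<lambda>_. count_space UNIV) (\<lambda>p. input (fst p) (snd p)) UNIV"
proof -
  let ?F = "\<lambda>p. {input (fst p) (snd p) -` B \<inter> space M |B. B \<in> sets (count_space UNIV)}"
  have "indep_sets ?F UNIV"
  proof (rule indep_setsI)
    show "?F p \<subseteq> events" for p by (auto intro: measurable_sets[OF input_measurable])
    fix E and J :: "(int \<times> nat) set"
    assume J: "finite J" and E: "\<forall>p\<in>J. E p \<in> ?F p"
    from E have "\<forall>p\<in>J. \<exists>B. E p = input (fst p) (snd p) -` B \<inter> space M" by blast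
    from bchoice[OF this] obtain Bs where Bs: "\<And>p. p \<in> J \<Longrightarrow> E p = input (fst p) (snd p) -` Bs p \<inter> space M"
      by blast
    define J0 where "J0 = {t. (t, 0) \<in> J}"
    define J1 where "J1 = {p\<in>J. snd p \<ge> 1}"
    have J_eq: "J = (\<lambda>t. (t, 0)) ` J0 \<union> J1"
    proof (intro set_eqI iffI)
      fix p assume "p \<in> J"
      then show "p \<in> (\<lambda>t. (t, 0)) ` J0 \<union> J1"
        by (cases p; cases "snd p = 0") (auto simp: J0_def J1_def)
    qed (auto simp: J0_def J1_def)
    have fin: "finite J0" "finite J1"
      using J finite_vimageI[OF J, of "\<lambda>t. (t, 0)"] by (auto simp: J0_def J1_def vimage_def inj_on_def)
    \<comment> \<open>Intersecting with the whole space makes the event certain when the group is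
      empty.\<close>
    define EA where "EA = space M \<inter> (\<Inter>t\<in>J0. A t -` Bs (t, 0) \<inter> space M)"
    define ES where "ES = space M \<inter> (\<Inter>p\<in>J1. S (fst p) (snd p) -` Bs p \<inter> space M)"
    have EA': "EA \<in> sets (vimage_algebra (space M) (\<lambda>\<omega> t. A t \<omega>) (\<Pi>\<^sub>M t\<in>UNIV. count_space UNIV))"
    proof -
      let ?P = "\<Pi>\<^sub>M t\<in>(UNIV :: int set). count_space (UNIV :: nat set)"
      let ?H = "{f \<in> space ?P. \<forall>t\<in>J0. f t \<in> Bs (t, 0)}"
      have "?H \<in> sets ?P"
      proof -
        have "(\<lambda>f. f t) \<in> measurable ?P (count_space UNIV)" for t
          by (rule measurable_component_singleton) simp
        then have "{f \<in> space ?P. f t \<in> Bs (t, 0)} \<in> sets ?P" for t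
          by (rule measurable_sets_Collect) simp
        then show ?thesis by (intro sets.sets_Collect_finite_All fin) auto
      qed
      from in_vimage_algebra[OF this, of "\<lambda>\<omega> t. A t \<omega>" "space M"]
      have "(\<lambda>\<omega> t. A t \<omega>) -` ?H \<inter> space M \<in> sets (vimage_algebra (space M) (\<lambda>\<omega> t. A t \<omega>) ?P)" .
      also have "(\<lambda>\<omega> t. A t \<omega>) -` ?H \<inter> space M = EA" by (auto simp: EA_def space_PiM)
      finally show ?thesis .
    qed
    have ES': "ES \<in> sets (vimage_algebra (space M) (\<lambda>\<omega>. \<lambda>(t, l)\<in>UNIV \<times> {1..}. S t l \<omega>) (\<Pi>\<^sub>M p\<in>UNIV \<times> {1..}. count_space UNIV))"
    proof -
      let ?P = "\<Pi>\<^sub>M p\<in>(UNIV :: int set) \<times> {1 :: nat..}. count_space (UNIV :: nat set)"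
      let ?H = "{f \<in> space ?P. \<forall>p\<in>J1. f p \<in> Bs p}"
      have "?H \<in> sets ?P"
      proof -
        have "{f \<in> space ?P. f p \<in> Bs p} \<in> sets ?P" if "p \<in> J1" for p
        proof (rule measurable_sets_Collect[where f = "\<lambda>f. f p" and N = "count_space UNIV" and P = "\<lambda>x. x \<in> Bs p"])
          show "(\<lambda>f. f p) \<in> measurable ?P (count_space UNIV)"
            using that by (intro measurable_component_singleton) (auto simp: J1_def mem_Times_iff)
        qed simp
        then show ?thesis by (intro sets.sets_Collect_finite_All fin) auto
      qed
      from in_vimage_algebra[OF this, of "\<lambda>\<omega>. \<lambda>(t, l)\<in>UNIV \<times> {1..}. S t l \<omega>" "space M"]
      have "(\<lambda>\<omega>. \<lambda>(t, l)\<in>UNIV \<times> {1..}. S t l \<omega>) -` ?H \<inter> space M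
        \<in> sets (vimage_algebra (space M) (\<lambda>\<omega>. \<lambda>(t, l)\<in>UNIV \<times> {1..}. S t l \<omega>) ?P)" .
      also have "(\<lambda>\<omega>. \<lambda>(t, l)\<in>UNIV \<times> {1..}. S t l \<omega>) -` ?H \<inter> space M = ES"
      proof -
        have "(\<lambda>(t, l)\<in>UNIV \<times> {1..}. S t l \<omega>) p = S (fst p) (snd p) \<omega>" if "p \<in> J1" for p \<omega>
          using that by (simp add: J1_def mem_Times_iff case_prod_unfold)
        then show ?thesis by (auto simp: ES_def space_PiM)
      qed
      finally show ?thesis .
    qed
    have pA: "prob EA = (\<Prod>t\<in>J0. prob (A t -` Bs (t, 0) \<inter> space M))"
    proof (cases "J0 = {}")
      case False
      have "EA = (\<Inter>t\<in>J0. A t -` Bs (t, 0) \<inter> space M)" using False by (auto simp: EA_def)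
      then show ?thesis using indep_varsD[OF arrivals_indep False fin(1), of "\<lambda>t. Bs (t, 0)"] by simp
    qed (simp add: EA_def prob_space)
    have pS: "prob ES = (\<Prod>p\<in>J1. prob (S (fst p) (snd p) -` Bs p \<inter> space M))"
    proof (cases "J1 = {}")
      case False
      have "ES = (\<Inter>p\<in>J1. S (fst p) (snd p) -` Bs p \<inter> space M)" using False by (auto simp: ES_def)
      moreover have "J1 \<subseteq> UNIV \<times> {1..}" by (auto simp: J1_def)
      ultimately show ?thesis using indep_varsD[OF service_indep False fin(2), of Bs] by (simp add: case_prod_unfold)
    qed (simp add: ES_def prob_space)
    assume ne: "J \<noteq> {}"
    have EA_E: "E (t, 0) = A t -` Bs (t, 0) \<inter> space M" if "t \<in> J0" for t
      using Bs[of "(t, 0)"] that by (simp add: J0_def input_def)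
    have ES_E: "E p = S (fst p) (snd p) -` Bs p \<inter> space M" if "p \<in> J1" for p
      using Bs[of p] that by (simp add: J1_def input_def)
    have EA_eq: "EA = space M \<inter> (\<Inter>t\<in>J0. E (t, 0))" and ES_eq: "ES = space M \<inter> (\<Inter>p\<in>J1. E p)"
      by (simp_all add: EA_def ES_def EA_E ES_E)
    have "(\<Inter>p\<in>J. E p) = EA \<inter> ES"
    proof -
      have "(\<Inter>p\<in>J. E p) = space M \<inter> (\<Inter>p\<in>J. E p)" using ne Bs by auto
      also have "\<dots> = EA \<inter> ES" unfolding EA_eq ES_eq by (subst J_eq) auto
      finally show ?thesis .
    qed
    then have "prob (\<Inter>p\<in>J. E p) = prob EA * prob ES"
      using indep_setD[OF arrivals_service_indep EA' ES'] by simp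
    also have "\<dots> = (\<Prod>t\<in>J0. prob (E (t, 0))) * (\<Prod>p\<in>J1. prob (E p))"
      unfolding pA pS using EA_E ES_E by simp
    also have "\<dots> = (\<Prod>p\<in>(\<lambda>t. (t, 0)) ` J0. prob (E p)) * (\<Prod>p\<in>J1. prob (E p))"
      by (subst prod.reindex) (auto simp: inj_on_def)
    also have "\<dots> = (\<Prod>p\<in>J. prob (E p))"
      by (subst J_eq, subst prod.union_disjoint) (use fin in \<open>auto simp: J1_def\<close>)
    finally show "prob (\<Inter>p\<in>J. E p) = (\<Prod>p\<in>J. prob (E p))" .
  qed
  then show ?thesis unfolding indep_vars_def2 by simp
qed

lemma service_prob: "l \<ge> 1 \<Longrightarrow> prob {\<omega> \<in> space M. S s l \<omega> = j} = (if j = 0 then 0 else G j - G (j - 1))"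
proof (cases j)
  case 0
  assume "l \<ge> 1"
  then have "S s l \<omega> \<noteq> 0" if "\<omega> \<in> space M" for \<omega>
    using service_pos[of l \<omega> s] that by simp
  then have "{\<omega> \<in> space M. S s l \<omega> = 0} = {}" by blast
  then show ?thesis by (simp only: 0 measure_empty if_True refl)
next
  case (Suc i)
  assume l: "l \<ge> 1"
  note [measurable] = S_measurable[OF l]
  have "prob {\<omega> \<in> space M. S s l \<omega> \<le> Suc i} = prob {\<omega> \<in> space M. S s l \<omega> \<le> i} + prob {\<omega> \<in> space M. S s l \<omega> = Suc i}"
    by (subst finite_measure_Union[symmetric]) (auto intro!: arg_cong[where f = prob])
  then show ?thesis using service_cdf[OF l] by (simp add: Suc)
qed

lemma input_ident: "distr M (count_space UNIV) (input s l) = distr M (count_space UNIV) (input 0 l)"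
proof (cases "l = 0")
  case False
  then have l: "l \<ge> 1" by simp
  note [measurable] = S_measurable[OF l]
  show ?thesis
  proof (rule measure_eqI_countable[of _ UNIV])
    fix j
    have "emeasure (distr M (count_space UNIV) (S s l)) {j} = ennreal (prob {\<omega> \<in> space M. S s l \<omega> = j})" for s
      by (subst emeasure_distr) (auto simp: emeasure_eq_measure vimage_def Int_def conj_commute)
    then show "emeasure (distr M (count_space UNIV) (input s l)) {j} = emeasure (distr M (count_space UNIV) (input 0 l)) {j}"
      using False l by (simp add: input_def service_prob)
  qed auto
qed (use arrivals_ident in \<open>simp add: input_def\<close>)

sublocale iid_slots M input "count_space UNIV"
  by unfold_locales (rule input_indep, rule input_ident)

end

lemma (in prob_space) AE_summable_of_expectation:
  fixes f :: "nat \<Rightarrow> 'a \<Rightarrow> real"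
  assumes f: "\<And>i. integrable M (f i)" "\<And>i \<omega>. 0 \<le> f i \<omega>" and s: "summable (\<lambda>i. expectation (f i))"
  shows "AE \<omega> in M. summable (\<lambda>i. f i \<omega>)"
proof -
  have [measurable]: "f i \<in> borel_measurable M" for i using f(1) by auto
  have "(\<integral>\<^sup>+\<omega>. (\<Sum>i. ennreal (f i \<omega>)) \<partial>M) = (\<Sum>i. \<integral>\<^sup>+\<omega>. ennreal (f i \<omega>) \<partial>M)"
    by (rule nn_integral_suminf) measurable
  also have "\<dots> = (\<Sum>i. ennreal (expectation (f i)))"
    using f by (simp add: nn_integral_eq_integral)
  also have "\<dots> = ennreal (\<Sum>i. expectation (f i))"
    using f s by (intro suminf_ennreal2) auto
  finally have "(\<integral>\<^sup>+\<omega>. (\<Sum>i. ennreal (f i \<omega>)) \<partial>M) \<noteq> \<infinity>" by simp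
  then have "AE \<omega> in M. (\<Sum>i. ennreal (f i \<omega>)) \<noteq> \<infinity>"
    by (intro nn_integral_PInf_AE) measurable
  then show ?thesis
    by eventually_elim (use f in \<open>auto intro: summable_suminf_not_top\<close>)
qed

lemma measurable_sum_upto_countable:
  fixes f :: "nat \<Rightarrow> 'a \<Rightarrow> real"
  assumes f: "\<And>l. l > lo \<Longrightarrow> f l \<in> borel_measurable M" and a: "a \<in> measurable M (count_space UNIV)"
  shows "(\<lambda>\<omega>. \<Sum>l\<in>{lo<..a \<omega>}. f l \<omega>) \<in> borel_measurable M"
  using f by (intro measurable_compose_countable[OF _ a, of "\<lambda>k \<omega>. \<Sum>l\<in>{lo<..k}. f l \<omega>"] borel_measurable_sum) auto

section \<open>Customers of one slot with a given service time\<close>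

context discrete_GI_G_infinity
begin

definition svc :: "nat \<Rightarrow> real" where
  "svc j = (if j = 0 then 0 else G j - G (j - 1))"

lemma svc_eq_prob: "l \<ge> 1 \<Longrightarrow> svc j = prob {\<omega> \<in> space M. S s l \<omega> = j}"
  by (simp add: svc_def service_prob)

lemma svc_nonneg: "0 \<le> svc j"
  using svc_eq_prob[of 1 j 0] by simp

lemma G_le_1: "G i \<le> 1" and G_nonneg: "0 \<le> G i"
  using service_cdf[of 1 0 i] by (auto simp flip: service_cdf[of 1 0 i])

lemma svc_le_tail: "svc (Suc i) \<le> 1 - G i"
  using G_le_1[of "Suc i"] by (simp add: svc_def)

lemma svc_sums_le: "(\<Sum>i<n. svc (Suc i)) \<le> 1"
proof -
  have "(\<Sum>i<n. svc (Suc i)) = G n - G 0"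
    unfolding svc_def by (simp add: sum_lessThan_telescope)
  then show ?thesis using G_le_1[of n] G_nonneg[of 0] by linarith
qed

lemma summable_svc: "summable (\<lambda>i. svc (Suc i))"
  by (rule summableI_nonneg_bounded[of _ 1]) (auto simp: svc_nonneg svc_sums_le)

text \<open>With \<open>lo = 0\<close> all customers of slot \<open>s\<close> count; with
  \<open>lo = m\<close> only those beyond the first \<open>m\<close>, which is the part lost when
  the number of arrivals is truncated at \<open>m\<close>.\<close>

definition served :: "nat \<Rightarrow> nat \<Rightarrow> int \<Rightarrow> 'a \<Rightarrow> real" where
  "served lo j s \<omega> = (\<Sum>l\<in>{lo<..A s \<omega>}. of_bool (S s l \<omega> = j))"

definition served_config :: "nat \<Rightarrow> nat \<Rightarrow> int \<Rightarrow> (int \<times> nat \<Rightarrow> nat) \<Rightarrow> real" where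
  "served_config lo j r c = (\<Sum>l\<in>{lo<..c (r, 0)}. of_bool (c (r, l) = j))"

lemma served_eq_config: "served lo j s \<omega> = served_config lo j (s - t) (config t \<omega>)"
  unfolding served_def served_config_def config_def
  by (intro sum.cong) (auto simp: input_def)

lemma config_component[measurable]: "(\<lambda>c. c p) \<in> measurable (PiM UNIV (\<lambda>_. count_space UNIV)) (count_space UNIV)"
  by (rule measurable_component_singleton) simp

lemma served_config_measurable[measurable]:
  "served_config lo j r \<in> borel_measurable (PiM UNIV (\<lambda>_. count_space UNIV))"
  unfolding served_config_def by (rule measurable_sum_upto_countable) measurable

lemma served_slots: "served lo j s \<in> borel_measurable (slots {s})"
proof -
  have [measurable]: "input s l \<in> measurable (slots {s}) (count_space UNIV)" for l
    by (rule X_measurable_slots) simp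
  have "(\<lambda>\<omega>. \<Sum>l\<in>{lo<..input s 0 \<omega>}. of_bool (input s l \<omega> = j) :: real) \<in> borel_measurable (slots {s})"
    by (rule measurable_sum_upto_countable) measurable
  also have "(\<lambda>\<omega>. \<Sum>l\<in>{lo<..input s 0 \<omega>}. of_bool (input s l \<omega> = j) :: real) = served lo j s"
    unfolding served_def by (intro ext sum.cong) (auto simp: input_def)
  finally show ?thesis .
qed

lemma served_measurable[measurable]: "served lo j s \<in> borel_measurable M"
  by (rule measurable_slots[OF served_slots])

lemma served_nonneg: "0 \<le> served lo j s \<omega>"
  unfolding served_def by (intro sum_nonneg) auto

text \<open>A count is at most its square, so the second moment bound also bounds the mean.\<close>

lemma served_le_square: "served lo j s \<omega> \<le> (served lo j s \<omega>)\<^sup>2"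
proof -
  have "served lo j s \<omega> = of_nat (\<Sum>l\<in>{lo<..A s \<omega>}. of_bool (S s l \<omega> = j))"
    by (simp add: served_def)
  then obtain k :: nat where k: "served lo j s \<omega> = real k" by blast
  have "k \<le> k\<^sup>2" by (simp add: power2_eq_square)
  then have "real k \<le> real (k\<^sup>2)" by (simp only: of_nat_le_iff)
  then show ?thesis by (simp add: k)
qed

lemma expectation_A: "(\<integral>\<omega>. f (A s \<omega>) \<partial>M) = (\<integral>\<omega>. f (A 0 \<omega>) \<partial>M)" for f :: "nat \<Rightarrow> real"
proof -
  have "(\<integral>\<omega>. f (A s \<omega>) \<partial>M) = integral\<^sup>L (distr M (count_space UNIV) (A s)) f" for s
    by (subst integral_distr) auto
  then show ?thesis using arrivals_ident[of s] by simp
qed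

lemma A_compose: "(\<lambda>\<omega>. f (A s \<omega>)) \<in> borel_measurable M" for f :: "nat \<Rightarrow> real"
  by (rule measurable_compose[OF A_measurable]) simp

lemma integrable_A: "integrable M (\<lambda>\<omega>. f (A s \<omega>)) \<longleftrightarrow> integrable M (\<lambda>\<omega>. f (A 0 \<omega>))" for f :: "nat \<Rightarrow> real"
proof -
  have "integrable M (\<lambda>\<omega>. f (A s \<omega>)) \<longleftrightarrow> integrable (distr M (count_space UNIV) (A s)) f" for s
    by (subst integrable_distr_eq) auto
  then show ?thesis using arrivals_ident[of s] by simp
qed

lemma arrival_service_indep:
  fixes f h :: "nat \<Rightarrow> real"
  assumes l: "l \<ge> 1" and f: "integrable M (\<lambda>\<omega>. f (A s \<omega>))" and h: "integrable M (\<lambda>\<omega>. h (S s l \<omega>))"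
  shows "integrable M (\<lambda>\<omega>. f (A s \<omega>) * h (S s l \<omega>))"
    "expectation (\<lambda>\<omega>. f (A s \<omega>) * h (S s l \<omega>)) = expectation (\<lambda>\<omega>. f (A s \<omega>)) * expectation (\<lambda>\<omega>. h (S s l \<omega>))"
proof -
  have "indep_vars (\<lambda>_. count_space UNIV) (\<lambda>b. (\<lambda>p. input (fst p) (snd p)) (case_bool (s, 0) (s, l) b)) UNIV"
    using l by (intro indep_vars_inj_reindex[OF input_indep]) (auto simp: inj_on_def split: bool.splits)
  then have "indep_vars (\<lambda>_. borel) (\<lambda>b \<omega>. (case_bool f h b) (input (fst (case_bool (s, 0) (s, l) b)) (snd (case_bool (s, 0) (s, l) b)) \<omega>)) UNIV"
    by (rule indep_vars_compose2) auto
  moreover have "(\<lambda>b \<omega>. (case_bool f h b) (input (fst (case_bool (s, 0) (s, l) b)) (snd (case_bool (s, 0) (s, l) b)) \<omega>))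
      = case_bool (\<lambda>\<omega>. f (A s \<omega>)) (\<lambda>\<omega>. h (S s l \<omega>))"
    "(\<lambda>_. borel) = case_bool borel (borel :: real measure)"
    using l by (auto simp: fun_eq_iff input_def split: bool.splits)
  ultimately have i: "indep_var borel (\<lambda>\<omega>. f (A s \<omega>)) borel (\<lambda>\<omega>. h (S s l \<omega>))"
    unfolding indep_var_def by simp
  show "integrable M (\<lambda>\<omega>. f (A s \<omega>) * h (S s l \<omega>))"
    "expectation (\<lambda>\<omega>. f (A s \<omega>) * h (S s l \<omega>)) = expectation (\<lambda>\<omega>. f (A s \<omega>)) * expectation (\<lambda>\<omega>. h (S s l \<omega>))"
    using indep_var_integrable[OF i f h] indep_var_lebesgue_integral[OF i f h] by auto
qed

lemma expectation_service: "l \<ge> 1 \<Longrightarrow> expectation (\<lambda>\<omega>. of_bool (S s l \<omega> = j)) = svc j"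
  "l \<ge> 1 \<Longrightarrow> integrable M (\<lambda>\<omega>. of_bool (S s l \<omega> = j) :: real)"
proof -
  assume l: "l \<ge> 1"
  note [measurable] = S_measurable[OF l]
  have e: "(of_bool (S s l \<omega> = j) :: real) = indicator {\<omega> \<in> space M. S s l \<omega> = j} \<omega>" if "\<omega> \<in> space M" for \<omega>
    using that by (simp add: indicator_def)
  show "integrable M (\<lambda>\<omega>. of_bool (S s l \<omega> = j) :: real)"
    by (rule integrable_const_bound[where B = 1]) auto
  have "expectation (\<lambda>\<omega>. of_bool (S s l \<omega> = j)) = expectation (indicator {\<omega> \<in> space M. S s l \<omega> = j})"
    using e by (intro Bochner_Integration.integral_cong) auto
  also have "\<dots> = svc j" unfolding svc_eq_prob[OF l, of j s] by simp
  finally show "expectation (\<lambda>\<omega>. of_bool (S s l \<omega> = j)) = svc j" .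
qed

definition A2_tail :: "nat \<Rightarrow> real" where
  "A2_tail lo = expectation (\<lambda>\<omega>. (real (A 0 \<omega>))\<^sup>2 * of_bool (A 0 \<omega> > lo))"

context
  assumes moment2: "integrable M (\<lambda>\<omega>. (real (A 0 \<omega>))\<^sup>2)"
begin

lemma integrable_A2_tail: "integrable M (\<lambda>\<omega>. (real (A s \<omega>))\<^sup>2 * of_bool (A s \<omega> > lo))"
proof -
  have "integrable M (\<lambda>\<omega>. (real (A 0 \<omega>))\<^sup>2 * of_bool (A 0 \<omega> > lo))"
    by (rule Bochner_Integration.integrable_bound[OF moment2 A_compose[of "\<lambda>a. (real a)\<^sup>2 * of_bool (a > lo)"]]) auto
  then show ?thesis using integrable_A[of "\<lambda>a. (real a)\<^sup>2 * of_bool (a > lo)" s] by simp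
qed

lemma A2_tail_nonneg: "0 \<le> A2_tail lo"
  unfolding A2_tail_def by (intro integral_nonneg_AE) auto

lemma A2_tail_tendsto: "A2_tail \<longlonglongrightarrow> 0"
proof -
  have "(\<lambda>lo. expectation (\<lambda>\<omega>. (real (A 0 \<omega>))\<^sup>2 * of_bool (A 0 \<omega> > lo))) \<longlonglongrightarrow> expectation (\<lambda>\<omega>. 0)"
  proof (rule integral_dominated_convergence[OF _ _ moment2])
    show "AE \<omega> in M. (\<lambda>lo. (real (A 0 \<omega>))\<^sup>2 * of_bool (A 0 \<omega> > lo)) \<longlonglongrightarrow> 0"
    proof (intro AE_I2)
      fix \<omega>
      have "\<forall>\<^sub>F lo in sequentially. (real (A 0 \<omega>))\<^sup>2 * of_bool (A 0 \<omega> > lo) = 0"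
        by (rule eventually_sequentiallyI[of "A 0 \<omega>"]) auto
      then show "(\<lambda>lo. (real (A 0 \<omega>))\<^sup>2 * of_bool (A 0 \<omega> > lo)) \<longlonglongrightarrow> 0"
        by (rule tendsto_eventually)
    qed
    show "(\<lambda>\<omega>. (real (A 0 \<omega>))\<^sup>2 * of_bool (A 0 \<omega> > lo)) \<in> borel_measurable M" for lo
      by (rule A_compose[of "\<lambda>a. (real a)\<^sup>2 * of_bool (a > lo)"])
  qed auto
  then show ?thesis by (simp add: A2_tail_def[abs_def])
qed

text \<open>Only one of the two factors of the square is bounded by the number of arrivals. The
  other stays a sum of service indicators, which are independent of the arrivals and contribute the
  factor \<open>svc j\<close>; this factor later makes the sum over service lengths
  converge.\<close>

lemma served_second_moment:
  "integrable M (\<lambda>\<omega>. (served lo j s \<omega>)\<^sup>2)" "expectation (\<lambda>\<omega>. (served lo j s \<omega>)\<^sup>2) \<le> svc j * A2_tail lo"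
proof -
  \<comment> \<open>The random upper limit is replaced by the fixed \<open>L\<close>, with the
    condition \<open>l \<le> A s \<omega>\<close> moved into the summand, so that expectation and
    sum can be exchanged; \<open>L\<close> tends to infinity at the end.\<close>
  define r where "r L \<omega> = (\<Sum>l\<in>{lo<..L}. of_bool (l \<le> A s \<omega>) * of_bool (S s l \<omega> = j) :: real)" for L \<omega>
  have r_meas: "r L \<in> borel_measurable M" for L
    unfolding r_def[abs_def]
  proof (rule borel_measurable_sum)
    fix l assume "l \<in> {lo<..L}"
    then have "l \<ge> 1" by auto
    note [measurable] = S_measurable[OF this]
    show "(\<lambda>\<omega>. of_bool (l \<le> A s \<omega>) * of_bool (S s l \<omega> = j) :: real) \<in> borel_measurable M" by measurable
  qed
  have r0: "0 \<le> r L \<omega>" for L \<omega> unfolding r_def by (intro sum_nonneg) auto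
  have count: "(\<Sum>l\<in>{lo<..L}. of_bool (l \<le> a) :: real) \<le> real a * of_bool (a > lo)" for L a :: nat
  proof -
    have "(\<Sum>l\<in>{lo<..L}. of_bool (l \<le> a) :: real) = card ({lo<..L} \<inter> {..a})"
      by (simp add: sum_of_bool_eq atMost_def)
    also have "{lo<..L} \<inter> {..a} \<subseteq> {lo<..a}" by auto
    then have "real (card ({lo<..L} \<inter> {..a})) \<le> real (card {lo<..a})" by (intro of_nat_mono card_mono) auto
    also have "\<dots> \<le> real a * of_bool (a > lo)" by auto
    finally show ?thesis .
  qed
  have r_le: "r L \<omega> \<le> A s \<omega>" for L \<omega>
  proof -
    have "r L \<omega> \<le> (\<Sum>l\<in>{lo<..L}. of_bool (l \<le> A s \<omega>))"
      unfolding r_def by (intro sum_mono) auto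
    also have "\<dots> \<le> real (A s \<omega>) * of_bool (A s \<omega> > lo)" by (rule count)
    also have "\<dots> \<le> A s \<omega>" by auto
    finally show ?thesis .
  qed
  have iA2: "integrable M (\<lambda>\<omega>. (real (A s \<omega>))\<^sup>2)" using moment2 integrable_A[of "\<lambda>a. (real a)\<^sup>2" s] by simp
  have ir: "integrable M (\<lambda>\<omega>. (r L \<omega>)\<^sup>2)" for L
  proof (rule Bochner_Integration.integrable_bound[OF iA2])
    show "AE \<omega> in M. norm ((r L \<omega>)\<^sup>2) \<le> norm ((real (A s \<omega>))\<^sup>2)"
      using power_mono[OF r_le r0, of _ _ 2] by (intro AE_I2) auto
  qed (use r_meas in measurable)
  have iAl: "integrable M (\<lambda>\<omega>. real (A s \<omega>) * of_bool (l \<le> A s \<omega>))" for l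
    by (rule Bochner_Integration.integrable_bound[OF iA2 A_compose[of "\<lambda>a. real a * of_bool (l \<le> a)"]])
      (auto simp: power2_eq_square le_square intro!: AE_I2 simp flip: of_nat_mult)
  have E: "expectation (\<lambda>\<omega>. (r L \<omega>)\<^sup>2) \<le> svc j * A2_tail lo" for L
  proof -
    have i1: "integrable M (\<lambda>\<omega>. (real (A s \<omega>) * of_bool (l \<le> A s \<omega>)) * of_bool (S s l \<omega> = j))"
      and e1: "expectation (\<lambda>\<omega>. (real (A s \<omega>) * of_bool (l \<le> A s \<omega>)) * of_bool (S s l \<omega> = j))
        = expectation (\<lambda>\<omega>. real (A s \<omega>) * of_bool (l \<le> A s \<omega>)) * svc j" if "l \<in> {lo<..L}" for l
      using that arrival_service_indep[of l "\<lambda>a. real a * of_bool (l \<le> a)" s "\<lambda>x. of_bool (x = j)"] iAl[of l] expectation_service[of l s j]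
      by auto
    have "expectation (\<lambda>\<omega>. (r L \<omega>)\<^sup>2) \<le> expectation (\<lambda>\<omega>. \<Sum>l\<in>{lo<..L}. (real (A s \<omega>) * of_bool (l \<le> A s \<omega>)) * of_bool (S s l \<omega> = j))"
    proof (rule integral_mono[OF ir])
      show "integrable M (\<lambda>\<omega>. \<Sum>l\<in>{lo<..L}. (real (A s \<omega>) * of_bool (l \<le> A s \<omega>)) * of_bool (S s l \<omega> = j))"
        using i1 by (rule Bochner_Integration.integrable_sum)
      fix \<omega>
      have "(r L \<omega>)\<^sup>2 \<le> real (A s \<omega>) * r L \<omega>"
        unfolding power2_eq_square by (intro mult_right_mono r_le r0)
      then show "(r L \<omega>)\<^sup>2 \<le> (\<Sum>l\<in>{lo<..L}. (real (A s \<omega>) * of_bool (l \<le> A s \<omega>)) * of_bool (S s l \<omega> = j))"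
        by (simp only: r_def sum_distrib_left mult.assoc)
    qed
    also have "\<dots> = (\<Sum>l\<in>{lo<..L}. expectation (\<lambda>\<omega>. real (A s \<omega>) * of_bool (l \<le> A s \<omega>))) * svc j"
      using i1 e1 by (subst Bochner_Integration.integral_sum) (auto simp: sum_distrib_right)
    also have "(\<Sum>l\<in>{lo<..L}. expectation (\<lambda>\<omega>. real (A s \<omega>) * of_bool (l \<le> A s \<omega>)))
        = expectation (\<lambda>\<omega>. \<Sum>l\<in>{lo<..L}. real (A s \<omega>) * of_bool (l \<le> A s \<omega>))"
      by (rule Bochner_Integration.integral_sum[OF iAl, symmetric])
    also have "\<dots> * svc j \<le> expectation (\<lambda>\<omega>. (real (A s \<omega>))\<^sup>2 * of_bool (A s \<omega> > lo)) * svc j"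
    proof (intro mult_right_mono svc_nonneg integral_mono integrable_A2_tail Bochner_Integration.integrable_sum iAl)
      fix \<omega>
      show "(\<Sum>l\<in>{lo<..L}. real (A s \<omega>) * of_bool (l \<le> A s \<omega>)) \<le> (real (A s \<omega>))\<^sup>2 * of_bool (A s \<omega> > lo)"
        using mult_left_mono[OF count[of "A s \<omega>" L] of_nat_0_le_iff[of "A s \<omega>"]]
        by (simp only: sum_distrib_left power2_eq_square mult.assoc)
    qed
    also have "\<dots> = svc j * A2_tail lo"
      using expectation_A[of "\<lambda>a. (real a)\<^sup>2 * of_bool (a > lo)" s] by (simp add: A2_tail_def mult.commute)
    finally show ?thesis .
  qed
  have lim: "AE \<omega> in M. (\<lambda>L. r L \<omega>) \<longlonglongrightarrow> served lo j s \<omega>"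
  proof (intro AE_I2)
    fix \<omega>
    have "\<forall>\<^sub>F L in sequentially. r L \<omega> = served lo j s \<omega>"
    proof (rule eventually_sequentiallyI[of "A s \<omega>"])
      fix L assume L: "A s \<omega> \<le> L"
      have "r L \<omega> = (\<Sum>l\<in>{lo<..A s \<omega>}. of_bool (l \<le> A s \<omega>) * of_bool (S s l \<omega> = j))"
        unfolding r_def using L by (intro sum.mono_neutral_right) auto
      then show "r L \<omega> = served lo j s \<omega>" by (simp add: served_def)
    qed
    then show "(\<lambda>L. r L \<omega>) \<longlonglongrightarrow> served lo j s \<omega>" by (rule tendsto_eventually)
  qed
  show "integrable M (\<lambda>\<omega>. (served lo j s \<omega>)\<^sup>2)" "expectation (\<lambda>\<omega>. (served lo j s \<omega>)\<^sup>2) \<le> svc j * A2_tail lo"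
    using second_moment_limit[OF r_meas served_measurable ir E lim] by auto
qed

lemma served_integrable: "integrable M (served lo j s)"
  by (rule square_integrable_imp_integrable[OF _ served_second_moment(1)]) auto

lemma served_expectation: "expectation (served lo j s) \<le> svc j * A2_tail lo"
  using integral_mono[OF served_integrable served_second_moment(1) served_le_square, of lo j s] served_second_moment(2)[of lo j s]
  by simp

lemma AE_summable_served: "AE \<omega> in M. summable (\<lambda>i. served 0 (Suc i) (t - int (Suc i)) \<omega>)"
proof (rule AE_summable_of_expectation)
  show "summable (\<lambda>i. expectation (served 0 (Suc i) (t - int (Suc i))))"
  proof (rule summable_comparison_test'[of "\<lambda>i. svc (Suc i) * A2_tail 0"])
    show "summable (\<lambda>i. svc (Suc i) * A2_tail 0)" by (intro summable_mult2 summable_svc)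
    show "norm (expectation (served 0 (Suc i) (t - int (Suc i)))) \<le> svc (Suc i) * A2_tail 0" for i
      using served_expectation[of 0 "Suc i" "t - int (Suc i)"] served_nonneg
      by (simp add: integral_nonneg_AE)
  qed
qed (auto simp: served_integrable served_nonneg)

end


text \<open>Bounded stationary weights that read only the \<open>b\<close> slots strictly before
  \<open>t\<close>, as do the indicators of a recent arrival.\<close>

definition window :: "nat \<Rightarrow> real \<Rightarrow> (int \<Rightarrow> 'a \<Rightarrow> real) \<Rightarrow> bool" where
  "window b K w \<longleftrightarrow> (\<forall>t. w t \<in> borel_measurable (slots {t - int b..t - 1}))
    \<and> (\<forall>t. \<forall>\<omega>\<in>space M. \<bar>w t \<omega>\<bar> \<le> K)
    \<and> (\<exists>f\<in>borel_measurable (PiM UNIV (\<lambda>_. count_space UNIV)). \<forall>t. \<forall>\<omega>\<in>space M. w t \<omega> = f (config t \<omega>))"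

definition departures_config :: "(int \<times> nat \<Rightarrow> nat) \<Rightarrow> real" where
  "departures_config c = (\<Sum>i. served_config 0 (Suc i) (- int (Suc i)) c)"

lemma departures_eq: "departures A S t \<omega> = (\<Sum>i. served 0 (Suc i) (t - int (Suc i)) \<omega>)"
proof -
  have "{0<..k} = {1..k}" for k :: nat by auto
  then show ?thesis by (simp add: departures_def served_def)
qed

lemma departures_eq_config: "departures A S t \<omega> = departures_config (config t \<omega>)"
  unfolding departures_eq departures_config_def served_eq_config[of _ _ _ _ t] by simp

lemma departures_config_measurable[measurable]:
  "departures_config \<in> borel_measurable (PiM UNIV (\<lambda>_. count_space UNIV))"
  unfolding departures_config_def[abs_def] by (intro borel_measurable_suminf served_config_measurable)

lemma departures_measurable[measurable]: "departures A S t \<in> borel_measurable M"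
  unfolding departures_eq_config[abs_def] by (rule measurable_compose[OF config_measurable departures_config_measurable])

text \<open>Two terms can be correlated only if their times differ by a difference of two offsets.
  What matters is the number of offsets, not how far they are spread.\<close>

lemma slots_dependence_card:
  fixes Of T :: "int set" and Y :: "int \<Rightarrow> 'a \<Rightarrow> real"
  assumes Y: "\<And>t. Y t \<in> borel_measurable (slots ((\<lambda>r. t + r) ` Of))" and Of: "finite Of"
    and int: "\<And>t. integrable M (Y t)" and 0: "\<And>t. expectation (Y t) = 0"
  shows "card {s \<in> T. expectation (\<lambda>\<omega>. Y t \<omega> * Y s \<omega>) \<noteq> 0} \<le> card Of * card Of"
proof -
  have "{s \<in> T. expectation (\<lambda>\<omega>. Y t \<omega> * Y s \<omega>) \<noteq> 0} \<subseteq> (\<lambda>(r, r'). t + r - r') ` (Of \<times> Of)"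
  proof
    fix s assume "s \<in> {s \<in> T. expectation (\<lambda>\<omega>. Y t \<omega> * Y s \<omega>) \<noteq> 0}"
    then have "expectation (\<lambda>\<omega>. Y t \<omega> * Y s \<omega>) \<noteq> 0" by simp
    then have "((\<lambda>r. t + r) ` Of) \<inter> ((\<lambda>r. s + r) ` Of) \<noteq> {}"
      using slots_uncorrelated[OF _ Y Y int int] 0 by blast
    then obtain r r' where "r \<in> Of" "r' \<in> Of" "t + r = s + r'" by auto
    then show "s \<in> (\<lambda>(r, r'). t + r - r') ` (Of \<times> Of)"
      by (intro image_eqI[of _ _ "(r, r')"]) auto
  qed
  then have "card {s \<in> T. expectation (\<lambda>\<omega>. Y t \<omega> * Y s \<omega>) \<noteq> 0} \<le> card ((\<lambda>(r, r'). t + r - r') ` (Of \<times> Of))"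
    using Of by (intro card_mono) auto
  also have "\<dots> \<le> card (Of \<times> Of)" using Of by (intro card_image_le) auto
  finally show ?thesis by (simp add: card_cartesian_product)
qed

section \<open>Weighted departures and their truncation\<close>

context
  fixes b :: nat and K :: real and w :: "int \<Rightarrow> 'a \<Rightarrow> real"
  assumes moment2: "integrable M (\<lambda>\<omega>. (real (A 0 \<omega>))\<^sup>2)" and w: "window b K w"
begin

lemma w_slots: "w t \<in> borel_measurable (slots {t - int b..t - 1})"
  using w by (simp add: window_def)

lemma w_measurable[measurable]: "w t \<in> borel_measurable M"
  by (rule measurable_slots[OF w_slots])

lemma w_bound: "\<omega> \<in> space M \<Longrightarrow> \<bar>w t \<omega>\<bar> \<le> K"
  using w by (simp add: window_def)

lemma w_K: "0 \<le> K"
  using not_empty w_bound[of _ 0] by fastforce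

definition summand :: "nat \<Rightarrow> nat \<Rightarrow> int \<Rightarrow> 'a \<Rightarrow> real" where
  "summand lo i t \<omega> = w t \<omega> * served lo (Suc i) (t - int (Suc i)) \<omega>"

lemma summand_measurable[measurable]: "summand lo i t \<in> borel_measurable M"
  unfolding summand_def[abs_def] by measurable

lemma summand_second_moment:
  "integrable M (\<lambda>\<omega>. (summand lo i t \<omega>)\<^sup>2)" "expectation (\<lambda>\<omega>. (summand lo i t \<omega>)\<^sup>2) \<le> K\<^sup>2 * (svc (Suc i) * A2_tail lo)"
proof -
  let ?s = "served lo (Suc i) (t - int (Suc i))"
  have isq: "integrable M (\<lambda>\<omega>. K\<^sup>2 * (?s \<omega>)\<^sup>2)" by (intro integrable_mult_right served_second_moment(1)[OF moment2])
  have le: "(summand lo i t \<omega>)\<^sup>2 \<le> K\<^sup>2 * (?s \<omega>)\<^sup>2" if "\<omega> \<in> space M" for \<omega>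
    unfolding summand_def power_mult_distrib using power_mono[OF w_bound[OF that, of t] abs_ge_zero, of 2]
    by (intro mult_right_mono) auto
  show i: "integrable M (\<lambda>\<omega>. (summand lo i t \<omega>)\<^sup>2)"
    using le by (intro Bochner_Integration.integrable_bound[OF isq]) (auto intro!: AE_I2)
  have "expectation (\<lambda>\<omega>. (summand lo i t \<omega>)\<^sup>2) \<le> expectation (\<lambda>\<omega>. K\<^sup>2 * (?s \<omega>)\<^sup>2)"
    by (rule integral_mono[OF i isq le])
  also have "\<dots> \<le> K\<^sup>2 * (svc (Suc i) * A2_tail lo)"
    using served_second_moment(2)[OF moment2, of lo "Suc i" "t - int (Suc i)"] by (simp add: mult_left_mono)
  finally show "expectation (\<lambda>\<omega>. (summand lo i t \<omega>)\<^sup>2) \<le> K\<^sup>2 * (svc (Suc i) * A2_tail lo)" .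
qed

lemma summand_integrable: "integrable M (summand lo i t)"
  by (rule square_integrable_imp_integrable[OF _ summand_second_moment(1)]) auto

lemma summand_expectation: "expectation (summand lo i t) = expectation (summand lo i 0)"
proof -
  obtain f where f[measurable]: "f \<in> borel_measurable (PiM UNIV (\<lambda>_. count_space UNIV))"
    and wf: "\<And>t \<omega>. \<omega> \<in> space M \<Longrightarrow> w t \<omega> = f (config t \<omega>)"
    using w by (auto simp: window_def)
  define g where "g c = f c * served_config lo (Suc i) (- int (Suc i)) c" for c
  have g: "g \<in> borel_measurable (PiM UNIV (\<lambda>_. count_space UNIV))" unfolding g_def by measurable
  have "expectation (summand lo i t) = expectation (\<lambda>\<omega>. g (config t \<omega>))" for t
    by (intro Bochner_Integration.integral_cong) (auto simp: summand_def g_def wf served_eq_config[of _ _ _ _ t])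
  then show ?thesis using expectation_config[OF g, of t] by simp
qed

definition centered :: "nat \<Rightarrow> nat \<Rightarrow> int \<Rightarrow> 'a \<Rightarrow> real" where
  "centered lo i t \<omega> = summand lo i t \<omega> - expectation (summand lo i 0)"

lemma centered_measurable[measurable]: "centered lo i t \<in> borel_measurable M"
  unfolding centered_def[abs_def] by measurable

lemma centered_second_moment:
  "integrable M (\<lambda>\<omega>. (centered lo i t \<omega>)\<^sup>2)" "expectation (\<lambda>\<omega>. (centered lo i t \<omega>)\<^sup>2) \<le> K\<^sup>2 * (svc (Suc i) * A2_tail lo)"
  and centered_integrable: "integrable M (centered lo i t)"
  and centered_mean: "expectation (centered lo i t) = 0"
proof -
  let ?\<mu> = "expectation (summand lo i 0)"
  note isq = summand_integrable[of lo i t] summand_second_moment(1)[of lo i t]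
  have eq: "(centered lo i t \<omega>)\<^sup>2 = (summand lo i t \<omega>)\<^sup>2 - 2 * ?\<mu> * summand lo i t \<omega> + ?\<mu>\<^sup>2" for \<omega>
    by (simp add: centered_def power2_diff)
  show "integrable M (\<lambda>\<omega>. (centered lo i t \<omega>)\<^sup>2)" unfolding eq using isq by simp
  show "integrable M (centered lo i t)" unfolding centered_def[abs_def] using isq by simp
  show "expectation (centered lo i t) = 0"
    unfolding centered_def[abs_def] using isq summand_expectation[of lo i t] by (simp add: prob_space)
  have "expectation (\<lambda>\<omega>. (centered lo i t \<omega>)\<^sup>2) = expectation (\<lambda>\<omega>. (summand lo i t \<omega>)\<^sup>2) - ?\<mu>\<^sup>2"
    unfolding eq using isq summand_expectation[of lo i t] by (simp add: prob_space power2_eq_square)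
  also have "\<dots> \<le> K\<^sup>2 * (svc (Suc i) * A2_tail lo)"
    using summand_second_moment(2)[of lo i t] zero_le_power2[of ?\<mu>] by linarith
  finally show "expectation (\<lambda>\<omega>. (centered lo i t \<omega>)\<^sup>2) \<le> K\<^sup>2 * (svc (Suc i) * A2_tail lo)" .
qed

text \<open>For one service length the term at \<open>t\<close> reads the \<open>b\<close> slots of
  the weight and the single arrival slot \<open>t - (i + 1)\<close>. That makes at most
  \<open>1 + b\<close> slots whatever \<open>i\<close> is, so the constant does not grow with the
  service length.\<close>

lemma centered_sum_second_moment:
  fixes T :: "int set"
  assumes T: "finite T"
  shows "integrable M (\<lambda>\<omega>. (\<Sum>t\<in>T. centered lo i t \<omega>)\<^sup>2)"
    and "expectation (\<lambda>\<omega>. (\<Sum>t\<in>T. centered lo i t \<omega>)\<^sup>2) \<le> card T * ((1 + real b)\<^sup>2 * (K\<^sup>2 * (svc (Suc i) * A2_tail lo)))"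
proof -
  define Of where "Of = insert (- int (Suc i)) {- int b..- 1}"
  have Of: "finite Of" "card Of \<le> 1 + b" unfolding Of_def
    by (auto intro!: order_trans[OF card_insert_le_m1[of "1 + b"]])
  have sl: "centered lo i t \<in> borel_measurable (slots ((\<lambda>r. t + r) ` Of))" for t
  proof -
    have "{t - int b..t - 1} \<subseteq> (\<lambda>r. t + r) ` Of"
    proof
      fix u assume "u \<in> {t - int b..t - 1}"
      then show "u \<in> (\<lambda>r. t + r) ` Of" by (intro image_eqI[of _ _ "u - t"]) (auto simp: Of_def)
    qed
    from slots_mono[OF this w_slots] have [measurable]: "w t \<in> borel_measurable (slots ((\<lambda>r. t + r) ` Of))" .
    have "{t - int (Suc i)} \<subseteq> (\<lambda>r. t + r) ` Of" by (auto simp: Of_def)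
    from slots_mono[OF this served_slots]
    have [measurable]: "served lo (Suc i) (t - int (Suc i)) \<in> borel_measurable (slots ((\<lambda>r. t + r) ` Of))" .
    show ?thesis unfolding centered_def[abs_def] summand_def[abs_def] by measurable
  qed
  have card: "card {s \<in> T. expectation (\<lambda>\<omega>. centered lo i t \<omega> * centered lo i s \<omega>) \<noteq> 0} \<le> (1 + b) * (1 + b)" for t
    by (rule order_trans[OF slots_dependence_card[OF sl Of(1) centered_integrable centered_mean]])
      (intro mult_mono Of(2), auto)
  note * = second_moment_sum_le[OF T centered_measurable centered_second_moment card]
  show "integrable M (\<lambda>\<omega>. (\<Sum>t\<in>T. centered lo i t \<omega>)\<^sup>2)" by (rule *(1))
  show "expectation (\<lambda>\<omega>. (\<Sum>t\<in>T. centered lo i t \<omega>)\<^sup>2) \<le> card T * ((1 + real b)\<^sup>2 * (K\<^sup>2 * (svc (Suc i) * A2_tail lo)))"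
    using *(2) by (simp only: of_nat_mult of_nat_add of_nat_1 power2_eq_square mult.assoc)
qed

lemma AE_summable_summand: "AE \<omega> in M. summable (\<lambda>i. norm (summand (f i) i t \<omega>))"
  and summable_norm_summand: "summable (\<lambda>i. expectation (\<lambda>\<omega>. norm (summand (f i) i t \<omega>)))"
proof -
  have mono: "A2_tail lo \<le> A2_tail 0" for lo
    unfolding A2_tail_def using integrable_A2_tail[OF moment2, of 0] by (intro integral_mono) auto
  have b: "expectation (\<lambda>\<omega>. norm (summand (f i) i t \<omega>)) \<le> K * A2_tail 0 * svc (Suc i)" for i
  proof -
    let ?s = "served (f i) (Suc i) (t - int (Suc i))"
    have "expectation (\<lambda>\<omega>. norm (summand (f i) i t \<omega>)) \<le> expectation (\<lambda>\<omega>. K * ?s \<omega>)"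
    proof (rule integral_mono)
      show "integrable M (\<lambda>\<omega>. norm (summand (f i) i t \<omega>))" by (intro integrable_norm summand_integrable)
      show "integrable M (\<lambda>\<omega>. K * ?s \<omega>)" by (intro integrable_mult_right served_integrable[OF moment2])
      fix \<omega> assume "\<omega> \<in> space M"
      then show "norm (summand (f i) i t \<omega>) \<le> K * ?s \<omega>"
        unfolding summand_def real_norm_def abs_mult abs_of_nonneg[OF served_nonneg]
        by (intro mult_right_mono w_bound served_nonneg)
    qed
    also have "\<dots> \<le> K * (svc (Suc i) * A2_tail (f i))"
      using served_expectation[OF moment2, of "f i" "Suc i"] w_K by (simp add: mult_left_mono)
    also have "\<dots> \<le> K * (svc (Suc i) * A2_tail 0)"
      using w_K svc_nonneg mono by (intro mult_left_mono) auto
    finally show ?thesis by (simp add: mult_ac)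
  qed
  show 1: "summable (\<lambda>i. expectation (\<lambda>\<omega>. norm (summand (f i) i t \<omega>)))"
  proof (rule summable_comparison_test')
    show "summable (\<lambda>i. K * A2_tail 0 * svc (Suc i))" by (intro summable_mult summable_svc)
    show "norm (expectation (\<lambda>\<omega>. norm (summand (f i) i t \<omega>))) \<le> K * A2_tail 0 * svc (Suc i)" for i
      using b[of i] by (simp add: integral_nonneg_AE)
  qed
  show "AE \<omega> in M. summable (\<lambda>i. norm (summand (f i) i t \<omega>))"
    by (rule AE_summable_of_expectation[OF _ _ 1]) (auto intro: summand_integrable)
qed

definition weighted :: "int \<Rightarrow> 'a \<Rightarrow> real" where
  "weighted t \<omega> = w t \<omega> * departures A S t \<omega>"

lemma weighted_measurable[measurable]: "weighted t \<in> borel_measurable M"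
  unfolding weighted_def[abs_def] by measurable

lemma weighted_sums: "AE \<omega> in M. (\<lambda>i. summand 0 i t \<omega>) sums weighted t \<omega>"
  using AE_summable_served[OF moment2, of t]
proof eventually_elim
  case (elim \<omega>)
  from sums_mult[OF summable_sums[OF elim], of "w t \<omega>"] show ?case
    by (simp add: summand_def weighted_def departures_eq)
qed

lemma weighted_integrable: "integrable M (weighted t)"
  and weighted_expectation_sums: "(\<lambda>i. expectation (summand 0 i t)) sums expectation (weighted t)"
proof -
  have i: "integrable M (\<lambda>\<omega>. \<Sum>i. summand 0 i t \<omega>)"
    by (rule integrable_suminf[OF summand_integrable AE_summable_summand summable_norm_summand])
  have s: "(\<lambda>i. expectation (summand 0 i t)) sums expectation (\<lambda>\<omega>. \<Sum>i. summand 0 i t \<omega>)"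
    by (rule sums_integral[OF summand_integrable AE_summable_summand summable_norm_summand])
  have eq: "AE \<omega> in M. (\<Sum>i. summand 0 i t \<omega>) = weighted t \<omega>"
    using weighted_sums[of t] by eventually_elim (simp add: sums_iff)
  show "integrable M (weighted t)"
    using i integrable_cong_AE[OF _ _ eq] by auto
  show "(\<lambda>i. expectation (summand 0 i t)) sums expectation (weighted t)"
    using s integral_cong_AE[OF _ _ eq] by auto
qed

lemma weighted_expectation: "expectation (weighted t) = expectation (weighted 0)"
  using weighted_expectation_sums[of t] weighted_expectation_sums[of 0] summand_expectation[of 0 _ t]
  by (simp add: sums_iff)

text \<open>Only service times up to \<open>m\<close> and the first \<open>m\<close> customers of
  each slot are kept, which makes the process bounded and finitely dependent.\<close>

definition truncated :: "nat \<Rightarrow> int \<Rightarrow> 'a \<Rightarrow> real" where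
  "truncated m t \<omega> = w t \<omega> * (\<Sum>i<m. served 0 (Suc i) (t - int (Suc i)) \<omega> - served m (Suc i) (t - int (Suc i)) \<omega>)"

lemma served_diff_bounds: "0 \<le> served 0 j s \<omega> - served m j s \<omega>" "served 0 j s \<omega> - served m j s \<omega> \<le> m"
proof -
  have "served 0 j s \<omega> - served m j s \<omega> = (\<Sum>l\<in>{0<..min (A s \<omega>) m}. of_bool (S s l \<omega> = j))"
  proof (cases "A s \<omega> \<le> m")
    case False
    then have "{0<..A s \<omega>} = {0<..m} \<union> {m<..A s \<omega>}" by auto
    then have "served 0 j s \<omega> = (\<Sum>l\<in>{0<..m}. of_bool (S s l \<omega> = j)) + served m j s \<omega>"
      unfolding served_def by (simp only:) (rule sum.union_disjoint, auto)
    then show ?thesis using False by (simp add: min_def)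
  qed (simp add: served_def min_def)
  moreover have "(\<Sum>l\<in>{0<..min (A s \<omega>) m}. of_bool (S s l \<omega> = j)) \<le> real (card {0<..min (A s \<omega>) m}) * 1"
    by (rule sum_bounded_above) auto
  moreover have "0 \<le> (\<Sum>l\<in>{0<..min (A s \<omega>) m}. of_bool (S s l \<omega> = j) :: real)" by (intro sum_nonneg) auto
  ultimately show "0 \<le> served 0 j s \<omega> - served m j s \<omega>" "served 0 j s \<omega> - served m j s \<omega> \<le> m" by auto
qed

lemma truncated_bound: "\<omega> \<in> space M \<Longrightarrow> \<bar>truncated m t \<omega>\<bar> \<le> K * (real m * real m)"
proof -
  assume \<omega>: "\<omega> \<in> space M"
  let ?x = "\<Sum>i<m. served 0 (Suc i) (t - int (Suc i)) \<omega> - served m (Suc i) (t - int (Suc i)) \<omega>"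
  have "?x \<le> real (card {..<m}) * m" by (rule sum_bounded_above) (rule served_diff_bounds)
  moreover have "0 \<le> ?x" by (intro sum_nonneg served_diff_bounds)
  ultimately have "\<bar>?x\<bar> \<le> real m * real m" by simp
  then show ?thesis unfolding truncated_def abs_mult by (intro mult_mono w_bound \<omega> w_K) auto
qed

lemma truncated_moving_block:
  "moving_block (m + b) (2 * (K * (real m * real m))) (\<lambda>t \<omega>. truncated m t \<omega> - expectation (truncated m 0))"
proof -
  obtain f where f[measurable]: "f \<in> borel_measurable (PiM UNIV (\<lambda>_. count_space UNIV))"
    and wf: "\<And>t \<omega>. \<omega> \<in> space M \<Longrightarrow> w t \<omega> = f (config t \<omega>)"
    using w by (auto simp: window_def)
  define g where "g c = f c * (\<Sum>i<m. served_config 0 (Suc i) (- int (Suc i)) c - served_config m (Suc i) (- int (Suc i)) c)" for c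
  have g[measurable]: "g \<in> borel_measurable (PiM UNIV (\<lambda>_. count_space UNIV))" unfolding g_def by measurable
  have tg: "truncated m t \<omega> = g (config t \<omega>)" if "\<omega> \<in> space M" for t \<omega>
    using that by (simp add: truncated_def g_def wf served_eq_config[of _ _ _ _ t])
  have sl: "truncated m t \<in> borel_measurable (slots {t - int (m + b)..t})" for t
  proof -
    have "served lo (Suc i) (t - int (Suc i)) \<in> borel_measurable (slots {t - int (m + b)..t})" if "i \<in> {..<m}" for i lo
      using that by (intro slots_mono[OF _ served_slots]) auto
    moreover have "w t \<in> borel_measurable (slots {t - int (m + b)..t})" by (rule slots_mono[OF _ w_slots]) auto
    ultimately show ?thesis
      unfolding truncated_def[abs_def] by (intro borel_measurable_times borel_measurable_sum borel_measurable_diff)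
  qed
  have mt[measurable]: "truncated m t \<in> borel_measurable M" for t by (rule measurable_slots[OF sl])
  have it: "integrable M (truncated m t)" for t
    using truncated_bound by (intro integrable_const_bound[where B = "K * (real m * real m)"]) auto
  have et: "expectation (truncated m t) = expectation (truncated m 0)" for t
  proof -
    have "expectation (truncated m t) = expectation (\<lambda>\<omega>. g (config t \<omega>))" for t
      by (intro Bochner_Integration.integral_cong) (auto simp: tg)
    then show ?thesis using expectation_config[OF g, of t] by simp
  qed
  have eb: "\<bar>expectation (truncated m 0)\<bar> \<le> K * (real m * real m)"
  proof -
    have "\<bar>expectation (truncated m 0)\<bar> \<le> expectation (\<lambda>\<omega>. \<bar>truncated m 0 \<omega>\<bar>)" by (rule integral_abs_bound)
    also have "\<dots> \<le> expectation (\<lambda>\<omega>. K * (real m * real m))"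
      using it truncated_bound by (intro integral_mono) auto
    finally show ?thesis by (simp add: prob_space)
  qed
  show ?thesis unfolding moving_block_def
  proof (intro conjI allI ballI bexI[of _ "\<lambda>c. g c - expectation (truncated m 0)"])
    show "(\<lambda>\<omega>. truncated m t \<omega> - expectation (truncated m 0)) \<in> borel_measurable (slots {t - int (m + b)..t})" for t
      using sl[of t] by measurable
    show "\<bar>truncated m t \<omega> - expectation (truncated m 0)\<bar> \<le> 2 * (K * (real m * real m))" if "\<omega> \<in> space M" for t \<omega>
      using truncated_bound[OF that, of m t] eb by linarith
    show "expectation (\<lambda>\<omega>. truncated m t \<omega> - expectation (truncated m 0)) = 0" for t
      using it[of t] et[of t] by (simp add: prob_space)
    show "truncated m t \<omega> - expectation (truncated m 0) = g (config t \<omega>) - expectation (truncated m 0)" if "\<omega> \<in> space M" for t \<omega>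
      using tg[OF that] by simp
  qed measurable
qed

text \<open>Writes the truncation remainder as one series: for \<open>i < m\<close> the customers
  beyond the first \<open>m\<close> are left over, for later \<open>i\<close> all customers.\<close>

definition cutoff :: "nat \<Rightarrow> nat \<Rightarrow> nat" where
  "cutoff m i = (if i < m then m else 0)"

lemma remainder_sums:
  "AE \<omega> in M. (\<lambda>i. summand (cutoff m i) i t \<omega>) sums (weighted t \<omega> - truncated m t \<omega>)"
  "(\<lambda>i. expectation (summand (cutoff m i) i t)) sums (expectation (weighted t) - expectation (truncated m t))"
proof -
  let ?h = "\<lambda>i \<omega>. w t \<omega> * (served 0 (Suc i) (t - int (Suc i)) \<omega> - served m (Suc i) (t - int (Suc i)) \<omega>)"
  have h: "summand 0 i t \<omega> - (if i < m then ?h i \<omega> else 0) = summand (cutoff m i) i t \<omega>" for i \<omega>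
    by (simp add: summand_def cutoff_def right_diff_distrib)
  have fin: "(\<lambda>i. if i < m then f i else 0) sums (\<Sum>i<m. f i)" for f :: "nat \<Rightarrow> real"
    using sums_If_finite_set[of "{..<m}" f] by simp
  show "AE \<omega> in M. (\<lambda>i. summand (cutoff m i) i t \<omega>) sums (weighted t \<omega> - truncated m t \<omega>)"
    using weighted_sums[of t]
  proof eventually_elim
    case (elim \<omega>)
    have "(\<lambda>i. summand 0 i t \<omega> - (if i < m then ?h i \<omega> else 0)) sums (weighted t \<omega> - (\<Sum>i<m. ?h i \<omega>))"
      by (intro sums_diff elim fin)
    then show ?case unfolding h by (simp only: truncated_def sum_distrib_left)
  qed
  have ih: "integrable M (?h i)" for i
    using Bochner_Integration.integrable_diff[OF summand_integrable[of 0 i t] summand_integrable[of m i t]]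
    by (simp add: summand_def right_diff_distrib)
  have eh: "expectation (?h i) = expectation (summand 0 i t) - expectation (summand m i t)" for i
    using Bochner_Integration.integral_diff[OF summand_integrable[of 0 i t] summand_integrable[of m i t]]
    by (simp add: summand_def right_diff_distrib)
  have et: "expectation (truncated m t) = (\<Sum>i<m. expectation (?h i))"
    unfolding truncated_def[abs_def] sum_distrib_left by (rule Bochner_Integration.integral_sum[OF ih])
  have "(\<lambda>i. expectation (summand 0 i t) - (if i < m then expectation (?h i) else 0)) sums (expectation (weighted t) - (\<Sum>i<m. expectation (?h i)))"
    by (intro sums_diff weighted_expectation_sums fin)
  moreover have "expectation (summand 0 i t) - (if i < m then expectation (?h i) else 0) = expectation (summand (cutoff m i) i t)" for i
  proof (cases "i < m")
    case True
    show ?thesis unfolding cutoff_def if_P[OF True] eh by simp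
  next
    case False
    show ?thesis unfolding cutoff_def if_not_P[OF False] by simp
  qed
  ultimately show "(\<lambda>i. expectation (summand (cutoff m i) i t)) sums (expectation (weighted t) - expectation (truncated m t))"
    unfolding et by simp
qed

text \<open>A single null set serves all times, so that the series can be added over a range of
  times.\<close>

lemma centered_sums:
  "AE \<omega> in M. \<forall>t. (\<lambda>i. centered (cutoff m i) i t \<omega>) sums
    ((weighted t \<omega> - expectation (weighted 0)) - (truncated m t \<omega> - expectation (truncated m 0)))"
  unfolding AE_all_countable
proof
  fix t
  show "AE \<omega> in M. (\<lambda>i. centered (cutoff m i) i t \<omega>) sums
    ((weighted t \<omega> - expectation (weighted 0)) - (truncated m t \<omega> - expectation (truncated m 0)))"
    using remainder_sums(1)[of m t]
  proof eventually_elim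
    case (elim \<omega>)
    from sums_diff[OF elim remainder_sums(2)[of m 0]] show ?case
      by (simp add: centered_def algebra_simps)
  qed
qed

context
  assumes service_tail: "summable (\<lambda>n. sqrt (1 - G (Suc n)))"
begin

text \<open>The geometric term keeps the weight positive where \<open>G i = 1\<close>. Since
  \<open>svc (Suc i)\<close> is at most \<open>1 - G i\<close>, dividing it by \<open>wt i\<close>
  leaves at most \<open>wt i\<close>, which is still summable.\<close>

definition wt :: "nat \<Rightarrow> real" where
  "wt i = sqrt (1 - G i) + (1 / 2) ^ i"

lemma wt_pos: "wt i > 0"
  using G_le_1[of i] by (auto simp: wt_def intro: add_nonneg_pos)

lemma summable_wt: "summable wt"
proof -
  have "summable (\<lambda>n. sqrt (1 - G n))" using service_tail summable_Suc_iff[of "\<lambda>n. sqrt (1 - G n)"] by blast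
  then show ?thesis unfolding wt_def[abs_def] by (intro summable_add summable_geometric) auto
qed

lemma svc_le_wt: "svc (Suc i) / wt i \<le> wt i"
proof -
  have "svc (Suc i) \<le> (sqrt (1 - G i))\<^sup>2" using svc_le_tail[of i] G_le_1[of i] by simp
  also have "\<dots> \<le> (wt i)\<^sup>2" unfolding wt_def using G_le_1[of i] by (intro power_mono) auto
  finally show ?thesis using wt_pos[of i] by (simp add: divide_le_eq power2_eq_square)
qed

text \<open>For each service length the second moment is of order \<open>n * svc (Suc i)\<close>.
  Weighted Cauchy-Schwarz over the service lengths turns this into the sum of
  \<open>svc (Suc i) / wt i\<close>, finite by the choice of \<open>wt\<close>. The bound is first
  proved for partial series and passes to the limit by Fatou's lemma.\<close>

lemma psum_remainder:
  defines "Y \<equiv> \<lambda>t \<omega>. weighted t \<omega> - expectation (weighted 0)"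
    and "Z \<equiv> \<lambda>m t \<omega>. truncated m t \<omega> - expectation (truncated m 0)"
  shows "integrable M (\<lambda>\<omega>. (psum Y a n \<omega> - psum (Z m) a n \<omega>)\<^sup>2)"
    and "expectation (\<lambda>\<omega>. (psum Y a n \<omega> - psum (Z m) a n \<omega>)\<^sup>2)
      \<le> suminf wt * ((1 + real b)\<^sup>2 * K\<^sup>2) * (suminf wt * A2_tail m + (suminf wt - (\<Sum>i<m. wt i)) * A2_tail 0) * n"
proof -
  let ?Q = "suminf wt" and ?c = "(1 + real b)\<^sup>2 * K\<^sup>2"
  define T where "T = {a<..a + int n}"
  have T: "finite T" "card T = n" by (auto simp: T_def)
  define V where "V i \<omega> = (\<Sum>t\<in>T. centered (cutoff m i) i t \<omega>)" for i \<omega>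
  have Vm[measurable]: "V i \<in> borel_measurable M" for i unfolding V_def[abs_def] by measurable
  have V2: "integrable M (\<lambda>\<omega>. (V i \<omega>)\<^sup>2)"
    "expectation (\<lambda>\<omega>. (V i \<omega>)\<^sup>2) \<le> n * (?c * (svc (Suc i) * A2_tail (cutoff m i)))" for i
    unfolding V_def using centered_sum_second_moment[OF T(1), of "cutoff m i" i] T(2) by (simp_all add: mult.assoc)
  have Q: "(\<Sum>i\<in>I. wt i) \<le> ?Q" if "finite I" for I
    using that summable_wt wt_pos by (intro sum_le_suminf) (auto intro: less_imp_le)
  have Q0: "0 \<le> ?Q" using Q[of "{}"] by simp
  note A0 = A2_tail_nonneg[OF moment2]
  have iR: "integrable M (\<lambda>\<omega>. (\<Sum>i<k. V i \<omega>)\<^sup>2)" for k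
  proof (rule Bochner_Integration.integrable_bound)
    show "integrable M (\<lambda>\<omega>. (\<Sum>i<k. wt i) * (\<Sum>i<k. (V i \<omega>)\<^sup>2 / wt i))"
      using V2(1) by (intro integrable_mult_right Bochner_Integration.integrable_sum integrable_divide)
    show "AE \<omega> in M. norm ((\<Sum>i<k. V i \<omega>)\<^sup>2) \<le> norm ((\<Sum>i<k. wt i) * (\<Sum>i<k. (V i \<omega>)\<^sup>2 / wt i))"
      using order_trans[OF weighted_square_sum_le[of "{..<k}" wt, OF wt_pos] abs_ge_self] by (intro AE_I2) simp
  qed measurable
  have ER: "expectation (\<lambda>\<omega>. (\<Sum>i<k. V i \<omega>)\<^sup>2) \<le> ?Q * ?c * (?Q * A2_tail m + (?Q - (\<Sum>i<m. wt i)) * A2_tail 0) * n" for k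
  proof -
    have "expectation (\<lambda>\<omega>. (\<Sum>i<k. V i \<omega>)\<^sup>2) \<le> expectation (\<lambda>\<omega>. (\<Sum>i<k. wt i) * (\<Sum>i<k. (V i \<omega>)\<^sup>2 / wt i))"
      using V2(1) weighted_square_sum_le[of "{..<k}" wt, OF wt_pos]
      by (intro integral_mono iR integrable_mult_right Bochner_Integration.integrable_sum integrable_divide)
    also have "\<dots> = (\<Sum>i<k. wt i) * (\<Sum>i<k. expectation (\<lambda>\<omega>. (V i \<omega>)\<^sup>2) / wt i)"
      using V2(1) by (subst integral_mult_right_zero, subst Bochner_Integration.integral_sum) auto
    also have "\<dots> \<le> ?Q * (\<Sum>i<k. (n * (?c * (svc (Suc i) * A2_tail (cutoff m i)))) / wt i)"
      using Q0 wt_pos V2(2) by (intro mult_mono Q sum_mono divide_right_mono sum_nonneg divide_nonneg_nonneg)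
        (auto intro: less_imp_le)
    also have "(\<Sum>i<k. (n * (?c * (svc (Suc i) * A2_tail (cutoff m i)))) / wt i)
        = n * ?c * (\<Sum>i<k. svc (Suc i) / wt i * A2_tail (cutoff m i))"
      by (simp add: sum_distrib_left mult_ac)
    also have "?Q * (n * ?c * (\<Sum>i<k. svc (Suc i) / wt i * A2_tail (cutoff m i)))
        \<le> ?Q * (n * ?c * (?Q * A2_tail m + (?Q - (\<Sum>i<m. wt i)) * A2_tail 0))"
    proof (intro mult_left_mono Q0)
      \<comment> \<open>Short service times carry the arrival tail \<open>A2_tail m\<close>; long
        ones carry the full second moment but only the tail of the weights. Both tend to 0 with
        growing \<open>m\<close>.\<close>
      have "(\<Sum>i<k. svc (Suc i) / wt i * A2_tail (cutoff m i)) \<le> (\<Sum>i<k. wt i * A2_tail m + (if i < m then 0 else wt i * A2_tail 0))"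
      proof (rule sum_mono)
        fix i
        have "svc (Suc i) / wt i * A2_tail (cutoff m i) \<le> wt i * A2_tail (cutoff m i)"
          by (intro mult_right_mono svc_le_wt A0)
        also have "\<dots> \<le> wt i * A2_tail m + (if i < m then 0 else wt i * A2_tail 0)"
          using wt_pos[of i] A0[of m] by (auto simp: cutoff_def intro: less_imp_le)
        finally show "svc (Suc i) / wt i * A2_tail (cutoff m i) \<le> wt i * A2_tail m + (if i < m then 0 else wt i * A2_tail 0)" .
      qed
      also have "\<dots> = (\<Sum>i<k. wt i) * A2_tail m + (\<Sum>i\<in>{..<k} - {..<m}. wt i) * A2_tail 0"
      proof -
        have "(\<Sum>i<k. if i < m then 0 else wt i * A2_tail 0) = (\<Sum>i\<in>{..<k} - {..<m}. wt i * A2_tail 0)"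
          by (intro sum.mono_neutral_cong_right) auto
        then show ?thesis by (simp add: sum.distrib sum_distrib_right)
      qed
      also have "\<dots> \<le> ?Q * A2_tail m + (?Q - (\<Sum>i<m. wt i)) * A2_tail 0"
      proof (intro add_mono mult_right_mono A0 Q)
        have "(\<Sum>i\<in>{..<k} - {..<m}. wt i) + (\<Sum>i<m. wt i) = (\<Sum>i\<in>({..<k} - {..<m}) \<union> {..<m}. wt i)"
          by (rule sum.union_disjoint[symmetric]) auto
        also have "\<dots> \<le> ?Q" by (intro Q) auto
        finally show "(\<Sum>i\<in>{..<k} - {..<m}. wt i) \<le> ?Q - (\<Sum>i<m. wt i)" by simp
      qed simp
      finally show "(\<Sum>i<k. svc (Suc i) / wt i * A2_tail (cutoff m i)) \<le> ?Q * A2_tail m + (?Q - (\<Sum>i<m. wt i)) * A2_tail 0" .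
    qed simp
    finally show ?thesis by (simp add: mult_ac)
  qed
  have lim: "AE \<omega> in M. (\<lambda>k. \<Sum>i<k. V i \<omega>) \<longlonglongrightarrow> psum Y a n \<omega> - psum (Z m) a n \<omega>"
    using centered_sums[of m]
  proof eventually_elim
    case (elim \<omega>)
    have "(\<lambda>i. \<Sum>t\<in>T. centered (cutoff m i) i t \<omega>) sums (\<Sum>t\<in>T. Y t \<omega> - Z m t \<omega>)"
      unfolding Y_def Z_def using elim by (intro sums_sum) auto
    then show ?case
      unfolding sums_def V_def psum_eq_sum T_def sum_subtractf .
  qed
  have mY: "Y t \<in> borel_measurable M" "Z m t \<in> borel_measurable M" for t
    unfolding Y_def Z_def using mb_measurable[OF truncated_moving_block, of m t] by measurable
  note [measurable] = mY
  have mV: "(\<lambda>\<omega>. \<Sum>i<k. V i \<omega>) \<in> borel_measurable M" for k by measurable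
  have mD: "(\<lambda>\<omega>. psum Y a n \<omega> - psum (Z m) a n \<omega>) \<in> borel_measurable M" by measurable
  show "integrable M (\<lambda>\<omega>. (psum Y a n \<omega> - psum (Z m) a n \<omega>)\<^sup>2)"
    and "expectation (\<lambda>\<omega>. (psum Y a n \<omega> - psum (Z m) a n \<omega>)\<^sup>2)
      \<le> ?Q * ?c * (?Q * A2_tail m + (?Q - (\<Sum>i<m. wt i)) * A2_tail 0) * n"
    using second_moment_limit[OF mV mD iR ER lim] by auto
qed

theorem approximable_weighted: "approximable (\<lambda>t \<omega>. weighted t \<omega> - expectation (weighted 0))"
  unfolding approximable_def
proof (intro conjI allI impI)
  show "(\<lambda>\<omega>. weighted t \<omega> - expectation (weighted 0)) \<in> borel_measurable M" for t by measurable
  fix \<delta> :: real assume \<delta>: "0 < \<delta>"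
  let ?Q = "suminf wt" and ?c = "(1 + real b)\<^sup>2 * K\<^sup>2"
  let ?C = "\<lambda>m. ?Q * ?c * (?Q * A2_tail m + (?Q - (\<Sum>i<m. wt i)) * A2_tail 0)"
  have "?C \<longlonglongrightarrow> ?Q * ?c * (?Q * 0 + (?Q - ?Q) * A2_tail 0)"
    by (intro tendsto_intros A2_tail_tendsto[OF moment2] summable_LIMSEQ[OF summable_wt])
  then have "\<forall>\<^sub>F m in sequentially. ?C m < \<delta>" using \<delta> by (intro order_tendstoD(2)) auto
  then obtain m where m: "?C m < \<delta>" by (auto dest: eventually_happens)
  let ?Z = "\<lambda>t \<omega>. truncated m t \<omega> - expectation (truncated m 0)"
  show "\<exists>m K Z. moving_block m K Z \<and> (\<forall>a n. integrable M (\<lambda>\<omega>. (psum (\<lambda>t \<omega>. weighted t \<omega> - expectation (weighted 0)) a n \<omega> - psum Z a n \<omega>)\<^sup>2)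
      \<and> expectation (\<lambda>\<omega>. (psum (\<lambda>t \<omega>. weighted t \<omega> - expectation (weighted 0)) a n \<omega> - psum Z a n \<omega>)\<^sup>2) \<le> \<delta> * n)"
  proof (intro exI[of _ "m + b"] exI[of _ "2 * (K * (real m * real m))"] exI[of _ ?Z] conjI allI truncated_moving_block)
    fix a n
    show "integrable M (\<lambda>\<omega>. (psum (\<lambda>t \<omega>. weighted t \<omega> - expectation (weighted 0)) a n \<omega> - psum ?Z a n \<omega>)\<^sup>2)"
      by (rule psum_remainder(1))
    have "expectation (\<lambda>\<omega>. (psum (\<lambda>t \<omega>. weighted t \<omega> - expectation (weighted 0)) a n \<omega> - psum ?Z a n \<omega>)\<^sup>2) \<le> ?C m * n"
      by (rule psum_remainder(2))
    also have "\<dots> \<le> \<delta> * n" using m by (intro mult_right_mono) auto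
    finally show "expectation (\<lambda>\<omega>. (psum (\<lambda>t \<omega>. weighted t \<omega> - expectation (weighted 0)) a n \<omega> - psum ?Z a n \<omega>)\<^sup>2) \<le> \<delta> * n" .
  qed
qed

end

end

end

text \<open>Counting backwards from \<open>t\<close> turns the greatest integer into a least natural
  number, which always exists.\<close>

lemma Greatest_less_iff:
  fixes P :: "int \<Rightarrow> bool"
  assumes "\<exists>n<t. P n"
  shows "t - (GREATEST n. n < t \<and> P n) \<le> int x \<longleftrightarrow> (\<exists>i\<in>{1..x}. P (t - int i))"
proof -
  define i where "i = (LEAST i. 1 \<le> i \<and> P (t - int i))"
  obtain n where n: "n < t" "P n" using assms by blast
  then have "1 \<le> nat (t - n) \<and> P (t - int (nat (t - n)))" by simp
  then have i: "1 \<le> i \<and> P (t - int i)" unfolding i_def by (rule LeastI)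
  have least: "i \<le> k" if "1 \<le> k" "P (t - int k)" for k unfolding i_def using that by (intro Least_le) simp
  have "(GREATEST n. n < t \<and> P n) = t - int i"
  proof (rule Greatest_equality)
    fix y assume y: "y < t \<and> P y"
    then have "i \<le> nat (t - y)" by (intro least) auto
    then show "y \<le> t - int i" using y by linarith
  qed (use i in auto)
  then have "t - (GREATEST n. n < t \<and> P n) \<le> int x \<longleftrightarrow> i \<le> x" by simp
  also have "\<dots> \<longleftrightarrow> (\<exists>k\<in>{1..x}. P (t - int k))"
  proof
    assume "\<exists>k\<in>{1..x}. P (t - int k)"
    then obtain k where "1 \<le> k" "k \<le> x" "P (t - int k)" by auto
    then show "i \<le> x" using least[of k] by simp
  qed (use i in auto)
  finally show ?thesis .
qed

section \<open>Recent arrivals as products of idle indicators\<close>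

context discrete_GI_G_infinity
begin

lemma expectation_prod_slots:
  fixes f :: "int \<Rightarrow> 'a \<Rightarrow> real"
  assumes I: "finite I" and f: "\<And>s. s \<in> I \<Longrightarrow> f s \<in> borel_measurable (slots {s})" "\<And>s. s \<in> I \<Longrightarrow> integrable M (f s)"
  shows "expectation (\<lambda>\<omega>. \<Prod>s\<in>I. f s \<omega>) = (\<Prod>s\<in>I. expectation (f s))"
proof -
  have "indep_vars (\<lambda>_. borel) f I"
    by (rule slots_indep_vars[where K = "\<lambda>s. {s}"]) (auto simp: disjoint_family_on_def f)
  from indep_vars_lebesgue_integral[OF I this f(2)] show ?thesis .
qed

definition idle :: "int \<Rightarrow> 'a \<Rightarrow> real" where
  "idle s \<omega> = of_bool (A s \<omega> = 0)"

definition idle_prob :: real where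
  "idle_prob = prob {\<omega> \<in> space M. A 0 \<omega> = 0}"

lemma idle_prob: "0 < idle_prob" "idle_prob < 1"
  using idle_slot by (auto simp: idle_prob_def)

lemma idle_slots: "idle s \<in> borel_measurable (slots {s})"
proof -
  have [measurable]: "input s 0 \<in> measurable (slots {s}) (count_space UNIV)" by (rule X_measurable_slots) simp
  have "(\<lambda>\<omega>. of_bool (input s 0 \<omega> = 0) :: real) \<in> borel_measurable (slots {s})" by measurable
  then show ?thesis by (simp add: idle_def[abs_def] input_def)
qed

lemma idle_measurable[measurable]: "idle s \<in> borel_measurable M"
  by (rule measurable_slots[OF idle_slots])

lemma idle_integrable: "integrable M (idle s)"
  by (rule integrable_const_bound[where B = 1]) (auto simp: idle_def)

lemma idle_expectation: "expectation (idle s) = idle_prob"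
proof -
  have "expectation (idle s) = expectation (idle 0)"
    using expectation_A[of "\<lambda>a. of_bool (a = 0)" s] by (simp add: idle_def[abs_def])
  also have "\<dots> = expectation (indicator {\<omega> \<in> space M. A 0 \<omega> = 0})"
    by (intro Bochner_Integration.integral_cong) (auto simp: idle_def indicator_def)
  also have "\<dots> = idle_prob" by (simp add: idle_prob_def)
  finally show ?thesis .
qed

lemma prod_idle: "(\<Prod>s\<in>I. idle s \<omega>) = of_bool (\<forall>s\<in>I. A s \<omega> = 0)" if "finite I"
  using that by induction (auto simp: idle_def)

text \<open>An arrival-free stretch of length \<open>k\<close> has probability
  \<open>idle_prob ^ k\<close>, which tends to 0.\<close>

lemma AE_previous_arrival: "AE \<omega> in M. \<forall>t. \<exists>n<t. A n \<omega> > 0"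
  unfolding AE_all_countable
proof
  fix t
  define e where "e \<omega> = (of_bool (\<forall>i. A (t - int (Suc i)) \<omega> = 0) :: real)" for \<omega>
  have [measurable]: "e \<in> borel_measurable M" unfolding e_def[abs_def] by measurable
  have ie: "integrable M e" by (rule integrable_const_bound[where B = 1]) (auto simp: e_def)
  have bound: "expectation e \<le> idle_prob ^ k" for k
  proof -
    let ?I = "(\<lambda>i. t - int (Suc i)) ` {..<k}"
    have "expectation e \<le> expectation (\<lambda>\<omega>. \<Prod>s\<in>?I. idle s \<omega>)"
    proof (rule integral_mono[OF ie])
      show "integrable M (\<lambda>\<omega>. \<Prod>s\<in>?I. idle s \<omega>)"
        by (rule integrable_const_bound[where B = 1]) (auto simp: idle_def abs_prod intro!: prod_le_1)
      show "e \<omega> \<le> (\<Prod>s\<in>?I. idle s \<omega>)" for \<omega>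
        by (auto simp: e_def prod_idle)
    qed
    also have "\<dots> = (\<Prod>s\<in>?I. expectation (idle s))"
      by (rule expectation_prod_slots) (auto intro: idle_slots idle_integrable)
    also have "\<dots> = idle_prob ^ k"
      by (simp add: idle_expectation card_image inj_on_def)
    finally show ?thesis .
  qed
  have "expectation e \<le> 0"
    by (rule tendsto_lowerbound[OF LIMSEQ_power_zero[of idle_prob]]) (use idle_prob bound in auto)
  moreover have "0 \<le> expectation e" by (rule Bochner_Integration.integral_nonneg) (simp add: e_def)
  ultimately have "expectation e = 0" by simp
  then have "AE \<omega> in M. e \<omega> = 0"
    using integral_nonneg_eq_0_iff_AE[OF ie] by (auto simp: e_def)
  then show "AE \<omega> in M. \<exists>n<t. A n \<omega> > 0"
  proof eventually_elim
    case (elim \<omega>)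
    then obtain i where "A (t - int (Suc i)) \<omega> \<noteq> 0" by (auto simp: e_def)
    then show ?case by (intro exI[of _ "t - int (Suc i)"]) auto
  qed
qed

text \<open>The indicator of an arrival in the \<open>x\<close> slots before \<open>t\<close>,
  written through a product over single slots because expectations of such products factor.\<close>

definition arrived :: "nat \<Rightarrow> int \<Rightarrow> 'a \<Rightarrow> real" where
  "arrived x t \<omega> = 1 - (\<Prod>s\<in>{t - int x..t - 1}. idle s \<omega>)"

lemma arrived_eq: "arrived x t \<omega> = of_bool (\<exists>i\<in>{1..x}. A (t - int i) \<omega> > 0)"
proof -
  have "(\<forall>s\<in>{t - int x..t - 1}. A s \<omega> = 0) \<longleftrightarrow> \<not> (\<exists>i\<in>{1..x}. A (t - int i) \<omega> > 0)"
  proof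
    assume a: "\<not> (\<exists>i\<in>{1..x}. A (t - int i) \<omega> > 0)"
    show "\<forall>s\<in>{t - int x..t - 1}. A s \<omega> = 0"
    proof
      fix s assume "s \<in> {t - int x..t - 1}"
      then have "nat (t - s) \<in> {1..x}" "s = t - int (nat (t - s))" by auto
      then show "A s \<omega> = 0" using a by (metis not_gr_zero)
    qed
  qed auto
  then show ?thesis by (simp add: arrived_def prod_idle)
qed

lemma arrived_window: "window x 1 (arrived x)"
  unfolding window_def
proof (intro conjI allI ballI bexI[of _ "\<lambda>c. 1 - (\<Prod>s\<in>{- int x..- 1}. of_bool (c (s, 0) = 0))"])
  show "arrived x t \<in> borel_measurable (slots {t - int x..t - 1})" for t
    unfolding arrived_def[abs_def]
    by (intro borel_measurable_diff borel_measurable_prod slots_mono[OF _ idle_slots]) auto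
  show "\<bar>arrived x t \<omega>\<bar> \<le> 1" for t \<omega> by (simp add: arrived_eq)
  show "arrived x t \<omega> = 1 - (\<Prod>s\<in>{- int x..- 1}. of_bool (config t \<omega> (s, 0) = 0))" for t \<omega>
    unfolding arrived_def
    by (intro arg_cong[where f = "(-) 1"] prod.reindex_bij_witness[where i = "\<lambda>s. s + t" and j = "\<lambda>s. s - t"])
      (auto simp: idle_def config_def input_def)
qed measurable

lemma AE_marked: "AE \<omega> in M. \<forall>x t. marked_departures A S x t \<omega> = arrived x t \<omega> * departures A S t \<omega>"
  using AE_previous_arrival
proof eventually_elim
  case (elim \<omega>)
  have "last_arrival_age A t \<omega> \<le> int x \<longleftrightarrow> (\<exists>i\<in>{1..x}. A (t - int i) \<omega> > 0)" for x t
    unfolding last_arrival_age_def using elim by (intro Greatest_less_iff) auto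
  then show ?case by (auto simp: marked_departures_def arrived_eq)
qed

text \<open>Without mass beyond \<open>x\<close> the tail \<open>1 - G\<close> would be constant and
  positive from \<open>x\<close> on, contradicting the finite mean.\<close>

lemma service_exceeds:
  assumes "G x < 1"
  obtains \<tau> where "\<tau> > x" "svc \<tau> > 0"
proof -
  have "\<exists>\<tau>>x. svc \<tau> > 0"
  proof (rule ccontr)
    assume "\<not> ?thesis"
    then have z: "svc j = 0" if "j > x" for j using that svc_nonneg[of j] by force
    have "G (x + k) = G x" for k
    proof (induction k)
      case (Suc k)
      then show ?case using z[of "x + Suc k"] by (simp add: svc_def)
    qed simp
    then have c: "1 - G (Suc (i + x)) = 1 - G x" for i
      by (metis add.commute add_Suc_right)
    have "(\<lambda>i. 1 - G (Suc i)) \<longlonglongrightarrow> 0" by (rule summable_LIMSEQ_zero[OF service_mean])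
    then have "(\<lambda>i. 1 - G (Suc (i + x))) \<longlonglongrightarrow> 0" by (rule LIMSEQ_ignore_initial_segment)
    then have "(\<lambda>i::nat. 1 - G x) \<longlonglongrightarrow> 0" unfolding c .
    then show False using assms by (simp add: tendsto_const_iff)
  qed
  then show ?thesis using that by blast
qed

section \<open>Positivity of the asymptotic variance\<close>

context
  fixes x \<tau> :: nat and h :: real
  assumes x: "x \<ge> 1" and \<tau>: "\<tau> > x" "svc \<tau> > 0"
    and moment2: "integrable M (\<lambda>\<omega>. (real (A 0 \<omega>))\<^sup>2)" and service_tail: "summable (\<lambda>n. sqrt (1 - G (Suc n)))"
begin

text \<open>
  Only a customer arriving in slot \<open>u\<close> with service time \<open>\<tau>\<close> sees a slot pattern that
  covers \<open>u\<close> and the \<open>x\<close> slots before its departure.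
\<close>

definition pattern :: "int \<Rightarrow> int set" where
  "pattern u = insert u {u + int \<tau> - int x..u + int \<tau> - 1}"

text \<open>A product of centred independent variables, one for each slot of the pattern: orthogonal
  to everything that ignores at least one of these slots.\<close>

definition probe :: "int \<Rightarrow> 'a \<Rightarrow> real" where
  "probe u \<omega> = (\<Prod>s\<in>pattern u. idle s \<omega> - idle_prob)"

lemma finite_pattern: "finite (pattern u)" by (simp add: pattern_def)

lemma idle_centered_bound: "\<bar>idle s \<omega> - idle_prob\<bar> \<le> 1"
  using idle_prob by (auto simp: idle_def)

lemma probe_bound: "\<bar>probe u \<omega>\<bar> \<le> 1"
  unfolding probe_def abs_prod by (intro prod_le_1) (auto simp: idle_centered_bound)

lemma prod_centered_slots:
  assumes "I \<subseteq> K" shows "(\<lambda>\<omega>. \<Prod>s\<in>I. idle s \<omega> - idle_prob) \<in> borel_measurable (slots K)"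
proof (intro borel_measurable_prod borel_measurable_diff)
  fix s assume "s \<in> I"
  then show "idle s \<in> borel_measurable (slots K)" using assms by (intro slots_mono[OF _ idle_slots]) auto
qed simp

lemma probe_measurable[measurable]: "probe u \<in> borel_measurable M"
  unfolding probe_def[abs_def] by measurable

lemma integrable_mult_probe:
  assumes "integrable M F" shows "integrable M (\<lambda>\<omega>. F \<omega> * probe u \<omega>)"
proof (rule Bochner_Integration.integrable_bound[OF assms])
  show "AE \<omega> in M. norm (F \<omega> * probe u \<omega>) \<le> norm (F \<omega>)"
    using probe_bound by (intro AE_I2) (auto simp: abs_mult intro: mult_left_le)
qed (use assms in measurable)

text \<open>The centred factor of slot \<open>s\<close> is independent of everything else in the
  expectation and has mean 0.\<close>

lemma probe_drop:
  assumes s: "s \<in> pattern u" and F: "F \<in> borel_measurable (slots (- {s}))" "integrable M F"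
  shows "expectation (\<lambda>\<omega>. F \<omega> * probe u \<omega>) = 0"
proof -
  let ?R = "\<lambda>\<omega>. \<Prod>s\<in>pattern u - {s}. idle s \<omega> - idle_prob"
  have R: "?R \<in> borel_measurable (slots (- {s}))" by (rule prod_centered_slots) auto
  have FR: "(\<lambda>\<omega>. F \<omega> * ?R \<omega>) \<in> borel_measurable (slots (- {s}))" by (intro borel_measurable_times F R)
  have iFR: "integrable M (\<lambda>\<omega>. F \<omega> * ?R \<omega>)"
  proof (rule Bochner_Integration.integrable_bound[OF F(2) measurable_slots[OF FR]])
    have "\<bar>?R \<omega>\<bar> \<le> 1" for \<omega> unfolding abs_prod by (intro prod_le_1) (auto simp: idle_centered_bound)
    then show "AE \<omega> in M. norm (F \<omega> * ?R \<omega>) \<le> norm (F \<omega>)"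
      by (intro AE_I2) (auto simp: abs_mult intro: mult_left_le)
  qed
  have "probe u \<omega> = ?R \<omega> * (idle s \<omega> - idle_prob)" for \<omega>
    unfolding probe_def using s finite_pattern[of u] by (subst prod.remove[of _ s]) auto
  then have "(\<lambda>\<omega>. F \<omega> * probe u \<omega>) = (\<lambda>\<omega>. (F \<omega> * ?R \<omega>) * (idle s \<omega> - idle_prob))"
    by (simp add: mult.assoc)
  moreover have "expectation (\<lambda>\<omega>. (F \<omega> * ?R \<omega>) * (idle s \<omega> - idle_prob)) = 0"
  proof (rule slots_uncorrelated[OF _ FR _ iFR])
    show "(\<lambda>\<omega>. idle s \<omega> - idle_prob) \<in> borel_measurable (slots {s})" by (intro borel_measurable_diff idle_slots) simp
    show "integrable M (\<lambda>\<omega>. idle s \<omega> - idle_prob)" using idle_integrable by simp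
    show "expectation (\<lambda>\<omega>. F \<omega> * ?R \<omega>) = 0 \<or> expectation (\<lambda>\<omega>. idle s \<omega> - idle_prob) = 0"
      using idle_integrable idle_expectation by (simp add: prob_space)
  qed auto
  ultimately show ?thesis by simp
qed

lemma probe_mean: "expectation (probe u) = 0"
proof -
  have "u \<in> pattern u" by (simp add: pattern_def)
  from probe_drop[OF this, of "\<lambda>_. 1"] have "expectation (\<lambda>\<omega>. 1 * probe u \<omega>) = 0"
    by (metis borel_measurable_const integrable_const)
  then show ?thesis by (simp only: mult_1)
qed

text \<open>Since \<open>\<tau> > x\<close>, the earliest slot of \<open>pattern u\<close> is
  \<open>u\<close> itself. Of two probes the later one therefore does not read the first slot of the
  earlier one.\<close>

lemma probe_orthogonal: "u \<noteq> v \<Longrightarrow> expectation (\<lambda>\<omega>. probe u \<omega> * probe v \<omega>) = 0"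
proof -
  have *: "expectation (\<lambda>\<omega>. probe v \<omega> * probe u \<omega>) = 0" if "u < v" for u v
  proof (rule probe_drop[of u])
    have "u \<notin> pattern v" using that \<tau> by (auto simp: pattern_def)
    then show "probe v \<in> borel_measurable (slots (- {u}))"
      unfolding probe_def[abs_def] by (intro prod_centered_slots) auto
    show "integrable M (probe v)" using probe_bound by (intro integrable_const_bound[where B = 1]) auto
  qed (simp add: pattern_def)
  assume "u \<noteq> v"
  then show ?thesis using *[of u v] *[of v u] by (auto simp: mult.commute neq_iff)
qed

definition served_mean :: real where "served_mean = expectation (served 0 \<tau> 0)"

lemma served_mean: "expectation (served 0 \<tau> u) = served_mean"
proof -
  have "expectation (served 0 \<tau> u) = expectation (\<lambda>\<omega>. served_config 0 \<tau> 0 (config u \<omega>))"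
    by (intro Bochner_Integration.integral_cong) (auto simp: served_eq_config[of _ _ _ _ u])
  also have "\<dots> = expectation (\<lambda>\<omega>. served_config 0 \<tau> 0 (config 0 \<omega>))" by (rule expectation_config) measurable
  also have "\<dots> = served_mean" unfolding served_mean_def
    by (intro Bochner_Integration.integral_cong) (auto simp: served_eq_config[of _ _ _ _ 0])
  finally show ?thesis .
qed

lemma served_mean_pos: "served_mean > 0"
proof -
  have i: "integrable M (\<lambda>\<omega>. (1 - of_bool (A 0 \<omega> = 0)) :: real)"
    using idle_integrable[of 0] by (simp add: idle_def[abs_def])
  note I = arrival_service_indep[of 1 "\<lambda>a. 1 - of_bool (a = 0)" 0 "\<lambda>j. of_bool (j = \<tau>)", OF _ i expectation_service(2)]
  let ?g = "\<lambda>\<omega>. (1 - of_bool (A 0 \<omega> = 0)) * of_bool (S 0 1 \<omega> = \<tau>) :: real"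
  have "expectation ?g = (1 - idle_prob) * svc \<tau>"
    using I(2) idle_expectation[of 0] idle_integrable[of 0] expectation_service(1)[of 1 0 \<tau>]
    by (simp add: idle_def[abs_def] prob_space)
  also have "\<dots> > 0" using idle_prob \<tau> by simp
  finally have "0 < expectation ?g" .
  also have "\<dots> \<le> served_mean"
    unfolding served_mean_def
  proof (rule integral_mono)
    show "integrable M ?g" using I(1) by simp
    show "integrable M (served 0 \<tau> 0)" by (rule served_integrable[OF moment2])
    fix \<omega>
    show "?g \<omega> \<le> served 0 \<tau> 0 \<omega>"
    proof (cases "A 0 \<omega> = 0")
      case False
      then have "of_bool (S 0 1 \<omega> = \<tau>) \<le> (\<Sum>l\<in>{0<..A 0 \<omega>}. of_bool (S 0 l \<omega> = \<tau>) :: real)"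
        by (intro member_le_sum[of 1 "{0<..A 0 \<omega>}" "\<lambda>l. of_bool (S 0 l \<omega> = \<tau>)"]) auto
      then show ?thesis using False by (simp add: served_def)
    qed (simp add: served_nonneg)
  qed
  finally show ?thesis .
qed

text \<open>Each of the \<open>x\<close> window slots contributes the variance
  \<open>idle_prob * (1 - idle_prob)\<close> of an idle indicator, and slot \<open>u\<close>
  contributes \<open>- idle_prob * served_mean\<close>; the sign is reversed by the minus in front
  of the product in \<open>arrived\<close>.\<close>

definition probe_gain :: real where
  "probe_gain = idle_prob * served_mean * (idle_prob * (1 - idle_prob)) ^ x"

lemma probe_gain_pos: "probe_gain > 0"
  using idle_prob served_mean_pos by (simp add: probe_gain_def)

text \<open>The last slot of the run gives \<open>u + \<tau> \<le> t\<close>. Then \<open>u\<close>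
  precedes the window and must be the arrival slot \<open>t - j\<close>, so the first slot of the
  run has to lie in the window, which gives the opposite inequality.\<close>

lemma pattern_covered:
  assumes "pattern u \<subseteq> insert (t - int j) {t - int x..t - 1}" and j: "j \<ge> 1"
  shows "t = u + int \<tau>" "j = \<tau>"
proof -
  have *: "v = t - int j \<or> (t - int x \<le> v \<and> v \<le> t - 1)" if "v \<in> pattern u" for v
    using subsetD[OF assms(1) that] by auto
  have 1: "u + int \<tau> - 1 = t - int j \<or> (t - int x \<le> u + int \<tau> - 1 \<and> u + int \<tau> - 1 \<le> t - 1)"
    by (rule *) (use x \<tau> in \<open>auto simp: pattern_def\<close>)
  have 2: "u = t - int j \<or> (t - int x \<le> u \<and> u \<le> t - 1)"
    by (rule *) (auto simp: pattern_def)
  have 3: "u + int \<tau> - int x = t - int j \<or> (t - int x \<le> u + int \<tau> - int x \<and> u + int \<tau> - int x \<le> t - 1)"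
    by (rule *) (use x \<tau> in \<open>auto simp: pattern_def\<close>)
  have le: "u + int \<tau> \<le> t" using 1 j by linarith
  then have uj: "u = t - int j" using 2 \<tau> by linarith
  then have "t \<le> u + int \<tau>" using 3 \<tau> by linarith
  with le show "t = u + int \<tau>" by linarith
  with uj show "j = \<tau>" by linarith
qed

lemma arrived_shift_window: "window x (1 + \<bar>h\<bar>) (\<lambda>t \<omega>. arrived x t \<omega> - h)"
  unfolding window_def
proof (intro conjI allI ballI)
  note W = arrived_window[of x, unfolded window_def]
  show "(\<lambda>\<omega>. arrived x t \<omega> - h) \<in> borel_measurable (slots {t - int x..t - 1})" for t
    using W by (intro borel_measurable_diff) auto
  show "\<bar>arrived x t \<omega> - h\<bar> \<le> 1 + \<bar>h\<bar>" for t \<omega> by (auto simp: arrived_eq)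
  obtain f where f: "f \<in> borel_measurable (PiM UNIV (\<lambda>_. count_space UNIV))"
    "\<forall>t. \<forall>\<omega>\<in>space M. arrived x t \<omega> = f (config t \<omega>)" using W by auto
  show "\<exists>f\<in>borel_measurable (PiM UNIV (\<lambda>_. count_space UNIV)). \<forall>t. \<forall>\<omega>\<in>space M. arrived x t \<omega> - h = f (config t \<omega>)"
    using f by (intro bexI[of _ "\<lambda>c. f c - h"]) auto
qed

text \<open>The weight is \<open>1 - h\<close> minus a product over the window. The constant part
  leaves a function of one slot, which misses a slot of the pattern; the product part reads the
  window and the arrival slot, which cover the pattern in one case only.\<close>

lemma expectation_summand_probe:
  "expectation (\<lambda>\<omega>. summand (\<lambda>t \<omega>. arrived x t \<omega> - h) 0 i t \<omega> * probe u \<omega>)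
    = (if t = u + int \<tau> \<and> Suc i = \<tau> then probe_gain else 0)"
proof -
  let ?s = "served 0 (Suc i) (t - int (Suc i))"
  let ?P = "\<lambda>\<omega>. \<Prod>s\<in>{t - int x..t - 1}. idle s \<omega>"
  have isv: "integrable M ?s" by (rule served_integrable[OF moment2])
  have P1: "\<bar>?P \<omega>\<bar> \<le> 1" for \<omega> by (simp add: prod_idle)
  have isP: "integrable M (\<lambda>\<omega>. ?s \<omega> * ?P \<omega>)"
    using P1 by (intro Bochner_Integration.integrable_bound[OF isv]) (auto simp: abs_mult intro!: AE_I2 mult_left_le)
  have "expectation (\<lambda>\<omega>. summand (\<lambda>t \<omega>. arrived x t \<omega> - h) 0 i t \<omega> * probe u \<omega>)
      = expectation (\<lambda>\<omega>. (1 - h) * (?s \<omega> * probe u \<omega>) - (?s \<omega> * ?P \<omega>) * probe u \<omega>)"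
  proof (intro Bochner_Integration.integral_cong refl)
    fix \<omega>
    have "summand (\<lambda>t \<omega>. arrived x t \<omega> - h) 0 i t \<omega> = (arrived x t \<omega> - h) * ?s \<omega>"
      by (rule summand_def[OF moment2 arrived_shift_window])
    then have "summand (\<lambda>t \<omega>. arrived x t \<omega> - h) 0 i t \<omega> = (1 - ?P \<omega> - h) * ?s \<omega>"
      unfolding arrived_def[of x t \<omega>] .
    note eq = this
    show "summand (\<lambda>t \<omega>. arrived x t \<omega> - h) 0 i t \<omega> * probe u \<omega> = (1 - h) * (?s \<omega> * probe u \<omega>) - (?s \<omega> * ?P \<omega>) * probe u \<omega>"
      unfolding eq by (simp add: algebra_simps)
  qed
  also have "\<dots> = (1 - h) * expectation (\<lambda>\<omega>. ?s \<omega> * probe u \<omega>) - expectation (\<lambda>\<omega>. (?s \<omega> * ?P \<omega>) * probe u \<omega>)"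
    using integrable_mult_probe[OF isv, of u] integrable_mult_probe[OF isP, of u] by simp
  also have "expectation (\<lambda>\<omega>. ?s \<omega> * probe u \<omega>) = 0"
  proof -
    \<comment> \<open>The pattern has at least two slots because \<open>x \<ge> 1\<close>, so one of
      them differs from the arrival slot.\<close>
    obtain s where s: "s \<in> pattern u" "s \<noteq> t - int (Suc i)"
    proof (cases "u = t - int (Suc i)")
      case True
      then show ?thesis using that[of "u + int \<tau> - int x"] x \<tau> by (auto simp: pattern_def)
    qed (use that[of u] in \<open>auto simp: pattern_def\<close>)
    show ?thesis by (rule probe_drop[OF s(1) slots_mono[OF _ served_slots] isv]) (use s(2) in auto)
  qed
  also have "expectation (\<lambda>\<omega>. (?s \<omega> * ?P \<omega>) * probe u \<omega>) = (if t = u + int \<tau> \<and> Suc i = \<tau> then - probe_gain else 0)"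
  proof (cases "pattern u \<subseteq> insert (t - int (Suc i)) {t - int x..t - 1}")
    case False
    then obtain s where s: "s \<in> pattern u" "s \<notin> insert (t - int (Suc i)) {t - int x..t - 1}" by blast
    have "expectation (\<lambda>\<omega>. (?s \<omega> * ?P \<omega>) * probe u \<omega>) = 0"
    proof (rule probe_drop[OF s(1) _ isP])
      show "(\<lambda>\<omega>. ?s \<omega> * ?P \<omega>) \<in> borel_measurable (slots (- {s}))"
        using s(2) by (intro borel_measurable_times borel_measurable_prod slots_mono[OF _ served_slots] slots_mono[OF _ idle_slots]) auto
    qed
    moreover have "\<not> (t = u + int \<tau> \<and> Suc i = \<tau>)" using False by (auto simp: pattern_def)
    ultimately show ?thesis by (simp only: if_False)
  next
    case True
    from pattern_covered[OF True] have t: "t = u + int \<tau>" and i: "Suc i = \<tau>" by auto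
    let ?I = "{u + int \<tau> - int x..u + int \<tau> - 1}"
    \<comment> \<open>All factors are regrouped by slot, so that the expectation becomes a product
      over the pattern.\<close>
    define f where "f s \<omega> = (if s = u then served 0 \<tau> u \<omega> * (idle u \<omega> - idle_prob) else idle s \<omega> * (idle s \<omega> - idle_prob))" for s \<omega>
    have u: "u \<notin> ?I" using \<tau> by auto
    have prod: "(?s \<omega> * ?P \<omega>) * probe u \<omega> = (\<Prod>s\<in>pattern u. f s \<omega>)" for \<omega>
    proof -
      have "(\<Prod>s\<in>pattern u. f s \<omega>) = f u \<omega> * (\<Prod>s\<in>?I. f s \<omega>)"
        unfolding pattern_def using u by (subst prod.insert) auto
      also have "(\<Prod>s\<in>?I. f s \<omega>) = (\<Prod>s\<in>?I. idle s \<omega> * (idle s \<omega> - idle_prob))"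
        using u by (intro prod.cong) (auto simp: f_def)
      also have "\<dots> = (\<Prod>s\<in>?I. idle s \<omega>) * (\<Prod>s\<in>?I. idle s \<omega> - idle_prob)" by (rule prod.distrib)
      finally show ?thesis
        unfolding probe_def pattern_def using u i t by (subst prod.insert) (auto simp: f_def)
    qed
    have fs: "f s \<in> borel_measurable (slots {s})" for s
      unfolding f_def[abs_def] by (cases "s = u")
        (auto intro!: borel_measurable_times borel_measurable_diff idle_slots served_slots)
    have su: "integrable M (\<lambda>\<omega>. served 0 \<tau> u \<omega> * idle_prob)" by (intro integrable_mult_left served_integrable[OF moment2])
    \<comment> \<open>A slot with a served customer is not idle, so there the centred indicator
      equals \<open>- idle_prob\<close>.\<close>
    have fu_eq: "f u \<omega> = - (served 0 \<tau> u \<omega> * idle_prob)" for \<omega>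
      by (simp add: f_def idle_def served_def)
    have fs_eq: "f s \<omega> = (1 - idle_prob) * idle s \<omega>" if "s \<noteq> u" for s \<omega>
      using that by (auto simp: f_def idle_def)
    have fi: "integrable M (f s)" for s
    proof (cases "s = u")
      case True then show ?thesis using su by (simp add: fu_eq[abs_def])
    next
      case False then show ?thesis using idle_integrable[of s] by (simp add: fs_eq[OF False, abs_def])
    qed
    have "expectation (\<lambda>\<omega>. (?s \<omega> * ?P \<omega>) * probe u \<omega>) = (\<Prod>s\<in>pattern u. expectation (f s))"
      unfolding prod by (rule expectation_prod_slots[OF finite_pattern fs fi])
    also have "\<dots> = expectation (f u) * (\<Prod>s\<in>?I. expectation (f s))"
      unfolding pattern_def using u by (subst prod.insert) auto
    also have "(\<Prod>s\<in>?I. expectation (f s)) = (\<Prod>s\<in>?I. (1 - idle_prob) * idle_prob)"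
    proof (rule prod.cong[OF refl])
      fix s assume "s \<in> ?I"
      then have "s \<noteq> u" using u by auto
      then show "expectation (f s) = (1 - idle_prob) * idle_prob" using fs_eq[OF \<open>s \<noteq> u\<close>, abs_def] by (simp add: idle_expectation)
    qed
    also have "\<dots> = (idle_prob * (1 - idle_prob)) ^ x" by (simp add: mult.commute)
    also have "expectation (f u) = - (served_mean * idle_prob)"
      using served_mean[of u] served_integrable[OF moment2, of 0 \<tau> u] by (simp add: fu_eq[abs_def])
    finally show ?thesis using t i by (simp add: probe_gain_def)
  qed
  finally show ?thesis by simp
qed

text \<open>Probes are bounded by 1, so the summable bound for the summands permits taking
  expectations term by term; a single service length contributes.\<close>

lemma expectation_weighted_probe:
  "expectation (\<lambda>\<omega>. weighted (\<lambda>t \<omega>. arrived x t \<omega> - h) t \<omega> * probe u \<omega>) = (if t = u + int \<tau> then probe_gain else 0)"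
proof -
  let ?w = "\<lambda>t \<omega>. arrived x t \<omega> - h"
  note W = arrived_shift_window
  let ?f = "\<lambda>i \<omega>. summand ?w 0 i t \<omega> * probe u \<omega>"
  have le: "norm (?f i \<omega>) \<le> norm (summand ?w 0 i t \<omega>)" for i \<omega>
    using probe_bound by (auto simp: abs_mult intro: mult_left_le)
  have i: "integrable M (?f i)" for i by (rule integrable_mult_probe[OF summand_integrable[OF moment2 W]])
  have ae: "AE \<omega> in M. summable (\<lambda>i. norm (?f i \<omega>))"
    using AE_summable_summand[OF moment2 W, of "\<lambda>_. 0" t]
  proof eventually_elim
    case (elim \<omega>)
    show ?case by (rule summable_comparison_test'[OF elim, of 0]) (use le in simp)
  qed
  have "summable (\<lambda>i. expectation (\<lambda>\<omega>. norm (?f i \<omega>)))"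
  proof (rule summable_comparison_test'[OF summable_norm_summand[OF moment2 W, of "\<lambda>_. 0" t], of 0])
    fix i
    have "expectation (\<lambda>\<omega>. norm (?f i \<omega>)) \<le> expectation (\<lambda>\<omega>. norm (summand ?w 0 i t \<omega>))"
      by (intro integral_mono integrable_norm i summand_integrable[OF moment2 W] le)
    then show "norm (expectation (\<lambda>\<omega>. norm (?f i \<omega>))) \<le> expectation (\<lambda>\<omega>. norm (summand ?w 0 i t \<omega>))" by simp
  qed
  from sums_integral[OF i ae this]
  have "(\<lambda>i. if t = u + int \<tau> \<and> Suc i = \<tau> then probe_gain else 0) sums expectation (\<lambda>\<omega>. \<Sum>i. ?f i \<omega>)"
    by (simp add: expectation_summand_probe)
  moreover have "expectation (\<lambda>\<omega>. \<Sum>i. ?f i \<omega>) = expectation (\<lambda>\<omega>. weighted ?w t \<omega> * probe u \<omega>)"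
  proof (rule integral_cong_AE)
    show "(\<lambda>\<omega>. weighted ?w t \<omega> * probe u \<omega>) \<in> borel_measurable M"
      using weighted_measurable[OF moment2 W] by measurable
    show "(\<lambda>\<omega>. \<Sum>i. ?f i \<omega>) \<in> borel_measurable M"
      using summand_measurable[OF moment2 W] by measurable
    show "AE \<omega> in M. (\<Sum>i. ?f i \<omega>) = weighted ?w t \<omega> * probe u \<omega>"
      using weighted_sums[OF moment2 W, of t]
      by eventually_elim (rule sums_unique[symmetric], rule sums_mult2)
  qed
  moreover have "(\<lambda>i. if t = u + int \<tau> \<and> Suc i = \<tau> then probe_gain else 0) sums (if t = u + int \<tau> then probe_gain else 0)"
  proof -
    have "(\<lambda>i. if i = \<tau> - 1 then (if t = u + int \<tau> then probe_gain else 0) else 0) sums (if t = u + int \<tau> then probe_gain else 0)"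
      by (rule sums_single)
    moreover have "(\<lambda>i. if i = \<tau> - 1 then (if t = u + int \<tau> then probe_gain else 0) else 0)
      = (\<lambda>i. if t = u + int \<tau> \<and> Suc i = \<tau> then probe_gain else 0)" using \<tau>(1) by (auto simp: fun_eq_iff)
    ultimately show ?thesis by simp
  qed
  ultimately show ?thesis by (simp add: sums_unique2)
qed

lemma expectation_sum_probes:
  assumes "integrable M F"
  shows "integrable M (\<lambda>\<omega>. F \<omega> * (\<Sum>u=1..N::nat. probe (int u) \<omega>))"
    and "expectation (\<lambda>\<omega>. F \<omega> * (\<Sum>u=1..N. probe (int u) \<omega>)) = (\<Sum>u=1..N. expectation (\<lambda>\<omega>. F \<omega> * probe (int u) \<omega>))"
  using integrable_mult_probe[OF assms] by (simp_all add: sum_distrib_left)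

text \<open>
  The partial sums are bounded from below in mean square by their projection onto the orthogonal probes.
\<close>

lemma weighted_variance_pos:
  defines "Y \<equiv> \<lambda>t \<omega>. weighted (\<lambda>t \<omega>. arrived x t \<omega> - h) t \<omega> - expectation (weighted (\<lambda>t \<omega>. arrived x t \<omega> - h) 0)"
  assumes lim: "(\<lambda>n. expectation (\<lambda>\<omega>. (psum Y 0 n \<omega>)\<^sup>2) / real n) \<longlonglongrightarrow> s"
  shows "s > 0"
proof -
  note W = arrived_shift_window
  have "approximable Y" unfolding Y_def by (rule approximable_weighted[OF moment2 W service_tail])
  then obtain C where C: "\<And>a n. integrable M (\<lambda>\<omega>. (psum Y a n \<omega>)\<^sup>2)"
    by (rule approximable_second_moment) (rule that)
  have iY: "integrable M (Y t)" for t unfolding Y_def using weighted_integrable[OF moment2 W] by simp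
  have iprobe: "integrable M (probe u)" for u using probe_bound by (intro integrable_const_bound[where B = 1]) auto
  have Yp: "expectation (\<lambda>\<omega>. Y t \<omega> * probe u \<omega>) = (if t = u + int \<tau> then probe_gain else 0)" for t u
  proof -
    have "expectation (\<lambda>\<omega>. Y t \<omega> * probe u \<omega>) = expectation (\<lambda>\<omega>. weighted (\<lambda>t \<omega>. arrived x t \<omega> - h) t \<omega> * probe u \<omega>)
      - expectation (weighted (\<lambda>t \<omega>. arrived x t \<omega> - h) 0) * expectation (probe u)"
      unfolding Y_def left_diff_distrib
      using integrable_mult_probe[OF weighted_integrable[OF moment2 W]] iprobe by (subst Bochner_Integration.integral_diff) auto
    then show ?thesis by (simp add: probe_mean expectation_weighted_probe)
  qed
  \<comment> \<open>The probe at \<open>u\<close> pairs with the departure slot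
    \<open>u + \<tau>\<close>, so exactly the \<open>n - \<tau>\<close> probes at
    \<open>u \<le> n - \<tau>\<close> are matched inside the sum.\<close>
  have lower: "probe_gain\<^sup>2 * real (n - \<tau>) \<le> expectation (\<lambda>\<omega>. (psum Y 0 n \<omega>)\<^sup>2)" if n: "n \<ge> \<tau>" for n
  proof -
    let ?g = probe_gain and ?N = "n - \<tau>" and ?P = "psum Y 0 n"
    let ?F = "\<lambda>\<omega>. \<Sum>u=1..?N. probe (int u) \<omega>"
    have iP: "integrable M ?P" using iY by (simp add: psum_def[abs_def])
    have iF: "integrable M ?F" using iprobe by simp
    have "expectation (\<lambda>\<omega>. ?P \<omega> * probe (int u) \<omega>) = ?g" if u: "u \<in> {1..?N}" for u
    proof -
      have "expectation (\<lambda>\<omega>. ?P \<omega> * probe (int u) \<omega>) = (\<Sum>r=1..n. expectation (\<lambda>\<omega>. Y (int r) \<omega> * probe (int u) \<omega>))"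
        unfolding psum_def sum_distrib_right using integrable_mult_probe[OF iY]
        by (subst Bochner_Integration.integral_sum) auto
      also have "\<dots> = (\<Sum>r=1..n. if r = u + \<tau> then ?g else 0)"
        by (intro sum.cong) (auto simp: Yp)
      also have "\<dots> = (\<Sum>r\<in>{1..n} \<inter> {u + \<tau>}. ?g)" by (subst sum.inter_restrict) auto
      also have "{1..n} \<inter> {u + \<tau>} = {u + \<tau>}" using u n by auto
      finally have "expectation (\<lambda>\<omega>. ?P \<omega> * probe (int u) \<omega>) = ?g" by simp
      then show ?thesis .
    qed
    then have PF: "expectation (\<lambda>\<omega>. ?P \<omega> * ?F \<omega>) = real ?N * ?g"
      using expectation_sum_probes(2)[OF iP, of ?N] by simp
    have "expectation (\<lambda>\<omega>. ?F \<omega> * probe (int v) \<omega>) \<le> 1" if v: "v \<in> {1..?N}" for v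
    proof -
      have "expectation (\<lambda>\<omega>. ?F \<omega> * probe (int v) \<omega>) = (\<Sum>u=1..?N. expectation (\<lambda>\<omega>. probe (int u) \<omega> * probe (int v) \<omega>))"
        unfolding sum_distrib_right using integrable_mult_probe[OF iprobe]
        by (subst Bochner_Integration.integral_sum) auto
      also have "\<dots> = (\<Sum>u=1..?N. if u = v then expectation (\<lambda>\<omega>. probe (int v) \<omega> * probe (int v) \<omega>) else 0)"
        by (intro sum.cong) (auto simp: probe_orthogonal)
      also have "\<dots> = expectation (\<lambda>\<omega>. probe (int v) \<omega> * probe (int v) \<omega>)" using v by simp
      also have "\<dots> \<le> expectation (\<lambda>_. 1)"
      proof (intro integral_mono integrable_mult_probe[OF iprobe])
        show "probe (int v) \<omega> * probe (int v) \<omega> \<le> 1" for \<omega>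
          using probe_bound[of "int v" \<omega>] by (simp add: abs_square_le_1 flip: power2_eq_square)
      qed simp
      finally show ?thesis by (simp add: prob_space)
    qed
    then have FF: "expectation (\<lambda>\<omega>. ?F \<omega> * ?F \<omega>) \<le> real ?N"
      using expectation_sum_probes(2)[OF iF, of ?N] sum_bounded_above[of "{1..?N}" "\<lambda>v. expectation (\<lambda>\<omega>. ?F \<omega> * probe (int v) \<omega>)" 1]
      by simp
    \<comment> \<open>Bessel's inequality in disguise: the mixed term is
      \<open>2 * ?g\<^sup>2 * ?N\<close>, while the probes are orthogonal and bounded by 1, so their
      sum has second moment at most \<open>?N\<close>.\<close>
    have "0 \<le> expectation (\<lambda>\<omega>. (?P \<omega> - ?g * ?F \<omega>)\<^sup>2)" by simp
    also have "\<dots> = expectation (\<lambda>\<omega>. ((?P \<omega>)\<^sup>2 - 2 * ?g * (?P \<omega> * ?F \<omega>)) + ?g\<^sup>2 * (?F \<omega> * ?F \<omega>))"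
      by (intro Bochner_Integration.integral_cong refl) (simp add: power2_eq_square algebra_simps)
    also have "\<dots> = expectation (\<lambda>\<omega>. (?P \<omega>)\<^sup>2) - 2 * ?g * (real ?N * ?g) + ?g\<^sup>2 * expectation (\<lambda>\<omega>. ?F \<omega> * ?F \<omega>)"
      using C[of 0 n] expectation_sum_probes(1)[OF iP, of ?N] expectation_sum_probes(1)[OF iF, of ?N] PF
      by (subst Bochner_Integration.integral_add; (intro integrable_diff integrable_mult_right)?)
        simp_all
    also have "\<dots> \<le> expectation (\<lambda>\<omega>. (?P \<omega>)\<^sup>2) - 2 * ?g * (real ?N * ?g) + ?g\<^sup>2 * real ?N"
      using FF by (intro add_left_mono mult_left_mono) auto
    finally show ?thesis by (simp add: power2_eq_square algebra_simps)
  qed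
  have "probe_gain\<^sup>2 \<le> s"
  proof (rule LIMSEQ_le[OF _ lim])
    have "(\<lambda>n. 1 - real \<tau> / real n) \<longlonglongrightarrow> 1 - 0" by (intro tendsto_diff tendsto_const tendsto_divide_0[OF tendsto_const] filterlim_at_top_imp_at_infinity filterlim_real_sequentially)
    from tendsto_mult_left[OF this, of "probe_gain\<^sup>2"]
    show "(\<lambda>n. probe_gain\<^sup>2 * (1 - real \<tau> / real n)) \<longlonglongrightarrow> probe_gain\<^sup>2" by simp
    show "\<exists>N. \<forall>n\<ge>N. probe_gain\<^sup>2 * (1 - real \<tau> / real n) \<le> expectation (\<lambda>\<omega>. (psum Y 0 n \<omega>)\<^sup>2) / real n"
    proof (intro exI[of _ "Suc \<tau>"] allI impI)
      fix n assume "n \<ge> Suc \<tau>"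
      then have "probe_gain\<^sup>2 * (1 - real \<tau> / real n) = probe_gain\<^sup>2 * real (n - \<tau>) / real n" "\<tau> \<le> n"
        by (simp_all add: of_nat_diff field_simps)
      then show "probe_gain\<^sup>2 * (1 - real \<tau> / real n) \<le> expectation (\<lambda>\<omega>. (psum Y 0 n \<omega>)\<^sup>2) / real n"
        using divide_right_mono[OF lower[of n], of "real n"] by simp
    qed
  qed
  then show ?thesis using probe_gain_pos zero_less_power[of probe_gain 2] by linarith
qed

end


definition rate :: real where
  "rate = expectation (departures A S 0)"

definition level :: "nat \<Rightarrow> real" where
  "level m = expectation (\<lambda>\<omega>. arrived m 0 \<omega> * departures A S 0 \<omega>) / rate"

text \<open>The linearised estimation error: its partial sum is the numerator of the estimator minus
  \<open>level m\<close> times the denominator, and it has mean 0 when \<open>rate\<close> is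
  positive.\<close>

definition err :: "nat \<Rightarrow> int \<Rightarrow> 'a \<Rightarrow> real" where
  "err m t \<omega> = (arrived m t \<omega> - level m) * departures A S t \<omega>"

lemma window_one: "window 0 1 (\<lambda>_ _. 1)"
  unfolding window_def by (auto intro!: bexI[of _ "\<lambda>_. 1"])

lemma arrived_measurable[measurable]: "arrived m t \<in> borel_measurable M"
  unfolding arrived_def[abs_def] by measurable

lemma err_measurable[measurable]: "err m t \<in> borel_measurable M"
  unfolding err_def[abs_def] by measurable

end

section \<open>Joint limit of the sample roots\<close>

locale marked_sample = discrete_GI_G_infinity M A S G
  for M :: "'a measure" and A :: "int \<Rightarrow> 'a \<Rightarrow> nat" and S :: "int \<Rightarrow> nat \<Rightarrow> 'a \<Rightarrow> nat" and G :: "nat \<Rightarrow> real" +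
  fixes x :: "'i \<Rightarrow> nat" and J :: "'i set"
  assumes moment2: "integrable M (\<lambda>\<omega>. (real (A 0 \<omega>))\<^sup>2)" and service_tail: "summable (\<lambda>n. sqrt (1 - G (Suc n)))"
    and J: "finite J" "J \<noteq> {}" and x: "\<And>j. j \<in> J \<Longrightarrow> x j \<ge> 1" and G1: "\<And>j. j \<in> J \<Longrightarrow> G (x j) < 1"
begin

lemma weighted_one: "weighted (\<lambda>_ _. 1) t = departures A S t"
  by (simp add: fun_eq_iff weighted_def[OF moment2 window_one])

lemma departures_integrable: "integrable M (departures A S t)"
  and departures_expectation: "expectation (departures A S t) = rate"
  using weighted_integrable[OF moment2 window_one, of t] weighted_expectation[OF moment2 window_one, of t]
  by (simp_all add: weighted_one rate_def)

lemma departures_approximable: "approximable (\<lambda>t \<omega>. departures A S t \<omega> - rate)"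
  using approximable_weighted[OF moment2 window_one service_tail] by (simp add: weighted_one rate_def)

lemma rate_pos:
  assumes m: "m \<ge> 1" "G m < 1" shows "rate > 0"
proof -
  obtain \<tau> where \<tau>: "\<tau> > m" "svc \<tau> > 0" by (rule service_exceeds[OF m(2)])
  have s: "(\<lambda>i. expectation (summand (\<lambda>_ _. 1) 0 i 0)) sums rate"
    using weighted_expectation_sums[OF moment2 window_one, of 0] by (simp add: weighted_one rate_def)
  have e: "summand (\<lambda>_ _. 1) 0 i 0 = served 0 (Suc i) (0 - int (Suc i))" for i
    by (simp add: fun_eq_iff summand_def[OF moment2 window_one])
  have "0 < suminf (\<lambda>i. expectation (summand (\<lambda>_ _. 1) 0 i 0))"
  proof (rule suminf_pos2[of _ "\<tau> - 1"])
    show "summable (\<lambda>i. expectation (summand (\<lambda>_ _. 1) 0 i 0))" using s by (rule sums_summable)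
    show "0 \<le> expectation (summand (\<lambda>_ _. 1) 0 i 0)" for i
      unfolding e by (intro Bochner_Integration.integral_nonneg served_nonneg)
    have "expectation (summand (\<lambda>_ _. 1) 0 (\<tau> - 1) 0) = expectation (served 0 \<tau> (- int \<tau>))"
      using \<tau>(1) unfolding e by simp
    then show "0 < expectation (summand (\<lambda>_ _. 1) 0 (\<tau> - 1) 0)"
      using served_mean[OF m(1) \<tau> moment2 service_tail, of "- int \<tau>"] served_mean_pos[OF m(1) \<tau> moment2 service_tail] by simp
  qed
  then show ?thesis using s by (simp add: sums_iff)
qed

lemma weighted_arrived: "weighted (arrived m) t \<omega> = arrived m t \<omega> * departures A S t \<omega>"
  by (rule weighted_def[OF moment2 arrived_window])

lemma arrived_departures_integrable: "integrable M (\<lambda>\<omega>. arrived m t \<omega> * departures A S t \<omega>)"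
  using weighted_integrable[OF moment2 arrived_window[of m], of t] by (simp add: weighted_arrived[abs_def])

lemma arrived_departures_expectation:
  "expectation (\<lambda>\<omega>. arrived m t \<omega> * departures A S t \<omega>) = expectation (\<lambda>\<omega>. arrived m 0 \<omega> * departures A S 0 \<omega>)"
  using weighted_expectation[OF moment2 arrived_window[of m], of t] by (simp add: weighted_arrived[abs_def])

lemma err_integrable: "integrable M (err m t)"
  unfolding err_def[abs_def] left_diff_distrib
  using arrived_departures_integrable departures_integrable by simp

lemma err_expectation: "rate \<noteq> 0 \<Longrightarrow> expectation (err m t) = 0"
  unfolding err_def[abs_def] left_diff_distrib
  using arrived_departures_integrable departures_integrable departures_expectation[of t] arrived_departures_expectation[of m t]
  by (simp add: level_def)

lemma rate_positive: "rate > 0"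
  using J x G1 rate_pos by blast

definition comb :: "('i \<Rightarrow> real) \<Rightarrow> int \<Rightarrow> 'a \<Rightarrow> real" where
  "comb \<theta> t \<omega> = (\<Sum>j\<in>J. \<theta> j * err (x j) t \<omega>)"

text \<open>A linear combination of the weights is again a window weight, the sum of the
  \<open>x j\<close> bounding all window lengths. Hence \<open>approximable_weighted\<close> applies
  to the whole combination at once, as the Cramer-Wold argument requires.\<close>

lemma weight_window:
  "window (\<Sum>j\<in>J. x j) (\<Sum>j\<in>J. \<bar>\<theta> j\<bar> * (1 + \<bar>level (x j)\<bar>)) (\<lambda>t \<omega>. \<Sum>j\<in>J. \<theta> j * (arrived (x j) t \<omega> - level (x j)))"
  unfolding window_def
proof (intro conjI allI ballI)
  let ?N = "PiM UNIV (\<lambda>_. count_space UNIV) :: (int \<times> nat \<Rightarrow> nat) measure"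
  show "(\<lambda>\<omega>. \<Sum>j\<in>J. \<theta> j * (arrived (x j) t \<omega> - level (x j))) \<in> borel_measurable (slots {t - int (sum x J)..t - 1})" for t
  proof (intro borel_measurable_sum borel_measurable_times borel_measurable_diff borel_measurable_const)
    fix j assume "j \<in> J"
    then have "x j \<le> sum x J" using J by (intro member_le_sum) auto
    then have "{t - int (x j)..t - 1} \<subseteq> {t - int (sum x J)..t - 1}" by (auto simp del: of_nat_sum)
    moreover have "arrived (x j) t \<in> borel_measurable (slots {t - int (x j)..t - 1})"
      using arrived_window[of "x j", unfolded window_def, THEN conjunct1] by (rule spec)
    ultimately show "arrived (x j) t \<in> borel_measurable (slots {t - int (sum x J)..t - 1})"
      by (rule slots_mono)
  qed
  show "\<bar>\<Sum>j\<in>J. \<theta> j * (arrived (x j) t \<omega> - level (x j))\<bar> \<le> (\<Sum>j\<in>J. \<bar>\<theta> j\<bar> * (1 + \<bar>level (x j)\<bar>))" for t \<omega>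
  proof (rule order_trans[OF sum_abs], rule sum_mono)
    fix j
    have "\<bar>arrived (x j) t \<omega> - level (x j)\<bar> \<le> 1 + \<bar>level (x j)\<bar>" by (auto simp: arrived_eq)
    then show "\<bar>\<theta> j * (arrived (x j) t \<omega> - level (x j))\<bar> \<le> \<bar>\<theta> j\<bar> * (1 + \<bar>level (x j)\<bar>)"
      by (simp add: abs_mult mult_left_mono)
  qed
  have "\<forall>m. \<exists>f. f \<in> borel_measurable ?N \<and> (\<forall>t. \<forall>\<omega>\<in>space M. arrived m t \<omega> = f (config t \<omega>))"
    using arrived_window[unfolded window_def Bex_def, THEN conjunct2, THEN conjunct2] by (rule allI)
  from choice[OF this] obtain f where f: "\<forall>m. f m \<in> borel_measurable ?N \<and> (\<forall>t. \<forall>\<omega>\<in>space M. arrived m t \<omega> = f m (config t \<omega>))" ..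
  show "\<exists>f\<in>borel_measurable ?N. \<forall>t. \<forall>\<omega>\<in>space M. (\<Sum>j\<in>J. \<theta> j * (arrived (x j) t \<omega> - level (x j))) = f (config t \<omega>)"
  proof (rule bexI[of _ "\<lambda>c. \<Sum>j\<in>J. \<theta> j * (f (x j) c - level (x j))"])
    show "\<forall>t. \<forall>\<omega>\<in>space M. (\<Sum>j\<in>J. \<theta> j * (arrived (x j) t \<omega> - level (x j))) = (\<Sum>j\<in>J. \<theta> j * (f (x j) (config t \<omega>) - level (x j)))"
      using f by simp
    show "(\<lambda>c. \<Sum>j\<in>J. \<theta> j * (f (x j) c - level (x j))) \<in> borel_measurable ?N"
      by (intro borel_measurable_sum borel_measurable_times borel_measurable_diff borel_measurable_const f[rule_format, THEN conjunct1])
  qed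
qed

lemma comb_approximable: "approximable (comb \<theta>)"
proof -
  have w: "weighted (\<lambda>t \<omega>. \<Sum>j\<in>J. \<theta> j * (arrived (x j) t \<omega> - level (x j))) = comb \<theta>"
    by (simp add: fun_eq_iff weighted_def[OF moment2 weight_window] comb_def err_def sum_distrib_right mult.assoc)
  have "expectation (comb \<theta> 0) = 0"
    unfolding comb_def[abs_def] using err_integrable err_expectation rate_positive by (subst Bochner_Integration.integral_sum) auto
  then show ?thesis using approximable_weighted[OF moment2 weight_window service_tail, of \<theta>] by (simp add: w)
qed

lemma psum_comb: "psum (comb \<theta>) a n \<omega> = (\<Sum>j\<in>J. \<theta> j * psum (err (x j)) a n \<omega>)"
  unfolding psum_def comb_def by (subst sum.swap) (simp add: sum_distrib_left)

text \<open>The coefficient vector of the \<open>i\<close>-th coordinate plus \<open>s\<close> times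
  the \<open>j\<close>-th, also meaningful for \<open>i = j\<close>; it serves polarisation with
  \<open>s = 1\<close> and \<open>s = -1\<close>.\<close>

definition unit :: "'i \<Rightarrow> 'i \<Rightarrow> real \<Rightarrow> 'i \<Rightarrow> real" where
  "unit i j s = (\<lambda>k. (if k = i then 1 else 0) + (if k = j then s else 0))"

lemma sum_unit: "i \<in> J \<Longrightarrow> j \<in> J \<Longrightarrow> (\<Sum>k\<in>J. unit i j s k * f k) = f i + s * f j"
  using J by (simp add: unit_def distrib_right sum.distrib if_distrib[of "\<lambda>c. c * _"] cong: if_cong)

lemma comb_unit: "i \<in> J \<Longrightarrow> j \<in> J \<Longrightarrow> comb (unit i j s) t \<omega> = err (x i) t \<omega> + s * err (x j) t \<omega>"
  by (simp add: comb_def sum_unit)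

lemma psum_unit: "i \<in> J \<Longrightarrow> j \<in> J \<Longrightarrow> psum (comb (unit i j s)) a n \<omega> = psum (err (x i)) a n \<omega> + s * psum (err (x j)) a n \<omega>"
  by (simp add: psum_comb sum_unit)

lemma err_approximable:
  assumes j: "j \<in> J" shows "approximable (err (x j))"
proof -
  have "comb (unit j j 0) = err (x j)" by (simp add: fun_eq_iff comb_unit[OF j j])
  then show ?thesis using comb_approximable[of "unit j j 0"] by simp
qed

definition sigma :: "('i \<Rightarrow> real) \<Rightarrow> real" where
  "sigma \<theta> = lim (\<lambda>n. expectation (\<lambda>\<omega>. (psum (comb \<theta>) 0 n \<omega>)\<^sup>2) / real n)"

lemma sigma: "(\<lambda>n. expectation (\<lambda>\<omega>. (psum (comb \<theta>) 0 n \<omega>)\<^sup>2) / real n) \<longlonglongrightarrow> sigma \<theta>"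
proof -
  obtain s where "(\<lambda>n. expectation (\<lambda>\<omega>. (psum (comb \<theta>) 0 n \<omega>)\<^sup>2) / real n) \<longlonglongrightarrow> s"
    by (rule approximable_variance_limit[OF comb_approximable])
  then show ?thesis unfolding sigma_def by (simp add: limI)
qed

text \<open>Polarisation of the limiting variance. Only variances of linear combinations are known
  to converge, so covariances are defined through them.\<close>

definition Sg :: "'i \<Rightarrow> 'i \<Rightarrow> real" where
  "Sg i j = (sigma (unit i j 1) - sigma (unit i j (-1))) / 4"

lemma psum_square_integrable:
  "integrable M (\<lambda>\<omega>. (psum (comb \<theta>) a n \<omega>)\<^sup>2)" "j \<in> J \<Longrightarrow> integrable M (\<lambda>\<omega>. (psum (err (x j)) a n \<omega>)\<^sup>2)"
proof -
  have *: "integrable M (\<lambda>\<omega>. (psum Y a n \<omega>)\<^sup>2)" if "approximable Y" for Y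
    by (rule approximable_second_moment[OF that])
  show "integrable M (\<lambda>\<omega>. (psum (comb \<theta>) a n \<omega>)\<^sup>2)" by (rule *[OF comb_approximable])
  show "j \<in> J \<Longrightarrow> integrable M (\<lambda>\<omega>. (psum (err (x j)) a n \<omega>)\<^sup>2)" by (rule *[OF err_approximable])
qed

lemma psum_err_measurable[measurable]: "psum (err m) a n \<in> borel_measurable M" by measurable

lemma covariance_limit:
  assumes "i \<in> J" "j \<in> J"
  shows "(\<lambda>n. expectation (\<lambda>\<omega>. psum (err (x i)) 0 n \<omega> * psum (err (x j)) 0 n \<omega>) / real n) \<longlonglongrightarrow> Sg i j"
proof -
  have eq: "expectation (\<lambda>\<omega>. psum (err (x i)) 0 n \<omega> * psum (err (x j)) 0 n \<omega>) / real n
    = (expectation (\<lambda>\<omega>. (psum (comb (unit i j 1)) 0 n \<omega>)\<^sup>2) / real n - expectation (\<lambda>\<omega>. (psum (comb (unit i j (-1))) 0 n \<omega>)\<^sup>2) / real n) / 4" for n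
  proof -
    have "expectation (\<lambda>\<omega>. (psum (comb (unit i j 1)) 0 n \<omega>)\<^sup>2) - expectation (\<lambda>\<omega>. (psum (comb (unit i j (-1))) 0 n \<omega>)\<^sup>2)
      = expectation (\<lambda>\<omega>. (psum (comb (unit i j 1)) 0 n \<omega>)\<^sup>2 - (psum (comb (unit i j (-1))) 0 n \<omega>)\<^sup>2)"
      using psum_square_integrable(1) by simp
    also have "\<dots> = expectation (\<lambda>\<omega>. 4 * (psum (err (x i)) 0 n \<omega> * psum (err (x j)) 0 n \<omega>))"
      by (intro Bochner_Integration.integral_cong refl) (simp add: psum_unit assms power2_eq_square algebra_simps)
    finally show ?thesis by (simp add: diff_divide_distrib[symmetric])
  qed
  show ?thesis unfolding eq Sg_def
    by (intro tendsto_divide tendsto_diff tendsto_const sigma) simp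
qed

lemma sigma_quadratic: "sigma \<theta> = (\<Sum>i\<in>J. \<Sum>j\<in>J. \<theta> i * \<theta> j * Sg i j)"
proof (rule LIMSEQ_unique[OF sigma])
  have eq: "expectation (\<lambda>\<omega>. (psum (comb \<theta>) 0 n \<omega>)\<^sup>2) / real n
    = (\<Sum>i\<in>J. \<Sum>j\<in>J. \<theta> i * \<theta> j * (expectation (\<lambda>\<omega>. psum (err (x i)) 0 n \<omega> * psum (err (x j)) 0 n \<omega>) / real n))" for n
  proof -
    have i: "integrable M (\<lambda>\<omega>. psum (err (x i)) 0 n \<omega> * psum (err (x j)) 0 n \<omega>)" if "i \<in> J" "j \<in> J" for i j
      using that by (intro integrable_mult_of_squares psum_square_integrable psum_err_measurable)
    have "(psum (comb \<theta>) 0 n \<omega>)\<^sup>2 = (\<Sum>i\<in>J. \<Sum>j\<in>J. \<theta> i * \<theta> j * (psum (err (x i)) 0 n \<omega> * psum (err (x j)) 0 n \<omega>))" for \<omega>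
      unfolding psum_comb power2_eq_square sum_product by (intro sum.cong) (auto simp: algebra_simps)
    then have "expectation (\<lambda>\<omega>. (psum (comb \<theta>) 0 n \<omega>)\<^sup>2) = (\<Sum>i\<in>J. \<Sum>j\<in>J. \<theta> i * \<theta> j * expectation (\<lambda>\<omega>. psum (err (x i)) 0 n \<omega> * psum (err (x j)) 0 n \<omega>))"
      using i by (simp add: Bochner_Integration.integral_sum)
    then show ?thesis by (simp add: sum_divide_distrib)
  qed
  show "(\<lambda>n. expectation (\<lambda>\<omega>. (psum (comb \<theta>) 0 n \<omega>)\<^sup>2) / real n) \<longlonglongrightarrow> (\<Sum>i\<in>J. \<Sum>j\<in>J. \<theta> i * \<theta> j * Sg i j)"
    unfolding eq by (intro tendsto_sum tendsto_mult_left covariance_limit)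
qed

text \<open>The diagonal entry is the limit variance of departures weighted by the arrival indicator
  minus \<open>level (x j)\<close>, to which the projection bound
  \<open>weighted_variance_pos\<close> applies.\<close>

lemma Sg_diagonal_pos:
  assumes j: "j \<in> J" shows "Sg j j > 0"
proof -
  obtain \<tau> where \<tau>: "\<tau> > x j" "svc \<tau> > 0" by (rule service_exceeds[OF G1[OF j]])
  let ?w = "\<lambda>t \<omega>. arrived (x j) t \<omega> - level (x j)"
  have w: "weighted ?w t \<omega> = err (x j) t \<omega>" for t \<omega>
    unfolding err_def by (rule weighted_def[OF moment2 arrived_shift_window[OF x[OF j] \<tau> moment2 service_tail]])
  have "(\<lambda>t \<omega>. weighted ?w t \<omega> - expectation (weighted ?w 0)) = err (x j)"
    using err_expectation rate_positive by (simp add: w[abs_def])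
  then show ?thesis
    using weighted_variance_pos[OF x[OF j] \<tau> moment2 service_tail, of "level (x j)" "Sg j j"] covariance_limit[OF j j]
    by (simp add: power2_eq_square)
qed

lemma departures_average_second_moment:
  obtains C where "\<And>n. integrable M (\<lambda>\<omega>. (psum (departures A S) 0 n \<omega> - rate * real n)\<^sup>2)"
    "\<And>n. expectation (\<lambda>\<omega>. (psum (departures A S) 0 n \<omega> - rate * real n)\<^sup>2) \<le> C * real n"
proof -
  have e: "psum (\<lambda>t \<omega>. departures A S t \<omega> - rate) 0 n \<omega> = psum (departures A S) 0 n \<omega> - rate * real n" for n \<omega>
    by (simp add: psum_def sum_subtractf)
  obtain C :: real where "\<And>a n. integrable M (\<lambda>\<omega>. (psum (\<lambda>t \<omega>. departures A S t \<omega> - rate) a n \<omega>)\<^sup>2)"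
    "\<And>a n. expectation (\<lambda>\<omega>. (psum (\<lambda>t \<omega>. departures A S t \<omega> - rate) a n \<omega>)\<^sup>2) \<le> C * real n"
    by (rule approximable_second_moment[OF departures_approximable]) (rule that)
  from this[of 0] show ?thesis unfolding e by (rule that)
qed

definition sample_root :: "nat \<Rightarrow> 'i \<Rightarrow> 'a \<Rightarrow> real" where
  "sample_root n j \<omega> = sqrt (real n) * (ratio (\<Sum>i=1..n. arrived (x j) (int i) \<omega> * departures A S (int i) \<omega>)
    (\<Sum>i=1..n. departures A S (int i) \<omega>) - level (x j))"

lemma sample_root_measurable[measurable]: "sample_root n j \<in> borel_measurable M"
  unfolding sample_root_def[abs_def] ratio_def by measurable

text \<open>The numerator of the root is asymptotically Gaussian by \<open>approximable_clt\<close>,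
  and the mean departure number tends to \<open>rate\<close> by Chebyshev's inequality, so
  \<open>char_ratio_tendsto\<close> applies.\<close>

lemma sample_root_char:
  "(\<lambda>n. \<integral>\<omega>. iexp (\<Sum>j\<in>J. \<theta> j * sample_root n j \<omega>) \<partial>M)
    \<longlonglongrightarrow> complex_of_real (exp (- ((\<Sum>i\<in>J. \<Sum>j\<in>J. \<theta> i * \<theta> j * Sg i j) / rate\<^sup>2) / 2))"
proof -
  have "\<forall>j\<in>J. \<exists>C. \<forall>n. expectation (\<lambda>\<omega>. (psum (err (x j)) 0 n \<omega>)\<^sup>2) \<le> C * real n"
  proof
    fix j assume "j \<in> J"
    then show "\<exists>C. \<forall>n. expectation (\<lambda>\<omega>. (psum (err (x j)) 0 n \<omega>)\<^sup>2) \<le> C * real n"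
      by (rule approximable_second_moment[OF err_approximable]) (rule exI, rule allI)
  qed
  from bchoice[OF this] obtain C where C: "\<And>j n. j \<in> J \<Longrightarrow> expectation (\<lambda>\<omega>. (psum (err (x j)) 0 n \<omega>)\<^sup>2) \<le> C j * real n"
    by blast
  let ?C = "\<Sum>j\<in>J. \<bar>C j\<bar>"
  show ?thesis
  proof (rule char_ratio_tendsto[where num = "\<lambda>n j \<omega>. psum (err (x j)) 0 n \<omega> / sqrt (real n)"
        and den = "\<lambda>n \<omega>. psum (departures A S) 0 n \<omega> / real n" and d = rate and C = ?C])
    show "prob_space M" by unfold_locales
    show "finite J" by (rule J)
    show "(\<lambda>\<omega>. psum (err (x j)) 0 n \<omega> / sqrt (real n)) \<in> borel_measurable M" for n j by measurable
    show "sample_root n j \<in> borel_measurable M" for n j by measurable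
    show "(\<lambda>\<omega>. psum (departures A S) 0 n \<omega> / real n) \<in> borel_measurable M" for n by measurable
    show "rate > 0" by (rule rate_positive)
    show "\<forall>\<^sub>F n in sequentially. integrable M (\<lambda>\<omega>. (psum (err (x j)) 0 n \<omega> / sqrt (real n))\<^sup>2)
        \<and> (\<integral>\<omega>. (psum (err (x j)) 0 n \<omega> / sqrt (real n))\<^sup>2 \<partial>M) \<le> ?C" if j: "j \<in> J" for j
      using eventually_gt_at_top[of 0]
    proof eventually_elim
      case (elim n)
      have "C j \<le> ?C" using member_le_sum[of j J "\<lambda>j. \<bar>C j\<bar>"] j J by auto
      moreover have "expectation (\<lambda>\<omega>. (psum (err (x j)) 0 n \<omega>)\<^sup>2) / real n \<le> C j"
        using C[OF j, of n] elim by (simp add: divide_le_eq)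
      ultimately show ?case using psum_square_integrable(2)[OF j, of 0 n] by (simp add: power_divide)
    qed
    obtain K where K: "\<And>n. integrable M (\<lambda>\<omega>. (psum (departures A S) 0 n \<omega> - rate * real n)\<^sup>2)"
      "\<And>n. expectation (\<lambda>\<omega>. (psum (departures A S) 0 n \<omega> - rate * real n)\<^sup>2) \<le> K * real n"
      by (rule departures_average_second_moment) (rule that)
    show "(\<lambda>n. measure M {\<omega> \<in> space M. \<bar>psum (departures A S) 0 n \<omega> / real n - rate\<bar> \<ge> \<eta>}) \<longlonglongrightarrow> 0" if \<eta>: "\<eta> > 0" for \<eta>
    proof (rule Lim_null_comparison)
      show "(\<lambda>n. K / \<eta>\<^sup>2 / real n) \<longlonglongrightarrow> 0" by (rule lim_const_over_n)
      show "\<forall>\<^sub>F n in sequentially. norm (measure M {\<omega> \<in> space M. \<bar>psum (departures A S) 0 n \<omega> / real n - rate\<bar> \<ge> \<eta>}) \<le> K / \<eta>\<^sup>2 / real n"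
        using eventually_gt_at_top[of 0]
      proof eventually_elim
        case (elim n)
        let ?q = "\<lambda>\<omega>. psum (departures A S) 0 n \<omega> - rate * real n"
        have c: "(\<eta> \<le> \<bar>psum (departures A S) 0 n \<omega> / real n - rate\<bar>) = ((\<eta> * real n)\<^sup>2 \<le> (?q \<omega>)\<^sup>2)" for \<omega>
        proof -
          have "\<bar>psum (departures A S) 0 n \<omega> / real n - rate\<bar> = \<bar>?q \<omega>\<bar> / real n"
          proof -
            have "psum (departures A S) 0 n \<omega> / real n - rate = ?q \<omega> / real n"
              using elim by (simp add: diff_divide_distrib)
            then show ?thesis by (simp only: abs_divide abs_of_nat)
          qed
          then have "(\<eta> \<le> \<bar>psum (departures A S) 0 n \<omega> / real n - rate\<bar>) = (\<bar>\<eta> * real n\<bar> \<le> \<bar>?q \<omega>\<bar>)"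
            using elim \<eta> by (simp add: pos_le_divide_eq abs_mult)
          then show ?thesis by (simp only: abs_le_square_iff)
        qed
        have "measure M {\<omega> \<in> space M. (\<eta> * real n)\<^sup>2 \<le> (?q \<omega>)\<^sup>2} \<le> expectation (\<lambda>\<omega>. (?q \<omega>)\<^sup>2) / (\<eta> * real n)\<^sup>2"
          by (rule integral_Markov_inequality_measure[OF K(1), of "{}"]) (use elim \<eta> in auto)
        also have "\<dots> \<le> (K * real n) / (\<eta> * real n)\<^sup>2" by (intro divide_right_mono K(2)) simp
        also have "\<dots> = K / \<eta>\<^sup>2 / real n" using elim \<eta> by (simp add: power2_eq_square field_simps)
        finally show ?case by (simp add: c)
      qed
    qed
    show "\<forall>\<^sub>F n in sequentially. \<forall>j\<in>J. \<forall>\<omega>\<in>space M. psum (departures A S) 0 n \<omega> / real n > 0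
        \<longrightarrow> sample_root n j \<omega> = psum (err (x j)) 0 n \<omega> / sqrt (real n) / (psum (departures A S) 0 n \<omega> / real n)"
      using eventually_gt_at_top[of 0]
    proof eventually_elim
      case (elim n)
      show ?case
      proof (intro ballI impI)
        fix j \<omega> assume "psum (departures A S) 0 n \<omega> / real n > 0"
        then have D: "psum (departures A S) 0 n \<omega> > 0" using elim by (simp add: zero_less_divide_iff)
        have e: "psum (err (x j)) 0 n \<omega> = (\<Sum>i=1..n. arrived (x j) (int i) \<omega> * departures A S (int i) \<omega>) - level (x j) * psum (departures A S) 0 n \<omega>"
          by (simp add: psum_def err_def left_diff_distrib sum_subtractf sum_distrib_left)
        have r: "real n = sqrt (real n) * sqrt (real n)" by simp
        have s: "sqrt (real n) > 0" using elim by simp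
        have "sample_root n j \<omega> = sqrt (real n) * (psum (err (x j)) 0 n \<omega> / psum (departures A S) 0 n \<omega>)"
          using D unfolding sample_root_def ratio_def e by (simp add: psum_def diff_divide_distrib)
        also have "\<dots> = psum (err (x j)) 0 n \<omega> / sqrt (real n) / (psum (departures A S) 0 n \<omega> / (sqrt (real n) * sqrt (real n)))"
          using s D by (simp add: divide_simps)
        finally show "sample_root n j \<omega> = psum (err (x j)) 0 n \<omega> / sqrt (real n) / (psum (departures A S) 0 n \<omega> / real n)"
          by simp
      qed
    qed
    \<comment> \<open>The limiting denominator is moved into the coefficients, so that the theorem
      for \<open>comb\<close> gives the required characteristic function.\<close>
    let ?\<theta> = "\<lambda>j. \<theta> j / rate"
    have "(\<lambda>n. \<integral>\<omega>. iexp (psum (comb ?\<theta>) 0 n \<omega> / sqrt (real n)) \<partial>M) \<longlonglongrightarrow> complex_of_real (exp (- sigma ?\<theta> / 2))"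
      by (rule approximable_clt[OF comb_approximable sigma])
    moreover have "psum (comb ?\<theta>) 0 n \<omega> / sqrt (real n) = (\<Sum>j\<in>J. \<theta> j * (psum (err (x j)) 0 n \<omega> / sqrt (real n) / rate))" for n \<omega>
      by (simp add: psum_comb sum_divide_distrib mult.commute divide_divide_eq_left)
    moreover have "sigma ?\<theta> = (\<Sum>i\<in>J. \<Sum>j\<in>J. \<theta> i * \<theta> j * Sg i j) / rate\<^sup>2"
      by (simp add: sigma_quadratic sum_divide_distrib power2_eq_square)
    ultimately show "(\<lambda>n. \<integral>\<omega>. iexp (\<Sum>j\<in>J. \<theta> j * (psum (err (x j)) 0 n \<omega> / sqrt (real n) / rate)) \<partial>M)
      \<longlonglongrightarrow> complex_of_real (exp (- ((\<Sum>i\<in>J. \<Sum>j\<in>J. \<theta> i * \<theta> j * Sg i j) / rate\<^sup>2) / 2))" by simp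
  qed
qed

end

section \<open>Error terms of the bootstrap approximation\<close>

context prob_space
begin

text \<open>Convergence to 0 in mean for nonnegative variables: stable under finite sums, and
  sufficient for Markov's inequality at the end.\<close>

definition vanishing :: "(nat \<Rightarrow> 'a \<Rightarrow> real) \<Rightarrow> bool" where
  "vanishing Q \<longleftrightarrow> (\<forall>n. integrable M (Q n)) \<and> (\<forall>n \<omega>. 0 \<le> Q n \<omega>) \<and> (\<lambda>n. expectation (Q n)) \<longlonglongrightarrow> 0"

lemma vanishingI:
  assumes "\<And>n. integrable M (Q n)" and Q: "\<And>n \<omega>. 0 \<le> Q n \<omega>" and c: "c \<longlonglongrightarrow> 0"
    and le: "\<forall>\<^sub>F n in sequentially. expectation (Q n) \<le> c n"
  shows "vanishing Q"
proof -
  have "norm (expectation (Q n)) = expectation (Q n)" for n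
    using Bochner_Integration.integral_nonneg[of M "Q n"] Q by simp
  then have "(\<lambda>n. expectation (Q n)) \<longlonglongrightarrow> 0" using le by (intro Lim_null_comparison[OF _ c]) simp
  then show ?thesis using assms by (simp add: vanishing_def)
qed

lemma vanishing_add: "vanishing P \<Longrightarrow> vanishing Q \<Longrightarrow> vanishing (\<lambda>n \<omega>. P n \<omega> + Q n \<omega>)"
  using tendsto_add[of "\<lambda>n. expectation (P n)" 0 sequentially "\<lambda>n. expectation (Q n)" 0] by (simp add: vanishing_def)

lemma vanishing_sum:
  assumes I: "finite I" and Q: "\<And>i. i \<in> I \<Longrightarrow> vanishing (Q i)"
  shows "vanishing (\<lambda>n \<omega>. \<Sum>i\<in>I. Q i n \<omega>)"
  using I Q
proof (induction I)
  case empty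
  then show ?case by (simp add: vanishing_def)
next
  case (insert i I)
  then show ?case using vanishing_add[of "Q i" "\<lambda>n \<omega>. \<Sum>i\<in>I. Q i n \<omega>"] by simp
qed

end

locale bootstrap_blocks = marked_sample M A S G x J
  for M :: "'a measure" and A :: "int \<Rightarrow> 'a \<Rightarrow> nat" and S :: "int \<Rightarrow> nat \<Rightarrow> 'a \<Rightarrow> nat" and G :: "nat \<Rightarrow> real"
    and x :: "'i \<Rightarrow> nat" and J :: "'i set" +
  fixes B :: "nat \<Rightarrow> nat"
  assumes B_lim: "filterlim B at_top sequentially" and B_small: "(\<lambda>n. (real (B n))\<^sup>2 / real n) \<longlonglongrightarrow> 0"
begin

abbreviation starts_count :: "nat \<Rightarrow> nat" where "starts_count n \<equiv> n - B n + 1"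

lemma B_pos: "\<forall>\<^sub>F n in sequentially. B n \<ge> 1"
  using B_lim by (simp add: filterlim_at_top)

lemma B_square_le: "c > 0 \<Longrightarrow> \<forall>\<^sub>F n in sequentially. (real (B n))\<^sup>2 \<le> c * real n \<and> n > 0"
proof -
  assume "c > 0"
  from order_tendstoD(2)[OF B_small this] eventually_gt_at_top[of "0::nat"]
  show ?thesis
  proof eventually_elim
    case (elim n)
    then have "(real (B n))\<^sup>2 < c * real n" by (subst (asm) pos_divide_less_eq) auto
    then show ?case using elim by simp
  qed
qed

lemma B_le_square: "real (B n) \<le> (real (B n))\<^sup>2"
  using le_square[of "B n"] unfolding power2_eq_square of_nat_mult[symmetric] of_nat_le_iff .

text \<open>Eventually \<open>2 * B \<le> 2 * B\<^sup>2 \<le> n\<close>, so at least half of all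
  positions are block starts and rates in \<open>n\<close> carry over to rates in the number of
  starts.\<close>

lemma starts_count_ge: "\<forall>\<^sub>F n in sequentially. real n \<le> 2 * real (starts_count n) \<and> n > 0"
  using B_square_le[of "1/2", simplified]
proof eventually_elim
  case (elim n)
  have "n \<le> (n - B n) + B n" by simp
  then have 1: "real n \<le> real (n - B n) + real (B n)" unfolding of_nat_add[symmetric] of_nat_le_iff .
  have 2: "real (starts_count n) = real (n - B n) + 1" by simp
  have 3: "2 * (real (B n))\<^sup>2 \<le> real n" using elim by auto
  have "N \<le> 2 * L" if "N \<le> d + b" "L = d + 1" "2 * c \<le> N" "b \<le> c" for N L b c d :: real
    using that by linarith
  from this[OF 1 2 3 B_le_square] show ?case using elim by simp
qed

lemma blocks_small: "(\<lambda>n. (real (B n))\<^sup>2 / real (starts_count n)) \<longlonglongrightarrow> 0"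
proof (rule Lim_null_comparison)
  show "(\<lambda>n. 2 * ((real (B n))\<^sup>2 / real n)) \<longlonglongrightarrow> 0" using tendsto_mult_left[OF B_small, of 2] by simp
  show "\<forall>\<^sub>F n in sequentially. norm ((real (B n))\<^sup>2 / real (starts_count n)) \<le> 2 * ((real (B n))\<^sup>2 / real n)"
    using starts_count_ge
  proof eventually_elim
    case (elim n)
    have "(real (B n))\<^sup>2 / real (starts_count n) \<le> (real (B n))\<^sup>2 / (real n / 2)"
      using elim by (intro divide_left_mono) auto
    then show ?case by (simp add: mult.commute)
  qed
qed

lemma root_small: "(\<lambda>n. real (B n) / sqrt (real n)) \<longlonglongrightarrow> 0"
  using tendsto_real_sqrt[OF B_small] by (simp add: real_sqrt_divide)

lemma inverse_B: "(\<lambda>n. C / real (B n)) \<longlonglongrightarrow> 0"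
  by (intro tendsto_divide_0[OF tendsto_const] filterlim_at_top_imp_at_infinity
      filterlim_compose[OF filterlim_real_sequentially B_lim])

lemma block_count_lim: "filterlim (\<lambda>n. n div B n) at_top sequentially"
proof (rule filterlim_at_top_mono[OF B_lim])
  show "\<forall>\<^sub>F n in sequentially. B n \<le> n div B n"
    using B_square_le[of 1, simplified] B_pos
  proof eventually_elim
    case (elim n)
    then have "B n * B n \<le> n" by (auto simp: power2_eq_square simp flip: of_nat_mult)
    then show ?case using elim by (simp add: less_eq_div_iff_mult_less_eq)
  qed
qed

lemma block_count_ratio: "(\<lambda>n. real (n div B n) * real (B n) / real n) \<longlonglongrightarrow> 1"
proof (rule tendsto_sandwich)
  show "(\<lambda>n. 1 - (real (B n))\<^sup>2 / real n) \<longlonglongrightarrow> 1" using tendsto_diff[OF tendsto_const[of 1] B_small] by simp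
  show "\<forall>\<^sub>F n in sequentially. 1 - (real (B n))\<^sup>2 / real n \<le> real (n div B n) * real (B n) / real n"
    using eventually_gt_at_top[of 0] B_pos
  proof eventually_elim
    case (elim n)
    have "n = (n div B n) * B n + n mod B n" by simp
    moreover have "n mod B n \<le> B n" using elim by (simp add: less_imp_le)
    ultimately have "n \<le> (n div B n) * B n + B n" by linarith
    then have "real n \<le> real (n div B n) * real (B n) + real (B n)"
      unfolding of_nat_mult[symmetric] of_nat_add[symmetric] of_nat_le_iff .
    then have "real n - (real (B n))\<^sup>2 \<le> real (n div B n) * real (B n)" using B_le_square[of n] by linarith
    from divide_right_mono[OF this, of "real n"] show ?case using elim by (simp add: diff_divide_distrib)
  qed
  show "\<forall>\<^sub>F n in sequentially. real (n div B n) * real (B n) / real n \<le> 1"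
    using eventually_gt_at_top[of 0]
  proof eventually_elim
    case (elim n)
    have "real (n div B n * B n) \<le> real n" unfolding of_nat_le_iff by simp
    then show ?case using elim by (simp add: divide_le_eq)
  qed
qed simp

text \<open>The squared average over the starts already has mean of order
  \<open>B\<^sup>2 / L\<close>, and division by \<open>c n \<ge> 1\<close> only helps. The divisor
  is kept general because it will be \<open>B\<close> in one place and its square in
  another.\<close>

lemma average_vanishing:
  assumes Y: "approximable Y" and c: "\<And>n. 0 \<le> c n" "\<forall>\<^sub>F n in sequentially. c n \<ge> 1"
  shows "vanishing (\<lambda>n \<omega>. (avg (starts_count n) (\<lambda>q. psum Y (int q) (B n) \<omega>))\<^sup>2 / c n)"
proof -
  obtain C :: real where C: "C \<ge> 0" "\<And>a n. integrable M (\<lambda>\<omega>. (psum Y a n \<omega>)\<^sup>2)"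
    "\<And>a n. expectation (\<lambda>\<omega>. (psum Y a n \<omega>)\<^sup>2) \<le> C * real n"
    by (rule approximable_second_moment[OF Y]) (rule that)
  note E = approximable_average_second_moment[OF C(2,3) _ approximable_measurable[OF Y], folded avg_def]
  have L: "starts_count n > 0" for n by simp
  show ?thesis
  proof (rule vanishingI)
    show "integrable M (\<lambda>\<omega>. (avg (starts_count n) (\<lambda>q. psum Y (int q) (B n) \<omega>))\<^sup>2 / c n)" for n
      using E(1)[OF L] by (rule integrable_divide)
    show "0 \<le> (avg (starts_count n) (\<lambda>q. psum Y (int q) (B n) \<omega>))\<^sup>2 / c n" for n \<omega> using c(1)[of n] by simp
    show "(\<lambda>n. C * ((real (B n))\<^sup>2 / real (starts_count n))) \<longlonglongrightarrow> 0" using tendsto_mult_left[OF blocks_small, of C] by simp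
    show "\<forall>\<^sub>F n in sequentially. expectation (\<lambda>\<omega>. (avg (starts_count n) (\<lambda>q. psum Y (int q) (B n) \<omega>))\<^sup>2 / c n)
        \<le> C * ((real (B n))\<^sup>2 / real (starts_count n))"
      using c(2)
    proof eventually_elim
      case (elim n)
      let ?e = "expectation (\<lambda>\<omega>. (avg (starts_count n) (\<lambda>q. psum Y (int q) (B n) \<omega>))\<^sup>2)"
      have "?e / c n \<le> ?e / 1" using elim by (intro divide_left_mono Bochner_Integration.integral_nonneg) auto
      also have "?e / 1 \<le> C * (real (B n))\<^sup>2 / real (starts_count n)" using E(2)[OF L, of n "B n"] by simp
      finally show ?case by simp
    qed
  qed
qed

text \<open>A block sum has second moment of order \<open>B\<close>, so division by the square of
  \<open>B\<close> leaves order \<open>1 / B\<close>.\<close>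

lemma square_average_vanishing:
  assumes Y: "approximable Y"
  shows "vanishing (\<lambda>n \<omega>. avg (starts_count n) (\<lambda>q. (psum Y (int q) (B n) \<omega>)\<^sup>2) / (real (B n))\<^sup>2)"
proof -
  obtain C :: real where C: "C \<ge> 0" "\<And>a n. integrable M (\<lambda>\<omega>. (psum Y a n \<omega>)\<^sup>2)"
    "\<And>a n. expectation (\<lambda>\<omega>. (psum Y a n \<omega>)\<^sup>2) \<le> C * real n"
    by (rule approximable_second_moment[OF Y]) (rule that)
  show ?thesis
  proof (rule vanishingI[OF _ _ inverse_B[of C]])
    show "integrable M (\<lambda>\<omega>. avg (starts_count n) (\<lambda>q. (psum Y (int q) (B n) \<omega>)\<^sup>2) / (real (B n))\<^sup>2)" for n
      unfolding avg_def using C(2) by (intro integrable_divide Bochner_Integration.integrable_sum)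
    show "0 \<le> avg (starts_count n) (\<lambda>q. (psum Y (int q) (B n) \<omega>)\<^sup>2) / (real (B n))\<^sup>2" for n \<omega>
      by (intro divide_nonneg_nonneg avg_nonneg) auto
    show "\<forall>\<^sub>F n in sequentially. expectation (\<lambda>\<omega>. avg (starts_count n) (\<lambda>q. (psum Y (int q) (B n) \<omega>)\<^sup>2) / (real (B n))\<^sup>2) \<le> C / real (B n)"
      using B_pos
    proof eventually_elim
      case (elim n)
      let ?L = "starts_count n"
      have "expectation (\<lambda>\<omega>. avg ?L (\<lambda>q. (psum Y (int q) (B n) \<omega>)\<^sup>2) / (real (B n))\<^sup>2)
        = avg ?L (\<lambda>q. expectation (\<lambda>\<omega>. (psum Y (int q) (B n) \<omega>)\<^sup>2)) / (real (B n))\<^sup>2"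
        unfolding avg_def using C(2) by simp
      also have "\<dots> \<le> avg ?L (\<lambda>q. C * real (B n)) / (real (B n))\<^sup>2"
        by (intro divide_right_mono avg_mono C(3)) simp
      also have "avg ?L (\<lambda>q. C * real (B n)) = C * real (B n)" by (intro avg_const) simp
      also have "C * real (B n) / (real (B n))\<^sup>2 = C / real (B n)" using elim by (simp add: power2_eq_square)
      finally show ?case .
    qed
  qed
qed

definition variance_error :: "('i \<Rightarrow> real) \<Rightarrow> nat \<Rightarrow> 'a \<Rightarrow> real" where
  "variance_error \<theta> n \<omega> = \<bar>(\<Sum>q=1..starts_count n. (psum (comb \<theta>) (int q) (B n) \<omega>)\<^sup>2) / real (starts_count n * B n) - sigma \<theta>\<bar>"

lemma variance_error_vanishing: "vanishing (variance_error \<theta>)"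
  unfolding vanishing_def
proof (intro conjI allI)
  show "integrable M (variance_error \<theta> n)" for n
    unfolding variance_error_def[abs_def] using psum_square_integrable(1)
    by (intro integrable_abs Bochner_Integration.integrable_diff integrable_divide Bochner_Integration.integrable_sum integrable_const)
  show "0 \<le> variance_error \<theta> n \<omega>" for n \<omega> by (simp add: variance_error_def)
  show "(\<lambda>n. expectation (variance_error \<theta> n)) \<longlonglongrightarrow> 0"
    unfolding variance_error_def[abs_def]
    by (rule approximable_average_square[OF comb_approximable sigma B_lim _ blocks_small]) simp
qed

definition lindeberg_error :: "'i \<Rightarrow> nat \<Rightarrow> 'a \<Rightarrow> real" where
  "lindeberg_error j n \<omega> = real (n div B n) * avg (starts_count n) (\<lambda>q. mcs (psum (err (x j)) (int q) (B n) \<omega> / sqrt (real n)))"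

lemma lindeberg_error_vanishing:
  assumes j: "j \<in> J" shows "vanishing (lindeberg_error j)"
  unfolding vanishing_def
proof (intro conjI allI)
  have mcs: "integrable M (\<lambda>\<omega>. mcs (psum (err (x j)) a b \<omega> / sqrt (real n)))" for a b n
  proof (rule Bochner_Integration.integrable_bound)
    show "integrable M (\<lambda>\<omega>. (psum (err (x j)) a b \<omega>)\<^sup>2 / real n)"
      using psum_square_integrable(2)[OF j] by (rule integrable_divide)
    show "(\<lambda>\<omega>. mcs (psum (err (x j)) a b \<omega> / sqrt (real n))) \<in> borel_measurable M" unfolding mcs_def by measurable
    show "AE \<omega> in M. norm (mcs (psum (err (x j)) a b \<omega> / sqrt (real n))) \<le> norm ((psum (err (x j)) a b \<omega>)\<^sup>2 / real n)"
      using mcs_le_square[of "psum (err (x j)) a b _ / sqrt (real n)"] by (intro AE_I2) (simp add: mcs_nonneg power_divide)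
  qed
  show "integrable M (lindeberg_error j n)" for n
    unfolding lindeberg_error_def[abs_def] avg_def
    by (intro integrable_mult_right integrable_divide Bochner_Integration.integrable_sum mcs)
  show "0 \<le> lindeberg_error j n \<omega>" for n \<omega>
    unfolding lindeberg_error_def by (intro mult_nonneg_nonneg avg_nonneg mcs_nonneg) simp
  have "(\<lambda>n. expectation (\<lambda>\<omega>. real (n div B n) / real (starts_count n) * (\<Sum>i=1..starts_count n.
      mcs (psum (err (x j)) (int i) (B n) \<omega> / sqrt (real n))))) \<longlonglongrightarrow> 0"
    unfolding mcs_def by (rule approximable_lindeberg[OF err_approximable[OF j] _ _ root_small]) auto
  then show "(\<lambda>n. expectation (lindeberg_error j n)) \<longlonglongrightarrow> 0" by (simp add: lindeberg_error_def[abs_def] avg_def)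
qed

definition cdep :: "int \<Rightarrow> 'a \<Rightarrow> real" where
  "cdep t \<omega> = departures A S t \<omega> - rate"

lemma cdep_approximable: "approximable cdep"
  using departures_approximable by (simp add: cdep_def[abs_def])

text \<open>One variable dominating all data-dependent quantities in the limits of
  \<open>bootstrap_data\<close>. The errors for \<open>unit i j 1\<close> and
  \<open>unit i j (-1)\<close> stand for the covariance error, through polarisation.\<close>

definition total_error :: "nat \<Rightarrow> 'a \<Rightarrow> real" where
  "total_error n \<omega> = (\<Sum>i\<in>J. \<Sum>j\<in>J. variance_error (unit i j 1) n \<omega> + variance_error (unit i j (-1)) n \<omega>)
    + (\<Sum>j\<in>J. (avg (starts_count n) (\<lambda>q. psum (err (x j)) (int q) (B n) \<omega>))\<^sup>2 / real (B n) + lindeberg_error j n \<omega>)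
    + ((avg (starts_count n) (\<lambda>q. psum cdep (int q) (B n) \<omega>))\<^sup>2 / (real (B n))\<^sup>2
      + avg (starts_count n) (\<lambda>q. (psum cdep (int q) (B n) \<omega>)\<^sup>2) / (real (B n))\<^sup>2)"

lemma total_error_vanishing: "vanishing total_error"
proof -
  have "\<forall>\<^sub>F n in sequentially. real (B n) \<ge> 1" "\<forall>\<^sub>F n in sequentially. (real (B n))\<^sup>2 \<ge> 1"
    using B_pos by (eventually_elim, simp)+
  then show ?thesis unfolding total_error_def[abs_def]
    by (intro vanishing_add vanishing_sum J variance_error_vanishing lindeberg_error_vanishing
        average_vanishing square_average_vanishing err_approximable cdep_approximable) auto
qed

lemma total_error_bounds:
  shows "i \<in> J \<Longrightarrow> j \<in> J \<Longrightarrow> variance_error (unit i j 1) n \<omega> + variance_error (unit i j (-1)) n \<omega> \<le> total_error n \<omega>"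
    and "j \<in> J \<Longrightarrow> (avg (starts_count n) (\<lambda>q. psum (err (x j)) (int q) (B n) \<omega>))\<^sup>2 / real (B n) \<le> total_error n \<omega>"
    and "j \<in> J \<Longrightarrow> lindeberg_error j n \<omega> \<le> total_error n \<omega>"
    and "(avg (starts_count n) (\<lambda>q. psum cdep (int q) (B n) \<omega>))\<^sup>2 / (real (B n))\<^sup>2 \<le> total_error n \<omega>"
    and "avg (starts_count n) (\<lambda>q. (psum cdep (int q) (B n) \<omega>)\<^sup>2) / (real (B n))\<^sup>2 \<le> total_error n \<omega>"
proof -
  let ?v = "\<lambda>i j. variance_error (unit i j 1) n \<omega> + variance_error (unit i j (-1)) n \<omega>"
  let ?a = "\<lambda>j. (avg (starts_count n) (\<lambda>q. psum (err (x j)) (int q) (B n) \<omega>))\<^sup>2 / real (B n)"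
  let ?c = "(avg (starts_count n) (\<lambda>q. psum cdep (int q) (B n) \<omega>))\<^sup>2 / (real (B n))\<^sup>2"
  let ?e = "avg (starts_count n) (\<lambda>q. (psum cdep (int q) (B n) \<omega>)\<^sup>2) / (real (B n))\<^sup>2"
  have v: "0 \<le> ?v i j" for i j by (simp add: variance_error_def)
  have a: "0 \<le> ?a j" for j by simp
  have l: "0 \<le> lindeberg_error j n \<omega>" for j
    unfolding lindeberg_error_def by (intro mult_nonneg_nonneg avg_nonneg mcs_nonneg) simp
  have c: "0 \<le> ?c" by simp
  have e: "0 \<le> ?e" by (intro divide_nonneg_nonneg avg_nonneg) auto
  have V: "0 \<le> (\<Sum>i\<in>J. \<Sum>j\<in>J. ?v i j)" by (intro sum_nonneg v)
  have W: "0 \<le> (\<Sum>j\<in>J. ?a j + lindeberg_error j n \<omega>)" by (intro sum_nonneg add_nonneg_nonneg a l)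
  show "?c \<le> total_error n \<omega>" "?e \<le> total_error n \<omega>" using V W c e by (simp_all add: total_error_def)
  {
    assume j: "j \<in> J"
    have "?a j + lindeberg_error j n \<omega> \<le> (\<Sum>j\<in>J. ?a j + lindeberg_error j n \<omega>)"
      using j J(1) by (intro member_le_sum add_nonneg_nonneg a l) auto
    then have "?a j + lindeberg_error j n \<omega> \<le> total_error n \<omega>" unfolding total_error_def using V c e by linarith
    then show "?a j \<le> total_error n \<omega>" "lindeberg_error j n \<omega> \<le> total_error n \<omega>" using a[of j] l[of j] by linarith+
  }
  assume ij: "i \<in> J" "j \<in> J"
  have "?v i j \<le> (\<Sum>j\<in>J. ?v i j)" using ij J(1) by (intro member_le_sum v) auto
  also have "\<dots> \<le> (\<Sum>i\<in>J. \<Sum>j\<in>J. ?v i j)" using ij J(1) by (intro member_le_sum[of i J "\<lambda>i. \<Sum>j\<in>J. ?v i j"] sum_nonneg v) auto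
  finally show "?v i j \<le> total_error n \<omega>" unfolding total_error_def using W c e by linarith
qed

text \<open>The same polarisation that defines \<open>Sg\<close>, applied to the empirical block
  moments.\<close>

lemma covariance_error:
  assumes ij: "i \<in> J" "j \<in> J"
  shows "\<bar>avg (starts_count n) (\<lambda>q. psum (err (x i)) (int q) (B n) \<omega> * psum (err (x j)) (int q) (B n) \<omega>) / real (B n) - Sg i j\<bar>
    \<le> total_error n \<omega>"
proof -
  let ?Q = "\<lambda>s. \<Sum>q=1..starts_count n. (psum (comb (unit i j s)) (int q) (B n) \<omega>)\<^sup>2"
  let ?P = "\<Sum>q=1..starts_count n. psum (err (x i)) (int q) (B n) \<omega> * psum (err (x j)) (int q) (B n) \<omega>"
  let ?d = "real (starts_count n * B n)"
  have "?Q 1 - ?Q (-1) = (\<Sum>q=1..starts_count n. 4 * (psum (err (x i)) (int q) (B n) \<omega> * psum (err (x j)) (int q) (B n) \<omega>))"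
    unfolding sum_subtractf[symmetric]
    by (intro sum.cong refl) (simp add: psum_unit ij power2_eq_square algebra_simps)
  then have "?Q 1 - ?Q (-1) = 4 * ?P" by (simp add: sum_distrib_left)
  then have P: "?P = (?Q 1 - ?Q (-1)) / 4" by simp
  have "avg (starts_count n) (\<lambda>q. psum (err (x i)) (int q) (B n) \<omega> * psum (err (x j)) (int q) (B n) \<omega>) / real (B n) = ?P / ?d"
    unfolding avg_def by (simp only: divide_divide_eq_left of_nat_mult)
  also have "\<dots> = (?Q 1 / ?d - ?Q (-1) / ?d) / 4" unfolding P by (simp only: diff_divide_distrib divide_divide_eq_left mult.commute)
  finally have eq: "avg (starts_count n) (\<lambda>q. psum (err (x i)) (int q) (B n) \<omega> * psum (err (x j)) (int q) (B n) \<omega>) / real (B n)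
    = (?Q 1 / ?d - ?Q (-1) / ?d) / 4" .
  have tri: "\<bar>(a - b) / 4 - (s - t) / 4\<bar> \<le> \<bar>a - s\<bar> + \<bar>b - t\<bar>" for a b s t :: real
  proof -
    have "\<bar>(a - b) / 4 - (s - t) / 4\<bar> = \<bar>(a - s) - (b - t)\<bar> / 4" by (simp flip: diff_divide_distrib add: algebra_simps)
    also have "\<dots> \<le> (\<bar>a - s\<bar> + \<bar>b - t\<bar>) / 4" by (intro divide_right_mono abs_triangle_ineq4) simp
    also have "\<dots> \<le> \<bar>a - s\<bar> + \<bar>b - t\<bar>" using abs_ge_zero[of "a - s"] abs_ge_zero[of "b - t"] by simp
    finally show ?thesis .
  qed
  show ?thesis
    unfolding eq Sg_def using total_error_bounds(1)[OF ij, of n \<omega>] tri unfolding variance_error_def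
    by (rule order_trans[rotated])
qed

definition boot_root :: "nat \<Rightarrow> 'a \<Rightarrow> 'i \<Rightarrow> (nat \<Rightarrow> nat) \<Rightarrow> real" where
  "boot_root n \<omega> j I = sqrt (real n) *
    (ratio (bootstrap_sum n (B n) I (\<lambda>t. arrived (x j) t \<omega> * departures A S t \<omega>)) (bootstrap_sum n (B n) I (\<lambda>t. departures A S t \<omega>))
     - ratio (measure_pmf.expectation (block_starts n (B n)) (\<lambda>I. 1 / real n * bootstrap_sum n (B n) I (\<lambda>t. arrived (x j) t \<omega> * departures A S t \<omega>)))
        (measure_pmf.expectation (block_starts n (B n)) (\<lambda>I. 1 / real n * bootstrap_sum n (B n) I (\<lambda>t. departures A S t \<omega>))))"

lemma block_sum_err:
  "block_sum (\<lambda>t. arrived (x j) t \<omega> * departures A S t \<omega> - level (x j) * departures A S t \<omega>) b q = psum (err (x j)) (int q) b \<omega>"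
  by (simp add: block_sum_def psum_def err_def left_diff_distrib)

lemma block_sum_departures: "block_sum (\<lambda>t. departures A S t \<omega>) b q = psum cdep (int q) b \<omega> + rate * real b"
  by (simp add: block_sum_def psum_def cdep_def sum_subtractf)

text \<open>Sample sizes and sample points may be chosen arbitrarily as long as
  \<open>total_error\<close> vanishes along them. No probability of the data is involved; each
  assumption of \<open>bootstrap_data\<close> is squeezed by \<open>total_error\<close>.\<close>

lemma boot_root_char:
  assumes N: "filterlim N at_top sequentially" and err0: "(\<lambda>\<nu>. total_error (N \<nu>) (w \<nu>)) \<longlonglongrightarrow> 0"
  shows "(\<lambda>\<nu>. \<integral>I. iexp (\<Sum>j\<in>J. \<theta> j * boot_root (N \<nu>) (w \<nu>) j I) \<partial>measure_pmf (block_starts (N \<nu>) (B (N \<nu>))))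
    \<longlonglongrightarrow> complex_of_real (exp (- ((\<Sum>i\<in>J. \<Sum>j\<in>J. \<theta> i * \<theta> j * Sg i j) / rate\<^sup>2) / 2))"
proof -
  let ?X = "\<lambda>\<nu> j t. arrived (x j) t (w \<nu>) * departures A S t (w \<nu>)" and ?D = "\<lambda>\<nu> t. departures A S t (w \<nu>)"
  have squeeze: "f \<longlonglongrightarrow> c" if "\<And>\<nu>. \<bar>f \<nu> - c\<bar> \<le> total_error (N \<nu>) (w \<nu>)" for f and c :: real
    using Lim_null_comparison[OF always_eventually err0, of "\<lambda>\<nu>. f \<nu> - c"] that LIM_zero_cancel by force
  have BD: "bootstrap_data N (\<lambda>\<nu>. B (N \<nu>)) ?D ?X (\<lambda>j. level (x j)) J Sg rate"
  proof (rule bootstrap_data.intro)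
    show "finite J" by (rule J)
    show "0 < rate" by (rule rate_positive)
    show "filterlim (\<lambda>\<nu>. N \<nu> div B (N \<nu>)) sequentially sequentially" by (rule filterlim_compose[OF block_count_lim N])
    show "(\<lambda>\<nu>. real (N \<nu> div B (N \<nu>)) * real (B (N \<nu>)) / real (N \<nu>)) \<longlonglongrightarrow> 1"
      by (rule filterlim_compose[OF block_count_ratio N])
  next
    fix i j assume "i \<in> J" "j \<in> J"
    then show "(\<lambda>\<nu>. avg (starts_count (N \<nu>)) (\<lambda>q. block_sum (\<lambda>t. ?X \<nu> i t - level (x i) * ?D \<nu> t) (B (N \<nu>)) q
        * block_sum (\<lambda>t. ?X \<nu> j t - level (x j) * ?D \<nu> t) (B (N \<nu>)) q) / real (B (N \<nu>))) \<longlonglongrightarrow> Sg i j"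
      unfolding block_sum_err by (intro squeeze covariance_error)
  next
    fix j assume j: "j \<in> J"
    show "(\<lambda>\<nu>. (avg (starts_count (N \<nu>)) (block_sum (\<lambda>t. ?X \<nu> j t - level (x j) * ?D \<nu> t) (B (N \<nu>))))\<^sup>2 / real (B (N \<nu>))) \<longlonglongrightarrow> 0"
      using total_error_bounds(2)[OF j] by (intro squeeze) (simp add: block_sum_err[abs_def])
    have "0 \<le> lindeberg_error j n \<omega>" for n \<omega>
      unfolding lindeberg_error_def by (intro mult_nonneg_nonneg avg_nonneg mcs_nonneg) simp
    then have "(\<lambda>\<nu>. lindeberg_error j (N \<nu>) (w \<nu>)) \<longlonglongrightarrow> 0" using total_error_bounds(3)[OF j] by (intro squeeze) simp
    then show "(\<lambda>\<nu>. real (N \<nu> div B (N \<nu>)) * avg (starts_count (N \<nu>)) (\<lambda>q. mcs (block_sum (\<lambda>t. ?X \<nu> j t - level (x j) * ?D \<nu> t) (B (N \<nu>)) q / sqrt (real (N \<nu>))))) \<longlonglongrightarrow> 0"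
      unfolding block_sum_err lindeberg_error_def .
  next
    have "(\<lambda>\<nu>. avg (starts_count (N \<nu>)) (block_sum (?D \<nu>) (B (N \<nu>))) / real (B (N \<nu>)) - rate) \<longlonglongrightarrow> 0"
    proof (rule Lim_null_comparison)
      show "(\<lambda>\<nu>. sqrt (total_error (N \<nu>) (w \<nu>))) \<longlonglongrightarrow> 0" using tendsto_real_sqrt[OF err0] by simp
      show "\<forall>\<^sub>F \<nu> in sequentially. norm (avg (starts_count (N \<nu>)) (block_sum (?D \<nu>) (B (N \<nu>))) / real (B (N \<nu>)) - rate) \<le> sqrt (total_error (N \<nu>) (w \<nu>))"
        using eventually_compose_filterlim[OF B_pos N]
      proof eventually_elim
        case (elim \<nu>)
        let ?a = "avg (starts_count (N \<nu>)) (\<lambda>q. psum cdep (int q) (B (N \<nu>)) (w \<nu>))"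
        have "avg (starts_count (N \<nu>)) (block_sum (?D \<nu>) (B (N \<nu>))) = ?a + rate * real (B (N \<nu>))"
          unfolding block_sum_departures[abs_def] avg_add by (simp add: avg_const)
        then have e: "avg (starts_count (N \<nu>)) (block_sum (?D \<nu>) (B (N \<nu>))) / real (B (N \<nu>)) - rate = ?a / real (B (N \<nu>))"
          using elim by (simp add: add_divide_distrib)
        have "norm (?a / real (B (N \<nu>))) = sqrt (?a\<^sup>2 / (real (B (N \<nu>)))\<^sup>2)" by (simp add: real_sqrt_divide)
        also have "\<dots> \<le> sqrt (total_error (N \<nu>) (w \<nu>))" by (intro real_sqrt_le_mono total_error_bounds(4))
        finally show ?case unfolding e .
      qed
    qed
    then show "(\<lambda>\<nu>. avg (starts_count (N \<nu>)) (block_sum (?D \<nu>) (B (N \<nu>))) / real (B (N \<nu>))) \<longlonglongrightarrow> rate" by (rule LIM_zero_cancel)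
    have "0 \<le> avg (starts_count n) (\<lambda>q. (psum cdep (int q) (B n) \<omega>)\<^sup>2) / (real (B n))\<^sup>2" for n \<omega>
      by (intro divide_nonneg_nonneg avg_nonneg) auto
    then show "(\<lambda>\<nu>. avg (starts_count (N \<nu>)) (\<lambda>q. (block_sum (?D \<nu>) (B (N \<nu>)) q - rate * real (B (N \<nu>)))\<^sup>2) / (real (B (N \<nu>)))\<^sup>2) \<longlonglongrightarrow> 0"
      unfolding block_sum_departures add_diff_cancel_right'
      using total_error_bounds(5) by (intro squeeze) (simp only: diff_zero abs_of_nonneg)
  qed
  show ?thesis
    using bootstrap_data.bootstrap_char_tendsto[OF BD, of \<theta>] unfolding bootstrap_data.root_error_def[OF BD] boot_root_def .
qed

text \<open>Passage from sequences to a uniform threshold: if none worked, failing sample sizes and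
  sample points with smaller and smaller \<open>total_error\<close> could be chosen, and along them
  the characteristic functions of both roots would have the same limit. The threshold does not
  depend on the data.\<close>

theorem bootstrap_approximates:
  assumes \<epsilon>: "\<epsilon> > 0"
  shows "\<exists>\<delta>>0. \<exists>n0. \<forall>n\<ge>n0. \<forall>\<omega>. total_error n \<omega> < \<delta> \<longrightarrow>
    (\<forall>y. \<bar>measure M {\<omega>' \<in> space M. \<forall>j\<in>J. sample_root n j \<omega>' \<le> y j}
      - measure_pmf.prob (block_starts n (B n)) {I. \<forall>j\<in>J. boot_root n \<omega> j I \<le> y j}\<bar> \<le> \<epsilon>)"
    (is "\<exists>\<delta>>0. \<exists>n0. \<forall>n\<ge>n0. \<forall>\<omega>. total_error n \<omega> < \<delta> \<longrightarrow> ?good n \<omega>")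
proof (rule ccontr)
  assume c: "\<not> ?thesis"
  \<comment> \<open>The failing sample size and sample point are chosen together; taking the size at
    least \<open>\<nu>\<close> makes it tend to infinity.\<close>
  have "\<forall>\<nu>. \<exists>p. fst p \<ge> \<nu> \<and> total_error (fst p) (snd p) < 1 / real (Suc \<nu>) \<and> \<not> ?good (fst p) (snd p)"
  proof
    fix \<nu>
    have "\<not> (\<exists>n0. \<forall>n\<ge>n0. \<forall>\<omega>. total_error n \<omega> < 1 / real (Suc \<nu>) \<longrightarrow> ?good n \<omega>)" using c by auto
    then have "\<not> (\<forall>n\<ge>\<nu>. \<forall>\<omega>. total_error n \<omega> < 1 / real (Suc \<nu>) \<longrightarrow> ?good n \<omega>)" by (rule contrapos_nn) (rule exI)
    then obtain n \<omega> where "n \<ge> \<nu>" "total_error n \<omega> < 1 / real (Suc \<nu>)" "\<not> ?good n \<omega>" by auto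
    then show "\<exists>p. fst p \<ge> \<nu> \<and> total_error (fst p) (snd p) < 1 / real (Suc \<nu>) \<and> \<not> ?good (fst p) (snd p)"
      by (intro exI[of _ "(n, \<omega>)"]) simp
  qed
  from choice[OF this] obtain p where p: "\<forall>\<nu>. fst (p \<nu>) \<ge> \<nu> \<and> total_error (fst (p \<nu>)) (snd (p \<nu>)) < 1 / real (Suc \<nu>)
    \<and> \<not> ?good (fst (p \<nu>)) (snd (p \<nu>))" ..
  define N where "N \<nu> = fst (p \<nu>)" for \<nu>
  define w where "w \<nu> = snd (p \<nu>)" for \<nu>
  have N1: "\<nu> \<le> N \<nu>" and e1: "total_error (N \<nu>) (w \<nu>) < 1 / real (Suc \<nu>)" and bad: "\<not> ?good (N \<nu>) (w \<nu>)" for \<nu>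
    using p by (simp_all add: N_def w_def)
  have N: "filterlim N at_top sequentially"
    by (rule filterlim_at_top_mono[OF filterlim_ident]) (simp add: N1)
  have "0 \<le> total_error n \<omega>" for n \<omega> using total_error_vanishing by (simp add: vanishing_def)
  then have e0: "(\<lambda>\<nu>. total_error (N \<nu>) (w \<nu>)) \<longlonglongrightarrow> 0"
    using e1 by (intro Lim_null_comparison[OF always_eventually LIMSEQ_Suc[OF lim_1_over_n]]) (simp add: less_imp_le)
  let ?\<phi> = "\<lambda>\<theta>. complex_of_real (exp (- ((\<Sum>i\<in>J. \<Sum>j\<in>J. \<theta> i * \<theta> j * Sg i j) / rate\<^sup>2) / 2))"
  have "\<forall>\<^sub>F \<nu> in sequentially. \<forall>y. \<bar>measure M {\<omega> \<in> space M. \<forall>j\<in>J. sample_root (N \<nu>) j \<omega> \<le> y j}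
      - measure (measure_pmf (block_starts (N \<nu>) (B (N \<nu>))))
          {I \<in> space (measure_pmf (block_starts (N \<nu>) (B (N \<nu>)))). \<forall>j\<in>J. boot_root (N \<nu>) (w \<nu>) j I \<le> y j}\<bar> \<le> \<epsilon>"
  proof (rule char_tendsto_imp_cdf_diff[where P = "\<lambda>_. M" and Q = "\<lambda>\<nu>. measure_pmf (block_starts (N \<nu>) (B (N \<nu>)))" and J = J
        and V = "\<lambda>\<nu>. sample_root (N \<nu>)" and W = "\<lambda>\<nu>. boot_root (N \<nu>) (w \<nu>)" and \<phi> = ?\<phi>
        and s = "\<lambda>j. sqrt (Sg j j) / rate" and \<epsilon> = \<epsilon>])
    show "prob_space M" by unfold_locales
    show "prob_space (measure_pmf (block_starts (N n) (B (N n))))" for n by (rule measure_pmf.prob_space_axioms)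
    show "finite J" by (rule J)
    show "sample_root (N n) j \<in> borel_measurable M" for n j by measurable
    show "boot_root (N n) (w n) j \<in> borel_measurable (measure_pmf (block_starts (N n) (B (N n))))" for n j by simp
    show "(\<lambda>n. \<integral>\<omega>. iexp (\<Sum>j\<in>J. \<theta> j * sample_root (N n) j \<omega>) \<partial>M) \<longlonglongrightarrow> ?\<phi> \<theta>" for \<theta>
      by (rule filterlim_compose[OF sample_root_char N])
    show "(\<lambda>\<nu>. \<integral>I. iexp (\<Sum>j\<in>J. \<theta> j * boot_root (N \<nu>) (w \<nu>) j I) \<partial>measure_pmf (block_starts (N \<nu>) (B (N \<nu>)))) \<longlonglongrightarrow> ?\<phi> \<theta>" for \<theta>
      by (rule boot_root_char[OF N e0])
    show "\<epsilon> > 0" by (rule \<epsilon>)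
    fix j assume j: "j \<in> J"
    show "0 < sqrt (Sg j j) / rate" using Sg_diagonal_pos[OF j] rate_positive by simp
    show "?\<phi> (\<lambda>i. if i = j then t else 0) = complex_of_real (exp (- (t * (sqrt (Sg j j) / rate))\<^sup>2 / 2))" for t
    proof -
      have "(\<Sum>i\<in>J. \<Sum>k\<in>J. (if i = j then t else 0) * (if k = j then t else 0) * Sg i k)
        = (\<Sum>i\<in>J. if i = j then t * t * Sg j j else 0)"
        using J j by (intro sum.cong refl) (auto simp: if_distrib[of "\<lambda>c. _ * c"] if_distrib[of "\<lambda>c. c * _"] cong: if_cong)
      also have "\<dots> = t * t * Sg j j" using J j by simp
      finally show ?thesis
        using Sg_diagonal_pos[OF j] by (simp add: power_mult_distrib power_divide power2_eq_square[of t])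
    qed
  qed
  then show False using bad by (auto dest!: eventually_happens)
qed

end

lemma integral_of_bool: "(\<integral>\<omega>. (of_bool (Q \<omega>) :: real) \<partial>P) = measure P {\<omega> \<in> space P. Q \<omega>}"
proof -
  have "(\<integral>\<omega>. (of_bool (Q \<omega>) :: real) \<partial>P) = (\<integral>\<omega>. indicator {\<omega>. Q \<omega>} \<omega> \<partial>P)"
    by (intro Bochner_Integration.integral_cong) (auto simp: indicator_def)
  then show ?thesis by (simp add: Int_def conj_commute)
qed

text \<open>Dominated convergence: if some coordinate exceeds \<open>y j\<close>, it eventually
  exceeds the approaching bound as well; otherwise it stays below all bounds, which approach from
  above.\<close>

lemma distribution_right_continuous:
  fixes V :: "'j \<Rightarrow> 'b \<Rightarrow> real"
  assumes P: "prob_space P" and J: "finite J" and [measurable]: "\<And>j. j \<in> J \<Longrightarrow> V j \<in> borel_measurable P"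
    and ge: "\<And>m j. y j \<le> z m j" and lim: "\<And>j. (\<lambda>m. z m j) \<longlonglongrightarrow> y j"
  shows "(\<lambda>m. measure P {\<omega> \<in> space P. \<forall>j\<in>J. V j \<omega> \<le> z m j}) \<longlonglongrightarrow> measure P {\<omega> \<in> space P. \<forall>j\<in>J. V j \<omega> \<le> y j}"
proof -
  interpret prob_space P by (rule P)
  have "(\<lambda>m. \<integral>\<omega>. of_bool (\<forall>j\<in>J. V j \<omega> \<le> z m j) \<partial>P) \<longlonglongrightarrow> (\<integral>\<omega>. (of_bool (\<forall>j\<in>J. V j \<omega> \<le> y j) :: real) \<partial>P)"
  proof (rule integral_dominated_convergence[where w = "\<lambda>_. 1"])
    show "(\<lambda>\<omega>. of_bool (\<forall>j\<in>J. V j \<omega> \<le> y j) :: real) \<in> borel_measurable P" using J by measurable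
    show "(\<lambda>\<omega>. of_bool (\<forall>j\<in>J. V j \<omega> \<le> z m j) :: real) \<in> borel_measurable P" for m using J by measurable
    show "AE \<omega> in P. (\<lambda>m. of_bool (\<forall>j\<in>J. V j \<omega> \<le> z m j) :: real) \<longlonglongrightarrow> of_bool (\<forall>j\<in>J. V j \<omega> \<le> y j)"
    proof (rule AE_I2)
      fix \<omega>
      show "(\<lambda>m. of_bool (\<forall>j\<in>J. V j \<omega> \<le> z m j) :: real) \<longlonglongrightarrow> of_bool (\<forall>j\<in>J. V j \<omega> \<le> y j)"
      proof (cases "\<forall>j\<in>J. V j \<omega> \<le> y j")
        case True
        then have "\<forall>j\<in>J. V j \<omega> \<le> z m j" for m using ge order_trans by blast
        then show ?thesis using True by simp
      next
        case False
        then obtain j where j: "j \<in> J" "y j < V j \<omega>" by auto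
        have "\<forall>\<^sub>F m in sequentially. z m j < V j \<omega>" by (rule order_tendstoD(2)[OF lim j(2)])
        then have "\<forall>\<^sub>F m in sequentially. (of_bool (\<forall>j\<in>J. V j \<omega> \<le> z m j) :: real) = of_bool (\<forall>j\<in>J. V j \<omega> \<le> y j)"
          by eventually_elim (use False j(1) in \<open>auto simp: not_le\<close>)
        then show ?thesis by (rule tendsto_eventually)
      qed
    qed
  qed auto
  then show ?thesis by (simp add: integral_of_bool)
qed

definition rational_vectors :: "(real ^ 'l) set" where
  "rational_vectors = {y. \<forall>j. y $ j \<in> \<rat>}"

lemma countable_rational_vectors: "countable (rational_vectors :: (real ^ 'l::finite) set)"
proof -
  have "countable (PiE (UNIV :: 'l set) (\<lambda>_. \<rat> :: real set))" by (intro countable_PiE) (auto simp: countable_rat)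
  then have "countable ((\<lambda>f. \<chi> j. f j) ` PiE (UNIV :: 'l set) (\<lambda>_. \<rat> :: real set))" by (rule countable_image)
  moreover have "(rational_vectors :: (real ^ 'l) set) \<subseteq> (\<lambda>f. \<chi> j. f j) ` PiE (UNIV :: 'l set) (\<lambda>_. \<rat> :: real set)"
  proof
    fix y :: "real ^ 'l" assume "y \<in> rational_vectors"
    then have "(\<lambda>j. y $ j) \<in> PiE UNIV (\<lambda>_. \<rat>)" by (auto simp: rational_vectors_def)
    then show "y \<in> (\<lambda>f. \<chi> j. f j) ` PiE (UNIV :: 'l set) (\<lambda>_. \<rat> :: real set)"
      by (intro image_eqI[of _ _ "\<lambda>j. y $ j"]) (auto simp: vec_eq_iff)
  qed
  ultimately show ?thesis by (rule countable_subset[rotated])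
qed

text \<open>Every vector is approached from above by rational ones, along which \<open>g\<close>
  converges to its value there. The supremum over an uncountable set is thereby governed by
  countably many values, which gives its measurability.\<close>

lemma SUP_le_iff_rational:
  fixes g :: "real ^ 'l \<Rightarrow> real"
  assumes right: "\<And>y z. (\<And>m j. y $ j \<le> z m $ j) \<Longrightarrow> (\<And>j. (\<lambda>m. z m $ j) \<longlonglongrightarrow> y $ j) \<Longrightarrow> (\<lambda>m. g (z m)) \<longlonglongrightarrow> g y"
    and bdd: "bdd_above (range g)"
  shows "(SUP y. g y) \<le> a \<longleftrightarrow> (\<forall>y\<in>rational_vectors. g y \<le> a)"
proof -
  have "g y \<le> a" if a: "\<forall>y\<in>rational_vectors. g y \<le> a" for y
  proof -
    have "\<forall>p. \<exists>q. q \<in> \<rat> \<and> y $ snd p < q \<and> q < y $ snd p + 1 / real (Suc (fst p))" for y :: "real ^ 'l"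
      using Rats_dense_in_real[of "y $ _" "y $ _ + 1 / real (Suc _)"] by (auto simp: Bex_def)
    from choice[OF this[of y]] obtain q :: "nat \<times> 'l \<Rightarrow> real" where
      q: "\<forall>p. q p \<in> \<rat> \<and> y $ snd p < q p \<and> q p < y $ snd p + 1 / real (Suc (fst p))" ..
    define z where "z m = (\<chi> j. q (m, j))" for m
    have z: "z m \<in> rational_vectors" "y $ j \<le> z m $ j" "z m $ j \<le> y $ j + 1 / real (Suc m)" for m j
      using q by (auto simp: z_def rational_vectors_def less_imp_le)
    have "(\<lambda>m. g (z m)) \<longlonglongrightarrow> g y"
    proof (rule right[OF z(2)])
      fix j
      have "(\<lambda>m. y $ j + 1 / real (Suc m)) \<longlonglongrightarrow> y $ j + 0"
        by (intro tendsto_add tendsto_const LIMSEQ_Suc[OF lim_1_over_n])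
      then have "(\<lambda>m. y $ j + 1 / real (Suc m)) \<longlonglongrightarrow> y $ j" by simp
      then show "(\<lambda>m. z m $ j) \<longlonglongrightarrow> y $ j"
        by (rule tendsto_sandwich[OF always_eventually always_eventually tendsto_const, rotated 2]) (simp_all only: z simp_thms)
    qed
    then show ?thesis by (rule LIMSEQ_le_const2) (use a z(1) in auto)
  qed
  then show ?thesis using cSUP_le_iff[OF UNIV_not_empty bdd, of a] by auto
qed

section \<open>Measurability, and coordinates without randomness\<close>

context discrete_GI_G_infinity
begin

lemma marked_departures_measurable[measurable]: "marked_departures A S m t \<in> borel_measurable M"
proof -
  have eq: "marked_departures A S m t \<omega> = departures A S t \<omega> *
    (if \<exists>i. A (t - int (Suc i)) \<omega> > 0 then arrived m t \<omega> else of_bool (t - (GREATEST n::int. False) \<le> int m))" for \<omega>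
  proof (cases "\<exists>n<t. A n \<omega> > 0")
    case True
    then obtain n where n: "n < t" "A n \<omega> > 0" by auto
    then have "A (t - int (Suc (nat (t - n - 1)))) \<omega> > 0" by simp
    then have "\<exists>i. A (t - int (Suc i)) \<omega> > 0" ..
    moreover have "last_arrival_age A t \<omega> \<le> int m \<longleftrightarrow> (\<exists>i\<in>{1..m}. A (t - int i) \<omega> > 0)"
      unfolding last_arrival_age_def using True by (intro Greatest_less_iff) auto
    ultimately show ?thesis by (simp add: marked_departures_def arrived_eq)
  next
    case False
    then have "\<not> (\<exists>i. A (t - int (Suc i)) \<omega> > 0)" by auto
    moreover have "(\<lambda>n. n < t \<and> A n \<omega> > 0) = (\<lambda>n. False)" using False by auto
    ultimately show ?thesis unfolding marked_departures_def last_arrival_age_def by (simp only: if_False)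
  qed
  have [measurable]: "arrived m t \<in> borel_measurable M" by (rule arrived_measurable)
  show ?thesis unfolding eq[abs_def] by measurable
qed

text \<open>If services last at most \<open>m\<close> almost surely, a departure in slot
  \<open>t\<close> forces an arrival within the preceding \<open>m\<close> slots, so the marking
  indicator changes nothing.\<close>

lemma AE_arrived_all:
  assumes m: "G m \<ge> 1"
  shows "AE \<omega> in M. \<forall>t. arrived m t \<omega> * departures A S t \<omega> = departures A S t \<omega>"
proof -
  have "AE \<omega> in M. \<forall>s l. l \<ge> 1 \<longrightarrow> S s l \<omega> \<le> m"
    unfolding AE_all_countable
  proof (intro allI)
    fix s l
    show "AE \<omega> in M. l \<ge> 1 \<longrightarrow> S s l \<omega> \<le> m"
    proof (cases "l \<ge> 1")
      case True
      then have "prob {\<omega> \<in> space M. S s l \<omega> \<le> m} = 1" using m G_le_1[of m] by (simp add: service_cdf)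
      from AE_prob_1[OF this] show ?thesis by eventually_elim auto
    qed auto
  qed
  then show ?thesis
  proof eventually_elim
    case (elim \<omega>)
    show ?case
    proof
      fix t
      show "arrived m t \<omega> * departures A S t \<omega> = departures A S t \<omega>"
      proof (cases "\<exists>i\<in>{1..m}. A (t - int i) \<omega> > 0")
        case False
        have "served 0 (Suc i) (t - int (Suc i)) \<omega> = 0" for i
        proof (cases "Suc i \<le> m")
          case True
          then have "A (t - int (Suc i)) \<omega> = 0" using False by (auto simp del: of_nat_Suc)
          then show ?thesis by (simp only: served_def) simp
        next
          case gt: False
          then have "S (t - int (Suc i)) l \<omega> \<noteq> Suc i" if "l \<ge> 1" for l
            using elim[rule_format, OF that, of "t - int (Suc i)"] by linarith
          then show ?thesis unfolding served_def by (intro sum.neutral) auto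
        qed
        then show ?thesis by (simp add: departures_eq)
      qed (simp add: arrived_eq)
    qed
  qed
qed

lemma marked_expectation:
  "expectation (marked_departures A S m t) = expectation (\<lambda>\<omega>. arrived m t \<omega> * departures A S t \<omega>)"
proof (rule integral_cong_AE)
  show "(\<lambda>\<omega>. arrived m t \<omega> * departures A S t \<omega>) \<in> borel_measurable M" by measurable
  show "AE \<omega> in M. marked_departures A S m t \<omega> = arrived m t \<omega> * departures A S t \<omega>"
    using AE_marked by eventually_elim simp
qed simp

text \<open>The block starts have finite support, so the conditional probability is a finite
  combination of indicators that are measurable in the data.\<close>

lemma bootstrap_probability_measurable:
  fixes r :: "'a \<Rightarrow> (nat \<Rightarrow> nat) \<Rightarrow> 'j::finite \<Rightarrow> real" and y :: "'j \<Rightarrow> real"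
  assumes [measurable]: "\<And>I j. (\<lambda>\<omega>. r \<omega> I j) \<in> borel_measurable M"
  shows "(\<lambda>\<omega>. measure_pmf.prob (block_starts n B) {I. \<forall>j. r \<omega> I j \<le> y j}) \<in> borel_measurable M"
proof -
  have "measure_pmf.prob (block_starts n B) {I. \<forall>j. r \<omega> I j \<le> y j}
    = (\<Sum>I\<in>set_pmf (block_starts n B). pmf (block_starts n B) I *\<^sub>R of_bool (\<forall>j. r \<omega> I j \<le> y j))" for \<omega>
  proof -
    have "(\<integral>I. (of_bool (\<forall>j. r \<omega> I j \<le> y j) :: real) \<partial>measure_pmf (block_starts n B))
      = (\<Sum>I\<in>set_pmf (block_starts n B). pmf (block_starts n B) I *\<^sub>R of_bool (\<forall>j. r \<omega> I j \<le> y j))"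
      by (rule integral_measure_pmf[OF finite_set_pmf_block_starts])
    then show ?thesis by (simp add: integral_of_bool)
  qed
  then show ?thesis by simp
qed

lemma bootstrap_sum_measurable:
  assumes "\<And>t. (\<lambda>\<omega>. X t \<omega>) \<in> borel_measurable M"
  shows "(\<lambda>\<omega>. bootstrap_sum n B I (\<lambda>t. X t \<omega>)) \<in> borel_measurable M"
  unfolding bootstrap_sum_def bootstrap_def by (intro borel_measurable_sum assms)

lemma bootstrap_mean_measurable:
  assumes "\<And>t. (\<lambda>\<omega>. X t \<omega>) \<in> borel_measurable M"
  shows "(\<lambda>\<omega>. measure_pmf.expectation (block_starts n B) (\<lambda>I. 1 / real n * bootstrap_sum n B I (\<lambda>t. X t \<omega>))) \<in> borel_measurable M"
proof -
  have "measure_pmf.expectation (block_starts n B) (\<lambda>I. 1 / real n * bootstrap_sum n B I (\<lambda>t. X t \<omega>))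
    = (\<Sum>I\<in>set_pmf (block_starts n B). pmf (block_starts n B) I *\<^sub>R (1 / real n * bootstrap_sum n B I (\<lambda>t. X t \<omega>)))" for \<omega>
    by (rule integral_measure_pmf[OF finite_set_pmf_block_starts])
  then show ?thesis using bootstrap_sum_measurable[OF assms] by simp
qed

lemma H_hat_measurable: "H_hat A S n m \<in> borel_measurable M"
  unfolding H_hat_def[abs_def] ratio_def by measurable

lemma H_hat_star_measurable: "(\<lambda>\<omega>. H_hat_star A S n B m \<omega> I) \<in> borel_measurable M"
proof -
  have [measurable]: "(\<lambda>\<omega>. bootstrap_sum n B I (\<lambda>t. marked_departures A S m t \<omega>)) \<in> borel_measurable M"
    "(\<lambda>\<omega>. bootstrap_sum n B I (\<lambda>t. departures A S t \<omega>)) \<in> borel_measurable M"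
    by (rule bootstrap_sum_measurable, simp)+
  show ?thesis unfolding H_hat_star_def ratio_def by measurable
qed

lemma H_star_measurable: "(\<lambda>\<omega>. H_star A S n B m \<omega>) \<in> borel_measurable M"
proof -
  have [measurable]: "(\<lambda>\<omega>. measure_pmf.expectation (block_starts n B) (\<lambda>I. 1 / real n * bootstrap_sum n B I (\<lambda>t. marked_departures A S m t \<omega>))) \<in> borel_measurable M"
    "(\<lambda>\<omega>. measure_pmf.expectation (block_starts n B) (\<lambda>I. 1 / real n * bootstrap_sum n B I (\<lambda>t. departures A S t \<omega>))) \<in> borel_measurable M"
    by (rule bootstrap_mean_measurable, simp)+
  show ?thesis unfolding H_star_def ratio_def by measurable
qed

end

section \<open>Bootstrap consistency\<close>

text \<open>Eventually \<open>m n \<ge> 1\<close>, hence the integer part of \<open>b n\<close> is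
  at most \<open>b n * m n\<close>, whose square is negligible against \<open>n\<close>.\<close>

lemma block_length_limits:
  fixes b m :: "nat \<Rightarrow> real"
  assumes b: "filterlim b at_top sequentially" and m: "filterlim m at_top sequentially"
    and small: "(\<lambda>n. (b n)\<^sup>2 * (m n)\<^sup>2 / real n) \<longlonglongrightarrow> 0"
  shows "filterlim (\<lambda>n. nat \<lfloor>b n\<rfloor>) at_top sequentially" "(\<lambda>n. (real (nat \<lfloor>b n\<rfloor>))\<^sup>2 / real n) \<longlonglongrightarrow> 0"
proof -
  show "filterlim (\<lambda>n. nat \<lfloor>b n\<rfloor>) at_top sequentially"
    by (rule filterlim_compose[OF filterlim_nat_sequentially filterlim_compose[OF filterlim_floor_sequentially b]])
  show "(\<lambda>n. (real (nat \<lfloor>b n\<rfloor>))\<^sup>2 / real n) \<longlonglongrightarrow> 0"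
  proof (rule Lim_null_comparison[OF _ small])
    have "\<forall>\<^sub>F n in sequentially. 1 \<le> b n" "\<forall>\<^sub>F n in sequentially. 1 \<le> m n"
      using b m by (simp_all add: filterlim_at_top)
    then show "\<forall>\<^sub>F n in sequentially. norm ((real (nat \<lfloor>b n\<rfloor>))\<^sup>2 / real n) \<le> (b n)\<^sup>2 * (m n)\<^sup>2 / real n"
    proof eventually_elim
      case (elim n)
      have "real (nat \<lfloor>b n\<rfloor>) \<le> b n * m n"
      proof -
        have "real (nat \<lfloor>b n\<rfloor>) \<le> b n" using elim by (simp add: of_nat_nat)
        also have "\<dots> \<le> b n * m n" using elim by simp
        finally show ?thesis .
      qed
      then have "(real (nat \<lfloor>b n\<rfloor>))\<^sup>2 \<le> (b n * m n)\<^sup>2" by (intro power_mono) auto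
      then show ?case by (simp add: power_mult_distrib divide_right_mono)
    qed
  qed
qed

context discrete_GI_G_infinity
begin

section \<open>Convergence of the supremum in probability\<close>

context
  fixes x :: "'l::finite \<Rightarrow> nat" and B :: "nat \<Rightarrow> nat"
  assumes x_pos: "\<And>j. x j \<ge> 1"
    and B_lim: "filterlim B at_top sequentially" and B_small: "(\<lambda>n. (real (B n))\<^sup>2 / real n) \<longlonglongrightarrow> 0"
    and moment2: "integrable M (\<lambda>\<omega>. (real (A 0 \<omega>))\<^sup>2)"
    and service_tail: "summable (\<lambda>n. sqrt (1 - G (Suc n)))"
begin

definition root :: "nat \<Rightarrow> 'l \<Rightarrow> 'a \<Rightarrow> real" where
  "root n j \<omega> = sqrt (real n) * (H_hat A S n (x j) \<omega> - H M A S (x j))"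

definition root_star :: "nat \<Rightarrow> 'a \<Rightarrow> (nat \<Rightarrow> nat) \<Rightarrow> 'l \<Rightarrow> real" where
  "root_star n \<omega> I j = sqrt (real n) * (H_hat_star A S n (B n) (x j) \<omega> I - H_star A S n (B n) (x j) \<omega>)"

definition cdf_diff :: "nat \<Rightarrow> 'a \<Rightarrow> real ^ 'l \<Rightarrow> real" where
  "cdf_diff n \<omega> y = \<bar>measure M {\<omega>' \<in> space M. \<forall>j. root n j \<omega>' \<le> y $ j}
    - measure_pmf.prob (block_starts n (B n)) {I. \<forall>j. root_star n \<omega> I j \<le> y $ j}\<bar>"

text \<open>For the remaining coordinates both roots are almost surely 0, so their distribution
  functions jump at 0 and cannot take part in the Gaussian comparison.\<close>

definition proper :: "'l set" where
  "proper = {j. G (x j) < 1}"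

lemma root_measurable[measurable]: "root n j \<in> borel_measurable M"
proof -
  have [measurable]: "H_hat A S n (x j) \<in> borel_measurable M" by (rule H_hat_measurable)
  show ?thesis unfolding root_def[abs_def] by measurable
qed

lemma root_star_measurable: "(\<lambda>\<omega>. root_star n \<omega> I j) \<in> borel_measurable M"
proof -
  have [measurable]: "(\<lambda>\<omega>. H_hat_star A S n (B n) (x j) \<omega> I) \<in> borel_measurable M"
    "(\<lambda>\<omega>. H_star A S n (B n) (x j) \<omega>) \<in> borel_measurable M"
    by (rule H_hat_star_measurable H_star_measurable)+
  show ?thesis unfolding root_star_def by measurable
qed

lemma cdf_diff_bounds: "0 \<le> cdf_diff n \<omega> y" "cdf_diff n \<omega> y \<le> 1"
proof -
  have "\<bar>a - b\<bar> \<le> 1" if "0 \<le> a" "a \<le> 1" "0 \<le> b" "b \<le> 1" for a b :: real using that by linarith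
  then show "cdf_diff n \<omega> y \<le> 1" unfolding cdf_diff_def by simp
qed (simp add: cdf_diff_def)

lemma cdf_diff_bdd: "bdd_above (range (cdf_diff n \<omega>))"
  by (rule bdd_aboveI[of _ 1]) (use cdf_diff_bounds in auto)

lemma SUP_cdf_diff_le_iff: "(SUP y. cdf_diff n \<omega> y) \<le> a \<longleftrightarrow> (\<forall>y\<in>rational_vectors. cdf_diff n \<omega> y \<le> a)"
proof (rule SUP_le_iff_rational[OF _ cdf_diff_bdd])
  fix y :: "real ^ 'l" and z :: "nat \<Rightarrow> real ^ 'l"
  assume z: "\<And>m j. y $ j \<le> z m $ j" "\<And>j. (\<lambda>m. z m $ j) \<longlonglongrightarrow> y $ j"
  have p: "prob_space M" by unfold_locales
  have 1: "(\<lambda>m. measure M {\<omega>' \<in> space M. \<forall>j. root n j \<omega>' \<le> z m $ j}) \<longlonglongrightarrow> measure M {\<omega>' \<in> space M. \<forall>j. root n j \<omega>' \<le> y $ j}"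
    using distribution_right_continuous[where P = M and J = UNIV and V = "root n" and y = "\<lambda>j. y $ j" and z = "\<lambda>m j. z m $ j",
        OF p finite root_measurable z] by simp
  have 2: "(\<lambda>m. measure_pmf.prob (block_starts n (B n)) {I. \<forall>j. root_star n \<omega> I j \<le> z m $ j})
      \<longlonglongrightarrow> measure_pmf.prob (block_starts n (B n)) {I. \<forall>j. root_star n \<omega> I j \<le> y $ j}"
    using distribution_right_continuous[where P = "measure_pmf (block_starts n (B n))" and J = UNIV
        and V = "\<lambda>j I. root_star n \<omega> I j" and y = "\<lambda>j. y $ j" and z = "\<lambda>m j. z m $ j", OF measure_pmf.prob_space_axioms finite _ z]
    by simp
  show "(\<lambda>m. cdf_diff n \<omega> (z m)) \<longlonglongrightarrow> cdf_diff n \<omega> y"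
    unfolding cdf_diff_def by (intro tendsto_rabs tendsto_diff 1 2)
qed

lemma SUP_cdf_diff_measurable: "(\<lambda>\<omega>. SUP y. cdf_diff n \<omega> y) \<in> borel_measurable M"
  unfolding borel_measurable_iff_le SUP_cdf_diff_le_iff
proof
  fix a
  have [measurable]: "(\<lambda>\<omega>. cdf_diff n \<omega> y) \<in> borel_measurable M" for y
  proof -
    have [measurable]: "(\<lambda>\<omega>. measure_pmf.prob (block_starts n (B n)) {I. \<forall>j. root_star n \<omega> I j \<le> y $ j}) \<in> borel_measurable M"
      by (rule bootstrap_probability_measurable[OF root_star_measurable])
    show ?thesis unfolding cdf_diff_def by measurable
  qed
  have 0: "(0 :: real ^ 'l) \<in> rational_vectors" by (simp add: rational_vectors_def)
  have "(\<Inter>y\<in>rational_vectors. {\<omega> \<in> space M. cdf_diff n \<omega> y \<le> a}) \<in> sets M"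
    by (rule sets.countable_INT'[OF countable_rational_vectors]) (use 0 in auto)
  also have "(\<Inter>y\<in>rational_vectors. {\<omega> \<in> space M. cdf_diff n \<omega> y \<le> a}) = {\<omega> \<in> space M. \<forall>y\<in>rational_vectors. cdf_diff n \<omega> y \<le> a}"
    using 0 by auto
  finally show "{\<omega> \<in> space M. \<forall>y\<in>rational_vectors. cdf_diff n \<omega> y \<le> a} \<in> sets M" .
qed

text \<open>The bootstrap root is formed from a fixed sample point, so the almost sure identities
  are collected in one pathwise condition on that point.\<close>

definition regular :: "'a \<Rightarrow> bool" where
  "regular \<omega> \<longleftrightarrow> (\<forall>m t. marked_departures A S m t \<omega> = arrived m t \<omega> * departures A S t \<omega>)
    \<and> (\<forall>j t. j \<notin> proper \<longrightarrow> arrived (x j) t \<omega> * departures A S t \<omega> = departures A S t \<omega>)"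

lemma AE_regular: "AE \<omega> in M. regular \<omega>"
proof -
  have "AE \<omega> in M. \<forall>j. j \<notin> proper \<longrightarrow> (\<forall>t. arrived (x j) t \<omega> * departures A S t \<omega> = departures A S t \<omega>)"
    unfolding AE_all_countable
  proof
    fix j
    show "AE \<omega> in M. j \<notin> proper \<longrightarrow> (\<forall>t. arrived (x j) t \<omega> * departures A S t \<omega> = departures A S t \<omega>)"
      using AE_arrived_all[of "x j"] by (cases "j \<in> proper") (auto simp: proper_def)
  qed
  with AE_marked show ?thesis by eventually_elim (auto simp: regular_def)
qed

lemma marked_regular: "regular \<omega> \<Longrightarrow> marked_departures A S m t \<omega> = arrived m t \<omega> * departures A S t \<omega>"
  unfolding regular_def by (elim conjE allE)

lemma marked_improper:
  assumes "regular \<omega>" and j: "j \<notin> proper"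
  shows "marked_departures A S (x j) t \<omega> = departures A S t \<omega>"
proof -
  have "marked_departures A S (x j) t \<omega> = arrived (x j) t \<omega> * departures A S t \<omega>"
    by (rule marked_regular[OF assms(1)])
  also have "\<dots> = departures A S t \<omega>"
    using assms(1)[unfolded regular_def, THEN conjunct2, rule_format, OF j] .
  finally show ?thesis .
qed

lemma H_improper:
  assumes j: "j \<notin> proper" shows "H M A S (x j) = 1"
proof -
  have "expectation (marked_departures A S (x j) 0) = expectation (departures A S 0)"
    using AE_regular by (intro integral_cong_AE) (auto elim!: eventually_mono simp: marked_improper[OF _ j])
  then show ?thesis by (simp add: H_def ratio_def)
qed

lemma root_improper: "regular \<omega> \<Longrightarrow> j \<notin> proper \<Longrightarrow> root n j \<omega> = 0"
  by (simp add: root_def H_improper H_hat_def marked_improper ratio_def)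

lemma root_star_improper: "regular \<omega> \<Longrightarrow> j \<notin> proper \<Longrightarrow> root_star n \<omega> I j = 0"
  by (simp add: root_star_def H_hat_star_def H_star_def marked_improper ratio_def)

text \<open>Both roots are 0 in this coordinate and thus exceed the negative bound, so both
  probabilities vanish.\<close>

lemma cdf_diff_improper:
  assumes w: "regular \<omega>" and y: "j \<notin> proper" "y $ j < 0" shows "cdf_diff n \<omega> y = 0"
proof -
  have "measure M {\<omega>' \<in> space M. \<forall>j. root n j \<omega>' \<le> y $ j} = measure M {}"
  proof (rule finite_measure_eq_AE)
    show "AE \<omega>' in M. (\<omega>' \<in> {\<omega>' \<in> space M. \<forall>j. root n j \<omega>' \<le> y $ j}) = (\<omega>' \<in> {})"
      using AE_regular
    proof eventually_elim
      case (elim \<omega>')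
      then have "\<not> root n j \<omega>' \<le> y $ j" using y root_improper[OF elim y(1), of n] by simp
      then show ?case by auto
    qed
  qed measurable
  moreover have "\<not> root_star n \<omega> I j \<le> y $ j" for I using y root_star_improper[OF w y(1), of n I] by simp
  then have empty: "{I. \<forall>j. root_star n \<omega> I j \<le> y $ j} = {}" by auto
  ultimately show ?thesis unfolding cdf_diff_def empty by simp
qed

text \<open>Nonnegative bounds in the improper coordinates hold automatically, for the sample and
  for the bootstrap root alike.\<close>

lemma cdf_diff_proper:
  assumes w: "regular \<omega>" and y: "\<And>j. j \<notin> proper \<Longrightarrow> 0 \<le> y $ j"
  shows "cdf_diff n \<omega> y = \<bar>measure M {\<omega>' \<in> space M. \<forall>j\<in>proper. root n j \<omega>' \<le> y $ j}
    - measure_pmf.prob (block_starts n (B n)) {I. \<forall>j\<in>proper. root_star n \<omega> I j \<le> y $ j}\<bar>"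
proof -
  have "measure M {\<omega>' \<in> space M. \<forall>j. root n j \<omega>' \<le> y $ j} = measure M {\<omega>' \<in> space M. \<forall>j\<in>proper. root n j \<omega>' \<le> y $ j}"
  proof (rule finite_measure_eq_AE)
    show "AE \<omega>' in M. (\<omega>' \<in> {\<omega>' \<in> space M. \<forall>j. root n j \<omega>' \<le> y $ j}) = (\<omega>' \<in> {\<omega>' \<in> space M. \<forall>j\<in>proper. root n j \<omega>' \<le> y $ j})"
      using AE_regular
    proof eventually_elim
      case (elim \<omega>')
      have "root n j \<omega>' \<le> y $ j" if "j \<notin> proper" for j using y[OF that] root_improper[OF elim that, of n] by simp
      then show ?case by auto
    qed
  qed measurable
  moreover have "root_star n \<omega> I j \<le> y $ j" if "j \<notin> proper" for I j
    using y[OF that] root_star_improper[OF w that, of n I] by simp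
  then have "{I. \<forall>j. root_star n \<omega> I j \<le> y $ j} = {I. \<forall>j\<in>proper. root_star n \<omega> I j \<le> y $ j}" by auto
  ultimately show ?thesis by (simp add: cdf_diff_def)
qed

text \<open>The control variable is quantified existentially because \<open>total_error\<close> is
  available only when at least one coordinate is proper. With none, the difference is 0 and the zero
  variable serves.\<close>

lemma controlled:
  "\<exists>R. vanishing R \<and> (\<forall>\<epsilon>>0. \<exists>\<delta>>0. \<exists>n0. \<forall>n\<ge>n0. \<forall>\<omega>. regular \<omega> \<longrightarrow> R n \<omega> < \<delta> \<longrightarrow> (\<forall>y. cdf_diff n \<omega> y \<le> \<epsilon>))"
proof (cases "proper = {}")
  case True
  have "cdf_diff n \<omega> y = 0" if w: "regular \<omega>" for n \<omega> y
  proof (cases "\<exists>j. y $ j < 0")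
    case True
    then show ?thesis using cdf_diff_improper[OF w] \<open>proper = {}\<close> by blast
  next
    case False
    then show ?thesis using \<open>proper = {}\<close> by (subst cdf_diff_proper[OF w]) (auto simp: not_less prob_space)
  qed
  then show ?thesis by (intro exI[of _ "\<lambda>_ _. 0"]) (auto simp: vanishing_def intro!: exI[of _ 1])
next
  case False
  interpret bootstrap_blocks M A S G x proper B
    by unfold_locales (use False moment2 service_tail x_pos B_lim B_small in \<open>auto simp: proper_def\<close>)
  have root: "AE \<omega> in M. root n j \<omega> = sample_root n j \<omega>" for n j
  proof -
    have "H M A S (x j) = level (x j)"
      using rate_positive by (simp add: H_def marked_expectation level_def rate_def ratio_def)
    then show ?thesis
      by (intro eventually_mono[OF AE_regular]) (simp add: root_def sample_root_def H_hat_def marked_regular)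
  qed
  have root_star: "root_star n \<omega> I j = boot_root n \<omega> j I" if "regular \<omega>" for n \<omega> I j
    using that by (simp add: root_star_def boot_root_def H_hat_star_def H_star_def marked_regular)
  have M_eq: "measure M {\<omega>' \<in> space M. \<forall>j\<in>proper. root n j \<omega>' \<le> y $ j} = measure M {\<omega>' \<in> space M. \<forall>j\<in>proper. sample_root n j \<omega>' \<le> y $ j}" for n y
  proof (rule finite_measure_eq_AE)
    have "AE \<omega>' in M. \<forall>j. root n j \<omega>' = sample_root n j \<omega>'" unfolding AE_all_countable using root by simp
    then show "AE \<omega>' in M. (\<omega>' \<in> {\<omega>' \<in> space M. \<forall>j\<in>proper. root n j \<omega>' \<le> y $ j}) = (\<omega>' \<in> {\<omega>' \<in> space M. \<forall>j\<in>proper. sample_root n j \<omega>' \<le> y $ j})"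
      by eventually_elim simp
  qed measurable
  show ?thesis
  proof (intro exI[of _ total_error] conjI allI impI)
    show "vanishing total_error" by (rule total_error_vanishing)
    fix \<epsilon> :: real assume \<epsilon>: "\<epsilon> > 0"
    from bootstrap_approximates[OF \<epsilon>] obtain \<delta> n0 where \<delta>: "\<delta> > 0"
      and good: "\<forall>n\<ge>n0. \<forall>\<omega>. total_error n \<omega> < \<delta> \<longrightarrow>
        (\<forall>y. \<bar>measure M {\<omega>' \<in> space M. \<forall>j\<in>proper. sample_root n j \<omega>' \<le> y j}
          - measure_pmf.prob (block_starts n (B n)) {I. \<forall>j\<in>proper. boot_root n \<omega> j I \<le> y j}\<bar> \<le> \<epsilon>)"
      by (elim exE conjE)
    have "cdf_diff n \<omega> y \<le> \<epsilon>" if n: "n \<ge> n0" and w: "regular \<omega>" and e: "total_error n \<omega> < \<delta>" for n \<omega> y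
    proof (cases "\<exists>j. j \<notin> proper \<and> y $ j < 0")
      case True
      then show ?thesis using cdf_diff_improper[OF w] \<epsilon> by fastforce
    next
      case neg: False
      show ?thesis
        using good[rule_format, OF n e, of "\<lambda>j. y $ j"] neg
        by (subst cdf_diff_proper[OF w]) (auto simp: not_less M_eq root_star[OF w])
    qed
    then show "\<exists>\<delta>>0. \<exists>n0. \<forall>n\<ge>n0. \<forall>\<omega>. regular \<omega> \<longrightarrow> total_error n \<omega> < \<delta> \<longrightarrow> (\<forall>y. cdf_diff n \<omega> y \<le> \<epsilon>)"
      using \<delta> by (intro exI[of _ \<delta>] conjI exI[of _ n0]) auto
  qed
qed

text \<open>On regular points a supremum above \<open>\<epsilon>\<close> forces the control variable
  to be at least \<open>\<delta>\<close>, and Markov's inequality bounds the probability of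
  that.\<close>

lemma SUP_cdf_diff_converges: "converges_in_probability M (\<lambda>n \<omega>. SUP y. cdf_diff n \<omega> y) 0"
  unfolding converges_in_probability_def
proof (intro conjI allI impI)
  show "(\<lambda>\<omega>. SUP y. cdf_diff n \<omega> y) \<in> borel_measurable M" for n by (rule SUP_cdf_diff_measurable)
  fix \<epsilon> :: real assume \<epsilon>: "\<epsilon> > 0"
  from controlled obtain R where R: "vanishing R"
    and control: "\<forall>\<epsilon>>0. \<exists>\<delta>>0. \<exists>n0. \<forall>n\<ge>n0. \<forall>\<omega>. regular \<omega> \<longrightarrow> R n \<omega> < \<delta> \<longrightarrow> (\<forall>y. cdf_diff n \<omega> y \<le> \<epsilon>)"
    by (elim exE conjE)
  from control[rule_format, OF \<epsilon>] obtain \<delta> n0 where \<delta>: "\<delta> > 0"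
    and good: "\<forall>n\<ge>n0. \<forall>\<omega>. regular \<omega> \<longrightarrow> R n \<omega> < \<delta> \<longrightarrow> (\<forall>y. cdf_diff n \<omega> y \<le> \<epsilon>)"
    by (elim exE conjE)
  show "(\<lambda>n. measure M {\<omega> \<in> space M. \<bar>(SUP y. cdf_diff n \<omega> y) - 0\<bar> > \<epsilon>}) \<longlonglongrightarrow> 0"
  proof (rule Lim_null_comparison)
    show "(\<lambda>n. expectation (R n) / \<delta>) \<longlonglongrightarrow> 0"
      using R tendsto_divide[of "\<lambda>n. expectation (R n)" 0 sequentially "\<lambda>_. \<delta>" \<delta>] \<delta> by (simp add: vanishing_def)
    show "\<forall>\<^sub>F n in sequentially. norm (measure M {\<omega> \<in> space M. \<bar>(SUP y. cdf_diff n \<omega> y) - 0\<bar> > \<epsilon>}) \<le> expectation (R n) / \<delta>"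
      using eventually_ge_at_top[of n0]
    proof eventually_elim
      case (elim n)
      have R': "integrable M (R n)" "\<And>\<omega>. 0 \<le> R n \<omega>" using R by (auto simp: vanishing_def)
      then have [measurable]: "R n \<in> borel_measurable M" by auto
      have "measure M {\<omega> \<in> space M. \<bar>(SUP y. cdf_diff n \<omega> y) - 0\<bar> > \<epsilon>} \<le> measure M {\<omega> \<in> space M. \<delta> \<le> R n \<omega>}"
      proof (rule finite_measure_mono_AE)
        show "AE \<omega> in M. \<omega> \<in> {\<omega> \<in> space M. \<bar>(SUP y. cdf_diff n \<omega> y) - 0\<bar> > \<epsilon>} \<longrightarrow> \<omega> \<in> {\<omega> \<in> space M. \<delta> \<le> R n \<omega>}"
          using AE_regular
        proof eventually_elim
          case w: (elim \<omega>)
          have "\<bar>(SUP y. cdf_diff n \<omega> y) - 0\<bar> \<le> \<epsilon>" if "R n \<omega> < \<delta>"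
          proof -
            have "(SUP y. cdf_diff n \<omega> y) \<le> \<epsilon>" using good elim w that by (intro cSUP_least) auto
            moreover have "0 \<le> (SUP y. cdf_diff n \<omega> y)"
              by (rule cSUP_upper2[OF cdf_diff_bdd UNIV_I[of 0] cdf_diff_bounds(1)])
            ultimately show ?thesis by simp
          qed
          then show ?case by (auto simp: not_less[symmetric])
        qed
      qed measurable
      also have "\<dots> \<le> expectation (R n) / \<delta>"
        by (rule integral_Markov_inequality_measure[OF R'(1), of "{}"]) (use R' \<delta> in auto)
      finally show ?case by simp
    qed
  qed
qed

end

end

theorem corollary5p2:
  fixes M :: "'a measure"
    and A :: "int \<Rightarrow> 'a \<Rightarrow> nat"
    and S :: "int \<Rightarrow> nat \<Rightarrow> 'a \<Rightarrow> nat"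
    and G :: "nat \<Rightarrow> real"
    and x :: "'l::finite \<Rightarrow> nat"
    and b m :: "nat \<Rightarrow> real"
  assumes queue: "discrete_GI_G_infinity M A S G"
    and x_pos: "\<And>j. x j \<ge> 1"
    and b_lim: "filterlim b at_top sequentially"
    and m_lim: "filterlim m at_top sequentially"
    and b_small: "(\<lambda>n. (b n)\<^sup>2 * (m n)\<^sup>2 / real n) \<longlonglongrightarrow> 0"
    and m_large: "(\<lambda>n. b n / (m n) ^ 4) \<longlonglongrightarrow> 0"
    and moment2: "integrable M (\<lambda>\<omega>. (real (A 0 \<omega>))\<^sup>2)"
    and service_tail: "summable (\<lambda>n. sqrt (1 - G (Suc n)))"
    and moment4: "integrable M (\<lambda>\<omega>. (real (A 0 \<omega>)) ^ 4)"
  shows "converges_in_probability M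
    (\<lambda>n \<omega>. let B = nat \<lfloor>b n\<rfloor> in
      SUP y :: real ^ 'l.
        \<bar>measure M {\<omega>' \<in> space M.
            sqrt (real n) *\<^sub>R ((\<chi> j. H_hat A S n (x j) \<omega>') - (\<chi> j. H M A S (x j))) \<le> y}
         - measure_pmf.prob (block_starts n B) {I.
            sqrt (real n) *\<^sub>R ((\<chi> j. H_hat_star A S n B (x j) \<omega> I)
              - (\<chi> j. H_star A S n B (x j) \<omega>)) \<le> y}\<bar>)
    0"
proof -
  interpret discrete_GI_G_infinity M A S G by (rule queue)
  note P = x_pos block_length_limits[OF b_lim m_lim b_small] moment2 service_tail
  from SUP_cdf_diff_converges[OF P] show ?thesis
    unfolding cdf_diff_def[OF P] root_def[OF P] root_star_def[OF P]
    by (simp add: Let_def less_eq_vec_def)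
qed

end
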